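(* Let $V\in C^\infty([0,\infty))$ be real-valued and suppose that for some $\alpha>0$ one has $V(x)=-\tfrac14 x^{-2}[1+r(x)]$ for all $x\ge 1$, where $|r^{(k)}(x)|\le c_k x^{-\alpha-k}$ for all $x\ge 1$, $k\in\mathbb{N}_0$ (for some constants $c_k$). Assume that there exist no $E<0$ and no nontrivial $h\in L^2((0,\infty))\cap C^\infty([0,\infty))$ with $h'(0)=0$ and $-h''+Vh=Eh$. Assume moreover that $V^{(2j+1)}(0)=0$ for all $j\in\mathbb{N}_0$. Then there exist constants $C_{k,\ell}>0$ such that for all even $f,g\in\mathcal{S}(\mathbb{R})$ the solution $u$ of the Cauchy problem $$\partial_t^2u(t,x)-\partial_x^2u(t,x)+V(x)u(t,x)=0,\quad u(0,x)=f(x),\quad \partial_tu(t,x)|_{t=0}=g(x)$$ on the half-line $x\ge0$ with the Neumann condition $\partial_xu(t,x)|_{x=0}=0$ satisfies $$\left\|\partial_t^\ell\sqrt A\,u(t,\cdot)\right\|_{H^k(\mathbb{R}_+)}\le C_{k,\ell}\left[\|\sqrt Af\|_{H^{k+\ell}(\mathbb{R}_+)}+\|g\|_{H^{k+\ell}(\mathbb{R}_+)}\right],$$ $$\left\|\partial_t^\ell\partial_tu(t,\cdot)\right\|_{H^k(\mathbb{R}_+)}\le C_{k,\ell}\left[\|\sqrt Af\|_{H^{k+\ell}(\mathbb{R}_+)}+\|g\|_{H^{k+\ell}(\mathbb{R}_+)}\right]$$ for all $t\ge0$ and all $k,\ell\in\mathbb{N}_0$.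
   Context: $\mathbb{R}_+:=[0,\infty)$, $\mathbb{N}_0=\{0,1,2,\dots\}$; $H^k(\mathbb{R}_+)$ is the standard $L^2$-based Sobolev space; $\mathcal{S}(\mathbb{R})$ is the Schwartz space, and its elements are restricted to $\mathbb{R}_+$ where appropriate. $Af:=-f''+Vf$ is the self-adjoint, nonnegative operator on $L^2(\mathbb{R}_+)$ with domain $\{f\in L^2(\mathbb{R}_+): f,f'\in AC_{loc}(\mathbb{R}_+),\ f'(0)=0,\ f''\in L^2(\mathbb{R}_+)\}$; $\sqrt A$ is defined by the functional calculus. The solution of the Cauchy problem is $u(t,\cdot)=\cos(t\sqrt A)f+\frac{\sin(t\sqrt A)}{\sqrt A}g$. *)

theory Defs
  imports "HOL-Analysis.Analysis"
begin

section \<open>Smooth functions on intervals\<close>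

text \<open>The derivatives are taken within \<open>S\<close>; at an endpoint of an interval they are therefore
  one-sided, and values of \<open>f\<close> outside \<open>S\<close> play no role at points of \<open>S\<close>.\<close>

definition nth_deriv :: "real set \<Rightarrow> nat \<Rightarrow> (real \<Rightarrow> 'a::real_normed_vector) \<Rightarrow> real \<Rightarrow> 'a" where
  "nth_deriv S n f = ((\<lambda>g x. vector_derivative g (at x within S)) ^^ n) f"

definition smooth_fun_on :: "real set \<Rightarrow> (real \<Rightarrow> 'a::real_normed_vector) \<Rightarrow> bool" where
  "smooth_fun_on S f \<longleftrightarrow> (\<forall>n. \<forall>x\<in>S. nth_deriv S n f differentiable (at x within S))"

definition schwartz :: "(real \<Rightarrow> complex) \<Rightarrow> bool" where
  "schwartz f \<longleftrightarrow> smooth_fun_on UNIV f \<and>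
     (\<forall>m n. \<exists>C. \<forall>x. \<bar>x\<bar> ^ m * norm (nth_deriv UNIV n f x) \<le> C)"

definition even_fun :: "(real \<Rightarrow> 'a) \<Rightarrow> bool" where
  "even_fun f \<longleftrightarrow> (\<forall>x. f (- x) = f x)"


section \<open>The Hilbert space \<open>L\<^sup>2([0,\<infinity>))\<close>\<close>

text \<open>Elements are represented by square-integrable functions; equality in the Hilbert space is
  equality almost everywhere on the half-line (\<open>l2_eq\<close>).\<close>

abbreviation halfline :: "real measure" where
  "halfline \<equiv> lebesgue_on {0..}"

definition L2 :: "(real \<Rightarrow> complex) set" where
  "L2 = {f \<in> borel_measurable halfline. integrable halfline (\<lambda>x. (cmod (f x))\<^sup>2)}"

definition l2_eq :: "(real \<Rightarrow> complex) \<Rightarrow> (real \<Rightarrow> complex) \<Rightarrow> bool" where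
  "l2_eq f g \<longleftrightarrow> (AE x in halfline. f x = g x)"

definition l2_inner :: "(real \<Rightarrow> complex) \<Rightarrow> (real \<Rightarrow> complex) \<Rightarrow> complex" where
  "l2_inner f g = (LINT x|halfline. f x * cnj (g x))"

definition l2_norm :: "(real \<Rightarrow> complex) \<Rightarrow> real" where
  "l2_norm f = sqrt (LINT x|halfline. (cmod (f x))\<^sup>2)"


section \<open>Sobolev spaces on the half-line\<close>

definition test_fun :: "(real \<Rightarrow> complex) \<Rightarrow> bool" where
  "test_fun \<phi> \<longleftrightarrow> smooth_fun_on UNIV \<phi> \<and> compact (closure {x. \<phi> x \<noteq> 0}) \<and>
     closure {x. \<phi> x \<noteq> 0} \<subseteq> {0<..}"

definition weak_deriv :: "nat \<Rightarrow> (real \<Rightarrow> complex) \<Rightarrow> (real \<Rightarrow> complex) \<Rightarrow> bool" where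
  "weak_deriv j f h \<longleftrightarrow>
     (\<forall>\<phi>. test_fun \<phi> \<longrightarrow>
        (LINT x|halfline. f x * nth_deriv UNIV j \<phi> x) = (-1) ^ j * (LINT x|halfline. h x * \<phi> x))"

definition sobolev :: "nat \<Rightarrow> (real \<Rightarrow> complex) set" where
  "sobolev k = {f \<in> L2. \<forall>j\<le>k. \<exists>h\<in>L2. weak_deriv j f h}"

text \<open>The norm is meaningful only on \<^term>\<open>sobolev k\<close>.\<close>

definition sobolev_norm :: "nat \<Rightarrow> (real \<Rightarrow> complex) \<Rightarrow> real" where
  "sobolev_norm k f = sqrt (\<Sum>j\<le>k. (l2_norm (SOME h. h \<in> L2 \<and> weak_deriv j f h))\<^sup>2)"


section \<open>The operator \<open>A = - d\<^sup>2/dx\<^sup>2 + V\<close> with Neumann condition\<close>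

definition abs_cont_on :: "real \<Rightarrow> real \<Rightarrow> (real \<Rightarrow> complex) \<Rightarrow> bool" where
  "abs_cont_on a b f \<longleftrightarrow>
     (\<forall>\<epsilon>>0. \<exists>\<delta>>0. \<forall>d S. d division_of S \<and> S \<subseteq> {a..b} \<and> (\<Sum>K\<in>d. Sup K - Inf K) < \<delta>
        \<longrightarrow> (\<Sum>K\<in>d. norm (f (Sup K) - f (Inf K))) < \<epsilon>)"

definition ac_loc :: "(real \<Rightarrow> complex) \<Rightarrow> bool" where
  "ac_loc f \<longleftrightarrow> (\<forall>b\<ge>0. abs_cont_on 0 b f)"

text \<open>Unbounded operators are given by their graphs. In the graph of \<open>A\<close>, the functions
  \<open>F\<close>, \<open>F1\<close> and \<open>F2\<close> are the absolutely continuous representative of \<open>f\<close>, its derivative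
  (continuous, since it is absolutely continuous, so that \<open>F\<close> is differentiable everywhere), and
  its second derivative (defined almost everywhere).\<close>

definition schroedinger :: "(real \<Rightarrow> real) \<Rightarrow> ((real \<Rightarrow> complex) \<times> (real \<Rightarrow> complex)) set" where
  "schroedinger V = {(f, h). f \<in> L2 \<and> h \<in> L2 \<and>
     (\<exists>F F1 F2. l2_eq f F \<and> ac_loc F \<and> ac_loc F1 \<and>
        (\<forall>x\<ge>0. (F has_vector_derivative F1 x) (at x within {0..})) \<and>
        F1 0 = 0 \<and> F2 \<in> L2 \<and>
        (AE x in halfline. (F1 has_vector_derivative F2 x) (at x within {0..})) \<and>
        l2_eq h (\<lambda>x. - F2 x + of_real (V x) * F x))}"


section \<open>Functional calculus of a self-adjoint operator\<close>

text \<open>Projection-valued measures on the Borel sets of the real line.\<close>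

definition pvm :: "(real set \<Rightarrow> (real \<Rightarrow> complex) \<Rightarrow> real \<Rightarrow> complex) \<Rightarrow> bool" where
  "pvm E \<longleftrightarrow>
     (\<forall>B\<in>sets borel.
        (\<forall>f\<in>L2. E B f \<in> L2) \<and>
        (\<forall>f\<in>L2. \<forall>g\<in>L2. l2_eq f g \<longrightarrow> l2_eq (E B f) (E B g)) \<and>
        (\<forall>f\<in>L2. \<forall>g\<in>L2. l2_eq (E B (\<lambda>x. f x + g x)) (\<lambda>x. E B f x + E B g x)) \<and>
        (\<forall>c. \<forall>f\<in>L2. l2_eq (E B (\<lambda>x. c * f x)) (\<lambda>x. c * E B f x)) \<and>
        (\<forall>f\<in>L2. l2_eq (E B (E B f)) (E B f)) \<and>
        (\<forall>f\<in>L2. \<forall>g\<in>L2. l2_inner (E B f) g = l2_inner f (E B g))) \<and>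
     (\<forall>f\<in>L2. l2_eq (E UNIV f) f) \<and>
     (\<forall>D. range D \<subseteq> sets borel \<and> disjoint_family D \<longrightarrow>
        (\<forall>f\<in>L2. (\<lambda>n. l2_norm (\<lambda>x. E (\<Union>i::nat. D i) f x - (\<Sum>i<n. E (D i) f x))) \<longlonglongrightarrow> 0))"

text \<open>The measure \<open>B \<mapsto> \<langle>E(B) f, f\<rangle> = \<parallel>E(B) f\<parallel>\<^sup>2\<close>.\<close>

definition spec_meas ::
  "(real set \<Rightarrow> (real \<Rightarrow> complex) \<Rightarrow> real \<Rightarrow> complex) \<Rightarrow> (real \<Rightarrow> complex) \<Rightarrow> real measure" where
  "spec_meas E f = measure_of UNIV (sets borel) (\<lambda>B. ennreal ((l2_norm (E B f))\<^sup>2))"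

definition spec_dom ::
  "(real set \<Rightarrow> (real \<Rightarrow> complex) \<Rightarrow> real \<Rightarrow> complex) \<Rightarrow> (real \<Rightarrow> real) \<Rightarrow> (real \<Rightarrow> complex) set" where
  "spec_dom E \<phi> = {f \<in> L2. integrable (spec_meas E f) (\<lambda>\<mu>. (\<phi> \<mu>)\<^sup>2)}"

text \<open>\<open>h = (\<integral> \<phi> dE) f\<close> for a real Borel function \<open>\<phi>\<close>: the condition is
  \<open>\<langle>h, g\<rangle> = \<integral> \<phi> d\<langle>E f, g\<rangle>\<close> for \<open>g\<close> in the (dense) domain, where the complex measure
  \<open>\<langle>E(\<cdot>) f, g\<rangle>\<close> is written by polarization as
  \<open>1/4 \<Sum>\<^sub>k \<i>\<^sup>k \<langle>E(\<cdot>) (f + \<i>\<^sup>k g), f + \<i>\<^sup>k g\<rangle>\<close>.\<close>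

definition spec_int ::
  "(real set \<Rightarrow> (real \<Rightarrow> complex) \<Rightarrow> real \<Rightarrow> complex) \<Rightarrow> (real \<Rightarrow> real)
     \<Rightarrow> (real \<Rightarrow> complex) \<Rightarrow> (real \<Rightarrow> complex) \<Rightarrow> bool" where
  "spec_int E \<phi> f h \<longleftrightarrow> f \<in> spec_dom E \<phi> \<and> h \<in> L2 \<and>
     (\<forall>g\<in>spec_dom E \<phi>. l2_inner h g =
        (\<Sum>k<4. \<i> ^ k * of_real (LINT \<mu>|spec_meas E (\<lambda>x. f x + \<i> ^ k * g x). \<phi> \<mu>)) / 4)"

text \<open>The spectral measure of an operator \<open>T\<close>, i.e. the one with \<open>T = \<integral> \<mu> dE(\<mu>)\<close>. It is
  determined by \<open>T\<close> up to equality almost everywhere of the representatives, and it exists if and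
  only if \<open>T\<close> is self-adjoint.\<close>

definition spectral_measure ::
  "((real \<Rightarrow> complex) \<times> (real \<Rightarrow> complex)) set
     \<Rightarrow> real set \<Rightarrow> (real \<Rightarrow> complex) \<Rightarrow> real \<Rightarrow> complex" where
  "spectral_measure T = (SOME E. pvm E \<and> T = {(f, h). spec_int E (\<lambda>\<mu>. \<mu>) f h})"

definition fcalc_dom ::
  "((real \<Rightarrow> complex) \<times> (real \<Rightarrow> complex)) set \<Rightarrow> (real \<Rightarrow> real) \<Rightarrow> (real \<Rightarrow> complex) set" where
  "fcalc_dom T \<phi> = spec_dom (spectral_measure T) \<phi>"

definition fcalc ::
  "((real \<Rightarrow> complex) \<times> (real \<Rightarrow> complex)) set \<Rightarrow> (real \<Rightarrow> real)
     \<Rightarrow> (real \<Rightarrow> complex) \<Rightarrow> real \<Rightarrow> complex" where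
  "fcalc T \<phi> f = (SOME h. spec_int (spectral_measure T) \<phi> f h)"

text \<open>The operators below are used for nonnegative \<open>A\<close> only, so the values of the functions on
  the negative half-line do not matter. At \<open>\<mu> = 0\<close>, \<open>sin (t \<surd>\<mu>) / \<surd>\<mu>\<close> is extended
  continuously by \<open>t\<close>.\<close>

abbreviation sqrt_A :: "(real \<Rightarrow> real) \<Rightarrow> (real \<Rightarrow> complex) \<Rightarrow> real \<Rightarrow> complex" where
  "sqrt_A V \<equiv> fcalc (schroedinger V) sqrt"

abbreviation dom_sqrt_A :: "(real \<Rightarrow> real) \<Rightarrow> (real \<Rightarrow> complex) set" where
  "dom_sqrt_A V \<equiv> fcalc_dom (schroedinger V) sqrt"

definition wave_solution ::
  "(real \<Rightarrow> real) \<Rightarrow> (real \<Rightarrow> complex) \<Rightarrow> (real \<Rightarrow> complex) \<Rightarrow> real \<Rightarrow> real \<Rightarrow> complex" where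
  "wave_solution V f g t = (\<lambda>x.
     fcalc (schroedinger V) (\<lambda>\<mu>. cos (t * sqrt \<mu>)) f x +
     fcalc (schroedinger V) (\<lambda>\<mu>. if \<mu> = 0 then t else sin (t * sqrt \<mu>) / sqrt \<mu>) g x)"


section \<open>Time derivatives and the Cauchy problem\<close>

text \<open>Since \<open>u t\<close> is an element of \<open>L\<^sup>2\<close>, \<open>\<partial>\<^sub>t\<close> is the derivative of an \<open>L\<^sup>2\<close>-valued
  function with respect to the norm.\<close>

definition has_time_deriv ::
  "(real \<Rightarrow> real \<Rightarrow> complex) \<Rightarrow> (real \<Rightarrow> complex) \<Rightarrow> real \<Rightarrow> bool" where
  "has_time_deriv u v t \<longleftrightarrow> (\<forall>s. u s \<in> L2) \<and> v \<in> L2 \<and>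
     ((\<lambda>s. l2_norm (\<lambda>x. (u s x - u t x) / of_real (s - t) - v x)) \<longlongrightarrow> 0) (at t)"

definition time_deriv :: "(real \<Rightarrow> real \<Rightarrow> complex) \<Rightarrow> real \<Rightarrow> real \<Rightarrow> complex" where
  "time_deriv u t = (SOME v. has_time_deriv u v t)"

definition time_smooth :: "(real \<Rightarrow> real \<Rightarrow> complex) \<Rightarrow> bool" where
  "time_smooth u \<longleftrightarrow> (\<forall>n t. \<exists>v. has_time_deriv ((time_deriv ^^ n) u) v t)"

text \<open>The wave equation \<open>\<partial>\<^sub>t\<^sup>2 u = - A u\<close>; the Neumann condition is contained in the domain
  of \<open>A\<close>.\<close>

definition solves_cauchy ::
  "(real \<Rightarrow> real) \<Rightarrow> (real \<Rightarrow> complex) \<Rightarrow> (real \<Rightarrow> complex) \<Rightarrow> (real \<Rightarrow> real \<Rightarrow> complex) \<Rightarrow> bool" where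
  "solves_cauchy V f g u \<longleftrightarrow> time_smooth u \<and>
     (\<forall>t. (u t, \<lambda>x. - (time_deriv ^^ 2) u t x) \<in> schroedinger V) \<and>
     l2_eq (u 0) f \<and> l2_eq (time_deriv u 0) g"


section \<open>Absence of negative eigenvalues\<close>

definition no_negative_eigenvalue :: "(real \<Rightarrow> real) \<Rightarrow> bool" where
  "no_negative_eigenvalue V \<longleftrightarrow>
     \<not> (\<exists>E<0. \<exists>h :: real \<Rightarrow> complex.
          h \<in> L2 \<and> smooth_fun_on {0..} h \<and> (\<exists>x\<ge>0. h x \<noteq> 0) \<and> nth_deriv {0..} 1 h 0 = 0 \<and>
          (\<forall>x\<ge>0. - nth_deriv {0..} 2 h x + of_real (V x) * h x = of_real E * h x))"

end

theory Submission
  imports Defs "HOL-Probability.Probability"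
begin

text \<open>
 Since \<open>V\<close> decays, a negative point of the spectrum of \<open>A\<close> would give a Weyl sequence that converges
 locally (Gronwall) and hence, by an estimate at infinity, in \<open>L\<^sup>2\<close>, to an eigenfunction; so
 \<open>A \<ge> 0\<close>. The spectral measure of \<open>A\<close> comes from that of the resolvent, a positive contraction \<open>R\<close>:
 point masses at \<open>k / n\<close> with weights \<open>(n choose k) \<langle>R\<^sup>k (1 - R)\<^sup>n\<^sup>-\<^sup>k f, f\<rangle>\<close> converge weakly to
 the measure with moments \<open>\<langle>R\<^sup>n f, f\<rangle>\<close>. On vectors in the domain of all powers of \<open>A\<close> the norms
 \<open>\<Sum>\<^sub>j\<^sub>\<le>\<^sub>k \<parallel>A\<^sup>j\<^sup>/\<^sup>2 u\<parallel>\<close> and \<open>\<parallel>u\<parallel>\<close> in \<open>H\<^sup>k\<close> are equivalent, because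
 \<open>u'' = V u - A u\<close> and \<open>\<parallel>u'\<parallel>\<^sup>2 = \<langle>A u, u\<rangle> - \<langle>V u, u\<rangle>\<close>. Both \<open>\<surd>A u\<close> and
 \<open>\<partial>\<^sub>t u\<close> are sums of \<open>cos (t\<surd>A + \<theta>)\<close> applied to \<open>\<surd>A f\<close> and \<open>g\<close>, and these operators commute
 with \<open>A\<close> and are contractions. The parity of \<open>V\<close>, \<open>f\<close>, \<open>g\<close> ensures that \<open>A\<^sup>n f\<close> and
 \<open>A\<^sup>n g\<close> satisfy the Neumann condition.
\<close>

text \<open>The Hilbert spaces are real; the complex structure enters as an isometry with square -1
  that commutes with the resolvent, and \<open>P_commute\<close> makes the spectral projections
  complex-linear. A bounded \<open>R\<close> with \<open>0 <= R <= 1\<close> is used because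
  measures on a compact interval are determined by their moments (Weierstrass), so that identities
  between projections can be verified on powers of \<open>R\<close>; the spectral variable of
  \<open>A\<close> is then \<open>1 / x - M\<close>. Since \<open>spectral_measure\<close> and
  \<open>fcalc\<close> are choices, a measure is constructed to show that one exists, and the
  calculus is then applied to the chosen one. The asymptotics of \<open>V\<close> enters through two
  consequences: bounded derivatives for the Sobolev norms, decay for the spectrum. The hypothesis on
  eigenvalues speaks of smooth eigenfunctions, so eigenvectors of \<open>A\<close> first need
  regularity. Local convergence of the Weyl sequence reduces to one number: by the Neumann
  condition, a solution with small right-hand side is controlled by its value at 0, and
  Bolzano-Weierstrass applies to these values. The right-hand side of the estimates contains
  \<open>sqrt A f\<close> in place of \<open>f\<close>, so \<open>sqrt A f\<close> is treated as the
  datum.\<close>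

abbreviation borel_fun :: "('a::topological_space => 'b::topological_space) set" where
 "borel_fun \<equiv> borel_measurable borel"

section \<open>Riesz representation and the moment problem\<close>

text \<open>The representing vector is the minimizer of \<open>J\<close>: by the parallelogram
  identity a minimizing sequence is Cauchy, and the first variation of \<open>J\<close> at its limit
  vanishes in every direction.\<close>

lemma riesz_representation:
 fixes L :: "'a::{real_inner,complete_space} => real"
 assumes L: "bounded_linear L"
 shows "\<exists>h. \<forall>g. L g = inner h g"
proof -
 interpret L: bounded_linear L by (rule L)
 obtain K where K: "\<And>x. \<bar>L x\<bar> \<le> norm x * K" and K0: "K > 0"
  using L.pos_bounded by auto
 define J where "J g = (norm g)\<^sup>2 / 2 - L g" for g :: 'a
 have J_lb: "- (K\<^sup>2 / 2) \<le> J g" for g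
 proof -
  have "0 \<le> (norm g - K)\<^sup>2" by simp
  then have "norm g * K \<le> (norm g)\<^sup>2 / 2 + K\<^sup>2 / 2"
   by (simp add: power2_diff)
  then show ?thesis using K[of g] by (simp add: J_def)
 qed
 have bdd: "bdd_below (range J)" using J_lb by (auto intro!: bdd_belowI)
 define m where "m = Inf (range J)"
 have m_le: "m \<le> J g" for g unfolding m_def by (rule cInf_lower[OF _ bdd]) simp
 have par: "(norm (x - y))\<^sup>2 = 4 * (J x + J y - 2 * J ((1/2) *\<^sub>R (x + y)))" for x y
  by (simp add: J_def L.add L.scaleR power2_norm_eq_inner inner_add_left inner_add_right
    inner_diff_left inner_diff_right inner_commute algebra_simps)
 have close: "(norm (x - y))\<^sup>2 \<le> 4 * ((J x - m) + (J y - m))" for x y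
  using par[of x y] m_le[of "(1/2) *\<^sub>R (x + y)"] by simp
 have "\<exists>g. J g < m + inverse (real (Suc n))" for n
 proof (rule ccontr)
  assume "\<not> ?thesis"
  then have "m + inverse (real (Suc n)) \<le> Inf (range J)"
   by (intro cInf_greatest) (auto simp: not_less)
  then show False by (simp add: m_def)
 qed
 then obtain g where g: "\<And>n. J (g n) < m + inverse (real (Suc n))" by metis
 have "Cauchy g"
 proof (rule metric_CauchyI)
  fix e :: real assume e: "e > 0"
  obtain N where N: "inverse (real (Suc N)) < e\<^sup>2 / 8"
   using reals_Archimedean[of "e\<^sup>2/8"] e by auto
  have "dist (g p) (g q) < e" if "p \<ge> N" "q \<ge> N" for p q
  proof -
   have "inverse (real (Suc p)) \<le> inverse (real (Suc N))"
      "inverse (real (Suc q)) \<le> inverse (real (Suc N))"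
    using that by (auto simp: field_simps)
   then have "J (g p) - m < e\<^sup>2 / 8" "J (g q) - m < e\<^sup>2 / 8"
    using g[of p] g[of q] N by linarith+
   then have "(norm (g p - g q))\<^sup>2 < e\<^sup>2"
    using close[of "g p" "g q"] by argo
   then show ?thesis using e by (simp add: dist_norm power2_less_imp_less)
  qed
  then show "\<exists>M. \<forall>m\<ge>M. \<forall>n\<ge>M. dist (g m) (g n) < e" by blast
 qed
 then obtain h where h: "g \<longlonglongrightarrow> h" using Cauchy_convergent convergent_def by blast
 have "(\<lambda>n. J (g n)) \<longlonglongrightarrow> J h"
  unfolding J_def by (intro tendsto_intros h L.tendsto) simp_all
 moreover have "(\<lambda>n. m + inverse (real (Suc n))) \<longlonglongrightarrow> m"
  using LIMSEQ_inverse_real_of_nat_add by simp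
 ultimately have Jh: "J h \<le> m"
  by (rule LIMSEQ_le) (use g less_imp_le in blast)
 have "L g = inner h g" for g
 proof -
  define a where "a = inner h g - L g"
  have "0 \<le> t * a + t\<^sup>2 * (norm g)\<^sup>2 / 2" for t
  proof -
   have "J h \<le> J (h + t *\<^sub>R g)" using Jh m_le order_trans by blast
   moreover have "(norm (h + t *\<^sub>R g))\<^sup>2 = (norm h)\<^sup>2 + 2 * (t * inner h g) + t\<^sup>2 * (norm g)\<^sup>2"
    unfolding power2_norm_eq_inner
    by (simp add: inner_add_left inner_add_right inner_commute[of g h] algebra_simps
      power2_eq_square del: dot_square_norm)
   ultimately show ?thesis
    by (simp add: J_def L.add L.scaleR a_def algebra_simps)
  qed
  \<comment> \<open>The quadratic in \<open>t\<close> is smallest at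
    \<open>- a / (norm g)^2\<close>; the added 1 keeps the denominator positive when
    \<open>g = 0\<close>.\<close>
  from this[of "- a / ((norm g)\<^sup>2 + 1)"]
  have "0 \<le> - (a\<^sup>2 / ((norm g)\<^sup>2 + 1)) + a\<^sup>2 * (norm g)\<^sup>2 / (2 * ((norm g)\<^sup>2 + 1)\<^sup>2)"
   by (simp add: power2_eq_square field_simps)
  moreover have "a\<^sup>2 * (norm g)\<^sup>2 / (2 * ((norm g)\<^sup>2 + 1)\<^sup>2) \<le> a\<^sup>2 / (2 * ((norm g)\<^sup>2 + 1))"
  proof -
   have p: "0 < (norm g)\<^sup>2 + 1" by (simp add: add_nonneg_pos)
   have "a\<^sup>2 * (norm g)\<^sup>2 \<le> a\<^sup>2 * ((norm g)\<^sup>2 + 1)" by (intro mult_left_mono) auto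
   then have "a\<^sup>2 * (norm g)\<^sup>2 / (2 * ((norm g)\<^sup>2 + 1)\<^sup>2) \<le> a\<^sup>2 * ((norm g)\<^sup>2 + 1) / (2 * ((norm g)\<^sup>2 + 1)\<^sup>2)"
    by (intro divide_right_mono) auto
   also have "\<dots> = a\<^sup>2 / (2 * ((norm g)\<^sup>2 + 1))" using p by (simp add: power2_eq_square)
   finally show ?thesis .
  qed
  moreover have "a\<^sup>2 / (2 * ((norm g)\<^sup>2 + 1)) = (a\<^sup>2 / ((norm g)\<^sup>2 + 1)) / 2" by simp
  moreover have "0 \<le> - X + Y ==> Y \<le> Z ==> Z = X / 2 ==> Z \<le> 0" for X Y Z :: real by linarith
  ultimately have "a\<^sup>2 / (2 * ((norm g)\<^sup>2 + 1)) \<le> 0" by blast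
  moreover have "0 < 2 * ((norm g)\<^sup>2 + 1)" by (simp add: add_nonneg_pos)
  ultimately have "a\<^sup>2 \<le> 0" by (simp add: divide_le_0_iff)
  then show ?thesis by (simp add: a_def)
 qed
 then show ?thesis by blast
qed

text \<open>Polynomials are dense in the continuous functions on \<open>[0, 1]\<close>, continuous
  ramps converge to indicators of half-lines, and half-lines generate the Borel sets. Summing over
  finitely many weighted measures lets a linear relation between several moment sequences pass to
  the measures; the weights admit powers and indicators as densities.\<close>

lemma moments_zero_imp_zero:
 fixes z :: "'i => real measure" and w :: "'i => real => real"
 assumes I: "finite I"
  and fin: "\<And>i. i \<in> I ==> finite_measure (z i)"
  and sets: "\<And>i. i \<in> I ==> sets (z i) = sets borel"
  and supp: "\<And>i. i \<in> I ==> AE x in z i. 0 \<le> x \<and> x \<le> 1"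
  and w: "\<And>i. i \<in> I ==> w i \<in> borel_fun"
  and K: "\<And>i x. i \<in> I ==> \<bar>w i x\<bar> \<le> K"
  and mom: "\<And>n::nat. (\<Sum>i\<in>I. LINT x|z i. x ^ n * w i x) = 0"
  and B: "B \<in> sets borel"
 shows "(\<Sum>i\<in>I. LINT x|z i. indicator B x * w i x) = 0"
proof -
 let ?J = "\<lambda>f. \<Sum>i\<in>I. LINT x|z i. f x * w i x"
 have meas: "borel_measurable (z i) = borel_fun" if "i \<in> I" for i
  using sets[OF that] by (rule measurable_cong_sets) simp
 have K0: "I = {} \<or> 0 \<le> K" using K by (metis abs_ge_zero all_not_in_conv order_trans)
 have int: "integrable (z i) (\<lambda>x. f x * w i x)"
  if i: "i \<in> I" and f: "f \<in> borel_fun" and C: "\<And>x. 0 \<le> x ==> x \<le> 1 ==> \<bar>f x\<bar> \<le> C" for f C i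
 proof (rule finite_measure.integrable_const_bound[OF fin[OF i], of _ "C * K"])
  show "AE x in z i. norm (f x * w i x) \<le> C * K"
   using supp[OF i]
  proof eventually_elim
   case (elim x)
   then have "\<bar>f x\<bar> * \<bar>w i x\<bar> \<le> C * K"
    using C[of x] K[OF i, of x] by (intro mult_mono) (auto intro: order_trans[OF abs_ge_zero])
   then show ?case by (simp add: abs_mult)
  qed
  show "(\<lambda>x. f x * w i x) \<in> borel_measurable (z i)"
   unfolding meas[OF i] using f w[OF i] by measurable
 qed
 have int1: "integrable (z i) (\<lambda>x. f x * w i x)"
  if "i \<in> I" "f \<in> borel_fun" "\<And>x. 0 \<le> x ==> x \<le> 1 ==> \<bar>f x\<bar> \<le> 1" for f i
  using that by (rule int)
 have poly: "(\<Sum>i\<in>I. LINT x|z i. (\<Sum>k\<le>n. a k * x ^ k) * w i x) = 0" for a :: "nat => real" and n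
 proof -
  have "(\<Sum>i\<in>I. LINT x|z i. (\<Sum>k\<le>n. a k * x ^ k) * w i x)
    = (\<Sum>i\<in>I. \<Sum>k\<le>n. a k * (LINT x|z i. x ^ k * w i x))"
  proof (rule sum.cong[OF refl])
   fix i assume i: "i \<in> I"
   have "(LINT x|z i. (\<Sum>k\<le>n. a k * x ^ k) * w i x) = (LINT x|z i. (\<Sum>k\<le>n. a k * (x ^ k * w i x)))"
    by (simp add: sum_distrib_right mult.assoc)
   also have "\<dots> = (\<Sum>k\<le>n. LINT x|z i. a k * (x ^ k * w i x))"
    by (intro Bochner_Integration.integral_sum integrable_mult_right int1[OF i])
     (auto simp: power_le_one)
   finally show "(LINT x|z i. (\<Sum>k\<le>n. a k * x ^ k) * w i x) = (\<Sum>k\<le>n. a k * (LINT x|z i. x ^ k * w i x))"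
    by simp
  qed
  also have "\<dots> = (\<Sum>k\<le>n. a k * (\<Sum>i\<in>I. LINT x|z i. x ^ k * w i x))"
   by (subst sum.swap) (simp add: sum_distrib_left)
  finally show ?thesis by (simp add: mom)
 qed
 have cont: "?J f = 0" if f: "continuous_on UNIV f" for f :: "real => real"
 proof -
  have fb: "f \<in> borel_fun" using f by (rule borel_measurable_continuous_onI)
  obtain C where C: "\<And>x. 0 \<le> x ==> x \<le> 1 ==> \<bar>f x\<bar> \<le> C"
  proof -
   have "compact (f ` {0..1})"
    by (rule compact_continuous_image) (auto intro: continuous_on_subset[OF f])
   then have "bounded (f ` {0..1})" by (rule compact_imp_bounded)
   then show ?thesis using that unfolding bounded_iff by (metis atLeastAtMost_iff imageI real_norm_def)
  qed
  define T where "T = (\<Sum>i\<in>I. K * measure (z i) (space (z i)))"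
  have T0: "0 \<le> T" unfolding T_def using K0 by (auto intro!: sum_nonneg)
  have "\<bar>?J f\<bar> \<le> e" if e: "e > 0" for e
  proof -
   define d where "d = e / (T + 1)"
   have d: "d > 0" using e T0 by (simp add: d_def)
   obtain g where g: "real_polynomial_function g" and fg: "\<And>x. x \<in> {0..1} ==> \<bar>f x - g x\<bar> < d"
    using Stone_Weierstrass_real_polynomial_function[of "{0..1::real}" f d] d
     continuous_on_subset[OF f subset_UNIV] by auto
   obtain a n where gp: "g = (\<lambda>x. \<Sum>k\<le>n. a k * x ^ k)"
    using g by (auto simp: real_polynomial_function_iff_sum)
   have gb: "g \<in> borel_fun" unfolding gp by measurable
   have gC: "\<bar>g x\<bar> \<le> C + d" if "0 \<le> x" "x \<le> 1" for x
    using C[of x] fg[of x] that by auto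
   have "?J f
     = ?J f - ?J g"
    using poly unfolding gp by simp
   also have "\<dots> = (\<Sum>i\<in>I. LINT x|z i. f x * w i x - g x * w i x)"
    unfolding sum_subtractf[symmetric]
    by (intro sum.cong refl Bochner_Integration.integral_diff[symmetric] int[OF _ fb C] int[OF _ gb gC])
   finally have "\<bar>?J f\<bar> \<le> (\<Sum>i\<in>I. \<bar>LINT x|z i. f x * w i x - g x * w i x\<bar>)"
    by simp
   also have "\<dots> \<le> (\<Sum>i\<in>I. d * (K * measure (z i) (space (z i))))"
   proof (rule sum_mono)
    fix i assume i: "i \<in> I"
    interpret finite_measure "z i" by (rule fin[OF i])
    have "\<bar>LINT x|z i. f x * w i x - g x * w i x\<bar> \<le> (LINT x|z i. \<bar>f x * w i x - g x * w i x\<bar>)"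
     by (rule integral_abs_bound)
    also have "\<dots> \<le> (LINT x|z i. d * K)"
    proof (rule integral_mono_AE)
     show "integrable (z i) (\<lambda>x. \<bar>f x * w i x - g x * w i x\<bar>)"
      by (intro integrable_abs Bochner_Integration.integrable_diff int[OF i fb C] int[OF i gb gC])
     show "integrable (z i) (\<lambda>x. d * K)" by simp
     show "AE x in z i. \<bar>f x * w i x - g x * w i x\<bar> \<le> d * K"
      using supp[OF i]
     proof eventually_elim
      case (elim x)
      then have "\<bar>f x - g x\<bar> * \<bar>w i x\<bar> \<le> d * K"
       using fg[of x] K[OF i, of x] by (intro mult_mono) auto
      then show ?case by (simp add: abs_mult[symmetric] left_diff_distrib)
     qed
    qed
    finally show "\<bar>LINT x|z i. f x * w i x - g x * w i x\<bar> \<le> d * (K * measure (z i) (space (z i)))"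
     by (simp add: mult_ac)
   qed
   also have "\<dots> = d * T" by (simp add: T_def sum_distrib_left)
   also have "\<dots> \<le> d * (T + 1)" using d by simp
   also have "\<dots> = e" using T0 by (simp add: d_def)
   finally show ?thesis .
  qed
  note le = this
  have "\<bar>?J f\<bar> \<le> 0"
  proof (rule field_le_epsilon)
   fix e :: real assume "0 < e"
   then show "\<bar>?J f\<bar> \<le> 0 + e" using le[of e] by linarith
  qed
  then show ?thesis by simp
 qed
 have half: "?J (indicator {..a}) = 0" for a
 proof -
  \<comment> \<open>For positive \<open>n\<close> a continuous ramp, equal to 1 up to
    \<open>a\<close> and to 0 from \<open>a + 1 / n\<close> on; it decreases to the indicator of
    \<open>{..a}\<close>.\<close>
  define s where "s n x = max 0 (min 1 (1 - real n * (x - a)))" for n x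
  have "(\<lambda>n. \<Sum>i\<in>I. LINT x|z i. s n x * w i x) \<longlonglongrightarrow> ?J (indicator {..a})"
  proof (rule tendsto_sum)
   fix i assume i: "i \<in> I"
   interpret finite_measure "z i" by (rule fin[OF i])
   show "(\<lambda>n. LINT x|z i. s n x * w i x) \<longlonglongrightarrow> (LINT x|z i. indicator {..a} x * w i x)"
   proof (rule integral_dominated_convergence[where w="\<lambda>_. K"])
    show "(\<lambda>x. indicator {..a} x * w i x) \<in> borel_measurable (z i)"
     unfolding meas[OF i] using w[OF i] by measurable
    show "(\<lambda>x. s n x * w i x) \<in> borel_measurable (z i)" for n
     unfolding meas[OF i] s_def using w[OF i] by measurable
    show "integrable (z i) (\<lambda>_. K)" by simp
    show "AE x in z i. norm (s n x * w i x) \<le> K" for n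
    proof (rule AE_I2)
     fix x
     have "\<bar>s n x\<bar> * \<bar>w i x\<bar> \<le> 1 * K" using K[OF i] by (intro mult_mono) (auto simp: s_def)
     then show "norm (s n x * w i x) \<le> K" by (simp add: abs_mult)
    qed
    show "AE x in z i. (\<lambda>n. s n x * w i x) \<longlonglongrightarrow> indicator {..a} x * w i x"
    proof (rule AE_I2, rule tendsto_mult_right)
     fix x
     show "(\<lambda>n. s n x) \<longlonglongrightarrow> indicator {..a} x"
     proof (cases "x \<le> a")
      case True
      then have "s n x = 1" for n
       by (auto simp: s_def max_def min_def mult_nonneg_nonpos)
      then show ?thesis using True by simp
     next
      case False
      then obtain N where N: "1 < real N * (x - a)"
       using ex_less_of_nat_mult[of "x - a" 1] by auto
      have "s n x = 0" if "n \<ge> N" for n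
      proof -
       have "real N * (x - a) \<le> real n * (x - a)" using that False by (intro mult_right_mono) auto
       then show ?thesis using N by (auto simp: s_def)
      qed
      then have "eventually (\<lambda>n. s n x = 0) sequentially" by (auto simp: eventually_sequentially)
      then show ?thesis using False by (simp add: tendsto_eventually)
     qed
    qed
   qed
  qed
  moreover have "?J (s n) = 0" for n
   by (rule cont) (auto simp: s_def intro!: continuous_intros)
  ultimately show ?thesis by (simp add: LIMSEQ_const_iff)
 qed
 have B': "B \<in> sigma_sets UNIV (range (\<lambda>a::real. {..a}))"
  using B by (simp add: borel_eq_atMost)
 have Int: "Int_stable (range (\<lambda>a::real. {..a}))" by (auto simp: Int_stable_def)
 have sub: "range (\<lambda>a::real. {..a}) \<subseteq> Pow UNIV" by simp
 show ?thesis
  using Int sub B'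
 proof (induction rule: sigma_sets_induct_disjoint)
  case (basic A)
  then show ?case using half by auto
 next
  case empty
  then show ?case by simp
 next
  case (compl A)
  have A: "A \<in> sets borel" using compl.hyps by (simp add: borel_eq_atMost)
  have "?J (indicator (UNIV - A))
    = (\<Sum>i\<in>I. LINT x|z i. 1 * w i x - indicator A x * w i x)"
   by (intro sum.cong refl Bochner_Integration.integral_cong) (auto simp: indicator_def)
  also have "\<dots> = (\<Sum>i\<in>I. (LINT x|z i. 1 * w i x) - (LINT x|z i. indicator A x * w i x))"
   using A by (intro sum.cong refl Bochner_Integration.integral_diff int1) (auto simp: indicator_def)
  also have "\<dots> = 0" using mom[of 0] compl.IH by (simp add: sum_subtractf)
  finally show ?case .
 next
  case (union D)
  have D: "D k \<in> sets borel" for k using union.hyps by (auto simp: borel_eq_atMost)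
  define s where "s n x = (\<Sum>k<n. indicator (D k) x :: real)" for n x
  have s: "s n x = indicator (\<Union>k<n. D k) x" for n x
   unfolding s_def
   by (subst indicator_UN_disjoint) (use union.hyps in \<open>auto simp: disjoint_family_on_def\<close>)
  have "(\<lambda>n. \<Sum>i\<in>I. LINT x|z i. s n x * w i x) \<longlonglongrightarrow> ?J (indicator (\<Union>(range D)))"
  proof (rule tendsto_sum)
   fix i assume i: "i \<in> I"
   interpret finite_measure "z i" by (rule fin[OF i])
   show "(\<lambda>n. LINT x|z i. s n x * w i x) \<longlonglongrightarrow> (LINT x|z i. indicator (\<Union>(range D)) x * w i x)"
   proof (rule integral_dominated_convergence[where w="\<lambda>_. K"])
    show "(\<lambda>x. indicator (\<Union>(range D)) x * w i x) \<in> borel_measurable (z i)"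
     unfolding meas[OF i] using w[OF i] D by measurable
    show "(\<lambda>x. s n x * w i x) \<in> borel_measurable (z i)" for n
     unfolding meas[OF i] s_def using w[OF i] D by measurable
    show "integrable (z i) (\<lambda>_. K)" by simp
    show "AE x in z i. norm (s n x * w i x) \<le> K" for n
    proof (rule AE_I2)
     fix x
     have "\<bar>s n x\<bar> * \<bar>w i x\<bar> \<le> 1 * K" using K[OF i] by (intro mult_mono) (auto simp: s indicator_def)
     then show "norm (s n x * w i x) \<le> K" by (simp add: abs_mult)
    qed
    show "AE x in z i. (\<lambda>n. s n x * w i x) \<longlonglongrightarrow> indicator (\<Union>(range D)) x * w i x"
     unfolding s by (rule AE_I2, rule tendsto_mult_right, rule LIMSEQ_indicator_UN)
   qed
  qed
  moreover have "?J (s n) = 0" for n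
  proof -
   have "?J (s n) = (\<Sum>i\<in>I. \<Sum>k<n. LINT x|z i. indicator (D k) x * w i x)"
    unfolding s_def sum_distrib_right
    using D by (intro sum.cong refl Bochner_Integration.integral_sum int1) (auto simp: indicator_def)
   also have "\<dots> = 0" by (subst sum.swap) (simp add: union.IH)
   finally show ?thesis .
  qed
  ultimately show ?case by (simp add: LIMSEQ_const_iff)
 qed
qed

lemma integral_point_distr:
 fixes q :: "real => real"
 assumes "finite A" "\<And>k. k \<in> A ==> 0 \<le> w k" "q \<in> borel_fun"
 shows "(LINT x|distr (point_measure A (\<lambda>k. ennreal (w k))) borel p. q x) = (\<Sum>k\<in>A. w k * q (p k))"
 using assms by (subst integral_distr) (auto simp: lebesgue_integral_point_measure_finite)

text \<open>\<open>factorial_moment\<close> is exact for ratios of binomial coefficients, whereas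
  moments need powers of \<open>k / n\<close>. Both are products of \<open>m\<close> factors, and
  corresponding factors differ by at most \<open>m / (n - m)\<close>, uniformly in
  \<open>k\<close>.\<close>

lemma falling_ratio_tendsto:
 fixes m :: nat
 shows "\<exists>y. y \<longlonglongrightarrow> (0::real) \<and> (\<forall>n\<ge>2 * m + 1. \<forall>k\<le>n. \<bar>real (k choose m) / real (n choose m) - (real k / real n) ^ m\<bar> \<le> y n)"
proof (intro exI conjI allI impI)
 show "(\<lambda>n. real m * (real m / (real n - real m))) \<longlonglongrightarrow> 0" by real_asymp
 fix n k assume n: "n \<ge> 2 * m + 1" and k: "k \<le> n"
 have prod: "real (j choose m) = (\<Prod>i<m. real j - real i) / fact m" for j
  by (simp add: binomial_gbinomial gbinomial_prod_rev atLeast0LessThan)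
 have "real (k choose m) / real (n choose m) = (\<Prod>i<m. (real k - real i) / (real n - real i))"
  unfolding prod by (simp add: prod_dividef)
 moreover have "(real k / real n) ^ m = (\<Prod>i<m. real k / real n)" by simp
 ultimately have "\<bar>real (k choose m) / real (n choose m) - (real k / real n) ^ m\<bar>
   = norm ((\<Prod>i<m. (real k - real i) / (real n - real i)) - (\<Prod>i<m. real k / real n))" by simp
 also have "\<dots> \<le> (\<Sum>i<m. norm ((real k - real i) / (real n - real i) - real k / real n))"
 proof (rule norm_prod_diff)
  fix i assume i: "i \<in> {..<m}"
  \<comment> \<open>For \<open>k < i\<close> the numerator is negative; its modulus is at most
    \<open>i\<close>, and \<open>n >= 2 * m + 1\<close> gives \<open>i <= n - i\<close>.\<close>
  show "norm ((real k - real i) / (real n - real i)) \<le> 1"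
   using i n k by (simp add: abs_le_iff divide_le_eq)
  show "norm (real k / real n) \<le> 1" using k n by simp
 qed
 also have "\<dots> \<le> (\<Sum>i<m. real m / (real n - real m))"
 proof (rule sum_mono)
  fix i assume i: "i \<in> {..<m}"
  have nz: "real n - real i > 0" "real n > 0" "real n - real m > 0" using i n by auto
  have "(real k - real i) / (real n - real i) - real k / real n
    = - (real i * ((real n - real k) / real n) / (real n - real i))"
   using nz by (simp add: field_simps)
  then have "norm ((real k - real i) / (real n - real i) - real k / real n)
    = real i * ((real n - real k) / real n) / (real n - real i)"
   using nz k by simp
  also have "\<dots> \<le> real m / (real n - real m)"
  proof (rule frac_le)
   have "(real n - real k) / real n \<le> 1" using nz by simp
   then show "real i * ((real n - real k) / real n) \<le> real m"
    using i mult_mono[of "real i" "real m" "(real n - real k) / real n" 1] k by simp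
  qed (use i nz in auto)
  finally show "norm ((real k - real i) / (real n - real i) - real k / real n) \<le> real m / (real n - real m)" .
 qed
 also have "\<dots> = real m * (real m / (real n - real m))" by simp
 finally show "\<bar>real (k choose m) / real (n choose m) - (real k / real n) ^ m\<bar> \<le> real m * (real m / (real n - real m))" .
qed

section \<open>The spectral theorem\<close>

text \<open>Models \<open>0 <= R <= 1\<close> in the sense of quadratic forms; the instance is the
  resolvent \<open>Rv\<close>. With \<open>S = 1 - R\<close> the weights below form a binomial
  distribution whose commuting "probabilities" are \<open>R\<close> and \<open>S\<close>.\<close>

locale positive_contraction =
 fixes R :: "'a::{real_inner,complete_space} => 'a"
 assumes lin: "linear R"
  and sym: "inner (R f) g = inner f (R g)"
  and pos: "0 \<le> inner (R f) f"
  and le: "inner (R f) f \<le> inner f f"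
begin

definition S where "S f = f - R f"

lemma symS: "inner (S f) g = inner f (S g)"
 by (simp add: S_def inner_diff_left inner_diff_right sym)

lemma RS: "R (S f) = S (R f)" by (simp add: S_def linear_diff[OF lin])

lemma SnR: "(S ^^ n) (R f) = R ((S ^^ n) f)" by (induction n) (simp_all add: RS)

lemma lin_pow: "linear (R ^^ n)"
proof (induction n)
 case 0
 then show ?case unfolding funpow.simps by (rule linear_id)
next
 case (Suc n)
 then show ?case unfolding funpow.simps by (rule linear_compose[OF _ lin])
qed

lemma sym_pow: "inner ((R ^^ n) f) g = inner f ((R ^^ n) g)"
 by (induction n arbitrary: f g) (simp_all add: sym funpow_swap1)

text \<open>By symmetry two equal factors can be shared between both sides of the inner product, so
  the exponents drop by two (\<open>nat_induct2\<close>) until each is 0 or 1.\<close>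

lemma weight_nonneg: "0 \<le> inner ((R ^^ k) ((S ^^ m) f)) f"
proof (induction k arbitrary: f rule: nat_induct2)
 case 0
 show ?case
 proof (induction m arbitrary: f rule: nat_induct2)
  case 1
  then show ?case using le[of f] by (simp add: S_def inner_diff_left)
 next
  case (step m)
  have "(S ^^ (m + 2)) f = S ((S ^^ m) (S f))" by (simp add: funpow_swap1)
  then show ?case using step[of "S f"] by (simp add: symS del: funpow.simps add_2_eq_Suc')
 qed simp
next
 case 1
 show ?case
 proof (induction m arbitrary: f rule: nat_induct2)
  case 0
  then show ?case using pos by simp
 next
  case 1
  \<comment> \<open>The mixed case: \<open>R S\<close> is multiplied by \<open>1 = R + S\<close>,
    and each summand is a positive operator conjugated by a symmetric one.\<close>
  have "R (S f) = R (S (R f)) + S (R (S f))"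
   by (simp add: S_def linear_diff[OF lin])
  then have "inner (R (S f)) f = inner (R (S (R f))) f + inner (S (R (S f))) f"
   by (metis inner_add_left)
  then have "inner (R (S f)) f = inner (S (R f)) (R f) + inner (R (S f)) (S f)"
   by (simp only: sym[of "S (R f)" f] symS[of "R (S f)" f])
  moreover have "0 \<le> inner (S (R f)) (R f)"
   using le[of "R f"] by (simp add: S_def inner_diff_left linear_diff[OF lin])
  ultimately show ?case using pos[of "S f"] by simp
 next
  case (step m)
  have "(S ^^ (m + 2)) f = S ((S ^^ m) (S f))" by (simp add: funpow_swap1)
  then show ?case using step[of "S f"] by (simp add: symS RS del: add_2_eq_Suc')
 qed
next
 case (step k)
 have "(R ^^ (k + 2)) ((S ^^ m) f) = R ((R ^^ k) ((S ^^ m) (R f)))"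
  by (simp add: SnR funpow_swap1)
 then have "inner ((R ^^ (k + 2)) ((S ^^ m) f)) f = inner ((R ^^ k) ((S ^^ m) (R f))) (R f)"
  by (simp only: sym)
 then show ?case using step by simp
qed

text \<open>Binomial theorem for the commuting operators \<open>R\<close> and \<open>S\<close>,
  whose sum is the identity.\<close>

lemma binomial_id: "(\<Sum>j\<le>N. real (N choose j) *\<^sub>R (R ^^ j) ((S ^^ (N - j)) f)) = f"
proof (induction N arbitrary: f)
 case (Suc N)
 define g where "g j = (R ^^ j) ((S ^^ (Suc N - j)) f)" for j
 have "(\<Sum>j\<le>Suc N. real (Suc N choose j) *\<^sub>R g j) = g 0 + (\<Sum>j\<le>N. real (Suc N choose Suc j) *\<^sub>R g (Suc j))"
  by (simp add: sum.atMost_Suc_shift del: sum.atMost_Suc binomial_Suc_Suc)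
 also have "(\<Sum>j\<le>N. real (Suc N choose Suc j) *\<^sub>R g (Suc j))
   = (\<Sum>j\<le>N. real (N choose j) *\<^sub>R g (Suc j)) + (\<Sum>j\<le>N. real (N choose Suc j) *\<^sub>R g (Suc j))"
  by (simp add: scaleR_add_left sum.distrib)
 also have "g 0 + (\<dots>) = (\<Sum>j\<le>N. real (N choose j) *\<^sub>R g (Suc j)) + (\<Sum>j\<le>Suc N. real (N choose j) *\<^sub>R g j)"
  by (simp add: sum.atMost_Suc_shift del: sum.atMost_Suc)
 also have "(\<Sum>j\<le>Suc N. real (N choose j) *\<^sub>R g j) = (\<Sum>j\<le>N. real (N choose j) *\<^sub>R g j)"
  by (simp add: binomial_eq_0)
 also have "\<dots> = (\<Sum>j\<le>N. real (N choose j) *\<^sub>R (R ^^ j) ((S ^^ (N - j)) (S f)))"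
  by (intro sum.cong refl) (simp add: g_def Suc_diff_le funpow_swap1)
 also have "\<dots> = S f" by (rule Suc.IH)
 also have "(\<Sum>j\<le>N. real (N choose j) *\<^sub>R g (Suc j)) = (\<Sum>j\<le>N. real (N choose j) *\<^sub>R (R ^^ j) ((S ^^ (N - j)) (R f)))"
  by (intro sum.cong refl) (simp add: g_def SnR funpow_swap1)
 also have "\<dots> = R f" by (rule Suc.IH)
 also have "R f + S f = f" by (simp add: S_def)
 finally show ?case by (simp only: g_def)
qed simp

text \<open>The product of \<open>n choose k\<close> and \<open>k choose m\<close> equals that of
  \<open>n choose m\<close> and \<open>(n - m) choose (k - m)\<close>. After this exchange
  \<open>R ^^ m\<close> splits off, and the remaining binomial sum of order \<open>n - m\<close> is
  the identity by \<open>binomial_id\<close>.\<close>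

lemma factorial_moment:
 assumes "m \<le> n"
 shows "(\<Sum>k\<le>n. real (n choose k) * inner ((R ^^ k) ((S ^^ (n - k)) f)) f * (real (k choose m) / real (n choose m)))
  = inner ((R ^^ m) f) f"
proof -
 have nz: "real (n choose m) \<noteq> 0" using assms by (simp add: zero_less_binomial)
 have "(\<Sum>k\<le>n. real (n choose k) * inner ((R ^^ k) ((S ^^ (n - k)) f)) f * (real (k choose m) / real (n choose m)))
   = (\<Sum>k\<in>{m..n}. real (n choose k) * inner ((R ^^ k) ((S ^^ (n - k)) f)) f * (real (k choose m) / real (n choose m)))"
  by (rule sum.mono_neutral_right) (auto simp: binomial_eq_0)
 also have "\<dots> = (\<Sum>k\<in>{m..n}. real ((n - m) choose (k - m)) * inner ((R ^^ k) ((S ^^ (n - k)) f)) f)"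
 proof (rule sum.cong[OF refl])
  fix k assume k: "k \<in> {m..n}"
  have "real (n choose k) * real (k choose m) = real (n choose m) * real ((n - m) choose (k - m))"
   using choose_mult[of m k n] k by (simp flip: of_nat_mult)
  then show "real (n choose k) * inner ((R ^^ k) ((S ^^ (n - k)) f)) f * (real (k choose m) / real (n choose m))
    = real ((n - m) choose (k - m)) * inner ((R ^^ k) ((S ^^ (n - k)) f)) f"
   using nz by (simp add: field_simps)
 qed
 also have "\<dots> = (\<Sum>j\<le>n - m. real ((n - m) choose j) * inner ((R ^^ (j + m)) ((S ^^ (n - m - j)) f)) f)"
  by (rule sum.reindex_bij_witness[of _ "\<lambda>j. j + m" "\<lambda>k. k - m"]) (use assms in auto)
 also have "\<dots> = (\<Sum>j\<le>n - m. inner (real ((n - m) choose j) *\<^sub>R (R ^^ j) ((S ^^ (n - m - j)) f)) ((R ^^ m) f))"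
 proof (rule sum.cong[OF refl])
  fix j
  have "(R ^^ (j + m)) h = (R ^^ m) ((R ^^ j) h)" for h by (simp add: add.commute[of j m] funpow_add)
  then show "real ((n - m) choose j) * inner ((R ^^ (j + m)) ((S ^^ (n - m - j)) f)) f
    = inner (real ((n - m) choose j) *\<^sub>R (R ^^ j) ((S ^^ (n - m - j)) f)) ((R ^^ m) f)"
   by (simp add: sym_pow)
 qed
 also have "\<dots> = inner f ((R ^^ m) f)"
  by (simp only: inner_sum_left[symmetric] binomial_id)
 finally show ?thesis by (simp add: inner_commute)
qed

text \<open>For a unit vector the discrete measures \<open>N n\<close> are probability measures, so
  tightness yields a weakly convergent subsequence. Their exact moments are known only in factorial
  form; \<open>falling_ratio_tendsto\<close> closes the gap in the limit.\<close>

lemma moment_measure_unit: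
 assumes f: "norm f = 1"
 shows "\<exists>M. finite_measure M \<and> sets M = sets (borel :: real measure) \<and> (AE x in M. 0 \<le> x \<and> x \<le> 1) \<and>
  (\<forall>n. (LINT x|M. x ^ n) = inner ((R ^^ n) f) f)"
proof -
 define w where "w n k = real (n choose k) * inner ((R ^^ k) ((S ^^ (n - k)) f)) f" for n k
 have w0: "0 \<le> w n k" for n k by (simp add: w_def weight_nonneg)
 have w1: "(\<Sum>k\<le>n. w n k) = 1" for n
  using factorial_moment[of 0 n f] f by (simp add: w_def dot_square_norm)
 \<comment> \<open>For \<open>n = 0\<close> the single atom sits at \<open>0 / 0 = 0\<close>, still
   inside \<open>[0, 1]\<close>.\<close>
 define N where "N n = distr (point_measure {..n} (\<lambda>k. ennreal (w n k))) borel (\<lambda>k. real k / real n)" for n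
 have intN: "(LINT x|N n. q x) = (\<Sum>k\<le>n. w n k * q (real k / real n))" if "q \<in> borel_fun" for q :: "real => real" and n
  unfolding N_def by (rule integral_point_distr) (use that w0 in auto)
 have pN: "prob_space (point_measure {..n} (\<lambda>k. ennreal (w n k)))" for n
  by (rule prob_spaceI) (simp add: space_point_measure emeasure_point_measure_finite sum_ennreal w0 w1)
 have rd: "real_distribution (N n)" for n
 proof -
  interpret prob_space "point_measure {..n} (\<lambda>k. ennreal (w n k))" by (rule pN)
  show ?thesis unfolding N_def by (rule real_distribution_distr) simp
 qed
 have "tight N"
  unfolding tight_def
 proof (intro conjI allI impI)
  fix y :: real assume e: "y > 0"
  \<comment> \<open>Tightness asks for an interval that is open on the left; the end -1 keeps the
    atom at 0 inside.\<close>
  have "measure (N n) {-1<..1} = 1" for n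
  proof -
   have "measure (N n) {-1<..1} = (LINT x|N n. indicator {-1<..1} x)"
    using rd[of n] by (simp add: real_distribution_def real_distribution_axioms_def)
   also have "\<dots> = (\<Sum>k\<le>n. w n k * indicator {-1<..1} (real k / real n))"
    by (rule intN) simp
   also have "\<dots> = (\<Sum>k\<le>n. w n k)"
   proof (rule sum.cong[OF refl])
    fix k assume "k \<in> {..n}"
    then have "real k / real n \<in> {-1<..1}"
     by (auto simp: divide_le_eq) (smt (verit) divide_nonneg_nonneg of_nat_0_le_iff)
    then show "w n k * indicator {-1<..1} (real k / real n) = w n k" by simp
   qed
   finally show ?thesis by (simp add: w1)
  qed
  then show "\<exists>a b. a < b \<and> (\<forall>n. measure (N n) {a<..b} > 1 - y)"
   using e by (intro exI[of _ "-1"] exI[of _ 1]) auto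
 qed (rule rd)
 then obtain r M where r: "strict_mono (r :: nat => nat)" and M: "real_distribution M" and conv: "weak_conv_m (N \<circ> id \<circ> r) M"
  using tight_imp_convergent_subsubsequence[of N id] by (auto simp: strict_mono_id)
 interpret M: real_distribution M by (rule M)
 have lim: "(\<lambda>n. \<Sum>k\<le>r n. w (r n) k * q (real k / real (r n))) \<longlonglongrightarrow> (LINT x|M. q x)"
  if c: "continuous_on UNIV q" and b: "\<And>x. \<bar>q x\<bar> \<le> 1" for q :: "real => real"
 proof -
  have "(\<lambda>n. LINT x|(N \<circ> id \<circ> r) n. q x) \<longlonglongrightarrow> (LINT x|M. q x)"
   by (rule weak_conv_imp_integral_bdd_continuous_conv[OF _ M conv, where B=1])
    (use rd c b in \<open>auto simp: continuous_on_eq_continuous_at\<close>)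
  then show ?thesis using c by (simp add: intN borel_measurable_continuous_onI)
 qed
 have frac01: "0 \<le> real k / real n \<and> real k / real n \<le> 1" if "k \<le> n" for k n
  using that by (simp add: divide_le_eq)
 \<comment> \<open>Distance to \<open>[0, 1]\<close>, cut off at 1: a bounded continuous function
   that vanishes on all atoms. Its integral against \<open>M\<close> is therefore 0, which confines
   \<open>M\<close> to \<open>[0, 1]\<close>.\<close>
 define z where "z x = min 1 \<bar>x - max 0 (min 1 x)\<bar>" for x :: real
 have cz: "continuous_on UNIV z" unfolding z_def by (intro continuous_intros)
 have bz: "\<bar>z x\<bar> \<le> 1" "0 \<le> z x" for x unfolding z_def by auto
 have mz: "z \<in> borel_fun" using cz by (rule borel_measurable_continuous_onI)
 have "(\<lambda>n. \<Sum>k\<le>r n. w (r n) k * z (real k / real (r n))) = (\<lambda>n. 0)"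
 proof (intro ext sum.neutral ballI)
  fix n k assume "k \<in> {..r n}"
  then have "z (real k / real (r n)) = 0" using frac01[of k "r n"] by (simp add: z_def)
  then show "w (r n) k * z (real k / real (r n)) = 0" by simp
 qed
 then have "(LINT x|M. z x) = 0" using lim[OF cz bz(1)] by (simp add: LIMSEQ_const_iff)
 moreover have "integrable M z"
  by (rule M.integrable_const_bound[of _ 1]) (use bz mz in auto)
 ultimately have "AE x in M. z x = 0"
  using bz by (subst (asm) integral_nonneg_eq_0_iff_AE) auto
 then have AE: "AE x in M. 0 \<le> x \<and> x \<le> 1"
  by eventually_elim (auto simp: z_def min_def max_def split: if_splits)
 have "(LINT x|M. x ^ m) = inner ((R ^^ m) f) f" for m
 proof -
  \<comment> \<open>Bounded continuous substitute for \<open>x ^ m\<close>, equal to it on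
    \<open>[0, 1]\<close>, where all the measures live.\<close>
  define q where "q x = (max 0 (min 1 x)) ^ m" for x :: real
  have cq: "continuous_on UNIV q" unfolding q_def by (intro continuous_intros)
  have bq: "\<bar>q x\<bar> \<le> 1" for x unfolding q_def by (auto simp: power_le_one)
  have "(\<lambda>n. \<Sum>k\<le>r n. w (r n) k * q (real k / real (r n))) = (\<lambda>n. \<Sum>k\<le>r n. w (r n) k * (real k / real (r n)) ^ m)"
  proof (intro ext sum.cong refl)
   fix n k assume "k \<in> {..r n}"
   then have "q (real k / real (r n)) = (real k / real (r n)) ^ m"
    using frac01[of k "r n"] by (simp add: q_def min.absorb2 max.absorb2)
   then show "w (r n) k * q (real k / real (r n)) = w (r n) k * (real k / real (r n)) ^ m" by simp
  qed
  moreover have "(LINT x|M. q x) = (LINT x|M. x ^ m)"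
   by (rule integral_cong_AE) (use AE in \<open>auto simp: q_def min_def max_def\<close>)
  ultimately have l1: "(\<lambda>n. \<Sum>k\<le>r n. w (r n) k * (real k / real (r n)) ^ m) \<longlonglongrightarrow> (LINT x|M. x ^ m)"
   using lim[OF cq bq] by simp
  obtain y where y: "y \<longlonglongrightarrow> (0::real)"
   and b: "\<And>n k. n\<ge>2 * m + 1 ==> k\<le>n ==> \<bar>real (k choose m) / real (n choose m) - (real k / real n) ^ m\<bar> \<le> y n"
   using falling_ratio_tendsto[of m] by blast
  have err: "\<bar>(\<Sum>k\<le>n. w n k * (real k / real n) ^ m) - inner ((R ^^ m) f) f\<bar> \<le> y n" if n: "n \<ge> 2 * m + 1" for n
  proof -
   have "inner ((R ^^ m) f) f = (\<Sum>k\<le>n. w n k * (real (k choose m) / real (n choose m)))"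
    using factorial_moment[of m n f] n by (simp add: w_def)
   then have "\<bar>(\<Sum>k\<le>n. w n k * (real k / real n) ^ m) - inner ((R ^^ m) f) f\<bar>
    = \<bar>\<Sum>k\<le>n. w n k * ((real k / real n) ^ m - real (k choose m) / real (n choose m))\<bar>"
    by (simp add: sum_subtractf right_diff_distrib)
   also have "\<dots> \<le> (\<Sum>k\<le>n. w n k * y n)"
   proof (rule order_trans[OF sum_abs], rule sum_mono)
    fix k assume "k \<in> {..n}"
    then have "\<bar>(real k / real n) ^ m - real (k choose m) / real (n choose m)\<bar> \<le> y n"
     using b[OF n, of k] by (simp add: abs_minus_commute)
    then show "\<bar>w n k * ((real k / real n) ^ m - real (k choose m) / real (n choose m))\<bar> \<le> w n k * y n"
     using w0[of n k] by (simp add: abs_mult mult_left_mono)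
   qed
   also have "\<dots> = y n" by (simp add: sum_distrib_right[symmetric] w1)
   finally show ?thesis .
  qed
  have "(\<lambda>n. (\<Sum>k\<le>r n. w (r n) k * (real k / real (r n)) ^ m) - inner ((R ^^ m) f) f) \<longlonglongrightarrow> 0"
  proof (rule Lim_null_comparison)
   show "(\<lambda>n. y (r n)) \<longlonglongrightarrow> 0" using LIMSEQ_subseq_LIMSEQ[OF y r] by (simp add: o_def)
   show "\<forall>\<^sub>F n in sequentially. norm ((\<Sum>k\<le>r n. w (r n) k * (real k / real (r n)) ^ m) - inner ((R ^^ m) f) f) \<le> y (r n)"
    unfolding eventually_sequentially
   proof (intro exI[of _ "2 * m + 1"] allI impI)
    fix n assume "2 * m + 1 \<le> n"
    then have "2 * m + 1 \<le> r n" using seq_suble[OF r, of n] by linarith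
    then show "norm ((\<Sum>k\<le>r n. w (r n) k * (real k / real (r n)) ^ m) - inner ((R ^^ m) f) f) \<le> y (r n)"
     using err[of "r n"] by simp
   qed
  qed
  then have "(\<lambda>n. (\<Sum>k\<le>r n. w (r n) k * (real k / real (r n)) ^ m)) \<longlonglongrightarrow> inner ((R ^^ m) f) f"
   by (rule LIM_zero_cancel)
  then show ?thesis using l1 LIMSEQ_unique by blast
 qed
 then show ?thesis
  by (intro exI[of _ M] conjI allI AE) (simp_all add: M.finite_measure_axioms)
qed

text \<open>Moments are quadratic in \<open>f\<close>, so the measure of the normalized vector is
  multiplied by \<open>(norm f)^2\<close>.\<close>

lemma moment_measure_exists:
 "\<exists>M. finite_measure M \<and> sets M = sets (borel :: real measure) \<and> (AE x in M. 0 \<le> x \<and> x \<le> 1) \<and>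
  (\<forall>n. (LINT x|M. x ^ n) = inner ((R ^^ n) f) f)"
proof (cases "f = 0")
 case True
 have "finite_measure (null_measure (borel :: real measure))"
  by (rule finite_measureI) simp
 moreover have "AE x in null_measure (borel :: real measure). 0 \<le> x \<and> x \<le> 1"
  by (rule AE_I[of _ _ UNIV]) simp_all
 ultimately show ?thesis
  by (intro exI[of _ "null_measure (borel :: real measure)"] conjI allI) (simp_all add: True)
next
 case False
 define g where "g = f /\<^sub>R norm f"
 have "norm g = 1" using False by (simp add: g_def)
 then obtain M where M: "finite_measure M" and s: "sets M = sets (borel :: real measure)"
  and AE: "AE x in M. 0 \<le> x \<and> x \<le> 1" and mom: "\<And>n. (LINT x|M. x ^ n) = inner ((R ^^ n) g) g"
  using moment_measure_unit by blast
 interpret finite_measure M by (rule M)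
 define c where "c = (norm f)\<^sup>2"
 define N where "N = density M (\<lambda>_. ennreal c)"
 have "finite_measure N"
  by (rule finite_measureI) (auto simp: N_def emeasure_density ennreal_mult_eq_top_iff)
 moreover have "sets N = sets borel" by (simp add: N_def s)
 moreover have "AE x in N. 0 \<le> x \<and> x \<le> 1"
  unfolding N_def using AE by (subst AE_density) auto
 moreover have "(LINT x|N. x ^ n) = inner ((R ^^ n) f) f" for n
 proof -
  have "(LINT x|N. x ^ n) = c * (LINT x|M. x ^ n)"
  proof -
   have m: "borel_measurable M = (borel_fun :: (real => real) set)"
    by (rule measurable_cong_sets[OF s refl])
   show ?thesis unfolding N_def by (subst integral_density) (simp_all add: m c_def)
  qed
  also have "\<dots> = inner ((R ^^ n) f) f"
   using False by (simp add: mom g_def c_def linear_scale[OF lin_pow] power2_eq_square field_simps)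
  finally show ?thesis .
 qed
 ultimately show ?thesis by (intro exI[of _ N] conjI allI)
qed

end

text \<open>Projection-valued measure on a real Hilbert space, with strong convergence of the
  partial sums. Multiplicativity over intersections is a consequence of additivity and idempotence
  (\<open>P_P\<close>).\<close>

locale spectral =
 fixes P :: "real set => 'a::{real_inner,complete_space} => 'a"
 assumes lin: "B \<in> sets borel ==> linear (P B)"
  and idem: "B \<in> sets borel ==> P B (P B f) = P B f"
  and sym: "B \<in> sets borel ==> inner (P B f) g = inner f (P B g)"
  and UNIV [simp]: "P UNIV f = f"
  and sums: "range D \<subseteq> sets borel ==> disjoint_family D ==> (\<lambda>n. \<Sum>i<n. P (D i) f) \<longlonglongrightarrow> P (\<Union>i::nat. D i) f"

section \<open>Spectral projections from the moment measures\<close>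

context positive_contraction
begin

definition mu where "mu f = (SOME M. finite_measure M \<and> sets M = sets (borel :: real measure) \<and>
 (AE x in M. 0 \<le> x \<and> x \<le> 1) \<and> (\<forall>n. (LINT x|M. x ^ n) = inner ((R ^^ n) f) f))"

lemma mu_props: "finite_measure (mu f) \<and> sets (mu f) = sets borel \<and>
 (AE x in mu f. 0 \<le> x \<and> x \<le> 1) \<and> (\<forall>n. (LINT x|mu f. x ^ n) = inner ((R ^^ n) f) f)"
 unfolding mu_def by (rule someI_ex[OF moment_measure_exists])

lemma finite_mu: "finite_measure (mu f)" using mu_props by blast
lemma sets_mu [simp, measurable_cong]: "sets (mu f) = sets borel" using mu_props by blast
lemma space_mu [simp]: "space (mu f) = UNIV" using sets_eq_imp_space_eq[OF sets_mu] by simp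
lemma AE_mu: "AE x in mu f. 0 \<le> x \<and> x \<le> 1" using mu_props by blast
lemma moment_mu: "(LINT x|mu f. x ^ n) = inner ((R ^^ n) f) f" using mu_props by blast

text \<open>Every property of the projections goes through this transfer: by
  \<open>moments_zero_imp_zero\<close>, a relation between quadratic forms that holds for all powers
  of \<open>R\<close> becomes one on Borel sets. The pairs form a list because vectors may
  coincide.\<close>

lemma mu_comb:
 fixes xs :: "('a \<times> (real => real)) list"
 assumes meas: "\<And>f w. (f, w) \<in> set xs ==> w \<in> borel_fun"
  and bdd: "\<And>f w. (f, w) \<in> set xs ==> \<exists>K. \<forall>x. \<bar>w x\<bar> \<le> K"
  and mom: "\<And>n. (\<Sum>(f, w)\<leftarrow>xs. LINT x|mu f. x ^ n * w x) = 0"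
  and B: "B \<in> sets borel"
 shows "(\<Sum>(f, w)\<leftarrow>xs. LINT x|mu f. indicator B x * w x) = 0"
proof -
 have mem: "(fst (xs ! i), snd (xs ! i)) \<in> set xs" if "i < length xs" for i using that by simp
 have "\<forall>i\<in>{..<length xs}. \<exists>K. \<forall>x. \<bar>snd (xs ! i) x\<bar> \<le> K" using bdd mem by blast
 then obtain K where K: "\<And>i x. i < length xs ==> \<bar>snd (xs ! i) x\<bar> \<le> K i" by (metis lessThan_iff)
 have "(\<Sum>i\<in>{..<length xs}. LINT x|mu (fst (xs ! i)). indicator B x * snd (xs ! i) x) = 0"
 proof (rule moments_zero_imp_zero[where K="\<Sum>i<length xs. \<bar>K i\<bar>"])
  show "\<bar>snd (xs ! i) x\<bar> \<le> (\<Sum>i<length xs. \<bar>K i\<bar>)" if "i \<in> {..<length xs}" for i x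
  proof -
   have "\<bar>snd (xs ! i) x\<bar> \<le> \<bar>K i\<bar>" using K[of i x] that by auto
   also have "\<dots> \<le> (\<Sum>i<length xs. \<bar>K i\<bar>)" using that by (intro member_le_sum) auto
   finally show ?thesis .
  qed
  show "(\<Sum>i<length xs. LINT x|mu (fst (xs ! i)). x ^ n * snd (xs ! i) x) = 0" for n
   using mom[of n] by (simp add: sum_list_sum_nth case_prod_beta atLeast0LessThan)
 qed (use finite_mu AE_mu B meas[OF mem] in auto)
 then show ?thesis by (simp add: sum_list_sum_nth case_prod_beta atLeast0LessThan)
qed

definition Q where "Q n f = inner ((R ^^ n) f) f"

lemma mu_comb_const:
 fixes xs :: "(real \<times> 'a) list"
 assumes mom: "\<And>n. (\<Sum>(c, f)\<leftarrow>xs. c * Q n f) = 0" and B: "B \<in> sets borel"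
 shows "(\<Sum>(c, f)\<leftarrow>xs. c * measure (mu f) B) = 0"
proof -
 have "(\<Sum>(f, w)\<leftarrow>map (\<lambda>(c, f). (f, \<lambda>_. c)) xs. LINT x|mu f. indicator B x * w x) = 0"
 proof (rule mu_comb)
  show "(\<Sum>(f, w)\<leftarrow>map (\<lambda>(c, f). (f, \<lambda>_. c)) xs. LINT x|mu f. x ^ n * w x) = 0" for n
   using mom[of n] by (simp add: case_prod_unfold o_def moment_mu Q_def mult.commute)
 qed (use B in auto)
 moreover have "(LINT x|mu f. indicator B x * c) = c * measure (mu f) B" for f c
  using B by simp
 ultimately show ?thesis by (simp add: case_prod_unfold o_def mult.commute)
qed

lemma polar: "Q n (a + b) - Q n (a - b) = 4 * inner ((R ^^ n) a) b"
 using sym_pow[of n b a]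
 by (simp add: Q_def linear_add[OF lin_pow] linear_diff[OF lin_pow] inner_add_left inner_add_right
   inner_diff_left inner_diff_right inner_commute)

text \<open>Polarization of the measures \<open>mu\<close>: the value that
  \<open>inner (P B f) g\<close> must have once \<open>P\<close> exists.\<close>

definition bf where "bf f g B = (measure (mu (f + g)) B - measure (mu (f - g)) B) / 4"

text \<open>On powers of \<open>R\<close> additivity is linearity of \<open>R ^^ n\<close>, by
  \<open>polar\<close>; \<open>mu_comb_const\<close> carries it to \<open>B\<close>. The next three
  lemmas proceed in the same way.\<close>

lemma bf_add:
 assumes B: "B \<in> sets borel" shows "bf (f + h) g B = bf f g B + bf h g B"
proof -
 have "(\<Sum>(c, f)\<leftarrow>[(1, f + h + g), (-1, f + h - g), (-1, f + g), (1, f - g), (-1, h + g), (1, h - g)]. c * Q n f) = 0" for n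
  using polar[of n "f + h" g] polar[of n f g] polar[of n h g]
  by (simp add: linear_add[OF lin_pow] inner_add_left)
 from mu_comb_const[OF this B]
 have "measure (mu (f + h + g)) B - measure (mu (f + h - g)) B
   = (measure (mu (f + g)) B - measure (mu (f - g)) B) + (measure (mu (h + g)) B - measure (mu (h - g)) B)"
  by simp
 then show ?thesis by (simp only: bf_def add_divide_distrib)
qed

lemma bf_scale:
 assumes B: "B \<in> sets borel" shows "bf (c *\<^sub>R f) g B = c * bf f g B"
proof -
 have "(\<Sum>(c, f)\<leftarrow>[(1, c *\<^sub>R f + g), (-1, c *\<^sub>R f - g), (-c, f + g), (c, f - g)]. c * Q n f) = 0" for n
 proof -
  have "c * (Q n (f + g) - Q n (f - g)) = 4 * (c * inner ((R ^^ n) f) g)"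
   by (simp add: polar)
  then show ?thesis
   using polar[of n "c *\<^sub>R f" g] by (simp add: linear_scale[OF lin_pow] right_diff_distrib)
 qed
 from mu_comb_const[OF this B]
 have "measure (mu (c *\<^sub>R f + g)) B - measure (mu (c *\<^sub>R f - g)) B = c * (measure (mu (f + g)) B - measure (mu (f - g)) B)"
  by (simp add: right_diff_distrib)
 then show ?thesis by (simp add: bf_def)
qed

lemma bf_commute:
 assumes B: "B \<in> sets borel" shows "bf f g B = bf g f B"
proof -
 have "(\<Sum>(c, f)\<leftarrow>[(1, f + g), (-1, f - g), (-1, g + f), (1, g - f)]. c * Q n f) = 0" for n
  using polar[of n f g] polar[of n g f] sym_pow[of n f g] by (simp add: inner_commute)
 from mu_comb_const[OF this B] show ?thesis by (simp add: bf_def)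
qed

lemma bf_self:
 assumes B: "B \<in> sets borel" shows "bf f f B = measure (mu f) B"
proof -
 have "(\<Sum>(c, f)\<leftarrow>[(1, f + f), (-1, f - f), (-4, f)]. c * Q n f) = 0" for n
  using polar[of n f f] by (simp add: Q_def)
 from mu_comb_const[OF this B] show ?thesis by (simp add: bf_def)
qed

lemma measure_mu_UNIV: "measure (mu f) UNIV = inner f f"
 using moment_mu[of f 0] by simp

lemma bf_UNIV: "bf f g UNIV = inner f g"
 by (simp add: bf_def measure_mu_UNIV inner_add_left inner_add_right inner_diff_left inner_diff_right inner_commute)

lemma measure_mu_le: "measure (mu f) B \<le> inner f f"
 using finite_measure.bounded_measure[OF finite_mu, of f B] by (simp add: measure_mu_UNIV)

text \<open>For unit vectors the parallelogram identity gives \<open>(2 + 2) / 4 = 1\<close>, and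
  homogeneity in both arguments does the rest. The bound is what Riesz representation needs to
  produce \<open>P B f\<close>.\<close>

lemma bf_bound:
 assumes B: "B \<in> sets borel" shows "\<bar>bf f g B\<bar> \<le> norm f * norm g"
proof -
 have 1: "\<bar>bf f g B\<bar> \<le> 1" if "norm f = 1" "norm g = 1" for f g
 proof -
  have "\<bar>measure (mu (f + g)) B - measure (mu (f - g)) B\<bar> \<le> inner (f + g) (f + g) + inner (f - g) (f - g)"
   using measure_mu_le[of "f + g" B] measure_mu_le[of "f - g" B]
    measure_nonneg[of "mu (f + g)" B] measure_nonneg[of "mu (f - g)" B] by linarith
  also have "\<dots> = 2 * (norm f)\<^sup>2 + 2 * (norm g)\<^sup>2"
   unfolding power2_norm_eq_inner
   by (simp add: inner_add_left inner_add_right inner_diff_left inner_diff_right inner_commute del: dot_square_norm)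
  finally show ?thesis using that by (simp add: bf_def)
 qed
 show ?thesis
 proof (cases "f = 0 \<or> g = 0")
  case True
  then show ?thesis using bf_scale[OF B, of 0 f g] bf_scale[OF B, of 0 g f] bf_commute[OF B, of f g] by auto
 next
  case False
  define f' g' where "f' = f /\<^sub>R norm f" and "g' = g /\<^sub>R norm g"
  have "norm f' = 1" "norm g' = 1" using False by (auto simp: f'_def g'_def)
  moreover have "f = norm f *\<^sub>R f'" "g = norm g *\<^sub>R g'" using False by (auto simp: f'_def g'_def)
  then have "bf f g B = norm f * (norm g * bf f' g' B)"
   by (metis B bf_commute bf_scale)
  ultimately show ?thesis using 1[of f' g'] False by (simp add: abs_mult mult_left_le)
 qed
qed

definition P where "P B f = (SOME h. \<forall>g. bf f g B = inner h g)"

lemma inner_P: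
 assumes B: "B \<in> sets borel" shows "inner (P B f) g = bf f g B"
proof -
 have "bounded_linear (\<lambda>g. bf f g B)"
 proof (rule bounded_linear_intro[where K="norm f"])
  show "bf f (g + h) B = bf f g B + bf f h B" for g h
   by (simp only: bf_commute[OF B, of f] bf_add[OF B])
  show "bf f (c *\<^sub>R g) B = c *\<^sub>R bf f g B" for c g
   by (simp only: bf_commute[OF B, of f] bf_scale[OF B] real_scaleR_def)
  show "norm (bf f g B) \<le> norm g * norm f" for g
   using bf_bound[OF B, of f g] by (simp add: mult.commute)
 qed
 from riesz_representation[OF this] show ?thesis
  unfolding P_def by (rule someI2_ex) simp
qed

text \<open>Comparison of moments shows that applying \<open>R ^^ n\<close> to \<open>f\<close>
  multiplies the polarized measure of \<open>f\<close> and \<open>g\<close> by \<open>x ^ n\<close>.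
  The cut-off in \<open>w\<close> makes this density bounded on the whole line, as
  \<open>mu_comb\<close> asks.\<close>

lemma bf_pow:
 assumes C: "C \<in> sets borel"
 shows "4 * bf ((R ^^ n) f) g C = (LINT x|mu (f + g). x ^ n * indicator C x) - (LINT x|mu (f - g). x ^ n * indicator C x)"
proof -
 define w :: "real => real" where "w x = indicator {0..1} x * x ^ n" for x
 have wm [measurable]: "w \<in> borel_fun" unfolding w_def by measurable
 have wb: "\<bar>w x\<bar> \<le> 1" for x by (auto simp: w_def indicator_def power_le_one)
 have wk: "(LINT x|mu h. x ^ k * w x) = inner ((R ^^ (k + n)) h) h" for k h
 proof -
  have "(LINT x|mu h. x ^ k * w x) = (LINT x|mu h. x ^ (k + n))"
   by (rule integral_cong_AE) (use AE_mu[of h] in \<open>auto simp: w_def power_add\<close>)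
  then show ?thesis by (simp add: moment_mu)
 qed
 have wC: "(LINT x|mu h. indicator C x * w x) = (LINT x|mu h. x ^ n * indicator C x)" for h
  by (rule integral_cong_AE) (use AE_mu[of h] C in \<open>auto simp: w_def\<close>)
 have "(\<Sum>(f, w)\<leftarrow>[((R ^^ n) f + g, \<lambda>_. 1), ((R ^^ n) f - g, \<lambda>_. -1), (f + g, \<lambda>x. - w x), (f - g, w)].
  LINT x|mu f. indicator C x * w x) = 0"
 proof (rule mu_comb[OF _ _ _ C])
  fix k
  have "Q (k + n) (f + g) - Q (k + n) (f - g) = 4 * inner ((R ^^ k) ((R ^^ n) f)) g"
   by (simp add: polar funpow_add)
  then show "(\<Sum>(f, w)\<leftarrow>[((R ^^ n) f + g, \<lambda>_. 1), ((R ^^ n) f - g, \<lambda>_. -1), (f + g, \<lambda>x. - w x), (f - g, w)].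
    LINT x|mu f. x ^ k * w x) = 0"
   using polar[of k "(R ^^ n) f" g] by (simp add: moment_mu wk Q_def)
 qed (use wb in \<open>auto intro!: exI[of _ 1]\<close>)
 then show ?thesis using C by (simp add: wC bf_def)
qed

text \<open>The moments of the form at \<open>f\<close> and \<open>P C g\<close> are inner products
  of \<open>(R ^^ k) f\<close> with \<open>P C g\<close>, which \<open>bf_pow\<close> turns into
  integrals of \<open>x ^ k\<close> over \<open>C\<close>; so restricting to \<open>C\<close> and
  then to \<open>B\<close> restricts to the intersection.\<close>

lemma P_mult:
 assumes B: "B \<in> sets borel" and C: "C \<in> sets borel"
 shows "inner (P B f) (P C g) = bf f g (B \<inter> C)"
proof -
 have "(\<Sum>(f, w)\<leftarrow>[(f + P C g, \<lambda>_. 1 :: real), (f - P C g, \<lambda>_. -1), (f + g, \<lambda>x. - indicator C x), (f - g, indicator C)].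
  LINT x|mu f. indicator B x * w x) = 0"
 proof (rule mu_comb[OF _ _ _ B])
  fix k
  have "inner ((R ^^ k) f) (P C g) = bf ((R ^^ k) f) g C"
   using inner_P[OF C, of g "(R ^^ k) f"] bf_commute[OF C, of g "(R ^^ k) f"] by (simp only: inner_commute)
  then show "(\<Sum>(f, w)\<leftarrow>[(f + P C g, \<lambda>_. 1 :: real), (f - P C g, \<lambda>_. -1), (f + g, \<lambda>x. - indicator C x), (f - g, indicator C)].
    LINT x|mu f. x ^ k * w x) = 0"
   using polar[of k f "P C g"] bf_pow[OF C, of k f g] by (simp add: moment_mu Q_def)
 qed (use C in \<open>auto intro!: exI[of _ 1] simp: indicator_def\<close>)
 moreover have "(LINT x|mu h. indicator B x * indicator C x) = measure (mu h) (B \<inter> C)" for h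
  using B C by (simp add: indicator_inter_arith[symmetric])
 ultimately have "bf f (P C g) B = bf f g (B \<inter> C)" using B by (simp add: bf_def)
 then show ?thesis by (simp add: inner_P[OF B])
qed

lemma inner_eqI: "(\<And>g. inner x g = inner y g) ==> x = (y :: 'a)"
 by (metis vector_eq_rdot)

lemma spectral_P: "spectral P"
proof (unfold spectral_def, intro conjI allI impI)
 fix B :: "real set" assume B: "B \<in> sets borel"
 show "linear (P B)"
  by (rule linearI) (rule inner_eqI, simp add: inner_P[OF B] bf_add[OF B] bf_scale[OF B] inner_add_left)+
next
 fix B :: "real set" and f assume B: "B \<in> sets borel"
 show "P B (P B f) = P B f"
 proof (rule inner_eqI)
  fix g
  have "inner (P B (P B f)) g = inner (P B g) (P B f)"
   by (simp only: inner_P[OF B] bf_commute[OF B, of "P B f"])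
  also have "\<dots> = inner (P B f) g"
   using P_mult[OF B B, of g f] inner_P[OF B, of f g] bf_commute[OF B, of f g] by simp
  finally show "inner (P B (P B f)) g = inner (P B f) g" .
 qed
next
 fix B :: "real set" and f g assume B: "B \<in> sets borel"
 show "inner (P B f) g = inner f (P B g)"
  using inner_P[OF B, of f g] inner_P[OF B, of g f] bf_commute[OF B, of f g] by (simp add: inner_commute)
next
 fix f show "P UNIV f = f" by (rule inner_eqI) (simp add: inner_P bf_UNIV)
next
 fix D :: "nat => real set" and f
 assume D: "range D \<subseteq> sets borel" and dis: "disjoint_family D"
 have Dm [measurable]: "D i \<in> sets borel" for i using D by auto
 interpret finite_measure "mu f" by (rule finite_mu)
 define U where "U n = (\<Union>i<n. D i)" for n
 have Um [measurable]: "U n \<in> sets borel" for n unfolding U_def by measurable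
 have sumP: "(\<Sum>i<n. P (D i) f) = P (U n) f" for n
 proof (rule inner_eqI)
  fix g
  have "measure (mu h) (U n) = (\<Sum>i<n. measure (mu h) (D i))" for h
   unfolding U_def using dis
   by (intro finite_measure.finite_measure_finite_Union finite_mu) (auto simp: disjoint_family_on_def)
  then show "inner (\<Sum>i<n. P (D i) f) g = inner (P (U n) f) g"
   by (simp add: inner_sum_left inner_P bf_def sum_subtractf sum_divide_distrib[symmetric])
 qed
 define V where "V = (\<Union>i. D i)"
 have Vm [measurable]: "V \<in> sets borel" unfolding V_def by measurable
 have UV: "U n \<inter> V = U n" "V \<inter> U n = U n" for n by (auto simp: U_def V_def)
 have "(\<lambda>n. measure (mu f) (U n)) \<longlonglongrightarrow> measure (mu f) (\<Union>n. U n)"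
 proof (rule finite_Lim_measure_incseq)
  show "incseq U" unfolding U_def incseq_def by (auto intro: less_le_trans)
 qed auto
 moreover have "(\<Union>n. U n) = V" by (auto simp: U_def V_def)
 ultimately have "(\<lambda>n. measure (mu f) V - measure (mu f) (U n)) \<longlonglongrightarrow> measure (mu f) V - measure (mu f) V"
  by (intro tendsto_diff) auto
 \<comment> \<open>Since \<open>U n\<close> lies in \<open>V\<close>, \<open>P_mult\<close> reduces
   all inner products in the squared norm to measures; norm convergence is then continuity of the
   measure from below.\<close>
 moreover have "measure (mu f) V - measure (mu f) (U n) = (norm (P (U n) f - P V f))\<^sup>2" for n
  unfolding power2_norm_eq_inner
  by (simp add: inner_diff_left inner_diff_right P_mult UV bf_self del: dot_square_norm)
 ultimately have "(\<lambda>n. (norm (P (U n) f - P V f))\<^sup>2) \<longlonglongrightarrow> 0" by simp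
 then have "(\<lambda>n. sqrt ((norm (P (U n) f - P V f))\<^sup>2)) \<longlonglongrightarrow> sqrt 0" by (rule tendsto_real_sqrt)
 then have "(\<lambda>n. P (U n) f - P V f) \<longlonglongrightarrow> 0" by (simp add: tendsto_norm_zero_iff)
 then show "(\<lambda>n. \<Sum>i<n. P (D i) f) \<longlonglongrightarrow> P (\<Union>i. D i) f"
  unfolding sumP V_def by (rule LIM_zero_cancel)
qed

lemma inner_P_self: "B \<in> sets borel ==> inner (P B f) f = measure (mu f) B"
 by (simp add: inner_P bf_self)

text \<open>An isometry that commutes with \<open>R\<close> preserves all moments, hence the
  measures and the forms \<open>bf\<close>; \<open>JJ\<close> makes \<open>J\<close> surjective.
  Applied with \<open>J = cmul \<i>\<close>.\<close>

lemma P_commute: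
 assumes J: "linear J" "\<And>f. R (J f) = J (R f)" and iso: "\<And>f g. inner (J f) (J g) = inner f g"
  and JJ: "\<And>f. J (J f) = - f" and B: "B \<in> sets borel"
 shows "P B (J f) = J (P B f)"
proof -
 have pow: "(R ^^ n) (J f) = J ((R ^^ n) f)" for n f
  by (induction n) (simp_all add: J)
 have meas: "measure (mu (J f)) B = measure (mu f) B" for f
  using mu_comb_const[of "[(1, J f), (-1, f)]" B] B by (simp add: pow iso Q_def)
 have "bf (J f) (J g) B = bf f g B" for f g
  by (simp add: bf_def linear_add[OF J(1), symmetric] linear_diff[OF J(1), symmetric] meas)
 then have *: "inner (P B (J f)) (J g) = inner (P B f) g" for g
  by (simp add: inner_P[OF B])
 show ?thesis
 proof (rule inner_eqI)
  fix g
  have "g = J (- J g)" by (simp add: linear_neg[OF J(1)] JJ)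
  then show "inner (P B (J f)) g = inner (J (P B f)) g"
   using *[of "- J g"] iso[of "P B f" "- J g"] by simp
 qed
qed

end

section \<open>Functional calculus of a projection-valued measure\<close>

text \<open>From \<open>(a - b)^2 <= 2 (a - h)^2 + 2 (b - h)^2\<close>. Taken with two
  approximations of the same function, it makes \<open>Phi\<close> independent of the approximating
  sequence.\<close>

lemma integral_sq_diff_tendsto:
 fixes f g :: "nat => 'b => real"
 assumes lim: "(\<lambda>n. LINT x|M. (f n x - h x)\<^sup>2) \<longlonglongrightarrow> 0"
  and "\<And>n. integrable M (\<lambda>x. (f n x - h x)\<^sup>2)"
  and lim': "(\<lambda>n. LINT x|M. (g n x - h x)\<^sup>2) \<longlonglongrightarrow> 0"
  and "\<And>n. integrable M (\<lambda>x. (g n x - h x)\<^sup>2)"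
  and [measurable]: "\<And>n. f n \<in> borel_measurable M" "\<And>n. g n \<in> borel_measurable M"
 shows "e > 0 ==> \<exists>N. \<forall>n\<ge>N. \<forall>m\<ge>N. (LINT x|M. (f n x - g m x)\<^sup>2) < e"
proof -
 assume e: "e > 0"
 have le: "(LINT x|M. (f n x - g m x)\<^sup>2) \<le> 2 * (LINT x|M. (f n x - h x)\<^sup>2) + 2 * (LINT x|M. (g m x - h x)\<^sup>2)" for n m
 proof -
  have pt: "(f n x - g m x)\<^sup>2 \<le> 2 * (f n x - h x)\<^sup>2 + 2 * (g m x - h x)\<^sup>2" for x
  proof -
   have "0 \<le> ((f n x - h x) + (g m x - h x))\<^sup>2" by simp
   then show ?thesis by (simp add: power2_eq_square algebra_simps)
  qed
  have i: "integrable M (\<lambda>x. 2 * (f n x - h x)\<^sup>2 + 2 * (g m x - h x)\<^sup>2)"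
   by (intro Bochner_Integration.integrable_add integrable_mult_right assms)
  have "integrable M (\<lambda>x. (f n x - g m x)\<^sup>2)"
   by (rule Bochner_Integration.integrable_bound[OF i]) (use pt in auto)
  then have "(LINT x|M. (f n x - g m x)\<^sup>2) \<le> (LINT x|M. 2 * (f n x - h x)\<^sup>2 + 2 * (g m x - h x)\<^sup>2)"
   by (intro integral_mono i pt)
  also have "\<dots> = 2 * (LINT x|M. (f n x - h x)\<^sup>2) + 2 * (LINT x|M. (g m x - h x)\<^sup>2)"
   using assms(2,4) by simp
  finally show ?thesis .
 qed
 have "e / 4 > 0" using e by simp
 from order_tendstoD(2)[OF lim this] order_tendstoD(2)[OF lim' this]
 obtain N1 N2 where N: "\<forall>n\<ge>N1. (LINT x|M. (f n x - h x)\<^sup>2) < e / 4"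
   "\<forall>n\<ge>N2. (LINT x|M. (g n x - h x)\<^sup>2) < e / 4"
  unfolding eventually_sequentially by blast
 show ?thesis
 proof (intro exI[of _ "max N1 N2"] allI impI)
  fix n m assume "max N1 N2 \<le> n" "max N1 N2 \<le> m"
  then show "(LINT x|M. (f n x - g m x)\<^sup>2) < e" using N le[of n m] by fastforce
 qed
qed

lemma simple_borel [measurable_dest]: "simple_function borel s ==> s \<in> borel_fun"
 by (rule borel_measurable_simple_function)

lemma simple_bounded:
 fixes s :: "real => real"
 assumes "simple_function borel s" shows "\<exists>K. \<forall>x. \<bar>s x\<bar> \<le> K"
proof -
 have "bounded (range s)" using assms by (intro finite_imp_bounded) (simp add: simple_function_def)
 then show ?thesis by (auto simp: bounded_iff)
qed

context spectral
begin

lemma P_0 [simp]: "B \<in> sets borel ==> P B 0 = 0"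
 using linear_0[OF lin] by blast

text \<open>Countable additivity for the constant sequence \<open>{}\<close>: the partial sums are
  the multiples \<open>n\<close> times \<open>P {} f\<close>, and since they converge, their
  increments tend to 0.\<close>

lemma P_empty [simp]: "P {} f = 0"
proof -
 have "(\<lambda>n. \<Sum>i<n. P {} f) \<longlonglongrightarrow> P {} f" using sums[of "\<lambda>_. {}" f] by (simp add: disjoint_family_on_def)
 from tendsto_diff[OF LIMSEQ_Suc[OF this] this] show ?thesis by (simp add: scaleR_left.diff[symmetric] LIMSEQ_const_iff)
qed

lemma P_Un:
 assumes "A \<in> sets borel" "B \<in> sets borel" "A \<inter> B = {}"
 shows "P (A \<union> B) f = P A f + P B f"
proof -
 define D where "D i = (if i = 0 then A else if i = 1 then B else {})" for i :: nat
 have "(\<lambda>n. \<Sum>i<n. P (D i) f) \<longlonglongrightarrow> P (\<Union>i. D i) f"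
  by (rule sums) (use assms in \<open>auto simp: D_def disjoint_family_on_def\<close>)
 moreover have "(\<Sum>i<n. P (D i) f) = P A f + P B f" if "n \<ge> 2" for n
 proof -
  have "(\<Sum>i<n. P (D i) f) = (\<Sum>i<2. P (D i) f)"
   using that by (intro sum.mono_neutral_right) (auto simp: D_def)
  then show ?thesis by (simp add: D_def numeral_2_eq_2)
 qed
 then have "(\<lambda>n. \<Sum>i<n. P (D i) f) \<longlonglongrightarrow> P A f + P B f"
  by (intro tendsto_eventually) (auto simp: eventually_sequentially)
 moreover have "(\<Union>i. D i) = A \<union> B" by (auto simp: D_def split: if_splits)
 ultimately show ?thesis by (metis LIMSEQ_unique)
qed

text \<open>Idempotence of the sum \<open>P A + P B\<close> forces
  \<open>P A P B + P B P A = 0\<close>; multiplying by \<open>P A\<close> on either side shows that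
  the two products agree, so both vanish.\<close>

lemma P_disjoint:
 assumes A: "A \<in> sets borel" and B: "B \<in> sets borel" and "A \<inter> B = {}"
 shows "P A (P B f) = 0"
proof -
 have AB: "A \<union> B \<in> sets borel" using A B by auto
 have *: "P A (P B f) + P B (P A f) = 0" for f
  using idem[OF AB, of f] by (simp add: P_Un assms linear_add[OF lin] idem)
 have "P A (P A (P B f) + P B (P A f)) = 0" by (simp add: * A)
 then have 1: "P A (P B f) + P A (P B (P A f)) = 0" by (simp add: linear_add[OF lin[OF A]] idem[OF A])
 have 2: "P A (P B (P A f)) + P B (P A f) = 0" using *[of "P A f"] by (simp add: idem[OF A])
 have "P A (P B f) = P B (P A f)" using 1 2 by (metis add.commute add_left_cancel)
 then have "2 *\<^sub>R P A (P B f) = 0" using *[of f] by (simp add: scaleR_2)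
 then show ?thesis by simp
qed

lemma P_P:
 assumes A: "A \<in> sets borel" and B: "B \<in> sets borel"
 shows "P A (P B f) = P (A \<inter> B) f"
proof -
 have AB: "A \<inter> B \<in> sets borel" "B - A \<in> sets borel" "A - B \<in> sets borel" using A B by auto
 have 1: "P B g = P (A \<inter> B) g + P (B - A) g" for g
 proof -
  have "(A \<inter> B) \<inter> (B - A) = {}" "(A \<inter> B) \<union> (B - A) = B" by auto
  then show ?thesis using P_Un[OF AB(1,2), of g] by metis
 qed
 have 2: "P A g = P (A \<inter> B) g + P (A - B) g" for g
 proof -
  have "(A \<inter> B) \<inter> (A - B) = {}" "(A \<inter> B) \<union> (A - B) = A" by auto
  then show ?thesis using P_Un[OF AB(1,3), of g] by metis
 qed
 have "P A (P (B - A) f) = 0" by (rule P_disjoint[OF A AB(2)]) auto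
 then have "P A (P B f) = P A (P (A \<inter> B) f)"
  by (simp add: 1[of f] linear_add[OF lin[OF A]])
 also have "\<dots> = P (A \<inter> B) (P (A \<inter> B) f) + P (A - B) (P (A \<inter> B) f)" by (rule 2)
 also have "P (A - B) (P (A \<inter> B) f) = 0" by (rule P_disjoint[OF AB(3,1)]) auto
 finally show ?thesis by (simp add: idem[OF AB(1)])
qed

lemma norm_P_sq: "B \<in> sets borel ==> (norm (P B f))\<^sup>2 = inner (P B f) f"
 unfolding power2_norm_eq_inner by (metis idem sym)

text \<open>The same formula as in \<open>spec_meas\<close>, so that both measures agree after
  passage to classes (\<open>spec_meas_eq\<close>).\<close>

definition mu where "mu f = measure_of UNIV (sets borel) (\<lambda>B. ennreal ((norm (P B f))\<^sup>2))"

lemma sets_mu [simp, measurable_cong]: "sets (mu f) = sets borel"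
 using sets.sigma_sets_eq[of "borel :: real measure"] by (simp add: mu_def)

lemma space_mu [simp]: "space (mu f) = UNIV"
 by (simp add: mu_def)

lemma emeasure_mu: assumes "B \<in> sets borel" shows "emeasure (mu f) B = ennreal ((norm (P B f))\<^sup>2)"
 unfolding mu_def
proof (rule emeasure_measure_of_sigma)
 show "sigma_algebra UNIV (sets (borel :: real measure))"
  using sets.sigma_algebra_axioms[of "borel :: real measure"] by simp
 show "positive (sets borel) (\<lambda>B. ennreal ((norm (P B f))\<^sup>2))" by (simp add: positive_def)
 show "countably_additive (sets borel) (\<lambda>B. ennreal ((norm (P B f))\<^sup>2))"
 proof (rule countably_additiveI)
  fix D :: "nat => real set" assume D: "range D \<subseteq> sets borel" "disjoint_family D" "(\<Union>i. D i) \<in> sets borel"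
  have Dm: "D i \<in> sets borel" for i using D by auto
  have "(\<lambda>n. inner (\<Sum>i<n. P (D i) f) f) \<longlonglongrightarrow> inner (P (\<Union>i. D i) f) f"
   by (intro tendsto_intros sums D)
  then have "(\<lambda>i. (norm (P (D i) f))\<^sup>2) sums (norm (P (\<Union>i. D i) f))\<^sup>2"
   by (simp add: sums_def norm_P_sq Dm D inner_sum_left)
  then show "(\<Sum>i. ennreal ((norm (P (D i) f))\<^sup>2)) = ennreal ((norm (P (\<Union>(range D)) f))\<^sup>2)"
   by (intro suminf_ennreal_eq) auto
 qed
qed fact

lemma finite_mu: "finite_measure (mu f)"
 by (rule finite_measureI) (simp add: emeasure_mu)

lemma measure_mu: "B \<in> sets borel ==> measure (mu f) B = inner (P B f) f"
 by (simp add: measure_def emeasure_mu flip: norm_P_sq)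

lemma inner_P_polar:
 assumes B: "B \<in> sets borel"
 shows "inner (P B f) g = (measure (mu (f + g)) B - measure (mu (f - g)) B) / 4"
 using sym[OF B, of g f]
 by (simp add: measure_mu[OF B] linear_add[OF lin[OF B]] linear_diff[OF lin[OF B]]
   inner_add_left inner_add_right inner_diff_left inner_diff_right inner_commute)

lemma bm_mu [simp]: "borel_measurable (mu f) = borel_fun"
 by (rule measurable_cong_sets) simp_all

lemma integrable_bounded:
 fixes p :: "real => real"
 assumes "p \<in> borel_fun" "\<And>x. \<bar>p x\<bar> \<le> K"
 shows "integrable (mu f) p"
 by (rule finite_measure.integrable_const_bound[OF finite_mu, of _ K]) (use assms in auto)

lemma integrable_ind: "A \<in> sets borel ==> integrable (mu f) (indicator A :: real => real)"
 using integrable_bounded[of "indicator A" 1 f] by (auto split: split_indicator)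

lemma integrable_simple: "simple_function borel s ==> integrable (mu f) (s :: real => real)"
 using simple_bounded[of s] integrable_bounded simple_borel by blast

lemma integral_simple:
 fixes s :: "real => real"
 assumes s: "simple_function borel s" and B: "B \<in> sets borel"
 shows "(LINT x|mu f. indicator B x * s x) = (\<Sum>y\<in>range s. y * measure (mu f) (B \<inter> s -` {y}))"
proof -
 have fin: "finite (range s)" and vim: "\<And>y. s -` {y} \<in> sets borel"
  using s measurable_sets[OF simple_borel[OF s], of "{_}"] by (auto simp: simple_function_def)
 have "indicator B x * s x = (\<Sum>y\<in>range s. y * indicator (B \<inter> s -` {y}) x)" for x
 proof -
  have "(\<Sum>y\<in>range s. y * indicator (B \<inter> s -` {y}) x) = (\<Sum>y\<in>range s. if y = s x then indicator B x * s x else 0)"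
   by (intro sum.cong) (auto simp: indicator_def)
  then show ?thesis using fin by simp
 qed
 then have "(LINT x|mu f. indicator B x * s x) = (LINT x|mu f. (\<Sum>y\<in>range s. y * indicator (B \<inter> s -` {y}) x))" by simp
 also have "\<dots> = (\<Sum>y\<in>range s. LINT x|mu f. y * indicator (B \<inter> s -` {y}) x)"
  by (intro Bochner_Integration.integral_sum integrable_mult_right integrable_ind sets.Int vim B)
 finally show ?thesis using vim B by simp
qed

text \<open>Integral of a simple function against \<open>P\<close>.\<close>

definition Sf where "Sf s f = (\<Sum>y\<in>range s. y *\<^sub>R P (s -` {y}) f)" for s :: "real => real"

lemma vimage_simple: "simple_function borel s ==> s -` {y::real} \<in> sets borel"
 using measurable_sets[OF simple_borel, of s "{y}"] by simp

text \<open>Polarization turns operator identities for \<open>Sf\<close> into identities between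
  integrals against \<open>mu (f + g)\<close> and \<open>mu (f - g)\<close>, that is, between
  functions.\<close>

lemma inner_P_Sf:
 assumes s: "simple_function borel s" and B: "B \<in> sets borel"
 shows "inner (P B (Sf s f)) g = ((LINT x|mu (f + g). indicator B x * s x) - (LINT x|mu (f - g). indicator B x * s x)) / 4"
proof -
 have "inner (P B (Sf s f)) g = (\<Sum>y\<in>range s. y * inner (P (B \<inter> s -` {y}) f) g)"
  by (simp add: Sf_def linear_sum[OF lin[OF B]] linear_scale[OF lin[OF B]] inner_sum_left P_P[OF B] vimage_simple[OF s])
 also have "\<dots> = (\<Sum>y\<in>range s. (y * measure (mu (f + g)) (B \<inter> s -` {y}) - y * measure (mu (f - g)) (B \<inter> s -` {y})) / 4)"
  using vimage_simple[OF s] B by (intro sum.cong refl) (simp add: inner_P_polar right_diff_distrib)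
 finally show ?thesis
  unfolding integral_simple[OF s B] by (simp only: sum_subtractf[symmetric] sum_divide_distrib)
qed

lemma inner_Sf:
 assumes s: "simple_function borel s"
 shows "inner (Sf s f) g = ((LINT x|mu (f + g). s x) - (LINT x|mu (f - g). s x)) / 4"
 using inner_P_Sf[OF s, of UNIV f g] by simp

lemma inner_eqI: "(\<And>g. inner x g = inner y g) ==> x = (y :: 'a)"
 by (metis vector_eq_rdot)

lemma simple_mult: "simple_function borel s ==> simple_function borel t ==> simple_function borel (\<lambda>x. s x * t x :: real)"
 by (rule simple_function_compose2)

lemma simple_diff: "simple_function borel s ==> simple_function borel t ==> simple_function borel (\<lambda>x. s x - t x :: real)"
 by (rule simple_function_compose2)

lemma simple_add: "simple_function borel s ==> simple_function borel t ==> simple_function borel (\<lambda>x. s x + t x :: real)"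
 by (rule simple_function_compose2)

lemma simple_ind: "B \<in> sets borel ==> simple_function borel (indicator B :: real => real)"
 by simp

lemma P_Sf:
 assumes s: "simple_function borel s" and B: "B \<in> sets borel"
 shows "P B (Sf s f) = Sf (\<lambda>x. indicator B x * s x) f"
 by (rule inner_eqI) (simp add: inner_P_Sf[OF s B] inner_Sf[OF simple_mult[OF simple_ind[OF B] s]])

lemma Sf_add:
 assumes s: "simple_function borel s" and t: "simple_function borel t"
 shows "Sf (\<lambda>x. s x + t x) f = Sf s f + Sf t f"
 by (rule inner_eqI)
  (simp add: inner_add_left inner_Sf s t simple_add integrable_simple add_divide_distrib diff_divide_distrib)

lemma Sf_diff:
 assumes s: "simple_function borel s" and t: "simple_function borel t"
 shows "Sf (\<lambda>x. s x - t x) f = Sf s f - Sf t f"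
 by (rule inner_eqI)
  (simp add: inner_diff_left inner_Sf s t simple_diff integrable_simple diff_divide_distrib)

lemma linear_Sf: assumes s: "simple_function borel s" shows "linear (Sf s)"
proof (rule linearI)
 show "Sf s (f + g) = Sf s f + Sf s g" for f g
  by (simp add: Sf_def linear_add[OF lin[OF vimage_simple[OF s]]] scaleR_add_right sum.distrib)
 show "Sf s (c *\<^sub>R f) = c *\<^sub>R Sf s f" for c f
  by (simp add: Sf_def linear_scale[OF lin[OF vimage_simple[OF s]]] scaleR_sum_right mult.commute)
qed

lemma sym_Sf: assumes s: "simple_function borel s" shows "inner (Sf s f) g = inner f (Sf s g)"
 by (simp add: Sf_def inner_sum_left inner_sum_right sym[OF vimage_simple[OF s]])

lemma Sf_Sf:
 assumes s: "simple_function borel s" and t: "simple_function borel t"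
 shows "Sf s (Sf t f) = Sf (\<lambda>x. s x * t x) f"
proof (rule inner_eqI)
 fix g
 have fin: "finite (range s)" using s by (simp add: simple_function_def)
 have ind: "simple_function borel (\<lambda>x. indicator (s -` {y}) x * t x)" for y
  by (intro simple_mult simple_ind vimage_simple s t)
 have pt: "(\<Sum>y\<in>range s. y * (indicator (s -` {y}) x * t x)) = s x * t x" for x
 proof -
  have "(\<Sum>y\<in>range s. y * (indicator (s -` {y}) x * t x)) = (\<Sum>y\<in>range s. if y = s x then s x * t x else 0)"
   by (intro sum.cong) (auto simp: indicator_def)
  then show ?thesis using fin by simp
 qed
 have int: "(\<Sum>y\<in>range s. y * (LINT x|mu h. indicator (s -` {y}) x * t x)) = (LINT x|mu h. s x * t x)" for h
 proof -
  have "(\<Sum>y\<in>range s. y * (LINT x|mu h. indicator (s -` {y}) x * t x))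
   = (LINT x|mu h. (\<Sum>y\<in>range s. y * (indicator (s -` {y}) x * t x)))"
   by (subst Bochner_Integration.integral_sum) (auto intro!: integrable_mult_right integrable_simple ind)
  then show ?thesis by (simp add: pt)
 qed
 have "Sf s (Sf t f) = (\<Sum>y\<in>range s. y *\<^sub>R Sf (\<lambda>x. indicator (s -` {y}) x * t x) f)"
  by (simp add: Sf_def[of s] P_Sf[OF t vimage_simple[OF s]])
 then have "inner (Sf s (Sf t f)) g = ((\<Sum>y\<in>range s. y * (LINT x|mu (f + g). indicator (s -` {y}) x * t x))
   - (\<Sum>y\<in>range s. y * (LINT x|mu (f - g). indicator (s -` {y}) x * t x))) / 4"
  by (simp only: inner_sum_left inner_Sf[OF ind] inner_scaleR_left sum_subtractf[symmetric] sum_divide_distrib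
    right_diff_distrib times_divide_eq_right)
 then show "inner (Sf s (Sf t f)) g = inner (Sf (\<lambda>x. s x * t x) f) g"
  unfolding int inner_Sf[OF simple_mult[OF s t]] .
qed

lemma inner_Sf_self:
 assumes s: "simple_function borel s" shows "inner (Sf s f) f = (LINT x|mu f. s x)"
 using integral_simple[OF s, of UNIV f] vimage_simple[OF s]
 by (simp add: Sf_def inner_sum_left measure_mu)

lemma norm_Sf:
 assumes s: "simple_function borel s" shows "(norm (Sf s f))\<^sup>2 = (LINT x|mu f. (s x)\<^sup>2)"
proof -
 have "(norm (Sf s f))\<^sup>2 = inner (Sf s (Sf s f)) f"
  unfolding power2_norm_eq_inner by (simp add: sym_Sf[OF s])
 then show ?thesis by (simp add: Sf_Sf[OF s s] inner_Sf_self[OF simple_mult[OF s s]] power2_eq_square)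
qed

text \<open>One fixed approximation for each \<open>p\<close>. The bound by \<open>2 * |p|\<close>
  supplies the majorants \<open>9 p^2\<close> and \<open>4 p^2\<close> for dominated convergence
  when \<open>p\<close> is unbounded.\<close>

definition apx :: "(real => real) => nat => real => real" where
 "apx p = (SOME F. (\<forall>i. simple_function borel (F i)) \<and> (\<forall>x. (\<lambda>i. F i x) \<longlonglongrightarrow> p x) \<and> (\<forall>i x. \<bar>F i x\<bar> \<le> 2 * \<bar>p x\<bar>))"

lemma apx:
 assumes "p \<in> borel_fun"
 shows simple_apx: "simple_function borel (apx p i)" and apx_tendsto: "(\<lambda>i. apx p i x) \<longlonglongrightarrow> p x"
  and apx_le: "\<bar>apx p i x\<bar> \<le> 2 * \<bar>p x\<bar>"
proof -
 obtain F where "\<And>i. simple_function borel (F i)" "\<And>x. (\<lambda>i. F i x) \<longlonglongrightarrow> p x"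
  "\<And>i x. dist (F i x) 0 \<le> 2 * dist (p x) 0"
  using borel_measurable_implies_sequence_metric[OF assms, of 0] by auto
 then have "\<exists>F. (\<forall>i. simple_function borel (F i)) \<and> (\<forall>x. (\<lambda>i. F i x) \<longlonglongrightarrow> p x) \<and> (\<forall>i x. \<bar>F i x\<bar> \<le> 2 * \<bar>p x\<bar>)"
  by (intro exI[of _ F]) auto
 from someI_ex[OF this] show "simple_function borel (apx p i)" "(\<lambda>i. apx p i x) \<longlonglongrightarrow> p x" "\<bar>apx p i x\<bar> \<le> 2 * \<bar>p x\<bar>"
  unfolding apx_def by blast+
qed

definition dom :: "(real => real) => 'a set" where "dom p = {f. integrable (mu f) (\<lambda>x. (p x)\<^sup>2)}"

text \<open>Convergence of \<open>s i\<close> to \<open>p\<close> in the \<open>L^2\<close> space of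
  the measure \<open>mu f\<close>; by the isometry \<open>norm_Sf\<close> it makes
  \<open>Sf (s i) f\<close> converge.\<close>

definition appr :: "'a => (real => real) => (nat => real => real) => bool" where "appr f p s \<longleftrightarrow> (\<forall>i::nat. simple_function borel (s i) \<and> integrable (mu f) (\<lambda>x. (s i x - p x)\<^sup>2)) \<and>
 (\<lambda>i. LINT x|mu f. (s i x - p x)\<^sup>2) \<longlonglongrightarrow> 0"

lemma appr_apx:
 assumes m [measurable]: "p \<in> borel_fun" and f: "f \<in> dom p"
 shows "appr f p (apx p)"
proof -
 have i: "integrable (mu f) (\<lambda>x. 9 * (p x)\<^sup>2)" using f by (simp add: dom_def)
 have le: "(apx p n x - p x)\<^sup>2 \<le> 9 * (p x)\<^sup>2" for n x
 proof -
  have "\<bar>apx p n x - p x\<bar> \<le> 3 * \<bar>p x\<bar>" using apx_le[OF m, of n x] by linarith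
  then have "\<bar>apx p n x - p x\<bar>\<^sup>2 \<le> (3 * \<bar>p x\<bar>)\<^sup>2" by (intro power_mono) auto
  then show ?thesis by (simp add: power_mult_distrib)
 qed
 have [measurable]: "apx p n \<in> borel_fun" for n using simple_apx[OF m] by (rule simple_borel)
 have "integrable (mu f) (\<lambda>x. (apx p n x - p x)\<^sup>2)" for n
  by (rule Bochner_Integration.integrable_bound[OF i]) (use le in auto)
 moreover have "(\<lambda>n. LINT x|mu f. (apx p n x - p x)\<^sup>2) \<longlonglongrightarrow> (LINT x|mu f. 0)"
 proof (rule integral_dominated_convergence[OF _ _ i])
  show "AE x in mu f. (\<lambda>n. (apx p n x - p x)\<^sup>2) \<longlonglongrightarrow> 0"
  proof (rule AE_I2)
   fix x
   have "(\<lambda>n. (apx p n x - p x)\<^sup>2) \<longlonglongrightarrow> (p x - p x)\<^sup>2" by (intro tendsto_intros apx_tendsto[OF m])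
   then show "(\<lambda>n. (apx p n x - p x)\<^sup>2) \<longlonglongrightarrow> 0" by simp
  qed
 qed (use le in auto)
 ultimately show ?thesis by (simp add: appr_def simple_apx[OF m])
qed

lemma appr_close:
 assumes [measurable]: "p \<in> borel_fun" and s: "appr f p s" and t: "appr f p t" and e: "e > 0"
 shows "\<exists>N. \<forall>n\<ge>N. \<forall>m\<ge>N. norm (Sf (s n) f - Sf (t m) f) < e"
proof -
 have [measurable]: "s n \<in> borel_fun" "t n \<in> borel_fun" for n
  using s t by (auto simp: appr_def intro: simple_borel)
 obtain N where N: "\<And>n m. n \<ge> N ==> m \<ge> N ==> (LINT x|mu f. (s n x - t m x)\<^sup>2) < e\<^sup>2"
  using integral_sq_diff_tendsto[of "mu f" s p t "e\<^sup>2"] s t e by (auto simp: appr_def)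
 have "norm (Sf (s n) f - Sf (t m) f) < e" if "n \<ge> N" "m \<ge> N" for n m
 proof -
  have sm: "simple_function borel (s n)" "simple_function borel (t m)" using s t by (auto simp: appr_def)
  have "(norm (Sf (s n) f - Sf (t m) f))\<^sup>2 < e\<^sup>2"
   using N[OF that] norm_Sf[OF simple_diff[OF sm], of f] by (simp add: Sf_diff[OF sm])
  then show ?thesis by (rule power2_less_imp_less) (use e in simp)
 qed
 then show ?thesis by (intro exI[of _ N]) simp
qed

text \<open>Meaningful for \<open>f\<close> in \<open>dom p\<close>, where the limit exists and
  every sequence with \<open>appr f p\<close> gives the same value
  (\<open>appr_tendsto\<close>).\<close>

definition Phi :: "(real => real) => 'a => 'a" where "Phi p f = lim (\<lambda>i. Sf (apx p i) f)"

lemma appr_tendsto: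
 assumes m: "p \<in> borel_fun" and f: "f \<in> dom p" and s: "appr f p s"
 shows "(\<lambda>i. Sf (s i) f) \<longlonglongrightarrow> Phi p f"
proof -
 note a = appr_apx[OF m f]
 have "Cauchy (\<lambda>i. Sf (apx p i) f)"
  by (rule CauchyI) (rule appr_close[OF m a a])
 then have l: "(\<lambda>i. Sf (apx p i) f) \<longlonglongrightarrow> Phi p f"
  unfolding Phi_def using Cauchy_convergent convergent_LIMSEQ_iff by blast
 have "(\<lambda>i. Sf (s i) f - Sf (apx p i) f) \<longlonglongrightarrow> 0"
 proof (rule LIMSEQ_I)
  fix e :: real assume "e > 0"
  then show "\<exists>N. \<forall>n\<ge>N. norm (Sf (s n) f - Sf (apx p n) f - 0) < e"
   using appr_close[OF m s a, of e] by auto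
 qed
 from tendsto_add[OF this l] show ?thesis by simp
qed

lemmas Phi_tendsto = appr_tendsto[OF _ _ appr_apx]

end

section \<open>Algebra and domains of the calculus for unbounded functions\<close>

context spectral
begin

lemma norm_Phi:
 assumes m [measurable]: "q \<in> borel_fun" and f: "f \<in> dom q"
 shows "(norm (Phi q f))\<^sup>2 = (LINT x|mu f. (q x)\<^sup>2)"
proof -
 have [measurable]: "apx q n \<in> borel_fun" for n using simple_apx[OF m] by (rule simple_borel)
 have i: "integrable (mu f) (\<lambda>x. 4 * (q x)\<^sup>2)" using f by (simp add: dom_def)
 have "(\<lambda>n. (norm (Sf (apx q n) f))\<^sup>2) \<longlonglongrightarrow> (norm (Phi q f))\<^sup>2"
  by (intro tendsto_intros Phi_tendsto[OF m f m f])
 moreover have "(\<lambda>n. LINT x|mu f. (apx q n x)\<^sup>2) \<longlonglongrightarrow> (LINT x|mu f. (q x)\<^sup>2)"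
 proof (rule integral_dominated_convergence[OF _ _ i])
  show "AE x in mu f. (\<lambda>n. (apx q n x)\<^sup>2) \<longlonglongrightarrow> (q x)\<^sup>2"
   by (rule AE_I2) (intro tendsto_intros apx_tendsto[OF m])
  show "AE x in mu f. norm ((apx q n x)\<^sup>2) \<le> 4 * (q x)\<^sup>2" for n
  proof (rule AE_I2)
   fix x
   have "\<bar>apx q n x\<bar>\<^sup>2 \<le> (2 * \<bar>q x\<bar>)\<^sup>2" using apx_le[OF m, of n x] by (intro power_mono) auto
   then show "norm ((apx q n x)\<^sup>2) \<le> 4 * (q x)\<^sup>2" by (simp add: power_mult_distrib)
  qed
 qed auto
 then have "(\<lambda>n. (norm (Sf (apx q n) f))\<^sup>2) \<longlonglongrightarrow> (LINT x|mu f. (q x)\<^sup>2)"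
  by (simp only: norm_Sf[OF simple_apx[OF m]])
 ultimately show ?thesis by (rule LIMSEQ_unique)
qed

lemma dom_bounded:
 assumes [measurable]: "q \<in> borel_fun" and K: "\<And>x. \<bar>q x\<bar> \<le> K" shows "f \<in> dom q"
 unfolding dom_def
proof (intro CollectI integrable_bounded[where K="K\<^sup>2"])
 fix x
 have "\<bar>q x\<bar>\<^sup>2 \<le> K\<^sup>2" using K[of x] by (intro power_mono) auto
 then show "\<bar>(q x)\<^sup>2\<bar> \<le> K\<^sup>2" by simp
qed measurable

lemma dom_le:
 assumes [measurable]: "q \<in> borel_fun" and f: "f \<in> dom z" and le: "\<And>x. \<bar>q x\<bar> \<le> \<bar>z x\<bar>"
 shows "f \<in> dom q"
 using f unfolding dom_def mem_Collect_eq
 by (rule Bochner_Integration.integrable_bound) (use power_mono[OF le abs_ge_zero, of _ 2] in auto)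

lemma dom_add:
 assumes m [measurable]: "q \<in> borel_fun" "z \<in> borel_fun" and f: "f \<in> dom q" "f \<in> dom z"
 shows "f \<in> dom (\<lambda>x. q x + z x)"
proof -
 have i: "integrable (mu f) (\<lambda>x. 2 * (q x)\<^sup>2 + 2 * (z x)\<^sup>2)" using f by (simp add: dom_def)
 show ?thesis unfolding dom_def mem_Collect_eq
 proof (rule Bochner_Integration.integrable_bound[OF i])
  have "norm ((q x + z x)\<^sup>2) \<le> norm (2 * (q x)\<^sup>2 + 2 * (z x)\<^sup>2)" for x
  proof -
   have "0 \<le> (q x - z x)\<^sup>2" by simp
   then have "(q x + z x)\<^sup>2 \<le> 2 * (q x)\<^sup>2 + 2 * (z x)\<^sup>2" by (simp add: power2_eq_square algebra_simps)
   then show ?thesis unfolding real_norm_def abs_power2 by (rule order_trans[OF _ abs_ge_self])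
  qed
  then show "AE x in mu f. norm ((q x + z x)\<^sup>2) \<le> norm (2 * (q x)\<^sup>2 + 2 * (z x)\<^sup>2)" by auto
 qed auto
qed

lemma dom_scale: "f \<in> dom q ==> f \<in> dom (\<lambda>x. c * q x)"
 by (simp add: dom_def power_mult_distrib)

lemma appr_add:
 assumes s: "appr f q s" and t: "appr f z t"
  and m [measurable]: "q \<in> borel_fun" "z \<in> borel_fun"
 shows "appr f (\<lambda>x. q x + z x) (\<lambda>i x. s i x + t i x)"
proof -
 have [measurable]: "s n \<in> borel_fun" "t n \<in> borel_fun" for n
  using s t by (auto simp: appr_def intro: simple_borel)
 have i: "integrable (mu f) (\<lambda>x. 2 * (s n x - q x)\<^sup>2 + 2 * (t n x - z x)\<^sup>2)" for n
  using s t by (simp add: appr_def)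
 have le: "(s n x + t n x - (q x + z x))\<^sup>2 \<le> 2 * (s n x - q x)\<^sup>2 + 2 * (t n x - z x)\<^sup>2" for n x
 proof -
  have "0 \<le> ((s n x - q x) - (t n x - z x))\<^sup>2" by simp
  then show ?thesis by (simp add: power2_eq_square algebra_simps)
 qed
 have i': "integrable (mu f) (\<lambda>x. (s n x + t n x - (q x + z x))\<^sup>2)" for n
  by (rule Bochner_Integration.integrable_bound[OF i[of n]]) (use le in auto)
 have "(\<lambda>n. LINT x|mu f. (s n x + t n x - (q x + z x))\<^sup>2) \<longlonglongrightarrow> 0"
 proof (rule tendsto_sandwich)
  show "\<forall>\<^sub>F n in sequentially. 0 \<le> (LINT x|mu f. (s n x + t n x - (q x + z x))\<^sup>2)" by simp
  show "\<forall>\<^sub>F n in sequentially. (LINT x|mu f. (s n x + t n x - (q x + z x))\<^sup>2)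
    \<le> 2 * (LINT x|mu f. (s n x - q x)\<^sup>2) + 2 * (LINT x|mu f. (t n x - z x)\<^sup>2)"
  proof (rule always_eventually, rule allI)
   fix n
   have "(LINT x|mu f. (s n x + t n x - (q x + z x))\<^sup>2) \<le> (LINT x|mu f. 2 * (s n x - q x)\<^sup>2 + 2 * (t n x - z x)\<^sup>2)"
    by (rule integral_mono[OF i' i le])
   then show "(LINT x|mu f. (s n x + t n x - (q x + z x))\<^sup>2)
    \<le> 2 * (LINT x|mu f. (s n x - q x)\<^sup>2) + 2 * (LINT x|mu f. (t n x - z x)\<^sup>2)"
    using s t by (simp add: appr_def)
  qed
  have "(\<lambda>n. 2 * (LINT x|mu f. (s n x - q x)\<^sup>2) + 2 * (LINT x|mu f. (t n x - z x)\<^sup>2)) \<longlonglongrightarrow> 2 * 0 + 2 * 0"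
   using s t unfolding appr_def by (intro tendsto_intros) auto
  then show "(\<lambda>n. 2 * (LINT x|mu f. (s n x - q x)\<^sup>2) + 2 * (LINT x|mu f. (t n x - z x)\<^sup>2)) \<longlonglongrightarrow> 0" by simp
 qed simp
 then show ?thesis using i' s t by (auto simp: appr_def simple_add)
qed

lemma Phi_add:
 assumes m: "q \<in> borel_fun" "z \<in> borel_fun" and f: "f \<in> dom q" "f \<in> dom z"
 shows "Phi (\<lambda>x. q x + z x) f = Phi q f + Phi z f"
proof -
 have m': "(\<lambda>x. q x + z x) \<in> borel_fun" using m by measurable
 have "(\<lambda>i. Sf (\<lambda>x. apx q i x + apx z i x) f) \<longlonglongrightarrow> Phi (\<lambda>x. q x + z x) f"
  by (rule appr_tendsto[OF m' dom_add[OF m f] appr_add[OF appr_apx[OF m(1) f(1)] appr_apx[OF m(2) f(2)] m]])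
 moreover have "(\<lambda>i. Sf (\<lambda>x. apx q i x + apx z i x) f) \<longlonglongrightarrow> Phi q f + Phi z f"
  unfolding Sf_add[OF simple_apx[OF m(1)] simple_apx[OF m(2)]]
  by (intro tendsto_add Phi_tendsto m f)
 ultimately show ?thesis by (rule LIMSEQ_unique)
qed

lemma appr_mult:
 assumes s: "appr f q s" and t: "simple_function borel t"
  and m [measurable]: "q \<in> borel_fun"
 shows "appr f (\<lambda>x. t x * q x) (\<lambda>i x. t x * s i x)"
proof -
 obtain K where K: "\<And>x. \<bar>t x\<bar> \<le> K" using simple_bounded[OF t] by blast
 have [measurable]: "t \<in> borel_fun" "s n \<in> borel_fun" for n
  using s t by (auto simp: appr_def intro: simple_borel)
 have le: "(t x * s n x - t x * q x)\<^sup>2 \<le> K\<^sup>2 * (s n x - q x)\<^sup>2" for n x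
 proof -
  have "\<bar>t x\<bar>\<^sup>2 \<le> K\<^sup>2" using K[of x] by (intro power_mono) auto
  then have "(t x)\<^sup>2 * (s n x - q x)\<^sup>2 \<le> K\<^sup>2 * (s n x - q x)\<^sup>2" by (intro mult_right_mono) auto
  then show ?thesis by (simp add: right_diff_distrib[symmetric] power_mult_distrib)
 qed
 have i: "integrable (mu f) (\<lambda>x. K\<^sup>2 * (s n x - q x)\<^sup>2)" for n using s by (simp add: appr_def)
 have i': "integrable (mu f) (\<lambda>x. (t x * s n x - t x * q x)\<^sup>2)" for n
  by (rule Bochner_Integration.integrable_bound[OF i[of n]]) (use le in auto)
 have "(\<lambda>n. LINT x|mu f. (t x * s n x - t x * q x)\<^sup>2) \<longlonglongrightarrow> 0"
 proof (rule tendsto_sandwich)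
  show "\<forall>\<^sub>F n in sequentially. 0 \<le> (LINT x|mu f. (t x * s n x - t x * q x)\<^sup>2)" by simp
  show "\<forall>\<^sub>F n in sequentially. (LINT x|mu f. (t x * s n x - t x * q x)\<^sup>2) \<le> K\<^sup>2 * (LINT x|mu f. (s n x - q x)\<^sup>2)"
   using integral_mono[OF i' i le] by simp
  show "(\<lambda>n. K\<^sup>2 * (LINT x|mu f. (s n x - q x)\<^sup>2)) \<longlonglongrightarrow> 0"
   using s by (auto simp: appr_def intro!: tendsto_mult_right_zero)
 qed simp
 then show ?thesis using i' s t by (auto simp: appr_def simple_mult)
qed

lemma Sf_bounded: assumes s: "simple_function borel s" shows "bounded_linear (Sf s)"
proof -
 obtain K where K: "\<And>x. \<bar>s x\<bar> \<le> K" using simple_bounded[OF s] by blast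
 have [measurable]: "s \<in> borel_fun" using s by (rule simple_borel)
 have K0: "0 \<le> K" using K[of 0] by auto
 show ?thesis
 proof (rule bounded_linear_intro[where K=K])
  fix f
  have sK: "(s x)\<^sup>2 \<le> K\<^sup>2" for x using power_mono[OF K[of x], of 2] by simp
  have "(norm (Sf s f))\<^sup>2 \<le> (LINT x|mu f. K\<^sup>2)"
   unfolding norm_Sf[OF s]
   by (intro integral_mono integrable_bounded[where K="K\<^sup>2"]) (use sK in auto)
  also have "\<dots> = K\<^sup>2 * (norm f)\<^sup>2" by (simp add: measure_mu dot_square_norm)
  finally have "(norm (Sf s f))\<^sup>2 \<le> (norm f * K)\<^sup>2" by (simp only: power_mult_distrib mult.commute)
  then show "norm (Sf s f) \<le> norm f * K" by (rule power2_le_imp_le) (simp add: K0)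
 qed (simp_all add: linear_add[OF linear_Sf[OF s]] linear_scale[OF linear_Sf[OF s]])
qed

lemma dom_simple_mult:
 assumes t: "simple_function borel t" and m [measurable]: "q \<in> borel_fun" and f: "f \<in> dom q"
 shows "f \<in> dom (\<lambda>x. t x * q x)"
proof -
 obtain K where K: "\<And>x. \<bar>t x\<bar> \<le> K" using simple_bounded[OF t] by blast
 have [measurable]: "t \<in> borel_fun" using t by (rule simple_borel)
 have "\<bar>t x * q x\<bar> \<le> \<bar>K * q x\<bar>" for x
  unfolding abs_mult by (rule mult_right_mono[OF order_trans[OF K abs_ge_self] abs_ge_zero])
 then show ?thesis by (rule dom_le[OF _ dom_scale[OF f, of K], rotated]) measurable
qed

lemma Sf_Phi:
 assumes t: "simple_function borel t" and m [measurable]: "q \<in> borel_fun" and f: "f \<in> dom q"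
 shows "Sf t (Phi q f) = Phi (\<lambda>x. t x * q x) f"
proof -
 have [measurable]: "t \<in> borel_fun" using t by (rule simple_borel)
 have "(\<lambda>i. Sf (\<lambda>x. t x * apx q i x) f) \<longlonglongrightarrow> Phi (\<lambda>x. t x * q x) f"
  by (intro appr_tendsto appr_mult appr_apx dom_simple_mult t m f) measurable
 moreover have "(\<lambda>i. Sf t (Sf (apx q i) f)) \<longlonglongrightarrow> Sf t (Phi q f)"
  by (intro bounded_linear.tendsto[OF Sf_bounded[OF t]] Phi_tendsto m f)
 then have "(\<lambda>i. Sf (\<lambda>x. t x * apx q i x) f) \<longlonglongrightarrow> Sf t (Phi q f)"
  by (simp only: Sf_Sf[OF t simple_apx[OF m]])
 ultimately show ?thesis by (rule LIMSEQ_unique[rotated])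
qed

lemma P_eq_Sf: assumes B: "B \<in> sets borel" shows "P B f = Sf (indicator B) f"
proof (rule inner_eqI)
 fix g show "inner (P B f) g = inner (Sf (indicator B) f) g"
  unfolding inner_Sf[OF simple_ind[OF B]] inner_P_polar[OF B] using B by simp
qed

text \<open>Applying \<open>P B\<close> to \<open>Phi q f\<close> multiplies \<open>q\<close> by the
  indicator of \<open>B\<close>, and \<open>norm_Phi\<close> evaluates the norm. The density makes
  domains of products computable (\<open>dom_Phi_iff\<close>).\<close>

lemma mu_Phi:
 assumes m [measurable]: "q \<in> borel_fun" and f: "f \<in> dom q"
 shows "mu (Phi q f) = density (mu f) (\<lambda>x. ennreal ((q x)\<^sup>2))"
proof (rule measure_eqI)
 fix B assume "B \<in> sets (mu (Phi q f))"
 then have B [measurable]: "B \<in> sets borel" by simp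
 have d: "f \<in> dom (\<lambda>x. indicator B x * q x)" by (rule dom_simple_mult[OF simple_ind[OF B] m f])
 have "emeasure (mu (Phi q f)) B = ennreal (LINT x|mu f. (indicator B x * q x)\<^sup>2)"
  unfolding emeasure_mu[OF B] P_eq_Sf[OF B] Sf_Phi[OF simple_ind[OF B] m f] by (subst norm_Phi[OF _ d]) simp_all
 also have "\<dots> = (\<integral>\<^sup>+x. ennreal ((indicator B x * q x)\<^sup>2) \<partial>mu f)"
  using d by (intro nn_integral_eq_integral[symmetric]) (simp_all add: dom_def)
 also have "\<dots> = emeasure (density (mu f) (\<lambda>x. ennreal ((q x)\<^sup>2))) B"
  by (subst emeasure_density) (simp_all, intro nn_integral_cong, simp split: split_indicator)
 finally show "emeasure (mu (Phi q f)) B = emeasure (density (mu f) (\<lambda>x. ennreal ((q x)\<^sup>2))) B" .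
qed simp

lemma dom_Phi_iff:
 assumes m [measurable]: "q \<in> borel_fun" "z \<in> borel_fun" and f: "f \<in> dom q"
 shows "Phi q f \<in> dom z \<longleftrightarrow> f \<in> dom (\<lambda>x. z x * q x)"
proof -
 have "integrable (density (mu f) (\<lambda>x. ennreal ((q x)\<^sup>2))) (\<lambda>x. (z x)\<^sup>2) \<longleftrightarrow> integrable (mu f) (\<lambda>x. (q x)\<^sup>2 *\<^sub>R (z x)\<^sup>2)"
  by (rule integrable_density) simp_all
 then show ?thesis
  by (simp only: dom_def mem_Collect_eq mu_Phi[OF m(1) f] real_scaleR_def power_mult_distrib mult.commute)
qed

lemma dom_uminus: "f \<in> dom (\<lambda>x. - q x) \<longleftrightarrow> f \<in> dom q"
 by (simp add: dom_def)

lemma Phi_simple: assumes s: "simple_function borel s" shows "Phi s f = Sf s f"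
proof -
 obtain K where K: "\<And>x. \<bar>s x\<bar> \<le> K" using simple_bounded[OF s] by blast
 have m: "s \<in> borel_fun" using s by (rule simple_borel)
 have "(\<lambda>i::nat. Sf s f) \<longlonglongrightarrow> Phi s f"
  by (rule appr_tendsto[OF m dom_bounded[OF m K]]) (simp add: appr_def s)
 then show ?thesis by (simp add: LIMSEQ_const_iff)
qed

lemma Phi_scale:
 assumes m: "q \<in> borel_fun" and f: "f \<in> dom q"
 shows "Phi (\<lambda>x. c * q x) f = c *\<^sub>R Phi q f"
proof -
 have s: "simple_function borel (\<lambda>x::real. c)" by simp
 have "Sf (\<lambda>x. c) g = c *\<^sub>R g" for g by (simp add: Sf_def)
 then show ?thesis using Sf_Phi[OF s m f] by simp
qed

lemma Phi_diff:
 assumes m [measurable]: "q \<in> borel_fun" "z \<in> borel_fun" and f: "f \<in> dom q" "f \<in> dom z"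
 shows "Phi (\<lambda>x. q x - z x) f = Phi q f - Phi z f"
 using Phi_add[OF m(1) _ f(1) dom_scale[OF f(2), of "-1"]] Phi_scale[OF m(2) f(2), of "-1"] by simp

lemma Phi_one [simp]: "Phi (\<lambda>x. 1) f = f"
 by (subst Phi_simple) (simp_all add: Sf_def)

text \<open>By \<open>norm_Phi\<close> the difference has norm zero. This is the way in which
  knowledge about the support of the spectral measure enters the calculus.\<close>

lemma Phi_AE_cong:
 assumes m [measurable]: "q \<in> borel_fun" "z \<in> borel_fun" and f: "f \<in> dom q"
  and AE: "AE x in mu f. q x = z x"
 shows "Phi q f = Phi z f" "f \<in> dom z"
proof -
 show f2: "f \<in> dom z"
  using f unfolding dom_def mem_Collect_eq
  by (subst (asm) integrable_cong_AE[where g="\<lambda>x. (z x)\<^sup>2"]) (use AE in auto)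
 have "f \<in> dom (\<lambda>x. q x - z x)" using dom_add[OF m(1) _ f dom_scale[OF f2, of "-1"]] by simp
 then have "(norm (Phi (\<lambda>x. q x - z x) f))\<^sup>2 = (LINT x|mu f. (q x - z x)\<^sup>2)"
  by (intro norm_Phi) measurable
 also have "\<dots> = (LINT x|mu f. 0)" by (rule integral_cong_AE) (use AE in auto)
 finally show "Phi q f = Phi z f" by (simp add: Phi_diff[OF m f f2])
qed

text \<open>For simple functions the triangle inequality for \<open>Sf\<close> bounds the integral
  against \<open>mu (f + g)\<close> uniformly in the approximation; Fatou passes to
  \<open>q\<close>.\<close>

lemma dom_sum:
 assumes m [measurable]: "q \<in> borel_fun" and f: "f \<in> dom q" and g: "g \<in> dom q"
 shows "f + g \<in> dom q"
proof -
 have [measurable]: "apx q n \<in> borel_fun" for n using simple_apx[OF m] by (rule simple_borel)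
 note si = simple_apx[OF m]
 have int2: "integrable (mu h) (\<lambda>x. (apx q n x)\<^sup>2)" for n h
  using integrable_simple[OF simple_mult[OF si[of n] si[of n]], of h] by (simp add: power2_eq_square)
 define C where "C = 8 * (LINT x|mu f. (q x)\<^sup>2) + 8 * (LINT x|mu g. (q x)\<^sup>2)"
 have sq: "(LINT x|mu h. (apx q n x)\<^sup>2) \<le> 4 * (LINT x|mu h. (q x)\<^sup>2)" if h: "h \<in> dom q" for h n
 proof -
  have "(LINT x|mu h. (apx q n x)\<^sup>2) \<le> (LINT x|mu h. 4 * (q x)\<^sup>2)"
  proof (rule integral_mono[OF int2])
   show "integrable (mu h) (\<lambda>x. 4 * (q x)\<^sup>2)" using h by (simp add: dom_def)
   fix x
   have "\<bar>apx q n x\<bar>\<^sup>2 \<le> (2 * \<bar>q x\<bar>)\<^sup>2" using apx_le[OF m, of n x] by (intro power_mono) auto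
   then show "(apx q n x)\<^sup>2 \<le> 4 * (q x)\<^sup>2" by (simp add: power_mult_distrib)
  qed
  then show ?thesis by simp
 qed
 have le: "(\<integral>\<^sup>+x. ennreal ((apx q n x)\<^sup>2) \<partial>mu (f + g)) \<le> ennreal C" for n
 proof -
  have "(LINT x|mu (f + g). (apx q n x)\<^sup>2) = (norm (Sf (apx q n) f + Sf (apx q n) g))\<^sup>2"
   by (simp add: norm_Sf[OF si, symmetric] linear_add[OF linear_Sf[OF si]])
  also have "\<dots> \<le> (norm (Sf (apx q n) f) + norm (Sf (apx q n) g))\<^sup>2"
   by (intro power_mono norm_triangle_ineq) simp
  also have "\<dots> \<le> 2 * (norm (Sf (apx q n) f))\<^sup>2 + 2 * (norm (Sf (apx q n) g))\<^sup>2"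
  proof -
   have "0 \<le> (norm (Sf (apx q n) f) - norm (Sf (apx q n) g))\<^sup>2" by simp
   then show ?thesis by (simp add: power2_eq_square algebra_simps)
  qed
  also have "\<dots> \<le> C" using sq[OF f, of n] sq[OF g, of n] by (simp add: norm_Sf[OF si] C_def)
  finally show ?thesis by (subst nn_integral_eq_integral[OF int2]) (auto intro: ennreal_leI)
 qed
 have "(\<integral>\<^sup>+x. ennreal ((q x)\<^sup>2) \<partial>mu (f + g)) = (\<integral>\<^sup>+x. liminf (\<lambda>n. ennreal ((apx q n x)\<^sup>2)) \<partial>mu (f + g))"
 proof (rule nn_integral_cong)
  fix x
  have "(\<lambda>n. ennreal ((apx q n x)\<^sup>2)) \<longlonglongrightarrow> ennreal ((q x)\<^sup>2)"
   by (intro tendsto_ennrealI tendsto_intros apx_tendsto[OF m])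
  from lim_imp_Liminf[OF trivial_limit_sequentially this]
  show "ennreal ((q x)\<^sup>2) = liminf (\<lambda>n. ennreal ((apx q n x)\<^sup>2))" by (rule HOL.sym)
 qed
 also have "\<dots> \<le> liminf (\<lambda>n. \<integral>\<^sup>+x. ennreal ((apx q n x)\<^sup>2) \<partial>mu (f + g))"
  by (rule nn_integral_liminf) measurable
 also have "\<dots> \<le> ennreal C"
  using Liminf_mono[of "\<lambda>n. \<integral>\<^sup>+x. ennreal ((apx q n x)\<^sup>2) \<partial>mu (f + g)" "\<lambda>_. ennreal C" sequentially] le
  by (simp add: Liminf_const)
 finally have "(\<integral>\<^sup>+x. ennreal ((q x)\<^sup>2) \<partial>mu (f + g)) < \<infinity>"
  by (simp add: le_less_trans[OF _ ennreal_less_top])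
 then show ?thesis unfolding dom_def mem_Collect_eq
  by (intro integrableI_bounded) auto
qed

lemma mu_uminus: "mu (- f) = mu f"
 by (rule measure_eqI) (simp_all add: emeasure_mu linear_neg[OF lin])

lemma dom_diff:
 assumes m: "q \<in> borel_fun" and f: "f \<in> dom q" and g: "g \<in> dom q"
 shows "f - g \<in> dom q"
 using dom_sum[OF m f, of "- g"] g by (simp add: dom_def mu_uminus)

lemma Phi_sum:
 assumes m: "q \<in> borel_fun" and f: "f \<in> dom q" and g: "g \<in> dom q"
 shows "Phi q (f + g) = Phi q f + Phi q g"
proof -
 have "(\<lambda>i. Sf (apx q i) (f + g)) \<longlonglongrightarrow> Phi q (f + g)"
  by (intro Phi_tendsto m dom_sum f g)
 moreover have "(\<lambda>i. Sf (apx q i) (f + g)) \<longlonglongrightarrow> Phi q f + Phi q g"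
  unfolding linear_add[OF linear_Sf[OF simple_apx[OF m]]] by (intro tendsto_add Phi_tendsto m f g)
 ultimately show ?thesis by (rule LIMSEQ_unique)
qed

lemma sym_Phi:
 assumes m: "q \<in> borel_fun" and f: "f \<in> dom q" and g: "g \<in> dom q"
 shows "inner (Phi q f) g = inner f (Phi q g)"
proof -
 have "(\<lambda>i. inner (Sf (apx q i) f) g) \<longlonglongrightarrow> inner (Phi q f) g"
  by (intro tendsto_inner Phi_tendsto m f tendsto_const)
 moreover have "(\<lambda>i. inner (Sf (apx q i) f) g) \<longlonglongrightarrow> inner f (Phi q g)"
  unfolding sym_Sf[OF simple_apx[OF m]] by (intro tendsto_inner Phi_tendsto m g tendsto_const)
 ultimately show ?thesis by (rule LIMSEQ_unique)
qed

lemma integrable_dom: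
 assumes [measurable]: "q \<in> borel_fun" and f: "f \<in> dom q"
 shows "integrable (mu f) q"
proof -
 have i: "integrable (mu f) (\<lambda>x. 1 + (q x)\<^sup>2)"
  using f integrable_bounded[of "\<lambda>_. 1" 1 f] by (simp add: dom_def)
 show ?thesis
 proof (rule Bochner_Integration.integrable_bound[OF i])
  have "norm (q x) \<le> norm (1 + (q x)\<^sup>2)" for x
  proof -
   have "0 \<le> (\<bar>q x\<bar> - 1)\<^sup>2 + \<bar>q x\<bar>\<^sup>2 + 1" by (intro add_nonneg_nonneg) auto
   then have "\<bar>q x\<bar> \<le> 1 + (q x)\<^sup>2" unfolding power2_diff by simp
   then show ?thesis unfolding real_norm_def by (rule order_trans[OF _ abs_ge_self])
  qed
  then show "AE x in mu f. norm (q x) \<le> norm (1 + (q x)\<^sup>2)" by auto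
 qed simp
qed

lemma integral_apx_tendsto:
 assumes m [measurable]: "q \<in> borel_fun" and f: "f \<in> dom q"
 shows "(\<lambda>n. LINT x|mu f. apx q n x) \<longlonglongrightarrow> (LINT x|mu f. q x)"
proof (rule integral_dominated_convergence)
 have [measurable]: "apx q n \<in> borel_fun" for n using simple_apx[OF m] by (rule simple_borel)
 show "integrable (mu f) (\<lambda>x. 2 * \<bar>q x\<bar>)" using integrable_dom[OF m f] by simp
 show "AE x in mu f. (\<lambda>n. apx q n x) \<longlonglongrightarrow> q x" by (rule AE_I2) (rule apx_tendsto[OF m])
 show "AE x in mu f. norm (apx q n x) \<le> 2 * \<bar>q x\<bar>" for n using apx_le[OF m] by auto
 show "apx q n \<in> borel_measurable (mu f)" for n by simp
qed simp

lemma inner_Phi: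
 assumes m: "q \<in> borel_fun" and f: "f \<in> dom q" and g: "g \<in> dom q"
 shows "inner (Phi q f) g = ((LINT x|mu (f + g). q x) - (LINT x|mu (f - g). q x)) / 4"
proof -
 have "(\<lambda>i. inner (Sf (apx q i) f) g) \<longlonglongrightarrow> inner (Phi q f) g"
  by (intro tendsto_inner Phi_tendsto m f tendsto_const)
 moreover have "(\<lambda>i. inner (Sf (apx q i) f) g) \<longlonglongrightarrow> ((LINT x|mu (f + g). q x) - (LINT x|mu (f - g). q x)) / 4"
  unfolding inner_Sf[OF simple_apx[OF m]]
  by (intro tendsto_intros integral_apx_tendsto m dom_sum dom_diff f g) simp
 ultimately show ?thesis by (rule LIMSEQ_unique)
qed

lemma inner_Phi_self:
 assumes m: "q \<in> borel_fun" and f: "f \<in> dom q"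
 shows "inner (Phi q f) f = (LINT x|mu f. q x)"
proof -
 have "(\<lambda>i. inner (Sf (apx q i) f) f) \<longlonglongrightarrow> inner (Phi q f) f"
  by (intro tendsto_inner Phi_tendsto m f tendsto_const)
 moreover have "(\<lambda>i. inner (Sf (apx q i) f) f) \<longlonglongrightarrow> (LINT x|mu f. q x)"
  unfolding inner_Sf_self[OF simple_apx[OF m]] by (intro integral_apx_tendsto m f)
 ultimately show ?thesis by (rule LIMSEQ_unique)
qed

text \<open>For simple \<open>z\<close> this is \<open>Sf_Phi\<close>. In general the error is, by
  \<open>mu_Phi\<close>, the distance of \<open>apx z i\<close> from \<open>z\<close> in the
  \<open>L^2\<close> space of \<open>mu (Phi q f)\<close>.\<close>

lemma Phi_Phi:
 assumes m [measurable]: "q \<in> borel_fun" "z \<in> borel_fun"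
  and f: "f \<in> dom q" and fp: "f \<in> dom (\<lambda>x. z x * q x)"
 shows "Phi z (Phi q f) = Phi (\<lambda>x. z x * q x) f"
proof -
 have [measurable]: "apx z n \<in> borel_fun" for n using simple_apx[OF m(2)] by (rule simple_borel)
 have d: "Phi q f \<in> dom z" using dom_Phi_iff[OF m f] fp by blast
 have l: "(\<lambda>i. Phi (\<lambda>x. apx z i x * q x) f) \<longlonglongrightarrow> Phi z (Phi q f)"
  using Phi_tendsto[OF m(2) d m(2) d] by (simp add: Sf_Phi[OF simple_apx[OF m(2)] m(1) f])
 have a: "(\<lambda>i. LINT x|mu (Phi q f). (apx z i x - z x)\<^sup>2) \<longlonglongrightarrow> 0"
  using appr_apx[OF m(2) d] by (simp add: appr_def)
 have "(norm (Phi (\<lambda>x. apx z i x * q x) f - Phi (\<lambda>x. z x * q x) f))\<^sup>2 = (LINT x|mu (Phi q f). (apx z i x - z x)\<^sup>2)" for i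
 proof -
  have d1: "f \<in> dom (\<lambda>x. apx z i x * q x)" by (rule dom_simple_mult[OF simple_apx[OF m(2)] m(1) f])
  have d2: "f \<in> dom (\<lambda>x. apx z i x * q x - z x * q x)"
   using dom_add[OF _ _ d1 dom_scale[OF fp, of "-1"]] by simp
  have "(norm (Phi (\<lambda>x. apx z i x * q x) f - Phi (\<lambda>x. z x * q x) f))\<^sup>2
   = (norm (Phi (\<lambda>x. apx z i x * q x - z x * q x) f))\<^sup>2"
   by (subst Phi_diff[OF _ _ d1 fp]) auto
  also have "\<dots> = (LINT x|mu f. (apx z i x * q x - z x * q x)\<^sup>2)" by (rule norm_Phi[OF _ d2]) measurable
  also have "\<dots> = (LINT x|mu (Phi q f). (apx z i x - z x)\<^sup>2)"
  proof -
   have "(a * p - b * p)\<^sup>2 = p\<^sup>2 *\<^sub>R (a - b)\<^sup>2" for a b p :: real by (simp add: power2_eq_square algebra_simps)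
   then show ?thesis unfolding mu_Phi[OF m(1) f] by (subst integral_density) simp_all
  qed
  finally show ?thesis .
 qed
 then have "(\<lambda>i. (norm (Phi (\<lambda>x. apx z i x * q x) f - Phi (\<lambda>x. z x * q x) f))\<^sup>2) \<longlonglongrightarrow> 0" using a by simp
 from tendsto_real_sqrt[OF this] have "(\<lambda>i. Phi (\<lambda>x. apx z i x * q x) f - Phi (\<lambda>x. z x * q x) f) \<longlonglongrightarrow> 0"
  by (simp add: tendsto_norm_zero_iff)
 then have "(\<lambda>i. Phi (\<lambda>x. apx z i x * q x) f) \<longlonglongrightarrow> Phi (\<lambda>x. z x * q x) f" by (rule LIM_zero_cancel)
 then show ?thesis by (rule LIMSEQ_unique[OF l])
qed

text \<open>On the sets where \<open>|q| <= n\<close> the function is bounded, so the projected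
  vectors lie in the domain; these sets exhaust the line.\<close>

lemma dom_dense:
 assumes m [measurable]: "q \<in> borel_fun"
 shows "\<exists>F. (\<forall>n::nat. F n \<in> dom q) \<and> F \<longlonglongrightarrow> g"
proof -
 define B where "B n = {x. \<bar>q x\<bar> \<le> real n}" for n :: nat
 have Bm [measurable]: "B n \<in> sets borel" for n unfolding B_def by measurable
 have "Phi (indicator (B n)) g \<in> dom q" for n
 proof (subst dom_Phi_iff[OF _ m])
  show "g \<in> dom (indicator (B n))" by (rule dom_bounded[where K=1]) (auto simp: indicator_def)
  show "g \<in> dom (\<lambda>x. q x * indicator (B n) x)"
   by (rule dom_bounded[where K="real n"]) (auto simp: indicator_def B_def)
 qed simp
 then have 1: "P (B n) g \<in> dom q" for n
  by (simp add: P_eq_Sf[OF Bm] Phi_simple[OF simple_ind[OF Bm]])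
 interpret finite_measure "mu g" by (rule finite_mu)
 have "(\<lambda>n. measure (mu g) (B n)) \<longlonglongrightarrow> measure (mu g) (\<Union>n. B n)"
  by (rule finite_Lim_measure_incseq) (auto simp: incseq_def B_def)
 moreover have "(\<Union>n. B n) = UNIV" by (auto simp: B_def real_arch_simple)
 ultimately have "(\<lambda>n. measure (mu g) UNIV - measure (mu g) (B n)) \<longlonglongrightarrow> measure (mu g) UNIV - measure (mu g) UNIV"
  by (intro tendsto_diff) auto
 moreover have "(norm (P (B n) g - g))\<^sup>2 = measure (mu g) UNIV - measure (mu g) (B n)" for n
  using norm_P_sq[OF Bm, of n g] unfolding power2_norm_eq_inner
  by (simp add: measure_mu inner_diff_left inner_diff_right inner_commute del: dot_square_norm)
 ultimately have "(\<lambda>n. (norm (P (B n) g - g))\<^sup>2) \<longlonglongrightarrow> 0" by simp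
 from tendsto_real_sqrt[OF this] have "(\<lambda>n. P (B n) g - g) \<longlonglongrightarrow> 0"
  by (simp add: tendsto_norm_zero_iff)
 then have "(\<lambda>n. P (B n) g) \<longlonglongrightarrow> g" by (rule LIM_zero_cancel)
 then show ?thesis using 1 by (intro exI[of _ "\<lambda>n. P (B n) g"]) simp
qed

text \<open>Density of the domain makes the weak identity determine \<open>h\<close>. This is the
  form in which \<open>spec_int\<close> describes an integral.\<close>

lemma Phi_unique:
 assumes m: "q \<in> borel_fun" and f: "f \<in> dom q"
  and h: "\<And>g. g \<in> dom q ==> inner h g = ((LINT x|mu (f + g). q x) - (LINT x|mu (f - g). q x)) / 4"
 shows "h = Phi q f"
proof (rule inner_eqI)
 fix g
 obtain F where F: "\<And>n. F n \<in> dom q" "F \<longlonglongrightarrow> g" using dom_dense[OF m, of g] by blast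
 have "(\<lambda>n. inner (Phi q f) (F n)) = (\<lambda>n. inner h (F n))" by (rule ext) (simp only: h[OF F(1)] inner_Phi[OF m f F(1)])
 moreover have "(\<lambda>n. inner h (F n)) \<longlonglongrightarrow> inner h g" "(\<lambda>n. inner (Phi q f) (F n)) \<longlonglongrightarrow> inner (Phi q f) g"
  by (intro tendsto_intros F)+
 ultimately show "inner h g = inner (Phi q f) g" by (metis LIMSEQ_unique)
qed

end

section \<open>The unbounded operator behind an injective contraction\<close>

locale injective_positive_contraction = positive_contraction +
 assumes inj: "R f = 0 ==> f = 0"
begin

interpretation sp: spectral P by (rule spectral_P)

text \<open>Reconciles the measure obtained from moments with the one defined from the
  projections.\<close>

lemma sp_mu: "sp.mu f = mu f"
proof (rule measure_eqI)
 fix B assume "B \<in> sets (sp.mu f)"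
 then have B: "B \<in> sets borel" by simp
 interpret finite_measure "mu f" by (rule finite_mu)
 show "emeasure (sp.mu f) B = emeasure (mu f) B"
  by (simp add: sp.emeasure_mu[OF B] sp.norm_P_sq[OF B] inner_P_self[OF B] emeasure_eq_measure)
qed simp

lemma bm_mu [simp]: "borel_measurable (mu f) = borel_fun"
 by (rule measurable_cong_sets) simp_all

lemma dom_ident: "f \<in> sp.dom (\<lambda>x. x)"
 unfolding sp.dom_def mem_Collect_eq sp_mu
proof (rule finite_measure.integrable_const_bound[OF finite_mu, of _ 1])
 show "AE x in mu f. norm (x\<^sup>2) \<le> 1"
  using AE_mu[of f] by eventually_elim (auto simp: power_le_one)
qed simp

lemma Phi_ident: "sp.Phi (\<lambda>x. x) f = R f"
proof (rule sp.Phi_unique[symmetric])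
 fix g
 show "inner (R f) g = ((LINT x|sp.mu (f + g). x) - (LINT x|sp.mu (f - g). x)) / 4"
  using polar[of 1 f g] moment_mu[of "f + g" 1] moment_mu[of "f - g" 1] by (simp add: sp_mu Q_def)
qed (auto simp: dom_ident)

lemma R_eq_0I:
 assumes "inner (R f) f = 0" shows "f = 0"
proof -
 have "(LINT x|mu f. x) = 0" using moment_mu[of f 1] assms by simp
 moreover have "integrable (mu f) (\<lambda>x. x)"
  using sp.integrable_dom[OF _ dom_ident, of f] by (simp add: sp_mu)
 ultimately have "AE x in mu f. x = 0"
  using AE_mu[of f] by (subst (asm) integral_nonneg_eq_0_iff_AE) auto
 then have "AE x in sp.mu f. x = 0" unfolding sp_mu .
 from sp.Phi_AE_cong(1)[OF _ _ dom_ident this]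
 have "sp.Phi (\<lambda>x. x) f = sp.Phi (\<lambda>x. 0) f" by simp
 moreover have "sp.Phi (\<lambda>x. 0) f = 0"
  using sp.Phi_scale[of "\<lambda>x. x" f 0] dom_ident by simp
 ultimately show ?thesis using inj by (simp add: Phi_ident)
qed

text \<open>The measure of \<open>P {..0} f\<close> lives on \<open>{..0}\<close> and on
  \<open>[0, 1]\<close>, hence at the point 0. So the form of \<open>R\<close> vanishes at this
  vector, and injectivity makes it 0. This gives \<open>1 / x\<close> a meaning almost
  everywhere.\<close>

lemma AE_pos: "AE x in sp.mu f. 0 < x"
proof -
 define g where "g = P {..0} f"
 have "sp.Phi (indicator {..0}) f = g"
  by (simp add: g_def sp.P_eq_Sf sp.Phi_simple)
 then have "mu g = density (sp.mu f) (\<lambda>x. ennreal ((indicator {..0} x)\<^sup>2))"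
  using sp.mu_Phi[of "indicator {..0}" f] sp.dom_bounded[of "indicator {..0}" 1 f]
  by (simp add: sp_mu split: split_indicator)
 moreover have "AE x in density (sp.mu f) (\<lambda>x. ennreal ((indicator {..0} x)\<^sup>2)). x \<le> 0"
  by (subst AE_density) (auto split: split_indicator)
 ultimately have "AE x in mu g. x \<le> 0" by metis
 then have "AE x in mu g. x = 0" using AE_mu[of g] by eventually_elim auto
 then have "(LINT x|mu g. x) = (LINT x|mu g. 0)"
  by (intro integral_cong_AE) (simp_all)
 then have "g = 0" using moment_mu[of g 1] by (intro R_eq_0I) simp
 then have "emeasure (sp.mu f) {..0} = 0" by (simp add: sp.emeasure_mu g_def)
 then show ?thesis
  by (intro AE_I[of _ _ "{..0}"]) auto
qed

lemma spectral_pushforward: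
 assumes t [measurable]: "p \<in> borel_fun"
 shows "spectral (\<lambda>B. P (p -` B))"
  and "spectral.mu (\<lambda>B. P (p -` B)) f = distr (sp.mu f) borel p"
proof -
 have v: "p -` B \<in> sets borel" if "B \<in> sets borel" for B
  using measurable_sets[OF t that] by simp
 show s: "spectral (\<lambda>B. P (p -` B))"
 proof (unfold spectral_def, intro conjI allI impI)
  fix D :: "nat => real set" and f assume D: "range D \<subseteq> sets borel" "disjoint_family D"
  have "(\<lambda>n. \<Sum>i<n. P (p -` D i) f) \<longlonglongrightarrow> P (\<Union>i. p -` D i) f"
   by (rule sp.sums) (use D v in \<open>auto simp: disjoint_family_on_def\<close>)
  then show "(\<lambda>n. \<Sum>i<n. P (p -` D i) f) \<longlonglongrightarrow> P (p -` (\<Union>i. D i)) f"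
   by (simp add: vimage_UN)
 qed (simp_all add: sp.lin sp.idem sp.sym v)
 interpret E: spectral "\<lambda>B. P (p -` B)" by (rule s)
 show "E.mu f = distr (sp.mu f) borel p"
 proof (rule measure_eqI)
  fix B assume "B \<in> sets (E.mu f)"
  then have B: "B \<in> sets borel" by simp
  have "emeasure (distr (sp.mu f) borel p) B = emeasure (sp.mu f) (p -` B \<inter> space (sp.mu f))"
   by (rule emeasure_distr) (use B in simp_all)
  then show "emeasure (E.mu f) B = emeasure (distr (sp.mu f) borel p) B"
   by (simp add: E.emeasure_mu[OF B] sp.emeasure_mu[OF v[OF B]])
 qed simp
qed

text \<open>The operator is given through its resolvent: \<open>f = R (h + M *\<^sub>R f)\<close>
  says that \<open>h\<close> is its value at \<open>f\<close>. As \<open>R\<close> is multiplication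
  by \<open>x\<close> in the spectral variable, the operator is multiplication by
  \<open>1 / x - M\<close>. The clause on \<open>J\<close> later supplies complex linearity.\<close>

theorem spectral_theorem:
 fixes M :: real
 shows "\<exists>E. spectral E \<and> (\<forall>f h. f \<in> spectral.dom E (\<lambda>x. x) \<and> h = spectral.Phi E (\<lambda>x. x) f \<longleftrightarrow> f = R (h + M *\<^sub>R f)) \<and>
  (\<forall>J B f. linear J \<and> (\<forall>f. R (J f) = J (R f)) \<and> (\<forall>f g. inner (J f) (J g) = inner f g) \<and> (\<forall>f. J (J f) = - f) \<and>
    B \<in> sets borel --> E B (J f) = J (E B f))"
proof -
 \<comment> \<open>At the origin \<open>1 / 0 = 0\<close>, a value that \<open>AE_pos\<close> hides
   from the calculus.\<close>
 define p :: "real => real" where "p x = 1 / x - M" for x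
 have t [measurable]: "p \<in> borel_fun" unfolding p_def by measurable
 define E where "E B = P (p -` B)" for B
 have sE: "spectral E" and muE: "spectral.mu E f = distr (sp.mu f) borel p" for f
  unfolding E_def by (rule spectral_pushforward[OF t])+
 interpret E: spectral E by (rule sE)
 have domE: "E.dom (\<lambda>x. x) = sp.dom p"
  by (simp add: E.dom_def sp.dom_def muE integrable_distr_eq)
 have PhiE: "E.Phi (\<lambda>x. x) f = sp.Phi p f" if f: "f \<in> sp.dom p" for f
 proof (rule sp.Phi_unique[OF t f])
  fix g assume g: "g \<in> sp.dom p"
  show "inner (E.Phi (\<lambda>x. x) f) g = ((LINT x|sp.mu (f + g). p x) - (LINT x|sp.mu (f - g). p x)) / 4"
   using f g by (subst E.inner_Phi) (auto simp: domE muE integral_distr)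
 qed
 have b1: "f \<in> sp.dom (\<lambda>x. c)" for f c by (rule sp.dom_bounded[of _ "\<bar>c\<bar>"]) auto
 have main: "f \<in> sp.dom p \<and> h = sp.Phi p f \<longleftrightarrow> f = R (h + M *\<^sub>R f)" for f h
 proof
  assume a: "f \<in> sp.dom p \<and> h = sp.Phi p f"
  then have f: "f \<in> sp.dom p" and h: "h = sp.Phi p f" by auto
  have d: "f \<in> sp.dom (\<lambda>x. p x + M)" by (rule sp.dom_add[OF t _ f b1]) simp
  have "sp.Phi (\<lambda>x. M) f = M *\<^sub>R f" using sp.Phi_scale[of "\<lambda>x. 1" f M] b1[of f 1] by simp
  then have "h + M *\<^sub>R f = sp.Phi (\<lambda>x. p x + M) f"
   using sp.Phi_add[OF t _ f b1, of M] by (simp add: h)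
  moreover have AE: "AE x in sp.mu f. 1 = x * (p x + M)"
   using AE_pos[of f] by eventually_elim (simp add: p_def)
  have c: "sp.Phi (\<lambda>x. 1) f = sp.Phi (\<lambda>x. x * (p x + M)) f" "f \<in> sp.dom (\<lambda>x. x * (p x + M))"
   by (rule sp.Phi_AE_cong[OF _ _ b1 AE]; measurable)+
  have "sp.Phi (\<lambda>x. x) (sp.Phi (\<lambda>x. p x + M) f) = f"
   using c by (subst sp.Phi_Phi[OF _ _ d]) auto
  ultimately show "f = R (h + M *\<^sub>R f)" by (simp add: Phi_ident)
 next
  assume f: "f = R (h + M *\<^sub>R f)"
  define k where "k = h + M *\<^sub>R f"
  have fk: "f = sp.Phi (\<lambda>x. x) k" using f by (simp add: k_def Phi_ident)
  \<comment> \<open>The product is square-integrable although \<open>p\<close> alone need not be, so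
    \<open>f = R k\<close> lies in the domain of \<open>p\<close>.\<close>
  have AE: "AE x in sp.mu k. 1 - M * x = p x * x"
   using AE_pos[of k] by eventually_elim (simp add: p_def field_simps)
  have d: "k \<in> sp.dom (\<lambda>x. 1 - M * x)"
   using sp.dom_add[OF _ _ b1 sp.dom_scale[OF dom_ident[of k], where c="-M"], of 1] by simp
  have c: "sp.Phi (\<lambda>x. 1 - M * x) k = sp.Phi (\<lambda>x. p x * x) k" "k \<in> sp.dom (\<lambda>x. p x * x)"
   by (rule sp.Phi_AE_cong[OF _ _ d AE]; measurable)+
  have fd: "f \<in> sp.dom p" unfolding fk using c(2) by (subst sp.dom_Phi_iff[OF _ t dom_ident]) auto
  have "sp.Phi p f = sp.Phi (\<lambda>x. 1 - M * x) k"
   unfolding fk c(1) by (rule sp.Phi_Phi[OF _ t dom_ident c(2)]) simp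
  also have "\<dots> = k - M *\<^sub>R R k"
   using sp.Phi_diff[OF _ _ b1 sp.dom_scale[OF dom_ident[of k], where c=M], of 1] sp.Phi_scale[OF _ dom_ident[of k], where c=M]
   by (simp add: Phi_ident)
  also have "\<dots> = h" using f by (simp add: k_def)
  finally show "f \<in> sp.dom p \<and> h = sp.Phi p f" using fd by simp
 qed
 have v: "p -` B \<in> sets borel" if "B \<in> sets borel" for B
  using measurable_sets[OF t that] by simp
 show ?thesis
 proof (intro exI[of _ E] conjI allI impI sE)
  fix f h
  show "f \<in> E.dom (\<lambda>x. x) \<and> h = E.Phi (\<lambda>x. x) f \<longleftrightarrow> f = R (h + M *\<^sub>R f)"
   using main[of f h] PhiE[of f] domE by auto
 next
  fix J :: "'a => 'a" and B :: "real set" and f :: 'a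
  assume "linear J \<and> (\<forall>f. R (J f) = J (R f)) \<and> (\<forall>f g. inner (J f) (J g) = inner f g) \<and> (\<forall>f. J (J f) = - f) \<and> B \<in> sets borel"
  then show "E B (J f) = J (E B f)" unfolding E_def by (intro P_commute v) auto
 qed
qed

end

section \<open>The Hilbert space of square-integrable classes\<close>

lemma L2_measurable: "f \<in> L2 ==> f \<in> borel_measurable halfline"
 by (simp add: L2_def)

lemma L2_integrable: "f \<in> L2 ==> integrable halfline (\<lambda>x. (cmod (f x))\<^sup>2)"
 by (simp add: L2_def)

lemma L2_I:
 assumes [measurable]: "f \<in> borel_measurable halfline"
  and "integrable halfline h" "\<And>x. x \<ge> 0 ==> (cmod (f x))\<^sup>2 \<le> h x"
 shows "f \<in> L2"
 unfolding L2_def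
proof (intro CollectI conjI)
 show "integrable halfline (\<lambda>x. (cmod (f x))\<^sup>2)"
 proof (rule Bochner_Integration.integrable_bound[OF assms(2)])
  show "AE x in halfline. norm ((cmod (f x))\<^sup>2) \<le> norm (h x)"
  proof (rule AE_I2)
   fix x assume "x \<in> space halfline"
   then have "(cmod (f x))\<^sup>2 \<le> h x" by (intro assms(3)) simp
   then show "norm ((cmod (f x))\<^sup>2) \<le> norm (h x)" by simp
  qed
 qed measurable
qed fact

lemma L2_prod_integrable:
 assumes f: "f \<in> L2" and g: "g \<in> L2"
 shows "integrable halfline (\<lambda>x. f x * g x)"
proof -
 have [measurable]: "f \<in> borel_measurable halfline" "g \<in> borel_measurable halfline"
  using f g by (auto intro: L2_measurable)
 have i: "integrable halfline (\<lambda>x. (cmod (f x))\<^sup>2 + (cmod (g x))\<^sup>2)"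
  using f g by (intro Bochner_Integration.integrable_add L2_integrable)
 show ?thesis
 proof (rule Bochner_Integration.integrable_bound[OF i])
  have "norm (f x * g x) \<le> norm ((cmod (f x))\<^sup>2 + (cmod (g x))\<^sup>2)" for x
  proof -
   have "0 \<le> (cmod (f x) - cmod (g x))\<^sup>2 + (cmod (f x))\<^sup>2 + (cmod (g x))\<^sup>2" by (intro add_nonneg_nonneg) auto
   then have "cmod (f x) * cmod (g x) \<le> (cmod (f x))\<^sup>2 + (cmod (g x))\<^sup>2" unfolding power2_diff by simp
   then show ?thesis by (simp add: norm_mult)
  qed
  then show "AE x in halfline. norm (f x * g x) \<le> norm ((cmod (f x))\<^sup>2 + (cmod (g x))\<^sup>2)" by simp
 qed measurable
qed

lemma L2_cnj: "f \<in> L2 ==> (\<lambda>x. cnj (f x)) \<in> L2"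
proof -
 assume f: "f \<in> L2"
 have "cnj \<in> borel_fun"
  by (intro borel_measurable_continuous_onI continuous_intros)
 from measurable_compose[OF L2_measurable[OF f] this] show ?thesis
  using L2_integrable[OF f] by (simp add: L2_def)
qed

lemma L2_inner_integrable:
 "f \<in> L2 ==> g \<in> L2 ==> integrable halfline (\<lambda>x. f x * cnj (g x))"
 by (rule L2_prod_integrable) (simp_all add: L2_cnj)

lemma L2_add: assumes f: "f \<in> L2" and g: "g \<in> L2" shows "(\<lambda>x. f x + g x) \<in> L2"
proof (rule L2_I)
 show "(\<lambda>x. f x + g x) \<in> borel_measurable halfline"
  using f g by (intro borel_measurable_add L2_measurable)
 show "integrable halfline (\<lambda>x. 2 * (cmod (f x))\<^sup>2 + 2 * (cmod (g x))\<^sup>2)"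
  using f g by (intro Bochner_Integration.integrable_add integrable_mult_right L2_integrable)
 fix x
 have "(cmod (f x + g x))\<^sup>2 \<le> (cmod (f x) + cmod (g x))\<^sup>2" by (intro power_mono norm_triangle_ineq) simp
 also have "\<dots> \<le> 2 * (cmod (f x))\<^sup>2 + 2 * (cmod (g x))\<^sup>2"
  using sum_squares_bound[of "cmod (f x)" "cmod (g x)"] by (simp add: power2_sum)
 finally show "(cmod (f x + g x))\<^sup>2 \<le> 2 * (cmod (f x))\<^sup>2 + 2 * (cmod (g x))\<^sup>2" .
qed

lemma L2_mult_bounded:
 assumes v: "v \<in> borel_measurable halfline" and K: "\<And>x. x \<ge> 0 ==> cmod (v x) \<le> K" and f: "f \<in> L2"
 shows "(\<lambda>x. v x * f x) \<in> L2"
proof (rule L2_I)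
 show "(\<lambda>x. v x * f x) \<in> borel_measurable halfline"
  by (rule borel_measurable_times[OF v L2_measurable[OF f]])
 show "integrable halfline (\<lambda>x. K\<^sup>2 * (cmod (f x))\<^sup>2)" using f by (simp add: L2_integrable)
 fix x :: real assume "x \<ge> 0"
 then have "(cmod (v x))\<^sup>2 \<le> K\<^sup>2" using K by (intro power_mono) auto
 then show "(cmod (v x * f x))\<^sup>2 \<le> K\<^sup>2 * (cmod (f x))\<^sup>2"
  by (simp add: norm_mult power_mult_distrib mult_right_mono)
qed

lemma L2_scale: "f \<in> L2 ==> (\<lambda>x. c * f x) \<in> L2"
 by (rule L2_mult_bounded[of "\<lambda>_. c" "cmod c"]) auto

lemma L2_minus: "f \<in> L2 ==> (\<lambda>x. - f x) \<in> L2"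
 using L2_scale[of f "-1"] by simp

lemma L2_diff: "f \<in> L2 ==> g \<in> L2 ==> (\<lambda>x. f x - g x) \<in> L2"
 using L2_add[of f "\<lambda>x. - g x"] L2_minus[of g] by simp

lemma L2_0 [simp]: "(\<lambda>x. 0) \<in> L2" by (simp add: L2_def)

lemma L2_sum: "(\<And>i. i \<in> I ==> f i \<in> L2) ==> (\<lambda>x. \<Sum>i\<in>I. f i x) \<in> L2"
 by (induction I rule: infinite_finite_induct) (auto intro: L2_add)

lemma L2_cong_AE:
 assumes f: "f \<in> L2" and eq: "l2_eq f g" and g: "g \<in> borel_measurable halfline"
 shows "g \<in> L2"
proof -
 have AE: "AE x in halfline. (cmod (f x))\<^sup>2 = (cmod (g x))\<^sup>2"
  using eq unfolding l2_eq_def by eventually_elim simp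
 have "integrable halfline (\<lambda>x. (cmod (g x))\<^sup>2)"
  by (rule integrable_cong_AE_imp[OF L2_integrable[OF f] _ AE]) (use g in measurable)
 then show ?thesis using g by (simp add: L2_def)
qed

lemma l2_eq_refl [simp]: "l2_eq f f" by (simp add: l2_eq_def)
lemma l2_eq_sym: "l2_eq f g ==> l2_eq g f" by (simp add: l2_eq_def eq_commute)
lemma l2_eq_trans: "l2_eq f g ==> l2_eq g h ==> l2_eq f h"
 unfolding l2_eq_def by (erule eventually_elim2, assumption, simp)

\<comment> \<open>A partial quotient: functions outside \<open>L2\<close> belong to no class.
  Equality almost everywhere becomes equality of vectors, as the abstract spectral theory
  requires.\<close>
quotient_type hl2 = "real => complex" / partial: "\<lambda>f g. f \<in> L2 \<and> g \<in> L2 \<and> l2_eq f g"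
proof (rule part_equivpI)
 show "\<exists>f. f \<in> L2 \<and> f \<in> L2 \<and> l2_eq f f" by (rule exI[of _ "\<lambda>_. 0"]) simp
 show "symp (\<lambda>f g. f \<in> L2 \<and> g \<in> L2 \<and> l2_eq f g)" by (auto intro: sympI l2_eq_sym)
 show "transp (\<lambda>f g. f \<in> L2 \<and> g \<in> L2 \<and> l2_eq f g)" by (auto intro: transpI l2_eq_trans)
qed

definition cls where "cls = abs_hl2"
definition rep where "rep = rep_hl2"

lemma rep_L2 [simp]: "rep u \<in> L2"
 using Quotient3_rep_reflp[OF Quotient3_hl2, of u] by (simp add: rep_def)

lemma cls_rep [simp]: "cls (rep u) = u"
 using Quotient3_abs_rep[OF Quotient3_hl2] by (simp add: rep_def cls_def)

lemma cls_eq_iff: "f \<in> L2 ==> g \<in> L2 ==> cls f = cls g \<longleftrightarrow> l2_eq f g"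
 using Quotient3_rel[OF Quotient3_hl2, of f g] by (simp add: cls_def)

lemma rep_cls: "f \<in> L2 ==> l2_eq (rep (cls f)) f"
 using cls_eq_iff[of "rep (cls f)" f] by simp

lemma cls_eqI: "f \<in> L2 ==> g \<in> L2 ==> l2_eq f g ==> cls f = cls g"
 by (simp add: cls_eq_iff)

lemma l2_eq_add: "l2_eq f f' ==> l2_eq g g' ==> l2_eq (\<lambda>x. f x + g x) (\<lambda>x. f' x + g' x)"
 unfolding l2_eq_def by (erule eventually_elim2, assumption, simp)

lemma l2_eq_mult: "l2_eq f f' ==> l2_eq (\<lambda>x. v x * f x) (\<lambda>x. v x * f' x)"
 unfolding l2_eq_def by (erule eventually_mono) simp

lemma l2_inner_cong:
 assumes "f \<in> L2" "f' \<in> L2" "g \<in> L2" "g' \<in> L2" "l2_eq f f'" "l2_eq g g'"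
 shows "l2_inner f g = l2_inner f' g'"
 unfolding l2_inner_def
proof (rule integral_cong_AE)
 show "AE x in halfline. f x * cnj (g x) = f' x * cnj (g' x)"
  using assms(5,6) unfolding l2_eq_def by eventually_elim simp
qed (use assms in \<open>auto intro!: L2_measurable L2_inner_integrable borel_measurable_integrable\<close>)

definition cmul :: "complex => hl2 => hl2" where
 "cmul c u = cls (\<lambda>x. c * rep u x)"

lemma cmul_cls: "f \<in> L2 ==> cmul c (cls f) = cls (\<lambda>x. c * f x)"
 unfolding cmul_def by (intro cls_eqI L2_scale l2_eq_mult rep_cls) auto

text \<open>The inner product is the real part of \<open>l2_inner\<close>;
  \<open>l2_inner_cls\<close> recovers the imaginary part.\<close>

instantiation hl2 :: real_inner
begin

definition zero_hl2 :: hl2 where "zero_hl2 = cls (\<lambda>x. 0)"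
definition plus_hl2 :: "hl2 => hl2 => hl2" where "plus_hl2 u v = cls (\<lambda>x. rep u x + rep v x)"
definition uminus_hl2 :: "hl2 => hl2" where "uminus_hl2 u = cmul (-1) u"
definition minus_hl2 :: "hl2 => hl2 => hl2" where "minus_hl2 u v = u + (- v)"
definition scaleR_hl2 :: "real => hl2 => hl2" where "scaleR_hl2 c u = cmul (of_real c) u"
definition inner_hl2 :: "hl2 => hl2 => real" where "inner_hl2 u v = Re (l2_inner (rep u) (rep v))"
definition norm_hl2 :: "hl2 => real" where "norm_hl2 u = sqrt (inner u u)"
definition dist_hl2 :: "hl2 => hl2 => real" where "dist_hl2 u v = norm (u - v)"
definition sgn_hl2 :: "hl2 => hl2" where "sgn_hl2 u = scaleR (inverse (norm u)) u"
definition uniformity_hl2 :: "(hl2 \<times> hl2) filter" where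
 "uniformity_hl2 = (INF e\<in>{0 <..}. principal {(x, y). dist x y < e})"
definition open_hl2 :: "hl2 set => bool" where
 "open_hl2 U \<longleftrightarrow> (\<forall>x\<in>U. \<forall>\<^sub>F (x', y) in uniformity. x' = x --> y \<in> U)"

lemma plus_cls: "f \<in> L2 ==> g \<in> L2 ==> cls f + cls g = cls (\<lambda>x. f x + g x)"
 unfolding plus_hl2_def by (intro cls_eqI L2_add l2_eq_add rep_cls) auto

lemma inner_cls: "f \<in> L2 ==> g \<in> L2 ==> inner (cls f) (cls g) = Re (l2_inner f g)"
 unfolding inner_hl2_def by (subst l2_inner_cong[of _ f _ g]) (auto intro: rep_cls)

lemma ex_cls: "\<exists>f\<in>L2. u = cls f"
 by (rule bexI[of _ "rep u"]) auto

lemma inner_self_cls: "f \<in> L2 ==> inner (cls f) (cls f) = (LINT x|halfline. (cmod (f x))\<^sup>2)"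
proof -
 assume f: "f \<in> L2"
 have "l2_inner f f = (LINT x|halfline. complex_of_real ((cmod (f x))\<^sup>2))"
  unfolding l2_inner_def complex_norm_square ..
 then show ?thesis using f by (simp add: inner_cls del: of_real_power)
qed

instance
proof
 fix u v w :: hl2 and a b :: real
 obtain f g h where [simp]: "f \<in> L2" "g \<in> L2" "h \<in> L2" and uvw: "u = cls f" "v = cls g" "w = cls h"
  using ex_cls by metis
 note [simp] = plus_cls L2_add L2_scale cmul_cls inner_cls
 show "u + v + w = u + (v + w)" by (simp add: uvw add.assoc)
 show "u + v = v + u" by (simp add: uvw add.commute)
 show "0 + u = u" by (simp add: uvw zero_hl2_def)
 show "- u + u = 0" by (simp add: uvw zero_hl2_def uminus_hl2_def L2_minus)
 show "u - v = u + - v" by (simp add: minus_hl2_def)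
 show "a *\<^sub>R (u + v) = a *\<^sub>R u + a *\<^sub>R v" by (simp add: uvw scaleR_hl2_def distrib_left)
 show "(a + b) *\<^sub>R u = a *\<^sub>R u + b *\<^sub>R u" by (simp add: uvw scaleR_hl2_def distrib_right)
 show "a *\<^sub>R b *\<^sub>R u = (a * b) *\<^sub>R u" by (simp add: uvw scaleR_hl2_def mult.assoc)
 show "1 *\<^sub>R u = u" by (simp add: uvw scaleR_hl2_def)
 show "dist u v = norm (u - v)" by (rule dist_hl2_def)
 show "sgn u = inverse (norm u) *\<^sub>R u" by (rule sgn_hl2_def)
 show "uniformity = (INF e\<in>{0<..}. principal {(x, y :: hl2). dist x y < e})" by (rule uniformity_hl2_def)
 show "open U = (\<forall>x\<in>U. \<forall>\<^sub>F (x', y) in uniformity. x' = x --> y \<in> U)" for U :: "hl2 set"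
  by (rule open_hl2_def)
 have "l2_inner g f = cnj (l2_inner f g)"
  unfolding l2_inner_def by (subst Bochner_Integration.integral_cnj[symmetric]) (simp add: mult.commute)
 then show "inner u v = inner v u" by (simp add: uvw)
 show "inner (u + v) w = inner u w + inner v w"
  by (simp add: uvw l2_inner_def distrib_right L2_inner_integrable)
 show "inner (a *\<^sub>R u) v = a * inner u v"
  by (simp add: uvw scaleR_hl2_def l2_inner_def mult.assoc)
 show "0 \<le> inner u u" by (simp add: uvw inner_self_cls del: inner_cls)
 show "inner u u = 0 \<longleftrightarrow> u = 0"
 proof -
  have "inner u u = 0 \<longleftrightarrow> (AE x in halfline. (cmod (f x))\<^sup>2 = 0)"
   unfolding uvw inner_self_cls[OF \<open>f \<in> L2\<close>]
   by (rule integral_nonneg_eq_0_iff_AE) (simp_all add: L2_integrable)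
  also have "\<dots> \<longleftrightarrow> u = 0"
   by (simp add: uvw zero_hl2_def cls_eq_iff l2_eq_def)
  finally show ?thesis .
 qed
 show "norm u = sqrt (inner u u)" by (rule norm_hl2_def)
qed

end

lemma scaleR_cls: "f \<in> L2 ==> c *\<^sub>R cls f = cls (\<lambda>x. of_real c * f x)"
 by (simp add: scaleR_hl2_def cmul_cls)

lemma minus_cls: "f \<in> L2 ==> - cls f = cls (\<lambda>x. - f x)"
 by (simp add: uminus_hl2_def cmul_cls)

lemma diff_cls: "f \<in> L2 ==> g \<in> L2 ==> cls f - cls g = cls (\<lambda>x. f x - g x)"
 by (simp add: minus_hl2_def minus_cls plus_cls L2_minus)

lemma zero_cls: "cls (\<lambda>x. 0) = 0" by (simp add: zero_hl2_def)

lemma sum_cls: "(\<And>i. i \<in> I ==> f i \<in> L2) ==> (\<Sum>i\<in>I. cls (f i)) = cls (\<lambda>x. \<Sum>i\<in>I. f i x)"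
 by (induction I rule: infinite_finite_induct) (auto simp: zero_cls plus_cls L2_sum)

lemma norm_cls: "f \<in> L2 ==> norm (cls f) = l2_norm f"
 by (simp add: norm_hl2_def inner_self_cls l2_norm_def)

lemma norm_cls_sq: "f \<in> L2 ==> (norm (cls f))\<^sup>2 = (LINT x|halfline. (cmod (f x))\<^sup>2)"
 by (simp only: power2_norm_eq_inner[of "cls f"] inner_self_cls)

lemma l2_norm_cong: "f \<in> L2 ==> g \<in> L2 ==> l2_eq f g ==> l2_norm f = l2_norm g"
 using cls_eqI[of f g] norm_cls[of f] norm_cls[of g] by simp

text \<open>\<open>l2_inner\<close> is conjugate-linear in its second argument, so the real part of
  the pairing with \<open>\<i> g\<close> is the imaginary part of the pairing with
  \<open>g\<close>.\<close>

lemma l2_inner_cls: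
 assumes f: "f \<in> L2" and g: "g \<in> L2"
 shows "l2_inner f g = Complex (inner (cls f) (cls g)) (inner (cls f) (cmul \<i> (cls g)))"
proof -
 have "l2_inner f (\<lambda>x. \<i> * g x) = - \<i> * l2_inner f g"
  unfolding l2_inner_def by (subst integral_mult_right_zero[symmetric]) (simp add: mult_ac)
 then show ?thesis using f g
  by (simp add: cmul_cls inner_cls L2_scale complex_eq_iff)
qed

lemma cmul_cmul: "cmul a (cmul b u) = cmul (a * b) u"
 using ex_cls[of u] by (auto simp: cmul_cls L2_scale mult.assoc)

lemma cmul_add: "cmul a (u + v) = cmul a u + cmul a v"
 using ex_cls[of u] ex_cls[of v] by (auto simp: cmul_cls L2_scale plus_cls L2_add distrib_left)

lemma cmul_scaleR: "cmul a (c *\<^sub>R u) = c *\<^sub>R cmul a u"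
 using ex_cls[of u] by (auto simp: cmul_cls L2_scale scaleR_cls mult.left_commute)

lemma linear_cmul: "linear (cmul a)"
 by (rule linearI) (simp_all add: cmul_add cmul_scaleR)

lemma cmul_ii: "cmul \<i> (cmul \<i> u) = - u"
 by (simp add: cmul_cmul uminus_hl2_def)

lemma inner_cmul_ii: "inner (cmul \<i> u) (cmul \<i> v) = inner u v"
proof -
 obtain f g where f: "f \<in> L2" and g: "g \<in> L2" and uv: "u = cls f" "v = cls g" using ex_cls by metis
 have "l2_inner (\<lambda>x. \<i> * f x) (\<lambda>x. \<i> * g x) = l2_inner f g"
  by (simp add: l2_inner_def mult.assoc[symmetric]) (simp add: mult.commute mult.left_commute)
 then show ?thesis using f g by (simp add: uv cmul_cls inner_cls L2_scale)
qed

lemma cmul_Complex: "cmul c u = Re c *\<^sub>R u + Im c *\<^sub>R cmul \<i> u"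
proof -
 obtain f where f: "f \<in> L2" "u = cls f" using ex_cls by metis
 have "c * f x = of_real (Re c) * f x + of_real (Im c) * (\<i> * f x)" for x
  by (subst complex_eq[of c]) (simp add: algebra_simps)
 then show ?thesis using f by (simp add: cmul_cls scaleR_cls plus_cls L2_scale)
qed

section \<open>Completeness (Riesz-Fischer)\<close>

lemma Cauchy_fast_subseq:
 fixes X :: "nat => 'a::metric_space"
 assumes "Cauchy X"
 shows "\<exists>r :: nat => nat. (\<forall>k. k \<le> r k) \<and> (\<forall>k. dist (X (r (Suc k))) (X (r k)) < (1/4) ^ k)"
proof -
 have "\<forall>k. \<exists>N. \<forall>m\<ge>N. \<forall>n\<ge>N. dist (X m) (X n) < (1/4) ^ k"
  using assms by (auto simp: Cauchy_def)
 then obtain N where N: "\<And>k m n. m \<ge> N k ==> n \<ge> N k ==> dist (X m) (X n) < (1/4) ^ k" by metis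
 define r where "r k = k + (\<Sum>i\<le>k. N i)" for k
 have "N k \<le> (\<Sum>i\<le>k. N i)" for k by (rule member_le_sum) auto
 then have "N k \<le> r k" for k by (simp add: r_def trans_le_add2)
 moreover have "r k \<le> r (Suc k)" for k by (simp add: r_def)
 ultimately have "dist (X (r (Suc k))) (X (r k)) < (1/4) ^ k" for k
  using N[of k "r (Suc k)" "r k"] le_trans by blast
 then show ?thesis by (intro exI[of _ r]) (simp add: r_def)
qed

lemma nn_integral_norm_sq: "f \<in> L2 ==> (\<integral>\<^sup>+x. ennreal ((cmod (f x))\<^sup>2) \<partial>halfline) = ennreal ((norm (cls f))\<^sup>2)"
 by (simp add: norm_cls_sq nn_integral_eq_integral L2_integrable)

lemma L2_nn_I:
 assumes [measurable]: "f \<in> borel_measurable halfline"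
  and le: "(\<integral>\<^sup>+x. ennreal ((cmod (f x))\<^sup>2) \<partial>halfline) \<le> ennreal (C\<^sup>2)" and C: "0 \<le> C"
 shows "f \<in> L2" "norm (cls f) \<le> C"
proof -
 have "integrable halfline (\<lambda>x. (cmod (f x))\<^sup>2)"
  by (rule integrableI_bounded) (use le in \<open>auto intro: le_less_trans\<close>)
 then show f: "f \<in> L2" by (simp add: L2_def)
 have "ennreal ((norm (cls f))\<^sup>2) \<le> ennreal (C\<^sup>2)" using le nn_integral_norm_sq[OF f] by simp
 then have "(norm (cls f))\<^sup>2 \<le> C\<^sup>2" by (simp add: ennreal_le_iff)
 then show "norm (cls f) \<le> C" using C by (rule power2_le_imp_le)
qed

instance hl2 :: complete_space
proof
 fix X :: "nat => hl2" assume X: "Cauchy X"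
 obtain r :: "nat => nat" where r: "\<And>k. k \<le> r k" and d: "\<And>k. dist (X (r (Suc k))) (X (r k)) < (1/4) ^ k"
  using Cauchy_fast_subseq[OF X] by blast
 define f where "f k = rep (X (r k))" for k
 define e where "e k x = f (Suc k) x - f k x" for k x
 have [measurable]: "f k \<in> borel_measurable halfline" for k unfolding f_def by (intro L2_measurable rep_L2)
 have [measurable]: "e k \<in> borel_measurable halfline" for k unfolding e_def by measurable
 have eL2: "e k \<in> L2" for k unfolding e_def f_def by (intro L2_diff rep_L2)
 have cls_e: "cls (e k) = X (r (Suc k)) - X (r k)" for k
  unfolding e_def f_def by (subst diff_cls[symmetric]) simp_all
 \<comment> \<open>The rate \<open>(1/4) ^ k\<close> of the subsequence leaves room for the weight
   \<open>4 ^ k\<close>: the weighted squares still have summable integrals, so almost everywhere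
   \<open>e k x\<close> decays like \<open>(1/2) ^ k\<close>.\<close>
 have le: "(\<integral>\<^sup>+x. ennreal (4 ^ k * (cmod (e k x))\<^sup>2) \<partial>halfline) \<le> ennreal ((1/4) ^ k)" for k
 proof -
  have "(norm (cls (e k)))\<^sup>2 \<le> ((1/4) ^ k)\<^sup>2"
   using d[of k] by (intro power_mono) (auto simp: cls_e dist_norm)
  then have "4 ^ k * (norm (cls (e k)))\<^sup>2 \<le> 4 ^ k * ((1/4) ^ k)\<^sup>2" by (intro mult_left_mono) auto
  also have "\<dots> = (1/4) ^ k" by (simp add: power2_eq_square power_mult_distrib[symmetric] mult.assoc[symmetric])
  finally have b: "4 ^ k * (norm (cls (e k)))\<^sup>2 \<le> (1/4) ^ k" .
  have "(\<integral>\<^sup>+x. ennreal (4 ^ k * (cmod (e k x))\<^sup>2) \<partial>halfline) = ennreal (4 ^ k) * (\<integral>\<^sup>+x. ennreal ((cmod (e k x))\<^sup>2) \<partial>halfline)"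
   by (subst nn_integral_cmult[symmetric]) (simp_all add: ennreal_mult)
  also have "\<dots> = ennreal (4 ^ k * (norm (cls (e k)))\<^sup>2)"
   unfolding nn_integral_norm_sq[OF eL2] by (rule ennreal_mult[symmetric]) simp_all
  also have "\<dots> \<le> ennreal ((1/4) ^ k)" using b by (rule ennreal_leI)
  finally show ?thesis .
 qed
 have "(\<integral>\<^sup>+x. (\<Sum>k. ennreal (4 ^ k * (cmod (e k x))\<^sup>2)) \<partial>halfline) = (\<Sum>k. \<integral>\<^sup>+x. ennreal (4 ^ k * (cmod (e k x))\<^sup>2) \<partial>halfline)"
  by (rule nn_integral_suminf) measurable
 also have "\<dots> \<le> (\<Sum>k. ennreal ((1/4) ^ k))" by (intro suminf_le le) auto
 also have "\<dots> = ennreal (\<Sum>k. (1/4) ^ k)" by (rule suminf_ennreal2) (auto intro: summable_geometric)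
 finally have "(\<integral>\<^sup>+x. (\<Sum>k. ennreal (4 ^ k * (cmod (e k x))\<^sup>2)) \<partial>halfline) \<noteq> \<infinity>"
  by (auto simp: top_unique)
 then have AE: "AE x in halfline. (\<Sum>k. ennreal (4 ^ k * (cmod (e k x))\<^sup>2)) \<noteq> \<infinity>"
  by (intro nn_integral_PInf_AE) measurable
 define F where "F x = lim (\<lambda>k. f k x)" for x
 have F [measurable]: "F \<in> borel_measurable halfline" unfolding F_def by measurable
 have AEF: "AE x in halfline. (\<lambda>k. f k x) \<longlonglongrightarrow> F x"
  using AE
 proof eventually_elim
  case (elim x)
  define a where "a k = ennreal (4 ^ k * (cmod (e k x))\<^sup>2)" for k
  define T where "T = suminf a"
  have "T \<noteq> top" using elim unfolding T_def a_def infinity_ennreal_def .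
  then obtain C where C: "T = ennreal C" and C0: "C \<ge> 0"
   by (cases T rule: ennreal_cases) blast+
  have "cmod (e k x) \<le> sqrt C * (1/2) ^ k" for k
  proof -
   have "sum a {k} \<le> T" unfolding T_def by (rule sum_le_suminf) simp_all
   then have "ennreal (4 ^ k * (cmod (e k x))\<^sup>2) \<le> ennreal C" by (simp only: C a_def sum.insert sum.empty finite.emptyI empty_iff not_False_eq_True add_0_right)
   then have "4 ^ k * (cmod (e k x))\<^sup>2 \<le> C" using C0 by (simp only: ennreal_le_iff)
   moreover have "(4::real) ^ k = (2 ^ k)\<^sup>2" by (simp add: power_mult_distrib[symmetric] power2_eq_square)
   ultimately have "(2 ^ k * cmod (e k x))\<^sup>2 \<le> C" by (simp add: power_mult_distrib)
   then have "2 ^ k * cmod (e k x) \<le> sqrt C" by (rule real_le_rsqrt)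
   then show ?thesis by (simp add: field_simps power_divide)
  qed
  then have "summable (\<lambda>k. e k x)"
  proof (intro summable_comparison_test[OF exI[of _ 0] summable_mult[OF summable_geometric[of "1/2"], of "sqrt C"]] allI impI)
   show "norm (1 / 2 :: real) < 1" by simp
  qed
  then have "convergent (\<lambda>n. \<Sum>k<n. e k x)" by (simp add: summable_iff_convergent)
  moreover have "(\<Sum>k<n. e k x) = f n x - f 0 x" for n
   unfolding e_def by (rule sum_lessThan_telescope)
  ultimately have "convergent (\<lambda>n. f n x - f 0 x)" by simp
  then have "convergent (\<lambda>n. (f n x - f 0 x) + f 0 x)" by (intro convergent_add convergent_const)
  then show ?case unfolding F_def by (simp add: convergent_LIMSEQ_iff)
 qed
 \<comment> \<open>Fatou along the subsequence turns the Cauchy bound for the classes into a bound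
   for the pointwise limit \<open>F\<close>.\<close>
 have key: "(\<lambda>x. F x - rep (X n) x) \<in> L2 \<and> norm (cls (\<lambda>x. F x - rep (X n) x)) \<le> p"
  if N: "\<And>m n. m \<ge> N ==> n \<ge> N ==> dist (X m) (X n) < p" and n: "n \<ge> N" and e: "p > 0" for N n p
 proof -
  have [measurable]: "rep (X n) \<in> borel_measurable halfline" by (intro L2_measurable rep_L2)
  have "(\<integral>\<^sup>+x. ennreal ((cmod (F x - rep (X n) x))\<^sup>2) \<partial>halfline)
   = (\<integral>\<^sup>+x. liminf (\<lambda>j. ennreal ((cmod (f j x - rep (X n) x))\<^sup>2)) \<partial>halfline)"
  proof (rule nn_integral_cong_AE)
   show "AE x in halfline. ennreal ((cmod (F x - rep (X n) x))\<^sup>2) = liminf (\<lambda>j. ennreal ((cmod (f j x - rep (X n) x))\<^sup>2))"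
    using AEF
   proof eventually_elim
    case (elim x)
    have "(\<lambda>j. ennreal ((cmod (f j x - rep (X n) x))\<^sup>2)) \<longlonglongrightarrow> ennreal ((cmod (F x - rep (X n) x))\<^sup>2)"
     by (intro tendsto_ennrealI tendsto_intros elim)
    from lim_imp_Liminf[OF trivial_limit_sequentially this] show ?case by (rule sym)
   qed
  qed
  also have "\<dots> \<le> liminf (\<lambda>j. \<integral>\<^sup>+x. ennreal ((cmod (f j x - rep (X n) x))\<^sup>2) \<partial>halfline)"
   by (rule nn_integral_liminf) measurable
  also have "\<dots> \<le> liminf (\<lambda>j::nat. ennreal (p\<^sup>2))"
  proof (rule Liminf_mono)
   show "\<forall>\<^sub>F j in sequentially. (\<integral>\<^sup>+x. ennreal ((cmod (f j x - rep (X n) x))\<^sup>2) \<partial>halfline) \<le> ennreal (p\<^sup>2)"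
    unfolding eventually_sequentially
   proof (intro exI[of _ N] allI impI)
    fix j assume "N \<le> j"
    then have "dist (X (r j)) (X n) < p" using r[of j] n by (intro N) auto
    moreover have "cls (\<lambda>x. f j x - rep (X n) x) = X (r j) - X n"
     unfolding f_def by (subst diff_cls[symmetric]) simp_all
    moreover have "(\<lambda>x. f j x - rep (X n) x) \<in> L2" unfolding f_def by (intro L2_diff rep_L2)
    ultimately show "(\<integral>\<^sup>+x. ennreal ((cmod (f j x - rep (X n) x))\<^sup>2) \<partial>halfline) \<le> ennreal (p\<^sup>2)"
     using e by (subst nn_integral_norm_sq) (auto simp: dist_norm intro!: ennreal_leI power_mono)
   qed
  qed
  also have "\<dots> = ennreal (p\<^sup>2)" by (rule Liminf_const) simp
  finally show ?thesis using e by (intro conjI L2_nn_I[of _ p]) auto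
 qed
 obtain N0 where "\<forall>m\<ge>N0. \<forall>n\<ge>N0. dist (X m) (X n) < 1"
  using X zero_less_one unfolding Cauchy_def by blast
 then have N0: "\<And>m n. m \<ge> N0 ==> n \<ge> N0 ==> dist (X m) (X n) < 1" by blast
 have FL2: "F \<in> L2"
 proof -
  have "(\<lambda>x. F x - rep (X N0) x) \<in> L2"
   by (rule conjunct1[OF key[where N=N0 and p=1, OF N0]]) simp_all
  from L2_add[OF this rep_L2[of "X N0"]] show ?thesis by simp
 qed
 have "X \<longlonglongrightarrow> cls F"
 proof (rule metric_LIMSEQ_I)
  fix p :: real assume e: "p > 0"
  then have "p / 2 > 0" by simp
  then obtain N where "\<forall>m\<ge>N. \<forall>n\<ge>N. dist (X m) (X n) < p / 2"
   using X unfolding Cauchy_def by blast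
  then have N: "\<And>m n. m \<ge> N ==> n \<ge> N ==> dist (X m) (X n) < p / 2" by blast
  have "dist (X n) (cls F) < p" if "n \<ge> N" for n
  proof -
   have "norm (cls (\<lambda>x. F x - rep (X n) x)) \<le> p / 2"
    by (rule conjunct2[OF key[where N=N and p="p / 2", OF N that]]) (simp_all add: e)
   moreover have "cls (\<lambda>x. F x - rep (X n) x) = cls F - X n"
    by (subst diff_cls[symmetric]) (simp_all add: FL2)
   ultimately show ?thesis using e by (simp add: dist_norm norm_minus_commute)
  qed
  then show "\<exists>N. \<forall>n\<ge>N. dist (X n) (cls F) < p" by blast
 qed
 then show "convergent X" by (rule convergentI)
qed

section \<open>Iterated derivatives\<close>

lemma nth_deriv_0 [simp]: "nth_deriv S 0 f = f"
 by (simp add: nth_deriv_def)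

lemma nth_deriv_Suc: "nth_deriv S (Suc n) f = (\<lambda>x. vector_derivative (nth_deriv S n f) (at x within S))"
 by (simp add: nth_deriv_def)

lemma smooth_has_deriv:
 "smooth_fun_on S f ==> x \<in> S ==> (nth_deriv S n f has_vector_derivative nth_deriv S (Suc n) f x) (at x within S)"
 unfolding smooth_fun_on_def nth_deriv_Suc vector_derivative_works by blast

lemma smooth_continuous: "smooth_fun_on S f ==> continuous_on S (nth_deriv S n f)"
 unfolding continuous_on_eq_continuous_within
 using smooth_has_deriv has_vector_derivative_continuous by blast

text \<open>No point of \<open>S\<close> is isolated in \<open>S\<close>; so derivatives within
  \<open>S\<close> are unique, and \<open>vector_derivative\<close> computes them.\<close>

definition nontriv :: "real set => bool" where
 "nontriv S \<longleftrightarrow> (\<forall>x\<in>S. at x within S \<noteq> bot)"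

lemma nontriv_UNIV [simp]: "nontriv UNIV" by (simp add: nontriv_def)

lemma nontriv_atLeast [simp]: "nontriv {a..}"
 unfolding nontriv_def
proof
 fix x assume "x \<in> {a..}"
 then have "at_right x \<le> at x within {a..}" by (intro at_le) auto
 then show "at x within {a..} \<noteq> bot" using trivial_limit_at_right_real[of x] bot_unique by metis
qed

text \<open>A candidate sequence in which each member is the derivative of the preceding one settles
  smoothness and the values of all iterated derivatives at once; the calculus rules below are
  instances.\<close>

lemma nth_deriv_chain:
 assumes S: "nontriv S" and d: "\<And>n x. x \<in> S ==> (d n has_vector_derivative d (Suc n) x) (at x within S)"
 shows "x \<in> S ==> nth_deriv S n (d 0) x = d n x" "smooth_fun_on S (d 0)"
proof -
 have eq: "\<forall>x\<in>S. nth_deriv S n (d 0) x = d n x" for n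
 proof (induction n)
  case (Suc n)
  show ?case
  proof
   fix x assume x: "x \<in> S"
   have "(nth_deriv S n (d 0) has_vector_derivative d (Suc n) x) (at x within S)"
    by (rule has_vector_derivative_transform[OF x _ d[OF x]]) (use Suc in simp)
   then show "nth_deriv S (Suc n) (d 0) x = d (Suc n) x"
    unfolding nth_deriv_Suc using S x by (intro vector_derivative_within) (auto simp: nontriv_def)
  qed
 qed simp
 then show "x \<in> S ==> nth_deriv S n (d 0) x = d n x" by simp
 show "smooth_fun_on S (d 0)"
  unfolding smooth_fun_on_def
 proof (intro allI ballI)
  fix n x assume x: "x \<in> S"
  have "(nth_deriv S n (d 0) has_vector_derivative d (Suc n) x) (at x within S)"
   by (rule has_vector_derivative_transform[OF x _ d[OF x]]) (use eq in simp)
  then show "nth_deriv S n (d 0) differentiable at x within S" by (rule differentiableI_vector)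
 qed
qed

text \<open>Iterating a choice of derivative inside \<open>K\<close> yields the sequence for
  \<open>nth_deriv_chain\<close>. Smoothness thus follows from closure under one
  differentiation.\<close>

lemma smooth_coind:
 assumes S: "nontriv S" and K: "\<And>f. f \<in> K ==> \<exists>f'\<in>K. \<forall>x\<in>S. (f has_vector_derivative f' x) (at x within S)"
  and f: "f \<in> K"
 shows "smooth_fun_on S f \<and> (\<forall>n. \<exists>g\<in>K. \<forall>x\<in>S. nth_deriv S n f x = g x)"
proof -
 obtain D where D: "\<And>f. f \<in> K ==> D f \<in> K" "\<And>f x. f \<in> K ==> x \<in> S ==> (f has_vector_derivative D f x) (at x within S)"
  using K by metis
 define d where "d n = (D ^^ n) f" for n
 have dK: "d n \<in> K" for n unfolding d_def using f D(1) by (induction n) auto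
 have "(d n has_vector_derivative d (Suc n) x) (at x within S)" if "x \<in> S" for n x
  using D(2)[OF dK that, of n] by (simp add: d_def)
 note c = nth_deriv_chain[OF S, where d=d, OF this]
 have d0: "d 0 = f" by (simp add: d_def)
 show ?thesis using c dK unfolding d0 by blast
qed

lemma nth_deriv_cong_smooth:
 assumes S: "nontriv S" and f: "smooth_fun_on S f" and eq: "\<And>x. x \<in> S ==> g x = f x"
 shows "smooth_fun_on S g" "x \<in> S ==> nth_deriv S n g x = nth_deriv S n f x"
proof -
 define d where "d n = (case n of 0 => g | Suc m => nth_deriv S (Suc m) f)" for n
 have eq': "x \<in> S ==> d n x = nth_deriv S n f x" for n x by (cases n) (simp_all add: d_def eq)
 have "(d n has_vector_derivative d (Suc n) x) (at x within S)" if x: "x \<in> S" for n x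
  unfolding eq'[OF x] by (rule has_vector_derivative_transform[OF x _ smooth_has_deriv[OF f x]]) (rule eq')
 note c = nth_deriv_chain[OF S, where d=d, OF this]
 have d0: "d 0 = g" by (simp add: d_def)
 show "smooth_fun_on S g" using c(2) unfolding d0 .
 show "x \<in> S ==> nth_deriv S n g x = nth_deriv S n f x" using c(1)[of x n] eq' unfolding d0 by simp
qed

lemma nth_deriv_subset:
 assumes S: "nontriv S" "S \<subseteq> T" and f: "smooth_fun_on T f"
 shows "smooth_fun_on S f" "x \<in> S ==> nth_deriv S n f x = nth_deriv T n f x"
proof -
 have "(nth_deriv T n f has_vector_derivative nth_deriv T (Suc n) f x) (at x within S)" if x: "x \<in> S" for n x
  by (rule has_vector_derivative_within_subset[OF smooth_has_deriv[OF f]]) (use x S in auto)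
 note c = nth_deriv_chain[OF S(1), where d="\<lambda>n. nth_deriv T n f", OF this]
 show "smooth_fun_on S f" using c(2) by simp
 show "x \<in> S ==> nth_deriv S n f x = nth_deriv T n f x" using c(1)[of x n] by simp
qed

lemma nth_deriv_add:
 assumes S: "nontriv S" and f: "smooth_fun_on S f" and g: "smooth_fun_on S g"
 shows "smooth_fun_on S (\<lambda>x. f x + g x)"
  "x \<in> S ==> nth_deriv S n (\<lambda>x. f x + g x) x = nth_deriv S n f x + nth_deriv S n g x"
proof -
 have "((\<lambda>x. nth_deriv S n f x + nth_deriv S n g x) has_vector_derivative (nth_deriv S (Suc n) f x + nth_deriv S (Suc n) g x)) (at x within S)" if x: "x \<in> S" for n x
  by (intro has_vector_derivative_add smooth_has_deriv f g x)
 note c = nth_deriv_chain[OF S, where d="\<lambda>n x. nth_deriv S n f x + nth_deriv S n g x", OF this]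
 show "smooth_fun_on S (\<lambda>x. f x + g x)" using c(2) by simp
 show "x \<in> S ==> nth_deriv S n (\<lambda>x. f x + g x) x = nth_deriv S n f x + nth_deriv S n g x" using c(1)[of x n] by simp
qed

lemma nth_deriv_linear:
 assumes S: "nontriv S" and f: "smooth_fun_on S f" and T: "bounded_linear T"
 shows "smooth_fun_on S (\<lambda>x. T (f x))"
  "x \<in> S ==> nth_deriv S n (\<lambda>x. T (f x)) x = T (nth_deriv S n f x)"
proof -
 have "((\<lambda>x. T (nth_deriv S n f x)) has_vector_derivative T (nth_deriv S (Suc n) f x)) (at x within S)" if x: "x \<in> S" for n x
  by (rule bounded_linear.has_vector_derivative[OF T smooth_has_deriv[OF f x]])
 note c = nth_deriv_chain[OF S, where d="\<lambda>n x. T (nth_deriv S n f x)", OF this]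
 show "smooth_fun_on S (\<lambda>x. T (f x))" using c(2) by simp
 show "x \<in> S ==> nth_deriv S n (\<lambda>x. T (f x)) x = T (nth_deriv S n f x)" using c(1)[of x n] by simp
qed

lemma nth_deriv_affine:
 assumes f: "smooth_fun_on UNIV f"
 shows "smooth_fun_on UNIV (\<lambda>x. f (c * x + b))"
  "nth_deriv UNIV n (\<lambda>x. f (c * x + b)) x = c ^ n *\<^sub>R nth_deriv UNIV n f (c * x + b)"
proof -
 have "((\<lambda>x. c ^ n *\<^sub>R nth_deriv UNIV n f (c * x + b)) has_vector_derivative (c ^ Suc n *\<^sub>R nth_deriv UNIV (Suc n) f (c * x + b))) (at x within UNIV)" for n x
 proof -
  have 1: "((\<lambda>x. c * x + b) has_vector_derivative c) (at x)" by (auto intro!: derivative_eq_intros)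
  have "((nth_deriv UNIV n f \<circ> (\<lambda>x. c * x + b)) has_vector_derivative c *\<^sub>R nth_deriv UNIV (Suc n) f (c * x + b)) (at x)"
   by (rule vector_diff_chain_at[OF 1]) (use smooth_has_deriv[OF f, of _ n] in simp)
  from bounded_linear.has_vector_derivative[OF bounded_linear_scaleR_right[of "c ^ n"] this]
  show ?thesis by (simp add: o_def mult.commute)
 qed
 note c = nth_deriv_chain[OF nontriv_UNIV, where d="\<lambda>n x. c ^ n *\<^sub>R nth_deriv UNIV n f (c * x + b)", OF this]
 show "smooth_fun_on UNIV (\<lambda>x. f (c * x + b))" using c(2) by simp
 show "nth_deriv UNIV n (\<lambda>x. f (c * x + b)) x = c ^ n *\<^sub>R nth_deriv UNIV n f (c * x + b)" using c(1)[of x n] by simp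
qed

text \<open>Pascal's rule, in the form that the induction step of Leibniz's formula
  produces.\<close>

lemma binomial_split:
 fixes a :: "nat => nat => 'a::real_vector"
 shows "(\<Sum>k\<le>n. real (n choose k) *\<^sub>R (a k (Suc (n - k)) + a (Suc k) (n - k)))
  = (\<Sum>k\<le>Suc n. real (Suc n choose k) *\<^sub>R a k (Suc n - k))"
proof -
 define g where "g k = a k (Suc n - k)" for k
 have "(\<Sum>k\<le>Suc n. real (Suc n choose k) *\<^sub>R g k) = g 0 + (\<Sum>k\<le>n. real (Suc n choose Suc k) *\<^sub>R g (Suc k))"
  by (simp add: sum.atMost_Suc_shift del: sum.atMost_Suc binomial_Suc_Suc)
 also have "(\<Sum>k\<le>n. real (Suc n choose Suc k) *\<^sub>R g (Suc k))
   = (\<Sum>k\<le>n. real (n choose k) *\<^sub>R g (Suc k)) + (\<Sum>k\<le>n. real (n choose Suc k) *\<^sub>R g (Suc k))"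
  by (simp add: scaleR_add_left sum.distrib)
 also have "g 0 + (\<dots>) = (\<Sum>k\<le>n. real (n choose k) *\<^sub>R g (Suc k)) + (\<Sum>k\<le>Suc n. real (n choose k) *\<^sub>R g k)"
  by (simp add: sum.atMost_Suc_shift del: sum.atMost_Suc)
 also have "(\<Sum>k\<le>Suc n. real (n choose k) *\<^sub>R g k) = (\<Sum>k\<le>n. real (n choose k) *\<^sub>R a k (Suc (n - k)))"
  by (simp add: binomial_eq_0 g_def Suc_diff_le)
 finally show ?thesis by (simp add: g_def scaleR_add_right sum.distrib add.commute del: sum.atMost_Suc binomial_Suc_Suc)
qed

lemma nth_deriv_scaleR:
 fixes f :: "real => real" and g :: "real => 'a::real_normed_vector"
 assumes S: "nontriv S" and f: "smooth_fun_on S f" and g: "smooth_fun_on S g"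
 shows "smooth_fun_on S (\<lambda>x. f x *\<^sub>R g x)"
  "x \<in> S ==> nth_deriv S n (\<lambda>x. f x *\<^sub>R g x) x = (\<Sum>k\<le>n. real (n choose k) *\<^sub>R (nth_deriv S k f x *\<^sub>R nth_deriv S (n - k) g x))"
proof -
 define d where "d n x = (\<Sum>k\<le>n. real (n choose k) *\<^sub>R (nth_deriv S k f x *\<^sub>R nth_deriv S (n - k) g x))" for n x
 have "(d n has_vector_derivative d (Suc n) x) (at x within S)" if x: "x \<in> S" for n x
 proof -
  have ff: "(nth_deriv S k f has_field_derivative nth_deriv S (Suc k) f x) (at x within S)" for k
   using smooth_has_deriv[OF f x, of k] by (simp add: has_real_derivative_iff_has_vector_derivative)
  have t: "((\<lambda>x. real (n choose k) *\<^sub>R (nth_deriv S k f x *\<^sub>R nth_deriv S (n - k) g x)) has_vector_derivative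
    real (n choose k) *\<^sub>R (nth_deriv S k f x *\<^sub>R nth_deriv S (Suc (n - k)) g x + nth_deriv S (Suc k) f x *\<^sub>R nth_deriv S (n - k) g x)) (at x within S)" for k
   by (rule bounded_linear.has_vector_derivative[OF bounded_linear_scaleR_right])
    (rule has_vector_derivative_scaleR[OF ff smooth_has_deriv[OF g x]])
  have "(d n has_vector_derivative (\<Sum>k\<le>n. real (n choose k) *\<^sub>R (nth_deriv S k f x *\<^sub>R nth_deriv S (Suc (n - k)) g x + nth_deriv S (Suc k) f x *\<^sub>R nth_deriv S (n - k) g x))) (at x within S)"
   unfolding d_def by (intro has_vector_derivative_sum t)
  then show ?thesis
   unfolding d_def binomial_split[of n "\<lambda>i j. nth_deriv S i f x *\<^sub>R nth_deriv S j g x"] .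
 qed
 note c = nth_deriv_chain[OF S, where d=d, OF this]
 have d0: "d 0 = (\<lambda>x. f x *\<^sub>R g x)" by (rule ext) (simp add: d_def)
 show "smooth_fun_on S (\<lambda>x. f x *\<^sub>R g x)" using c(2) unfolding d0 .
 show "x \<in> S ==> nth_deriv S n (\<lambda>x. f x *\<^sub>R g x) x = (\<Sum>k\<le>n. real (n choose k) *\<^sub>R (nth_deriv S k f x *\<^sub>R nth_deriv S (n - k) g x))"
  using c(1)[of x n] unfolding d0 by (simp add: d_def)
qed

text \<open>Reflection at 0 changes the sign of a derivative of odd order there, but leaves
  \<open>f\<close> fixed.\<close>

lemma nth_deriv_odd_zero:
 fixes f :: "real => complex"
 assumes f: "smooth_fun_on UNIV f" and ev: "even_fun f"
 shows "nth_deriv UNIV (2 * j + 1) f 0 = 0"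
proof -
 have "(\<lambda>x. f ((-1) * x + 0)) = f" using ev by (simp add: even_fun_def)
 then have "nth_deriv UNIV (2 * j + 1) f 0 = (-1) ^ (2 * j + 1) *\<^sub>R nth_deriv UNIV (2 * j + 1) f ((-1) * 0 + 0)"
  using nth_deriv_affine(2)[OF f, of "2 * j + 1" "-1" 0 0] by simp
 then have "nth_deriv UNIV (2 * j + 1) f 0 = - nth_deriv UNIV (2 * j + 1) f 0" by simp
 then show ?thesis by (simp add: eq_neg_iff_add_eq_0 mult_2[symmetric])
qed

section \<open>A smooth bump function\<close>

definition bump :: "real => real" where
 "bump x = (if x > 0 then exp (- (1 / x)) else 0)"

lemma bump_nonneg: "0 \<le> bump x" and bump_le_1: "bump x \<le> 1"
 by (auto simp: bump_def)

lemma poly_exp_tendsto_0: "((\<lambda>x. poly p x * exp (- x)) \<longlongrightarrow> (0::real)) at_top"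
proof -
 have "((\<lambda>x. (\<Sum>i\<le>degree p. coeff p i * (x ^ i / exp x))) \<longlongrightarrow> (\<Sum>i\<le>degree p. coeff p i * 0)) at_top"
  by (intro tendsto_intros tendsto_power_div_exp_0)
 moreover have "(\<Sum>i\<le>degree p. coeff p i * (x ^ i / exp x)) = poly p x * exp (- x)" for x
  by (simp add: poly_altdef exp_minus sum_distrib_right divide_inverse mult.assoc)
 ultimately show ?thesis by simp
qed

text \<open>With \<open>y = 1 / x\<close>, differentiation in \<open>x\<close> sends
  \<open>p(y) exp (- y)\<close> to \<open>y^2 (p - p')(y) exp (- y)\<close>, hence the factor
  \<open>[:0, 0, 1:]\<close>. At 0 the difference quotient is \<open>y p(y) exp (- y)\<close>, which
  tends to 0 as \<open>y\<close> tends to infinity.\<close>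

lemma bump_family_deriv:
 defines "B \<equiv> \<lambda>p x. if x > 0 then poly p (1 / x) * exp (- (1 / x)) else (0::real)"
 shows "(B p has_real_derivative B ([:0, 0, 1:] * (p - pderiv p)) x) (at x)"
proof (cases "x = 0")
 case False
 then consider "x > 0" | "x < 0" by linarith
 then show ?thesis
 proof cases
  case 1
  have "((\<lambda>x. poly p (1 / x) * exp (- (1 / x))) has_real_derivative
    (poly (pderiv p) (1 / x) * (- 1 / x\<^sup>2)) * exp (- (1 / x)) + (exp (- (1 / x)) * (1 / x\<^sup>2)) * poly p (1 / x)) (at x)"
  proof (rule DERIV_mult)
   have inv: "((\<lambda>x. 1 / x) has_real_derivative (- 1 / x\<^sup>2)) (at x)"
    using 1 by (auto intro!: derivative_eq_intros simp: power2_eq_square)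
   show "((\<lambda>x. poly p (1 / x)) has_real_derivative (poly (pderiv p) (1 / x) * (- 1 / x\<^sup>2))) (at x)"
    using DERIV_chain2[OF poly_DERIV inv] .
   show "((\<lambda>x. exp (- (1 / x))) has_real_derivative (exp (- (1 / x)) * (1 / x\<^sup>2))) (at x)"
    using 1 by (auto intro!: derivative_eq_intros simp: power2_eq_square)
  qed
  moreover have "\<forall>\<^sub>F y in nhds x. y > 0" using 1 by (intro eventually_nhds_in_open[of "{0<..}", simplified]) auto
  then have "\<forall>\<^sub>F y in nhds x. B p y = poly p (1 / y) * exp (- (1 / y))"
   by eventually_elim (simp add: B_def)
  ultimately show ?thesis
   using 1 by (subst DERIV_cong_ev[OF refl, of _ "\<lambda>x. poly p (1 / x) * exp (- (1 / x))"])
    (auto simp: B_def power2_eq_square algebra_simps elim!: DERIV_cong)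
 next
  case 2
  have "\<forall>\<^sub>F y in nhds x. y < 0" using 2 by (intro eventually_nhds_in_open[of "{..<0}", simplified]) auto
  then have "\<forall>\<^sub>F y in nhds x. B p y = 0" by eventually_elim (simp add: B_def)
  then show ?thesis using 2 by (subst DERIV_cong_ev[OF refl, of _ "\<lambda>x. 0"]) (auto simp: B_def)
 qed
next
 case True
 have r: "((\<lambda>y. B p y / y) \<longlongrightarrow> 0) (at_right 0)"
 proof -
  have "((\<lambda>y. poly ([:0, 1:] * p) (inverse y) * exp (- inverse y)) \<longlongrightarrow> 0) (at_right 0)"
   by (rule filterlim_compose[OF poly_exp_tendsto_0 filterlim_inverse_at_top_right])
  moreover have "\<forall>\<^sub>F y in at_right 0. poly ([:0, 1:] * p) (inverse y) * exp (- inverse y) = B p y / y"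
   using eventually_at_right_less[of "0::real"]
   by eventually_elim (simp add: B_def divide_inverse mult_ac)
  ultimately show ?thesis by (rule Lim_transform_eventually)
 qed
 have l: "((\<lambda>y. B p y / y) \<longlongrightarrow> 0) (at_left 0)"
 proof (rule tendsto_eventually)
  have "\<forall>\<^sub>F y in at_left (0::real). y < 0" by (simp add: eventually_at_filter)
  then show "\<forall>\<^sub>F y in at_left 0. B p y / y = 0" by eventually_elim (simp add: B_def)
 qed
 have "((\<lambda>y. B p y / y) \<longlongrightarrow> 0) (at 0)" by (rule filterlim_split_at[OF l r])
 then show ?thesis using True by (simp add: has_field_derivative_iff B_def)
qed

lemma smooth_bump: "smooth_fun_on UNIV bump"
proof -
 define B where "B p x = (if x > 0 then poly p (1 / x) * exp (- (1 / x)) else (0::real))" for p x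
 have "smooth_fun_on UNIV (B 1) \<and> (\<forall>n. \<exists>g\<in>range B. \<forall>x\<in>UNIV. nth_deriv UNIV n (B 1) x = g x)"
 proof (rule smooth_coind)
  fix f assume "f \<in> range B"
  then obtain p where "f = B p" by blast
  have "(B p has_real_derivative B ([:0, 0, 1:] * (p - pderiv p)) x) (at x)" for x
   unfolding B_def[abs_def] by (rule bump_family_deriv)
  then show "\<exists>f'\<in>range B. \<forall>x\<in>UNIV. (f has_vector_derivative f' x) (at x within UNIV)"
   unfolding \<open>f = B p\<close> has_real_derivative_iff_has_vector_derivative by blast
 qed auto
 moreover have "B 1 = bump" by (auto simp: B_def bump_def)
 ultimately show ?thesis by simp
qed

text \<open>The scaling by \<open>Suc n\<close> steepens both flanks, so that these functions,
  supported in \<open>[a, b]\<close>, converge pointwise to the indicator of the open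
  interval.\<close>

definition bump_on :: "nat => real => real => real => complex" where
 "bump_on n a b x = of_real (bump (real (Suc n) * (x - a)) * bump (real (Suc n) * (b - x)))"

lemma test_fun_bump_on:
 assumes a: "0 < a" shows "test_fun (bump_on n a b)"
 unfolding test_fun_def
proof (intro conjI)
 have 1: "smooth_fun_on UNIV (\<lambda>x. bump (real (Suc n) * x + (- (real (Suc n) * a))))"
  by (rule nth_deriv_affine(1)[OF smooth_bump])
 have 2: "smooth_fun_on UNIV (\<lambda>x. bump (- real (Suc n) * x + real (Suc n) * b))"
  by (rule nth_deriv_affine(1)[OF smooth_bump])
 have "smooth_fun_on UNIV (\<lambda>x. complex_of_real (bump (real (Suc n) * x + (- (real (Suc n) * a))) *\<^sub>R bump (- real (Suc n) * x + real (Suc n) * b)))"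
  by (rule nth_deriv_linear(1)[OF nontriv_UNIV nth_deriv_scaleR(1)[OF nontriv_UNIV 1 2] bounded_linear_of_real])
 moreover have "(\<lambda>x. complex_of_real (bump (real (Suc n) * x + (- (real (Suc n) * a))) *\<^sub>R bump (- real (Suc n) * x + real (Suc n) * b))) = bump_on n a b"
  by (rule ext) (simp only: bump_on_def real_scaleR_def right_diff_distrib, simp add: algebra_simps)
 ultimately show "smooth_fun_on UNIV (bump_on n a b)" by simp
 have "{x. bump_on n a b x \<noteq> 0} \<subseteq> {a..b}"
  by (auto simp: bump_on_def bump_def zero_less_mult_iff split: if_splits)
 then have c: "closure {x. bump_on n a b x \<noteq> 0} \<subseteq> {a..b}" by (rule closure_minimal) simp
 then show "closure {x. bump_on n a b x \<noteq> 0} \<subseteq> {0<..}" using a by auto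
 show "compact (closure {x. bump_on n a b x \<noteq> 0})"
  using bounded_subset[OF bounded_closed_interval subset_trans[OF closure_subset c]] by (simp add: compact_closure)
qed

lemma bump_on_bound: "cmod (bump_on n a b x) \<le> indicator {a..b} x"
proof (cases "x \<in> {a..b}")
 case True
 have "bump (real (Suc n) * (x - a)) * bump (real (Suc n) * (b - x)) \<le> 1 * 1"
  by (intro mult_mono bump_le_1 bump_nonneg) simp
 then show ?thesis using True by (simp add: bump_on_def norm_mult bump_nonneg del: of_nat_Suc)
next
 case False
 then show ?thesis by (auto simp: bump_on_def bump_def zero_less_mult_iff)
qed

lemma bump_scaled_tendsto: "y > 0 ==> (\<lambda>n. bump (real (Suc n) * y)) \<longlonglongrightarrow> 1"
proof -
 assume y: "y > 0"
 have "(\<lambda>n. exp (- (inverse (real (Suc n)) * (1 / y)))) \<longlonglongrightarrow> exp (- (0 * (1 / y)))"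
  by (intro tendsto_intros LIMSEQ_inverse_real_of_nat)
 moreover have "exp (- (inverse (real (Suc n)) * (1 / y))) = bump (real (Suc n) * y)" for n
  using y by (simp add: bump_def divide_inverse del: of_nat_Suc)
 ultimately show ?thesis by simp
qed

lemma bump_on_tendsto: "(\<lambda>n. bump_on n a b x) \<longlonglongrightarrow> indicator {a<..<b} x"
proof (cases "x \<in> {a<..<b}")
 case True
 have "(\<lambda>n. complex_of_real (bump (real (Suc n) * (x - a)) * bump (real (Suc n) * (b - x)))) \<longlonglongrightarrow> of_real (1 * 1)"
  using True by (intro tendsto_intros bump_scaled_tendsto) auto
 then show ?thesis using True by (simp add: bump_on_def)
next
 case False
 then have "bump_on n a b x = 0" for n by (auto simp: bump_on_def bump_def zero_less_mult_iff)
 then show ?thesis using False by simp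
qed

section \<open>Functions with bounded derivatives\<close>

text \<open>For \<open>S = {0..}\<close> these are the coefficients that multiply every Sobolev
  space of the half-line into itself.\<close>

definition bdd_smooth :: "real set => (real => real) => bool" where
 "bdd_smooth S f \<longleftrightarrow> smooth_fun_on S f \<and> (\<forall>n. \<exists>C. \<forall>x\<in>S. \<bar>nth_deriv S n f x\<bar> \<le> C)"

lemma bdd_smooth_mult:
 assumes S: "nontriv S" and f: "bdd_smooth S f" and g: "bdd_smooth S g"
 shows "bdd_smooth S (\<lambda>x. f x * g x)"
proof -
 have sf: "smooth_fun_on S f" and sg: "smooth_fun_on S g" using f g by (auto simp: bdd_smooth_def)
 obtain F G where F: "\<And>n x. x \<in> S ==> \<bar>nth_deriv S n f x\<bar> \<le> F n" and G: "\<And>n x. x \<in> S ==> \<bar>nth_deriv S n g x\<bar> \<le> G n"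
  using f g unfolding bdd_smooth_def by metis
 note L = nth_deriv_scaleR[OF S sf sg, unfolded real_scaleR_def]
 have "\<bar>nth_deriv S n (\<lambda>x. f x * g x) x\<bar> \<le> (\<Sum>k\<le>n. real (n choose k) * (F k * G (n - k)))" if x: "x \<in> S" for n x
  unfolding L(2)[OF x]
 proof (rule order_trans[OF sum_abs], rule sum_mono)
  fix k
  have "\<bar>nth_deriv S k f x\<bar> * \<bar>nth_deriv S (n - k) g x\<bar> \<le> F k * G (n - k)"
   by (rule mult_mono[OF F[OF x] G[OF x] order_trans[OF abs_ge_zero F[OF x]] abs_ge_zero])
  then show "\<bar>real (n choose k) * (nth_deriv S k f x * nth_deriv S (n - k) g x)\<bar> \<le> real (n choose k) * (F k * G (n - k))"
   by (simp add: abs_mult mult_left_mono)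
 qed
 then show ?thesis using L(1) by (auto simp: bdd_smooth_def)
qed

lemma bdd_smooth_add:
 assumes S: "nontriv S" and f: "bdd_smooth S f" and g: "bdd_smooth S g"
 shows "bdd_smooth S (\<lambda>x. f x + g x)"
proof -
 have sf: "smooth_fun_on S f" and sg: "smooth_fun_on S g" using f g by (auto simp: bdd_smooth_def)
 obtain F G where F: "\<And>n x. x \<in> S ==> \<bar>nth_deriv S n f x\<bar> \<le> F n" and G: "\<And>n x. x \<in> S ==> \<bar>nth_deriv S n g x\<bar> \<le> G n"
  using f g unfolding bdd_smooth_def by metis
 note L = nth_deriv_add[OF S sf sg]
 have "\<bar>nth_deriv S n (\<lambda>x. f x + g x) x\<bar> \<le> F n + G n" if x: "x \<in> S" for n x
  unfolding L(2)[OF x] using F[OF x, of n] G[OF x, of n] by linarith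
 then show ?thesis using L(1) by (auto simp: bdd_smooth_def)
qed

text \<open>Multiples of powers with nonpositive exponent are closed under differentiation, and each
  of them is bounded on \<open>{1..}\<close>.\<close>

lemma bdd_smooth_powr:
 assumes a: "a \<le> 0" shows "bdd_smooth {1..} (\<lambda>x. c * x powr a)"
proof -
 define K where "K = {\<lambda>x::real. c * x powr a | c a. a \<le> 0}"
 have "smooth_fun_on {1..} (\<lambda>x. c * x powr a) \<and> (\<forall>n. \<exists>g\<in>K. \<forall>x\<in>{1..}. nth_deriv {1..} n (\<lambda>x. c * x powr a) x = g x)"
 proof (rule smooth_coind)
  fix f assume "f \<in> K"
  then obtain c a where f: "f = (\<lambda>x. c * x powr a)" and a: "a \<le> 0" by (auto simp: K_def)
  have "((\<lambda>x. c * x powr a) has_real_derivative (c * a) * x powr (a - 1)) (at x within {1..})" if "x \<in> {1..}" for x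
   using that by (auto intro!: derivative_eq_intros DERIV_subset[OF has_real_derivative_powr])
  moreover have "a - 1 \<le> 0" using a by simp
  then have "(\<lambda>x. (c * a) * x powr (a - 1)) \<in> K" unfolding K_def by blast
  ultimately show "\<exists>f'\<in>K. \<forall>x\<in>{1..}. (f has_vector_derivative f' x) (at x within {1..})"
   unfolding f has_real_derivative_iff_has_vector_derivative[symmetric] by (intro bexI[of _ "\<lambda>x. (c * a) * x powr (a - 1)"]) auto
 next
  show "(\<lambda>x. c * x powr a) \<in> K" using a by (auto simp: K_def)
 qed simp
 moreover have "\<exists>C. \<forall>x\<in>{1..}. \<bar>g x\<bar> \<le> C" if "g \<in> K" for g
 proof -
  obtain c a where g: "g = (\<lambda>x. c * x powr a)" and a: "a \<le> 0" using \<open>g \<in> K\<close> by (auto simp: K_def)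
  have "\<bar>g x\<bar> \<le> \<bar>c\<bar>" if "x \<in> {1..}" for x
  proof -
   have "x powr a \<le> x powr 0" using that a by (intro powr_mono) auto
   then have "\<bar>c\<bar> * x powr a \<le> \<bar>c\<bar> * 1" using that by (intro mult_left_mono) auto
   then show ?thesis by (simp add: g abs_mult)
  qed
  then show ?thesis by blast
 qed
 ultimately show ?thesis unfolding bdd_smooth_def by metis
qed

lemma bdd_smooth_const: "bdd_smooth {1..} (\<lambda>x. c)"
proof -
 have sm: "smooth_fun_on {1..} (\<lambda>x. c)" and d: "x \<in> {1..} ==> nth_deriv {1..} n (\<lambda>x. c) x = (if n = 0 then c else 0)" for n x
  using nth_deriv_chain[of "{1::real..}" "\<lambda>n x. if n = 0 then c else 0"] by simp_all
 show ?thesis unfolding bdd_smooth_def using sm d by (auto intro!: exI[of _ "\<bar>c\<bar>"])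
qed

text \<open>Beyond 1 the explicit formula makes \<open>V\<close> a product of functions with bounded
  derivatives; on \<open>{0..1}\<close> the derivatives are continuous on a compact set.
  \<open>nth_deriv_subset\<close> identifies derivatives within \<open>{1..}\<close> with those
  within \<open>{0..}\<close>.\<close>

lemma potential_bdd_smooth:
 fixes V r :: "real => real"
 assumes V: "smooth_fun_on {0..} V"
  and as: "\<And>x. x \<ge> 1 ==> V x = - (1 / 4) * x powr (- 2) * (1 + r x)"
  and r: "smooth_fun_on {1..} r" and \<alpha>: "\<alpha> > 0"
  and rb: "\<And>k x. x \<ge> 1 ==> \<bar>nth_deriv {1..} k r x\<bar> \<le> c k * x powr (- \<alpha> - real k)"
 shows "bdd_smooth {0..} V"
proof -
 have "\<bar>nth_deriv {1..} k r x\<bar> \<le> \<bar>c k\<bar>" if x: "x \<in> {1..}" for k x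
 proof -
  have "x powr (- \<alpha> - real k) \<le> x powr 0" using x \<alpha> by (intro powr_mono) auto
  then have "\<bar>c k\<bar> * x powr (- \<alpha> - real k) \<le> \<bar>c k\<bar> * 1" using x by (intro mult_left_mono) auto
  moreover have "c k * x powr (- \<alpha> - real k) \<le> \<bar>c k\<bar> * x powr (- \<alpha> - real k)" by (intro mult_right_mono) auto
  moreover have "x \<ge> 1" using x by simp
  ultimately show ?thesis using rb[of x k] by linarith
 qed
 then have br: "bdd_smooth {1..} r" using r by (auto simp: bdd_smooth_def)
 have "bdd_smooth {1..} (\<lambda>x. (- (1 / 4) * x powr (- 2)) * (1 + r x))"
  by (intro bdd_smooth_mult bdd_smooth_powr bdd_smooth_add bdd_smooth_const br) simp_all
 then have sm: "smooth_fun_on {1..} (\<lambda>x. (- (1 / 4) * x powr (- 2)) * (1 + r x))"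
  and bd: "\<And>n. \<exists>C. \<forall>x\<in>{1..}. \<bar>nth_deriv {1..} n (\<lambda>x. (- (1 / 4) * x powr (- 2)) * (1 + r x)) x\<bar> \<le> C"
  by (auto simp: bdd_smooth_def)
 have "\<exists>C. \<forall>x\<in>{0..}. \<bar>nth_deriv {0..} n V x\<bar> \<le> C" for n
 proof -
  obtain C where C: "\<forall>x\<in>{1..}. \<bar>nth_deriv {1..} n (\<lambda>x. (- (1 / 4) * x powr (- 2)) * (1 + r x)) x\<bar> \<le> C" using bd by blast
  have C1: "\<bar>nth_deriv {0..} n V x\<bar> \<le> C" if "x \<ge> 1" for x
  proof -
   have "nth_deriv {0..} n V x = nth_deriv {1..} n V x"
    by (rule nth_deriv_subset(2)[OF nontriv_atLeast _ V, symmetric]) (use that in auto)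
   also have "\<dots> = nth_deriv {1..} n (\<lambda>x. (- (1 / 4) * x powr (- 2)) * (1 + r x)) x"
    by (rule nth_deriv_cong_smooth(2)[OF nontriv_atLeast sm]) (use that as in auto)
   finally show ?thesis using C that by auto
  qed
  have "compact (nth_deriv {0..} n V ` {0..1})"
   by (rule compact_continuous_image[OF continuous_on_subset[OF smooth_continuous[OF V]]]) auto
  then have "bounded (nth_deriv {0..} n V ` {0..1})" by (rule compact_imp_bounded)
  then obtain D where "\<forall>y\<in>nth_deriv {0..} n V ` {0..1}. \<bar>y\<bar> \<le> D" unfolding bounded_iff real_norm_def by blast
  then have D: "\<bar>nth_deriv {0..} n V x\<bar> \<le> D" if "x \<in> {0..1}" for x using that by blast
  have "\<bar>nth_deriv {0..} n V x\<bar> \<le> max C D" if "x \<in> {0..}" for x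
   using C1[of x] D[of x] that by (cases "x \<ge> 1") auto
  then show ?thesis by blast
 qed
 then show ?thesis using V by (simp add: bdd_smooth_def)
qed

lemma potential_decay:
 fixes V r :: "real => real"
 assumes as: "\<And>x. x \<ge> 1 ==> V x = - (1 / 4) * x powr (- 2) * (1 + r x)" and \<alpha>: "\<alpha> > 0"
  and rb: "\<And>k x. x \<ge> 1 ==> \<bar>nth_deriv {1..} k r x\<bar> \<le> c k * x powr (- \<alpha> - real k)"
  and e: "q > 0"
 shows "\<exists>b\<ge>1. \<forall>x\<ge>b. \<bar>V x\<bar> \<le> q"
proof -
 have le: "\<bar>V x\<bar> \<le> (1 + \<bar>c 0\<bar>) * x powr (-2)" if x: "x \<ge> 1" for x
 proof -
  have "x powr (- \<alpha> - real 0) \<le> x powr 0" using x \<alpha> by (intro powr_mono) auto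
  then have "\<bar>c 0\<bar> * x powr (- \<alpha> - real 0) \<le> \<bar>c 0\<bar> * 1" using x by (intro mult_left_mono) auto
  moreover have "c 0 * x powr (- \<alpha> - real 0) \<le> \<bar>c 0\<bar> * x powr (- \<alpha> - real 0)" by (intro mult_right_mono) auto
  ultimately have "\<bar>r x\<bar> \<le> \<bar>c 0\<bar>" using rb[OF x, of 0] unfolding nth_deriv_0 by linarith
  then have "\<bar>1 + r x\<bar> \<le> 1 + \<bar>c 0\<bar>" by linarith
  then have "(1 / 4 * x powr (-2)) * \<bar>1 + r x\<bar> \<le> (1 * x powr (-2)) * (1 + \<bar>c 0\<bar>)"
   by (intro mult_mono) auto
  then show ?thesis by (simp add: as[OF x] abs_mult mult.commute)
 qed
 have "((\<lambda>x::real. (1 + \<bar>c 0\<bar>) * x powr (-2)) \<longlongrightarrow> (1 + \<bar>c 0\<bar>) * 0) at_top"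
  by (intro tendsto_intros tendsto_neg_powr filterlim_ident) simp
 then have "\<forall>\<^sub>F x in at_top. (1 + \<bar>c 0\<bar>) * x powr (-2) < q"
  using e by (auto dest: order_tendstoD(2))
 then obtain b where b: "\<And>x. x \<ge> b ==> (1 + \<bar>c 0\<bar>) * x powr (-2) < q" by (auto simp: eventually_at_top_linorder)
 show ?thesis
 proof (intro exI[of _ "max 1 b"] conjI allI impI)
  fix x assume "max 1 b \<le> x"
  then show "\<bar>V x\<bar> \<le> q" using le[of x] b[of x] by simp
 qed simp
qed

section \<open>Absolutely continuous functions\<close>

definition locL1 :: "(real => complex) => bool" where
 "locL1 f \<longleftrightarrow> (\<forall>b. f absolutely_integrable_on {0..b})"

text \<open>The locally absolutely continuous functions together with their derivative.
  \<open>indef_ac_loc\<close>, \<open>indef_AE_deriv\<close> and \<open>indef_iff_ac\<close> are the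
  two directions of Lebesgue's fundamental theorem; the calculus of representatives uses this
  notion.\<close>

definition indef :: "(real => complex) => (real => complex) => bool" where
 "indef F f \<longleftrightarrow> locL1 f \<and> (\<forall>x\<ge>0. F x = F 0 + integral {0..x} f)"

lemma abs_int_halfline_iff:
 fixes f :: "real => complex"
 assumes "0 \<le> a"
 shows "f absolutely_integrable_on {a..b} \<longleftrightarrow> integrable halfline (\<lambda>x. indicator {a..b} x *\<^sub>R f x)"
proof -
 have "integrable halfline (\<lambda>x. indicator {a..b} x *\<^sub>R f x)
  \<longleftrightarrow> integrable lebesgue (\<lambda>x. indicator {0..} x *\<^sub>R (indicator {a..b} x *\<^sub>R f x))"
  by (rule integrable_restrict_space) simp
 also have "(\<lambda>x. indicator {0..} x *\<^sub>R (indicator {a..b} x *\<^sub>R f x)) = (\<lambda>x. indicator {a..b} x *\<^sub>R f x)"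
  using assms by (auto simp: indicator_def)
 finally show ?thesis by (simp add: set_integrable_def)
qed

lemma integral_halfline_interval:
 fixes f :: "real => complex"
 assumes "0 \<le> a" and f: "f absolutely_integrable_on {a..b}"
 shows "(LINT x|halfline. indicator {a..b} x *\<^sub>R f x) = integral {a..b} f"
proof -
 have "(LINT x|halfline. indicator {a..b} x *\<^sub>R f x)
   = (LINT x|lebesgue. indicator {0..} x *\<^sub>R (indicator {a..b} x *\<^sub>R f x))"
  by (rule integral_restrict_space) simp
 also have "(\<lambda>x. indicator {0..} x *\<^sub>R (indicator {a..b} x *\<^sub>R f x)) = (\<lambda>x. indicator {a..b} x *\<^sub>R f x)"
  using assms(1) by (auto simp: indicator_def)
 finally show ?thesis using set_lebesgue_integral_eq_integral(2)[OF f] by (simp add: set_lebesgue_integral_def)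
qed

lemma locL1_integrable:
 assumes "integrable halfline f" shows "locL1 f"
 unfolding locL1_def
proof
 fix b
 have "integrable halfline (\<lambda>x. indicator {0..b} x *\<^sub>R f x)"
  by (rule integrable_mult_indicator[OF _ assms]) (simp add: sets_restrict_space_iff)
 then show "f absolutely_integrable_on {0..b}" by (subst abs_int_halfline_iff) auto
qed

lemma interval_L2:
 assumes "0 \<le> a" shows "(\<lambda>x. indicator {a..b} x) \<in> L2"
 unfolding L2_def
proof (intro CollectI conjI)
 show "(\<lambda>x. indicator {a..b} x :: complex) \<in> borel_measurable halfline"
  using assms by (intro borel_measurable_indicator) (auto simp: sets_restrict_space_iff)
 have "(\<lambda>x. 1 :: complex) absolutely_integrable_on {a..b}"
  by (rule absolutely_integrable_continuous_real) simp
 then have "integrable halfline (\<lambda>x. indicator {a..b} x *\<^sub>R (1 :: complex))"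
  unfolding abs_int_halfline_iff[OF assms] .
 from integrable_norm[OF this] show "integrable halfline (\<lambda>x. (cmod (indicator {a..b} x))\<^sup>2)"
  by (simp add: indicator_def of_bool_def if_distrib[of norm] if_distrib[of "\<lambda>x. x\<^sup>2"] cong: if_cong)
qed

lemma locL1_L2: assumes "f \<in> L2" shows "locL1 f"
 unfolding locL1_def
proof
 fix b
 have "integrable halfline (\<lambda>x. indicator {0..b} x * f x)"
  by (rule L2_prod_integrable[OF interval_L2 assms]) simp
 moreover have "(\<lambda>x. indicator {0..b} x * f x) = (\<lambda>x. indicator {0..b} x *\<^sub>R f x)"
  by (auto simp: indicator_def)
 ultimately show "f absolutely_integrable_on {0..b}" by (subst abs_int_halfline_iff) simp_all
qed

lemma locL1_sub:
 assumes f: "locL1 f" and "0 \<le> a" shows "f absolutely_integrable_on {a..b}"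
proof (rule absolutely_integrable_on_subinterval)
 show "f absolutely_integrable_on {0..b}" using f unfolding locL1_def by (rule spec)
 show "{a..b} \<subseteq> {0..b}" using assms(2) by simp
qed

lemma locL1_integrable_on:
 assumes "locL1 f" "0 \<le> a" shows "f integrable_on {a..b}"
 by (rule set_lebesgue_integral_eq_integral(1)[OF locL1_sub[OF assms]])

lemma indef_locL1: "indef F f ==> locL1 f"
 unfolding indef_def by (rule conjunct1)

lemma indefD: "indef F f ==> 0 \<le> x ==> F x = F 0 + integral {0..x} f"
 unfolding indef_def by blast

lemma indef_diff:
 assumes F: "indef F f" and "0 \<le> a" "a \<le> b"
 shows "F b - F a = integral {a..b} f"
proof -
 have "integral {0..a} f + integral {a..b} f = integral {0..b} f"
  by (rule Henstock_Kurzweil_Integration.integral_combine[OF assms(2,3) locL1_integrable_on[OF indef_locL1[OF F]]]) simp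
 moreover have "F b = F 0 + integral {0..b} f" by (rule indefD[OF F]) (use assms in simp)
 moreover have "F a = F 0 + integral {0..a} f" by (rule indefD[OF F]) (use assms in simp)
 moreover have "B - A = J" if "I + J = L" "B = c + L" "A = c + I" for A B I J L c :: complex
  by (simp add: that(2,3) that(1)[symmetric])
 ultimately show ?thesis by blast
qed

text \<open>Uniform integrability: the excess of \<open>|f|\<close> over the level \<open>n\<close>
  has small integral, and below that level an increment is at most \<open>n\<close> times the
  length. This fixes the modulus \<open>p / (2 * (n + 1))\<close>.\<close>

lemma indef_ac_loc:
 assumes F: "indef F f" shows "ac_loc F"
 unfolding ac_loc_def abs_cont_on_def
proof (intro allI impI)
 fix b p :: real assume b: "0 \<le> b" and e: "0 < p"
 have f: "f absolutely_integrable_on {0..b}" by (rule locL1_sub[OF indef_locL1[OF F]]) simp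
 define M where "M = lebesgue_on {0..b}"
 have iM: "integrable M (\<lambda>x. norm (f x))"
  using f unfolding M_def set_integrable_def
  by (subst integrable_restrict_space) (auto dest: integrable_norm)
 define g where "g = (\<lambda>(n::nat) x. max (norm (f x) - real n) 0)"
 have gi: "integrable M (g n)" for n
  by (rule Bochner_Integration.integrable_bound[OF iM])
   (use borel_measurable_integrable[OF iM] in \<open>simp_all add: g_def\<close>)
 have "(\<lambda>n. LINT x|M. g n x) \<longlonglongrightarrow> (LINT x|M. 0)"
 proof (rule integral_dominated_convergence[OF _ _ iM])
  show "g n \<in> borel_measurable M" for n using gi by blast
  show "AE x in M. (\<lambda>n. g n x) \<longlonglongrightarrow> 0"
  proof (rule AE_I2, rule tendsto_eventually)
   fix x
   obtain N where "norm (f x) \<le> real N" using real_arch_simple by blast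
   then show "\<forall>\<^sub>F n in sequentially. g n x = 0"
    unfolding eventually_sequentially g_def by (intro exI[of _ N]) auto
  qed
  show "AE x in M. norm (g n x) \<le> norm (f x)" for n by (auto simp: g_def)
 qed simp
 then have "\<forall>\<^sub>F n in sequentially. (LINT x|M. g n x) < p / 2"
  using e by (intro order_tendstoD(2)) auto
 then obtain n where n: "(LINT x|M. g n x) < p / 2" by (auto simp: eventually_sequentially)
 have gint: "g n integrable_on {0..b}" and gI: "(LINT x|M. g n x) = integral {0..b} (g n)"
  using has_integral_integral_lebesgue_on[OF gi[of n, unfolded M_def]] unfolding M_def
  by (auto simp: integral_unique intro: has_integral_integrable)
 show "\<exists>z>0. \<forall>d S. d division_of S \<and> S \<subseteq> {0..b} \<and> (\<Sum>K\<in>d. Sup K - Inf K) < z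
     --> (\<Sum>K\<in>d. norm (F (Sup K) - F (Inf K))) < p"
 proof (intro exI[of _ "p / (2 * (real n + 1))"] conjI allI impI)
  show "0 < p / (2 * (real n + 1))" using e by simp
  fix d S assume a: "d division_of S \<and> S \<subseteq> {0..b} \<and> (\<Sum>K\<in>d. Sup K - Inf K) < p / (2 * (real n + 1))"
  then have d: "d division_of S" and S: "S \<subseteq> {0..b}" and l: "(\<Sum>K\<in>d. Sup K - Inf K) < p / (2 * (real n + 1))" by auto
  have Kform: "\<exists>u v. K = {u..v} \<and> u \<le> v \<and> 0 \<le> u \<and> v \<le> b" if KD: "K \<in> d" for K
  proof -
   obtain u v where K: "K = cbox u v" using division_ofD(4)[OF d KD] by blast
   have "K \<noteq> {}" "K \<subseteq> {0..b}" using division_ofD(2,3)[OF d KD] S by auto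
   then show ?thesis unfolding K by (intro exI[of _ u] exI[of _ v]) auto
  qed
  have gK: "g n integrable_on K" if "K \<in> d" for K
   using Kform[OF that] integrable_on_subinterval[OF gint] by auto
  have "(\<Sum>K\<in>d. norm (F (Sup K) - F (Inf K))) \<le> (\<Sum>K\<in>d. real n * (Sup K - Inf K) + integral K (g n))"
  proof (rule sum_mono)
   fix K assume K: "K \<in> d"
   then obtain u v where uv: "K = {u..v}" "u \<le> v" "0 \<le> u" "v \<le> b" using Kform by blast
   have fK: "f absolutely_integrable_on {u..v}" by (rule locL1_sub[OF indef_locL1[OF F] uv(3)])
   have "norm (F v - F u) = norm (integral {u..v} f)" using indef_diff[OF F uv(3,2)] by simp
   also have "\<dots> \<le> integral {u..v} (\<lambda>x. real n + g n x)"
   proof (rule integral_norm_bound_integral)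
    show "f integrable_on {u..v}" using set_lebesgue_integral_eq_integral(1)[OF fK] .
    show "(\<lambda>x. real n + g n x) integrable_on {u..v}"
     using gK[OF K] uv by (intro integrable_add) auto
    show "norm (f x) \<le> real n + g n x" for x by (simp add: g_def)
   qed
   also have "\<dots> = real n * (v - u) + integral {u..v} (g n)"
    using gK[OF K] uv by (subst integral_add) auto
   finally show "norm (F (Sup K) - F (Inf K)) \<le> real n * (Sup K - Inf K) + integral K (g n)"
    using uv by simp
  qed
  also have "\<dots> = real n * (\<Sum>K\<in>d. Sup K - Inf K) + integral S (g n)"
   by (simp add: sum.distrib sum_distrib_left integral_combine_division_bottomup[OF d gK])
  also have "integral S (g n) \<le> integral {0..b} (g n)"
  proof (rule integral_subset_le[OF S _ gint])
   show "g n integrable_on S" using integrable_combine_division[OF d] gK by blast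
  qed (auto simp: g_def)
  also have "\<dots> < p / 2" using n gI by simp
  also have "real n * (\<Sum>K\<in>d. Sup K - Inf K) \<le> real n * (p / (2 * (real n + 1)))"
   using l by (intro mult_left_mono) auto
  also have "\<dots> \<le> (real n + 1) * (p / (2 * (real n + 1)))"
   using e by (intro mult_right_mono) auto
  also have "\<dots> = p / 2" by (simp add: field_simps)
  finally show "(\<Sum>K\<in>d. norm (F (Sup K) - F (Inf K))) < p" by simp
 qed
qed

lemma indef_continuous:
 assumes F: "indef F f" shows "continuous_on {0..} F"
proof -
 have c: "continuous_on {0..b} F" for b
 proof -
  have "continuous_on {0..b} (\<lambda>x. F 0 + integral {0..x} f)"
   by (intro continuous_intros indefinite_integral_continuous_1 locL1_integrable_on indef_locL1[OF F]) simp
  then show ?thesis by (rule continuous_on_eq) (rule indefD[OF F, symmetric], simp)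
 qed
 have "continuous (at x within {0..}) F" if x: "x \<in> {0..}" for x
 proof -
  have "continuous (at x within {0..x+1}) F"
   using c[of "x + 1"] unfolding continuous_on_eq_continuous_within by (rule bspec) (use x in simp)
  moreover have "at x within {0..x+1} = at x within {0..}"
   by (rule at_within_nhd[of _ "{..<x+1}"]) auto
  ultimately show ?thesis by (simp only:)
 qed
 then show ?thesis unfolding continuous_on_eq_continuous_within by (rule ballI)
qed

text \<open>Lebesgue's differentiation theorem for intervals with left end \<open>x\<close>; the
  quotients from the left come from a reflection in \<open>indef_AE_deriv\<close>.\<close>

lemma quotient_right_deriv:
 fixes f :: "real => complex"
 assumes "\<And>a b. f integrable_on {a..b}"
 obtains N where "negligible N"
  "\<And>x e. x \<notin> N ==> 0 < e ==> \<exists>d>0. \<forall>h. 0 < h \<and> h < d --> norm (integral {x..x + h} f - h *\<^sub>R f x) \<le> e * h"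
proof -
 obtain N where N: "negligible N" and q: "\<And>x e. x \<notin> N ==> 0 < e ==>
   \<exists>d>0. \<forall>h. 0 < h \<and> h < d --> norm (integral (cbox x (x + h *\<^sub>R One)) f /\<^sub>R h ^ DIM(real) - f x) < e"
  using integrable_ccontinuous_explicit[of f] assms by auto
 show ?thesis
 proof (rule that[OF N])
  fix x e :: real assume "x \<notin> N" "0 < e"
  then obtain d where d: "d > 0" "\<And>h. 0 < h ==> h < d ==> norm (integral {x..x + h} f /\<^sub>R h - f x) < e"
   using q[of x e] by auto
  have "norm (integral {x..x + h} f - h *\<^sub>R f x) \<le> e * h" if h: "0 < h" "h < d" for h
  proof -
   have "integral {x..x + h} f - h *\<^sub>R f x = h *\<^sub>R (integral {x..x + h} f /\<^sub>R h - f x)"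
    using h by (simp add: scaleR_diff_right)
   then have "norm (integral {x..x + h} f - h *\<^sub>R f x) = h * norm (integral {x..x + h} f /\<^sub>R h - f x)"
    using h by simp
   also have "\<dots> \<le> h * e" using d(2)[OF h] h by (intro mult_left_mono) auto
   finally show ?thesis by (simp add: mult.commute)
  qed
  then show "\<exists>d>0. \<forall>h. 0 < h \<and> h < d --> norm (integral {x..x + h} f - h *\<^sub>R f x) \<le> e * h"
   using d(1) by blast
 qed
qed

lemma AE_halfline_negligible:
 assumes "negligible N" shows "AE x in halfline. x \<notin> N"
proof -
 have "N \<in> null_sets lebesgue" using assms by (simp add: negligible_iff_null_sets)
 then have "AE x in lebesgue. x \<notin> N" by (rule AE_not_in)
 then show ?thesis by (subst AE_restrict_space_iff) auto
qed

lemma AE_halfline_pos: "AE x in halfline. x > 0"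
 using AE_halfline_negligible[of "{0}"] AE_space[of halfline] by (auto elim!: eventually_elim2)

lemma indef_AE_deriv:
 assumes F: "indef F f"
 shows "AE x in halfline. (F has_vector_derivative f x) (at x within {0..})"
proof -
 \<comment> \<open>Extension by zero: the differentiation theorem asks for integrability on all
   intervals, also to the left of 0.\<close>
 define g where "g x = (if x \<ge> 0 then f x else 0)" for x
 have gi: "g integrable_on {a..b}" for a b
 proof -
  have "f integrable_on {0..b}" by (rule locL1_integrable_on[OF indef_locL1[OF F]]) simp
  then have "g integrable_on {0..b}" by (rule integrable_eq) (simp add: g_def)
  moreover have "g integrable_on {min a 0..0}"
   by (rule integrable_spike[OF integrable_0, of "{0}"]) (simp_all add: g_def)
  ultimately have 1: "g integrable_on {min a 0..b}" if "0 \<le> b"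
   by (intro Henstock_Kurzweil_Integration.integrable_combine[of "min a 0" 0 b g]) (simp_all add: that)
  have 2: "g integrable_on {min a 0..b}" if "b < 0"
   by (rule integrable_eq[OF integrable_0]) (use that in \<open>simp add: g_def\<close>)
  have "g integrable_on {min a 0..b}" using 1 2 by (cases "0 \<le> b") simp_all
  then show ?thesis by (rule integrable_on_subinterval) auto
 qed
 obtain N1 where N1: "negligible N1"
  "\<And>x e. x \<notin> N1 ==> 0 < e ==> \<exists>d>0. \<forall>h. 0 < h \<and> h < d --> norm (integral {x..x + h} g - h *\<^sub>R g x) \<le> e * h"
  using quotient_right_deriv[OF gi] by blast
 have gi': "(\<lambda>x. g (- x)) integrable_on {a..b}" for a b
  using Henstock_Kurzweil_Integration.integrable_reflect_real[where f=g and a="-b" and b="-a"] gi[of "-b" "-a"] by simp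
 obtain N2 where N2: "negligible N2"
  "\<And>x e. x \<notin> N2 ==> 0 < e ==> \<exists>d>0. \<forall>h. 0 < h \<and> h < d --> norm (integral {x..x + h} (\<lambda>x. g (- x)) - h *\<^sub>R g (- x)) \<le> e * h"
  using quotient_right_deriv[OF gi'] by blast
 have N2': "negligible (uminus ` N2)"
  by (rule negligible_differentiable_image_negligible[OF _ N2(1)]) (auto intro!: derivative_intros simp: differentiable_on_def)
 have "AE x in halfline. x \<notin> N1" "AE x in halfline. x \<notin> uminus ` N2"
  using AE_halfline_negligible N1(1) N2' by blast+
 then show ?thesis using AE_halfline_pos
 proof eventually_elim
  case (elim x)
  have xN2: "- x \<notin> N2"
  proof
   assume "- x \<in> N2"
   then have "- (- x) \<in> uminus ` N2" by (rule imageI)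
   then show False using elim by simp
  qed
  have gf: "integral {a..b} g = integral {a..b} f" if "0 \<le> a" for a b
   using that by (intro integral_cong) (auto simp: g_def)
  show ?case
   unfolding has_vector_derivative_def has_derivative_within_alt
  proof (intro conjI allI impI bounded_linear_scaleR_left)
   fix e :: real assume e: "0 < e"
   obtain d1 where d1: "d1 > 0" "\<And>h. 0 < h ==> h < d1 ==> norm (integral {x..x + h} g - h *\<^sub>R g x) \<le> e * h"
    using N1(2)[OF elim(1) e] by blast
   obtain d2 where d2: "d2 > 0" "\<And>h. 0 < h ==> h < d2 ==> norm (integral {-x..-x + h} (\<lambda>x. g (- x)) - h *\<^sub>R g (- (- x))) \<le> e * h"
    using N2(2)[OF xN2 e] by blast
   show "\<exists>d>0. \<forall>y\<in>{0..}. norm (y - x) < d --> norm (F y - F x - (y - x) *\<^sub>R f x) \<le> e * norm (y - x)"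
   proof (intro exI[of _ "min d1 d2"] conjI ballI impI)
    show "0 < min d1 d2" using d1 d2 by simp
    fix y :: real assume y: "y \<in> {0..}" and n: "norm (y - x) < min d1 d2"
    consider "y = x" | "y > x" | "y < x" by linarith
    then show "norm (F y - F x - (y - x) *\<^sub>R f x) \<le> e * norm (y - x)"
    proof cases
     case 2
     have "F y - F x = integral {x..y} g" using indef_diff[OF F, of x y] 2 elim gf by simp
     then show ?thesis using d1(2)[of "y - x"] 2 n elim by (simp add: g_def)
    next
     case 3
     have "F x - F y = integral {y..x} g" using indef_diff[OF F, of y x] 3 y gf by simp
     also have "\<dots> = integral {-x..-y} (\<lambda>x. g (- x))"
      using integral_reflect_real[where a=y and b=x and f=g] by simp
     finally have "F y - F x - (y - x) *\<^sub>R f x = - (integral {-x..-x + (x - y)} (\<lambda>x. g (- x)) - (x - y) *\<^sub>R g (- (- x)))"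
      using elim by (simp add: g_def algebra_simps)
     then show ?thesis using d2(2)[of "x - y"] 3 n by (simp add: norm_minus_commute right_diff_distrib del: minus_diff_eq)
    qed simp
   qed
  qed
 qed
qed

lemma abs_cont_onE:
 assumes "abs_cont_on a b F" and "e > 0"
 obtains r where "r > 0" "\<And>d S. d division_of S ==> S \<subseteq> {a..b} ==> (\<Sum>K\<in>d. Sup K - Inf K) < r
    ==> (\<Sum>K\<in>d. norm (F (Sup K) - F (Inf K))) < e"
proof -
 from assms(1)[unfolded abs_cont_on_def, THEN spec, THEN mp, OF assms(2)]
 obtain r where 1: "0 < r \<and> (\<forall>d S. d division_of S \<and> S \<subseteq> {a..b} \<and> (\<Sum>K\<in>d. Sup K - Inf K) < r
    --> (\<Sum>K\<in>d. norm (F (Sup K) - F (Inf K))) < e)" ..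
 show thesis
 proof (rule that)
  show "r > 0" by (rule conjunct1[OF 1])
  fix d S assume "d division_of S" "S \<subseteq> {a..b}" "(\<Sum>K\<in>d. Sup K - Inf K) < r"
  then show "(\<Sum>K\<in>d. norm (F (Sup K) - F (Inf K))) < e"
   by (intro 1[THEN conjunct2, THEN spec, THEN spec, THEN mp] conjI)
 qed
qed

text \<open>The gauge is chosen inside an open superset of small measure at the points of the exceptional
 null set, where absolute continuity controls the increments.\<close>

lemma ac_deriv_has_integral:
 assumes b: "0 \<le> b" and ac: "abs_cont_on 0 b F"
  and AE: "AE x in halfline. (F has_vector_derivative f x) (at x within {0..})"
 shows "(f has_integral (F b - F 0)) {0..b}"
proof -
 define N where "N = {x\<in>{0..}. \<not> (F has_vector_derivative f x) (at x within {0..})}"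
 have negN: "negligible N"
 proof -
  have "AE x in lebesgue. x \<in> {0..} --> (F has_vector_derivative f x) (at x within {0..})"
   using AE by (subst (asm) AE_restrict_space_iff) auto
  then obtain M where M: "M \<in> null_sets lebesgue"
   "{x\<in>space lebesgue. \<not> (x \<in> {0..} --> (F has_vector_derivative f x) (at x within {0..}))} \<subseteq> M"
   unfolding eventually_ae_filter by blast
  have "N \<subseteq> M" using M(2) by (auto simp: N_def)
  then show ?thesis using M(1) negligible_iff_null_sets negligible_subset by blast
 qed
 then have nullN: "N \<in> null_sets lebesgue" by (simp add: negligible_iff_null_sets)
 define g where "g x = (if x \<in> N then 0 else f x)" for x
 have "(g has_integral (F b - F 0)) {0..b}"
  unfolding has_integral_real
 proof (intro allI impI)
  fix e :: real assume e: "0 < e"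
  \<comment> \<open>Half of \<open>e\<close> is spread over an interval of length \<open>b\<close>,
    for the tags outside \<open>N\<close>; the 1 keeps the denominator positive when
    \<open>b = 0\<close>.\<close>
  define l where "l = e / (2 * (b + 1))"
  have l: "l > 0" using e b by (simp add: l_def)
  have "e / 2 > 0" using e by simp
  from abs_cont_onE[OF ac this] obtain r where r: "r > 0" and acd: "\<And>d S. d division_of S ==> S \<subseteq> {0..b} ==> (\<Sum>K\<in>d. Sup K - Inf K) < r
    ==> (\<Sum>K\<in>d. norm (F (Sup K) - F (Inf K))) < e / 2"
   using ac unfolding abs_cont_on_def by blast
  have "N \<in> sets lebesgue" using nullN by (rule null_setsD2)
  from sets_lebesgue_outer_open[OF this r] obtain U where U: "open U" "N \<subseteq> U" "emeasure lebesgue (U - N) < ennreal r"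
   by metis
  have Um: "emeasure lebesgue U < ennreal r"
   using U(3) emeasure_Diff_null_set[OF nullN, of U] U(1) by simp
  have "\<forall>t\<in>{0..} - N. \<exists>d. 0 < d \<and> (\<forall>y\<in>{0..}. norm (y - t) < d --> norm (F y - F t - (y - t) *\<^sub>R f t) \<le> l * norm (y - t))"
  proof
   fix t assume "t \<in> {0..} - N"
   then have "(F has_vector_derivative f t) (at t within {0..})" by (simp add: N_def)
   from this[unfolded has_vector_derivative_def has_derivative_within_alt, THEN conjunct2, THEN spec, THEN mp, OF l]
   show "\<exists>d. 0 < d \<and> (\<forall>y\<in>{0..}. norm (y - t) < d --> norm (F y - F t - (y - t) *\<^sub>R f t) \<le> l * norm (y - t))" .
  qed
  from bchoice[OF this] obtain D where D': "\<forall>t\<in>{0..} - N. 0 < D t \<and> (\<forall>y\<in>{0..}. norm (y - t) < D t --> norm (F y - F t - (y - t) *\<^sub>R f t) \<le> l * norm (y - t))" ..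
  have D: "D t > 0" if "t \<in> {0..} - N" for t using D'[THEN bspec, OF that] by (rule conjunct1)
  have D2: "norm (F y - F t - (y - t) *\<^sub>R f t) \<le> l * norm (y - t)" if "t \<in> {0..} - N" "y \<in> {0..}" "norm (y - t) < D t" for t y
   using D'[THEN bspec, OF that(1), THEN conjunct2, THEN bspec, OF that(2), THEN mp, OF that(3)] .
  define \<gamma> where "\<gamma> t = (if t \<in> N then U else ball t (if t \<in> {0..} then D t else 1))" for t
  have G: "gauge \<gamma>" unfolding gauge_def \<gamma>_def using U(1,2) D by auto
  have H: "norm ((\<Sum>(x,K)\<in>p. measure lborel K *\<^sub>R g x) - (F b - F 0)) < e"
   if p: "p tagged_division_of {0..b}" and fine: "\<gamma> fine p" for p
  proof -
   note pD = tagged_division_ofD[OF p]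
   have form: "\<exists>u v. K = {u..v} \<and> u \<le> t \<and> t \<le> v \<and> 0 \<le> u \<and> v \<le> b" if tK: "(t, K) \<in> p" for t K
   proof -
    obtain u v where K: "K = cbox u v" using pD(4)[OF tK] by blast
    show ?thesis using pD(2,3)[OF tK] unfolding K by (intro exI[of _ u] exI[of _ v]) auto
   qed
   define T where "T = (\<lambda>(x, K). norm (measure lborel K *\<^sub>R g x - (F (Sup K) - F (Inf K))))"
   define p1 where "p1 = {(t, K)\<in>p. t \<notin> N}"
   \<comment> \<open>Degenerate intervals are dropped: they contribute nothing, and two tags could
     share one of them, against \<open>inj\<close> below.\<close>
   define p2 where "p2 = {(t, K)\<in>p. t \<in> N \<and> measure lborel K \<noteq> 0}"
   have finp: "finite p" by (rule pD(1))
   have fin: "finite p1" "finite p2" unfolding p1_def p2_def by (auto intro: finite_subset[OF _ finp])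
   have "(\<Sum>(x,K)\<in>p. measure lborel K *\<^sub>R g x) - (F b - F 0) = (\<Sum>(x,K)\<in>p. measure lborel K *\<^sub>R g x - (F (Sup K) - F (Inf K)))"
    using additive_tagged_division_1[OF b p, of F] by (simp add: case_prod_unfold sum_subtractf)
   then have "norm ((\<Sum>(x,K)\<in>p. measure lborel K *\<^sub>R g x) - (F b - F 0)) \<le> sum T p"
    unfolding T_def case_prod_unfold by (simp add: norm_sum)
   also have "sum T p = sum T (p1 \<union> p2)"
   proof (rule sum.mono_neutral_right[OF finp])
    show "p1 \<union> p2 \<subseteq> p" by (auto simp: p1_def p2_def)
    show "\<forall>i\<in>p - (p1 \<union> p2). T i = 0"
    proof
     fix i assume i: "i \<in> p - (p1 \<union> p2)"
     obtain t K where tK: "i = (t, K)" by (cases i)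
     then have c: "measure lborel K = 0" and "(t, K) \<in> p" using i by (auto simp: p1_def p2_def)
     from form[OF \<open>(t, K) \<in> p\<close>] obtain u v where uv: "K = {u..v} \<and> u \<le> t \<and> t \<le> v \<and> 0 \<le> u \<and> v \<le> b" by blast
     then have "u = v" using c by simp
     then have "K = {u..u}" using uv by simp
     then show "T i = 0" using c by (simp add: T_def tK)
    qed
   qed
   also have "\<dots> = sum T p1 + sum T p2"
    by (rule sum.union_disjoint[OF fin]) (auto simp: p1_def p2_def)
   finally have total: "norm ((\<Sum>(x,K)\<in>p. measure lborel K *\<^sub>R g x) - (F b - F 0)) \<le> sum T p1 + sum T p2" .
   have "sum T p1 \<le> (\<Sum>(x,K)\<in>p1. l * measure lborel K)"
   proof (rule sum_mono)
    fix i assume i: "i \<in> p1"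
    obtain t K where tK: "i = (t, K)" by (cases i)
    then have tp: "(t, K) \<in> p" and tN: "t \<notin> N" using i by (auto simp: p1_def)
    obtain u v where uv: "K = {u..v}" "u \<le> t" "t \<le> v" "0 \<le> u" "v \<le> b" using form[OF tp] by blast
    have t: "t \<in> {0..} - N" using uv tN by auto
    have sub: "K \<subseteq> ball t (D t)" using fineD[OF fine tp] tN t by (auto simp: \<gamma>_def)
    have "u \<in> K" "v \<in> K" using uv by simp_all
    then have "u \<in> ball t (D t)" "v \<in> ball t (D t)" by (simp_all only: subsetD[OF sub])
    then have 1: "norm (F u - F t - (u - t) *\<^sub>R f t) \<le> l * norm (u - t)" "norm (F v - F t - (v - t) *\<^sub>R f t) \<le> l * norm (v - t)"
     using D2[OF t, of u] D2[OF t, of v] uv by (simp_all add: dist_norm norm_minus_commute)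
    have "T i = norm ((F u - F t - (u - t) *\<^sub>R f t) - (F v - F t - (v - t) *\<^sub>R f t))"
     using uv tN by (simp add: T_def tK g_def algebra_simps)
    also have "\<dots> \<le> l * norm (u - t) + l * norm (v - t)"
     using norm_triangle_ineq4[of "F u - F t - (u - t) *\<^sub>R f t" "F v - F t - (v - t) *\<^sub>R f t"] 1 by linarith
    also have "\<dots> = l * measure lborel K" using uv by (simp add: algebra_simps)
    finally show "T i \<le> (case i of (x, K) => l * measure lborel K)" by (simp add: tK)
   qed
   also have "(\<Sum>(x,K)\<in>p1. l * measure lborel K) \<le> (\<Sum>(x,K)\<in>p. l * measure lborel K)"
    by (rule sum_mono2[OF finp]) (use l in \<open>auto simp: p1_def\<close>)
   also have "\<dots> = l * b"
    using additive_content_tagged_division[of p 0 b] p b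
    by (simp add: case_prod_unfold sum_distrib_left[symmetric])
   also have "\<dots> \<le> l * (b + 1)" using l by simp
   also have "\<dots> = e / 2"
   proof -
    have "e / (2 * c) * c = e / 2" if "c > 0" for c :: real using that by simp
    from this[of "b + 1"] show ?thesis using b unfolding l_def by linarith
   qed
   finally have first: "sum T p1 \<le> e / 2" .
   have "sum T p2 < e / 2"
   proof -
    have inj: "inj_on snd p2"
    proof (rule inj_onI)
     fix i j assume ij: "i \<in> p2" "j \<in> p2" "snd i = snd j"
     obtain t K s where tK: "i = (t, K)" "j = (s, K)" using ij(3) by (metis prod.collapse)
     have "i = j"
     proof (rule ccontr)
      assume "i \<noteq> j"
      then have "interior K \<inter> interior K = {}"
       using pD(5)[of t K s K] ij tK by (auto simp: p2_def)
      moreover have "(t, K) \<in> p" using ij tK by (auto simp: p2_def)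
      then obtain u v where "K = cbox u v" using pD(4) by blast
      ultimately have "measure lborel K = 0" by (simp add: content_eq_0_interior)
      then show False using ij tK by (auto simp: p2_def)
     qed
     then show "i = j" .
    qed
    have "p2 tagged_partial_division_of {0..b}"
     using p unfolding tagged_division_of_def
     by (auto intro: tagged_partial_division_subset[of p] simp: p2_def)
    then have div: "(snd ` p2) division_of \<Union>(snd ` p2)" by (rule partial_division_of_tagged_division)
    have K2: "\<exists>u v. K = {u..v} \<and> u \<le> v \<and> 0 \<le> u \<and> v \<le> b" and KU: "K \<subseteq> U" if KP: "K \<in> snd ` p2" for K
    proof -
     obtain t where t: "(t, K) \<in> p" "t \<in> N" using KP by (auto simp: p2_def)
     from form[OF t(1)] obtain u v where "K = {u..v} \<and> u \<le> t \<and> t \<le> v \<and> 0 \<le> u \<and> v \<le> b" by blast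
     then show "\<exists>u v. K = {u..v} \<and> u \<le> v \<and> 0 \<le> u \<and> v \<le> b"
      by (intro exI[of _ u] exI[of _ v]) simp
     show "K \<subseteq> U" using fineD[OF fine t(1)] t(2) by (simp add: \<gamma>_def)
    qed
    have sub: "\<Union>(snd ` p2) \<subseteq> {0..b}"
    proof (rule Union_least)
     fix K assume "K \<in> snd ` p2"
     from K2[OF this] obtain u v where "K = {u..v} \<and> u \<le> v \<and> 0 \<le> u \<and> v \<le> b" by blast
     then show "K \<subseteq> {0..b}" by simp
    qed
    have cl: "Sup K - Inf K = measure lborel K" if "K \<in> snd ` p2" for K
    proof -
     from K2[OF that] obtain u v where "K = {u..v} \<and> u \<le> v \<and> 0 \<le> u \<and> v \<le> b" by blast
     then show ?thesis by simp
    qed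
    have "measure lborel K = measure lebesgue K" if "K \<in> snd ` p2" for K
    proof -
     from K2[OF that] obtain u v where "K = {u..v}" by blast
     then show ?thesis by simp
    qed
    then have "(\<Sum>K\<in>snd ` p2. Sup K - Inf K) = (\<Sum>K\<in>snd ` p2. measure lebesgue K)"
     using cl by (intro sum.cong refl) simp
    also have "\<dots> = measure lebesgue (\<Union>(snd ` p2))" by (rule content_division[OF div])
    also have "\<dots> < r"
    proof -
     have "emeasure lebesgue (\<Union>(snd ` p2)) \<le> emeasure lebesgue U"
      using KU U(1) by (intro emeasure_mono) auto
     then have "emeasure lebesgue (\<Union>(snd ` p2)) < ennreal r" using Um by (rule le_less_trans)
     then show ?thesis using r unfolding measure_def
      by (cases "emeasure lebesgue (\<Union>(snd ` p2))" rule: ennreal_cases) (simp_all add: ennreal_less_iff)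
    qed
    finally have "(\<Sum>K\<in>snd ` p2. norm (F (Sup K) - F (Inf K))) < e / 2"
     by (rule acd[OF div sub])
    also have "(\<Sum>K\<in>snd ` p2. norm (F (Sup K) - F (Inf K))) = sum T p2"
     unfolding sum.reindex[OF inj] o_def
    proof (rule sum.cong[OF refl])
     fix i assume "i \<in> p2"
     then obtain t K where "i = (t, K)" "t \<in> N" unfolding p2_def by blast
     then show "norm (F (Sup (snd i)) - F (Inf (snd i))) = T i"
      by (simp add: T_def g_def norm_minus_commute)
    qed
    finally show ?thesis .
   qed
   then show ?thesis using total first by linarith
  qed
  show "\<exists>\<gamma>. gauge \<gamma> \<and> (\<forall>p. p tagged_division_of {0..b} \<and> \<gamma> fine p -->
    norm ((\<Sum>(x,K)\<in>p. measure lborel K *\<^sub>R g x) - (F b - F 0)) < e)"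
  proof (intro exI[of _ \<gamma>] conjI allI impI G)
   fix p assume a: "p tagged_division_of {0..b} \<and> \<gamma> fine p"
   show "norm ((\<Sum>(x,K)\<in>p. measure lborel K *\<^sub>R g x) - (F b - F 0)) < e"
    by (rule H[OF conjunct1[OF a] conjunct2[OF a]])
  qed
 qed
 then show ?thesis
  by (rule has_integral_spike[OF negN, rotated]) (simp add: g_def)
qed

lemma indef_iff_ac:
 assumes ac: "ac_loc F" and AE: "AE x in halfline. (F has_vector_derivative f x) (at x within {0..})" and f: "locL1 f"
 shows "indef F f"
 unfolding indef_def
proof (intro conjI allI impI f)
 fix x :: real assume x: "0 \<le> x"
 have "(f has_integral (F x - F 0)) {0..x}"
  using ac_deriv_has_integral[OF x _ AE] ac x by (simp add: ac_loc_def)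
 then show "F x = F 0 + integral {0..x} f" by (simp add: integral_unique)
qed

lemma cont_bounded_interval:
 fixes F :: "real => complex"
 assumes "continuous_on {0..} F"
 obtains M where "\<And>x. 0 \<le> x ==> x \<le> b ==> cmod (F x) \<le> M" "0 \<le> M"
proof -
 have "compact (F ` {0..b})" by (rule compact_continuous_image[OF continuous_on_subset[OF assms]]) auto
 then have "bounded (F ` {0..b})" by (rule compact_imp_bounded)
 then obtain M where M: "\<forall>y\<in>F ` {0..b}. norm y \<le> M" unfolding bounded_iff ..
 have "cmod (F x) \<le> \<bar>M\<bar>" if "0 \<le> x" "x \<le> b" for x
 proof -
  have "F x \<in> F ` {0..b}" using that by (intro imageI) simp
  then have "norm (F x) \<le> M" by (rule M[THEN bspec])
  then show ?thesis by linarith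
 qed
 then show ?thesis by (rule that) simp_all
qed

lemma ac_loc_mult:
 assumes F: "ac_loc F" "continuous_on {0..} F" and G: "ac_loc G" "continuous_on {0..} G"
 shows "ac_loc (\<lambda>x. F x * G x)"
 unfolding ac_loc_def abs_cont_on_def
proof (intro allI impI)
 fix b m :: real assume b: "0 \<le> b" and e: "0 < m"
 obtain A where A: "\<And>x. 0 \<le> x ==> x \<le> b ==> cmod (F x) \<le> A" "0 \<le> A" using cont_bounded_interval[OF F(2)] by blast
 obtain B where B: "\<And>x. 0 \<le> x ==> x \<le> b ==> cmod (G x) \<le> B" "0 \<le> B" using cont_bounded_interval[OF G(2)] by blast
 have e1: "m / (2 * (A + B + 1)) > 0" using e A B by simp
 have aF: "abs_cont_on 0 b F" and aG: "abs_cont_on 0 b G" using F(1) G(1) b by (auto simp: ac_loc_def)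
 from abs_cont_onE[OF aF e1] obtain d1 where d1: "d1 > 0" "\<And>d S. d division_of S ==> S \<subseteq> {0..b} ==> (\<Sum>K\<in>d. Sup K - Inf K) < d1
    ==> (\<Sum>K\<in>d. norm (F (Sup K) - F (Inf K))) < m / (2 * (A + B + 1))"
  using aF e1 unfolding abs_cont_on_def by blast
 from abs_cont_onE[OF aG e1] obtain d2 where d2: "d2 > 0" "\<And>d S. d division_of S ==> S \<subseteq> {0..b} ==> (\<Sum>K\<in>d. Sup K - Inf K) < d2
    ==> (\<Sum>K\<in>d. norm (G (Sup K) - G (Inf K))) < m / (2 * (A + B + 1))"
  using aG e1 unfolding abs_cont_on_def by blast
 show "\<exists>r>0. \<forall>d S. d division_of S \<and> S \<subseteq> {0..b} \<and> (\<Sum>K\<in>d. Sup K - Inf K) < r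
     --> (\<Sum>K\<in>d. norm (F (Sup K) * G (Sup K) - F (Inf K) * G (Inf K))) < m"
 proof (intro exI[of _ "min d1 d2"] conjI allI impI)
  show "0 < min d1 d2" using d1 d2 by simp
  fix d S assume a: "d division_of S \<and> S \<subseteq> {0..b} \<and> (\<Sum>K\<in>d. Sup K - Inf K) < min d1 d2"
  then have d: "d division_of S" and S: "S \<subseteq> {0..b}" by auto
  have sF: "(\<Sum>K\<in>d. norm (F (Sup K) - F (Inf K))) < m / (2 * (A + B + 1))" by (rule d1(2)[OF d S]) (use a in simp)
  have sG: "(\<Sum>K\<in>d. norm (G (Sup K) - G (Inf K))) < m / (2 * (A + B + 1))" by (rule d2(2)[OF d S]) (use a in simp)
  have "(\<Sum>K\<in>d. norm (F (Sup K) * G (Sup K) - F (Inf K) * G (Inf K)))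
    \<le> (\<Sum>K\<in>d. A * norm (G (Sup K) - G (Inf K)) + B * norm (F (Sup K) - F (Inf K)))"
  proof (rule sum_mono)
   fix K assume K: "K \<in> d"
   obtain u v where uv: "K = cbox u v" using division_ofD(4)[OF d K] by blast
   have ne: "K \<noteq> {}" "K \<subseteq> {0..b}" using division_ofD(2,3)[OF d K] S by auto
   then have uv': "u \<le> v" "0 \<le> u" "v \<le> b" by (auto simp: uv)
   have "F v * G v - F u * G u = F v * (G v - G u) + G u * (F v - F u)" by (simp add: algebra_simps)
   then have "norm (F v * G v - F u * G u) \<le> norm (F v) * norm (G v - G u) + norm (G u) * norm (F v - F u)"
    by (metis norm_mult norm_triangle_ineq)
   also have "\<dots> \<le> A * norm (G v - G u) + B * norm (F v - F u)"
    using A(1)[of v] B(1)[of u] uv' by (intro add_mono mult_right_mono) auto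
   finally show "norm (F (Sup K) * G (Sup K) - F (Inf K) * G (Inf K)) \<le> A * norm (G (Sup K) - G (Inf K)) + B * norm (F (Sup K) - F (Inf K))"
    using uv' by (simp add: uv)
  qed
  also have "\<dots> = A * (\<Sum>K\<in>d. norm (G (Sup K) - G (Inf K))) + B * (\<Sum>K\<in>d. norm (F (Sup K) - F (Inf K)))"
   by (simp add: sum.distrib sum_distrib_left)
  also have "\<dots> \<le> A * (m / (2 * (A + B + 1))) + B * (m / (2 * (A + B + 1)))"
   using sF sG A(2) B(2) by (intro add_mono mult_left_mono) auto
  also have "\<dots> = (A + B) * (m / (2 * (A + B + 1)))" by (rule distrib_right[symmetric])
  also have "\<dots> \<le> (A + B + 1) * (m / (2 * (A + B + 1)))" using e1 by (intro mult_right_mono) auto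
  also have "\<dots> = m / 2"
  proof -
   have "c * (m / (2 * c)) = m / 2" if "c > 0" for c :: real using that by simp
   from this[of "A + B + 1"] show ?thesis using A(2) B(2) by linarith
  qed
  finally show "(\<Sum>K\<in>d. norm (F (Sup K) * G (Sup K) - F (Inf K) * G (Inf K))) < m" using e by simp
 qed
qed

lemma locL1_mult_cont:
 assumes F: "continuous_on {0..} F" and f: "locL1 f"
 shows "locL1 (\<lambda>x. F x * f x)"
 unfolding locL1_def
proof
 fix b
 have c: "continuous_on {0..b} F" by (rule continuous_on_subset[OF F]) auto
 show "(\<lambda>x. F x * f x) absolutely_integrable_on {0..b}"
 proof (rule absolutely_integrable_bounded_measurable_product[where h="(*)" and f=F and g=f])
  show "bilinear ((*) :: complex => complex => complex)" by (rule bilinear_times)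
  show "F \<in> borel_measurable (lebesgue_on {0..b})"
   by (rule continuous_imp_measurable_on_sets_lebesgue[OF c]) simp
  show "bounded (F ` {0..b})" using compact_continuous_image[OF c] compact_imp_bounded by blast
  show "f absolutely_integrable_on {0..b}" using f by (simp add: locL1_sub)
 qed simp
qed

lemma locL1_add: "locL1 f ==> locL1 g ==> locL1 (\<lambda>x. f x + g x)"
 unfolding locL1_def by (blast intro: set_integral_add)

lemma locL1_cmult: "locL1 f ==> locL1 (\<lambda>x. c * f x)"
 by (rule locL1_mult_cont) simp

text \<open>The product rule holds almost everywhere, and \<open>indef_iff_ac\<close> upgrades it
  because products of the absolutely continuous factors stay absolutely continuous.\<close>

lemma indef_mult:
 assumes F: "indef F f" and G: "indef G g"
 shows "indef (\<lambda>x. F x * G x) (\<lambda>x. F x * g x + f x * G x)"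
proof (rule indef_iff_ac)
 show "ac_loc (\<lambda>x. F x * G x)"
  by (intro ac_loc_mult indef_ac_loc[OF F] indef_ac_loc[OF G] indef_continuous[OF F] indef_continuous[OF G])
 show "AE x in halfline. ((\<lambda>x. F x * G x) has_vector_derivative F x * g x + f x * G x) (at x within {0..})"
  using indef_AE_deriv[OF F] indef_AE_deriv[OF G]
  by eventually_elim (rule bounded_bilinear.has_vector_derivative[OF bounded_bilinear_mult])
 have "locL1 (\<lambda>x. G x * f x)" by (rule locL1_mult_cont[OF indef_continuous[OF G] indef_locL1[OF F]])
 then show "locL1 (\<lambda>x. F x * g x + f x * G x)"
  by (intro locL1_add locL1_mult_cont[OF indef_continuous[OF F] indef_locL1[OF G]]) (simp add: mult.commute)
qed

lemma indef_cmult: assumes F: "indef F f" shows "indef (\<lambda>x. c * F x) (\<lambda>x. c * f x)"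
 unfolding indef_def
proof (intro conjI allI impI locL1_cmult indef_locL1[OF F])
 fix x :: real assume x: "0 \<le> x"
 show "c * F x = c * F 0 + integral {0..x} (\<lambda>x. c * f x)"
  by (subst indefD[OF F x]) (simp add: distrib_left)
qed

lemma indef_add: assumes F: "indef F f" and G: "indef G g" shows "indef (\<lambda>x. F x + G x) (\<lambda>x. f x + g x)"
 unfolding indef_def
proof (intro conjI allI impI locL1_add indef_locL1[OF F] indef_locL1[OF G])
 fix x :: real assume x: "0 \<le> x"
 have "integral {0..x} (\<lambda>x. f x + g x) = integral {0..x} f + integral {0..x} g"
  by (rule integral_add) (intro locL1_integrable_on indef_locL1[OF F] indef_locL1[OF G]; simp)+
 then show "F x + G x = F 0 + G 0 + integral {0..x} (\<lambda>x. f x + g x)"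
  by (subst indefD[OF F x], subst indefD[OF G x]) simp
qed

lemma indef_diff': "indef F f ==> indef G g ==> indef (\<lambda>x. F x - G x) (\<lambda>x. f x - g x)"
 using indef_add[OF _ indef_cmult[of G g "-1"], of F f] by simp

lemma indef_cnj: assumes F: "indef F f" shows "indef (\<lambda>x. cnj (F x)) (\<lambda>x. cnj (f x))"
 unfolding indef_def
proof (intro conjI allI impI)
 show "locL1 (\<lambda>x. cnj (f x))"
  using indef_locL1[OF F] unfolding locL1_def
  by (auto intro!: absolutely_integrable_linear[where h=cnj, unfolded o_def] bounded_linear_cnj)
 fix x :: real assume x: "0 \<le> x"
 have "integral {0..x} (cnj \<circ> f) = cnj (integral {0..x} f)"
  by (rule integral_linear[OF _ bounded_linear_cnj]) (rule locL1_integrable_on[OF indef_locL1[OF F]], simp)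
 then show "cnj (F x) = cnj (F 0) + integral {0..x} (\<lambda>x. cnj (f x))"
  by (subst indefD[OF F x]) (simp add: o_def)
qed

lemma indef_C1:
 assumes d: "\<And>x. 0 \<le> x ==> (F has_vector_derivative f x) (at x within {0..})" and c: "continuous_on {0..} f"
 shows "indef F f"
 unfolding indef_def locL1_def
proof (intro conjI allI impI)
 show "f absolutely_integrable_on {0..b}" for b
  by (rule absolutely_integrable_continuous_real, rule continuous_on_subset[OF c]) auto
 fix x :: real assume x: "0 \<le> x"
 have "(f has_integral (F x - F 0)) {0..x}"
  by (rule fundamental_theorem_of_calculus[OF x], rule has_vector_derivative_within_subset[OF d]) auto
 then show "F x = F 0 + integral {0..x} f" by (simp add: integral_unique)
qed

lemma indef_cong:
 assumes F: "indef F f" and eq: "\<And>x. 0 \<le> x ==> G x = F x" "\<And>x. 0 \<le> x ==> g x = f x"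
 shows "indef G g"
 unfolding indef_def locL1_def
proof (intro conjI allI impI)
 fix b
 have "f absolutely_integrable_on {0..b}" using locL1_sub[OF indef_locL1[OF F]] by simp
 then show "g absolutely_integrable_on {0..b}"
  unfolding set_integrable_def
  by (subst Bochner_Integration.integrable_cong[OF refl, of _ _ "\<lambda>x. indicat_real {0..b} x *\<^sub>R f x"]) (auto simp: eq indicator_def)
next
 fix x :: real assume x: "0 \<le> x"
 have "integral {0..x} g = integral {0..x} f" by (rule integral_cong) (simp add: eq)
 then show "G x = G 0 + integral {0..x} g" using indefD[OF F x] by (simp only: eq(1)[OF x] eq(1)[OF order_refl])
qed

section \<open>Integration by parts up to infinity\<close>

lemma integral_halfline_tendsto:
 fixes w :: "real => complex"
 assumes w: "integrable halfline w"
 shows "((\<lambda>x. integral {0..x} w) \<longlongrightarrow> (LINT x|halfline. w x)) at_top"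
proof -
 have [measurable]: "w \<in> borel_measurable halfline" using w by (rule borel_measurable_integrable)
 have ind: "(\<lambda>x. indicator {0..t} x *\<^sub>R w x) \<in> borel_measurable halfline" for t :: real
  by (intro borel_measurable_scaleR borel_measurable_indicator) (simp_all add: sets_restrict_space_iff)
 have "((\<lambda>t. LINT x|halfline. indicator {0..t} x *\<^sub>R w x) \<longlongrightarrow> (LINT x|halfline. w x)) at_top"
 proof (rule integral_dominated_convergence_at_top[where w="\<lambda>x. norm (w x)"])
  show "AE x in halfline. ((\<lambda>t. indicator {0..t} x *\<^sub>R w x) \<longlongrightarrow> w x) at_top"
  proof (rule AE_I2, rule tendsto_eventually)
   fix x assume "x \<in> space halfline"
   then show "\<forall>\<^sub>F t in at_top. indicator {0..t} x *\<^sub>R w x = w x"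
    by (intro eventually_mono[OF eventually_ge_at_top[of x]]) simp
  qed
  show "\<forall>\<^sub>F t in at_top. AE x in halfline. norm (indicator {0..t} x *\<^sub>R w x) \<le> norm (w x)"
   by (auto simp: indicator_def)
 qed (use w ind in auto)
 moreover have "(LINT x|halfline. indicator {0..t} x *\<^sub>R w x) = integral {0..t} w" for t
  by (rule integral_halfline_interval) (simp_all add: locL1_sub[OF locL1_integrable[OF w]])
 ultimately show ?thesis by simp
qed

lemma integrable_not_bounded_below:
 fixes W :: "real => complex"
 assumes W: "integrable halfline W" and c: "c > 0" and b0: "\<And>x. x \<ge> b0 ==> c \<le> norm (W x)"
 shows False
proof -
 define b where "b = max 0 b0"
 have int: "c * t \<le> (LINT x|halfline. norm (W x))" if t: "t \<ge> 0" for t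
 proof -
  have ip: "(\<lambda>x. complex_of_real c) absolutely_integrable_on {b..b + t}" by (rule absolutely_integrable_continuous_real) simp
  then have i: "integrable halfline (\<lambda>x. indicator {b..b + t} x *\<^sub>R complex_of_real c)"
   by (subst (asm) abs_int_halfline_iff) (auto simp: b_def)
  have "complex_of_real (c * t) = integral {b..b + t} (\<lambda>x. complex_of_real c)" using t by (simp add: scaleR_conv_of_real)
  also have "\<dots> = (LINT x|halfline. indicator {b..b + t} x *\<^sub>R complex_of_real c)"
   by (rule integral_halfline_interval[symmetric]) (use ip in \<open>auto simp: b_def\<close>)
  finally have "c * t = norm (LINT x|halfline. indicator {b..b + t} x *\<^sub>R complex_of_real c)"
   using c t by (metis norm_of_real abs_of_nonneg mult_nonneg_nonneg less_imp_le)
  also have "\<dots> \<le> (LINT x|halfline. norm (indicator {b..b + t} x *\<^sub>R complex_of_real c))" by (rule integral_norm_bound)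
  also have "\<dots> \<le> (LINT x|halfline. norm (W x))"
  proof (rule integral_mono[OF integrable_norm[OF i] integrable_norm[OF W]])
   fix x
   show "norm (indicator {b..b + t} x *\<^sub>R complex_of_real c) \<le> norm (W x)"
    using b0[of x] c by (auto simp: indicator_def b_def)
  qed
  finally show ?thesis .
 qed
 define I where "I = (LINT x|halfline. norm (W x))"
 have "0 \<le> I" unfolding I_def by simp
 then have "c * ((I + 1) / c) \<le> I" using int[of "(I + 1) / c"] c unfolding I_def by simp
 then show False using c by simp
qed

lemma integrable_limit_zero:
 fixes W :: "real => complex"
 assumes W: "integrable halfline W" and lim: "(W \<longlongrightarrow> L) at_top"
 shows "L = 0"
proof (rule ccontr)
 assume L: "L \<noteq> 0"
 have "norm L / 2 < norm L" using L by simp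
 with tendsto_norm[OF lim] have "\<forall>\<^sub>F x in at_top. norm L / 2 < norm (W x)" by (rule order_tendstoD(1))
 then obtain b0 where "\<forall>x\<ge>b0. norm L / 2 < norm (W x)" unfolding eventually_at_top_linorder by blast
 then show False using L by (intro integrable_not_bounded_below[OF W, of "norm L / 2" b0]) auto
qed

text \<open>\<open>W\<close> has a limit at infinity because \<open>w\<close> is integrable, and the
  only possible limit of an integrable function is 0. Hence \<open>indef_ibp\<close> has no boundary
  term at infinity.\<close>

lemma indef_integral_total:
 assumes W: "indef W w" and iW: "integrable halfline W" and iw: "integrable halfline w"
 shows "(LINT x|halfline. w x) = - W 0"
proof -
 have "((\<lambda>x. W 0 + integral {0..x} w) \<longlongrightarrow> W 0 + (LINT x|halfline. w x)) at_top"
  by (intro tendsto_intros integral_halfline_tendsto iw)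
 moreover have "\<forall>\<^sub>F x in at_top. W 0 + integral {0..x} w = W x"
  using eventually_ge_at_top[of 0] by eventually_elim (rule indefD[OF W, symmetric])
 ultimately have "(W \<longlongrightarrow> W 0 + (LINT x|halfline. w x)) at_top" by (rule Lim_transform_eventually)
 from integrable_limit_zero[OF iW this] show ?thesis by (simp add: add_eq_0_iff)
qed

lemma indef_ibp:
 assumes U: "indef U u" and W: "indef W w" and L: "U \<in> L2" "u \<in> L2" "W \<in> L2" "w \<in> L2"
 shows "(LINT x|halfline. U x * w x) = - U 0 * W 0 - (LINT x|halfline. u x * W x)"
proof -
 have "(LINT x|halfline. U x * w x + u x * W x) = - (U 0 * W 0)"
  by (rule indef_integral_total[OF indef_mult[OF U W]])
   (intro Bochner_Integration.integrable_add L2_prod_integrable L)+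
 moreover have "(LINT x|halfline. U x * w x + u x * W x) = (LINT x|halfline. U x * w x) + (LINT x|halfline. u x * W x)"
  by (intro Bochner_Integration.integral_add L2_prod_integrable L)
 ultimately show ?thesis by (simp add: eq_diff_eq)
qed

section \<open>Uniqueness of weak derivatives\<close>

lemma halfline_within_nontriv: "x \<ge> 0 ==> at x within {0..} \<noteq> (bot :: real filter)"
 using nontriv_atLeast[of 0] by (simp add: nontriv_def)

text \<open>Bumps approximate indicators of intervals with left end \<open>a > 0\<close>, where test
  functions live; so the primitive \<open>D\<close> of \<open>d\<close> is constant on the open
  half-line. Continuity at 0 makes it zero, and its derivative with it.\<close>

lemma fundamental_lemma:
 assumes d: "d \<in> L2" and z: "\<And>q. test_fun q ==> (LINT x|halfline. d x * q x) = 0"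
 shows "AE x in halfline. d x = 0"
proof -
 have lo: "locL1 d" using d by (rule locL1_L2)
 have [measurable]: "d \<in> borel_measurable halfline" using d by (rule L2_measurable)
 have int0: "integral {a..b} d = 0" if a: "0 < a" for a b
 proof -
  have i: "integrable halfline (\<lambda>x. indicator {a..b} x *\<^sub>R d x)"
   using locL1_sub[OF lo, of a b] a by (simp add: abs_int_halfline_iff)
  have bm: "bump_on n a b \<in> borel_measurable halfline" for n
  proof -
   have "continuous_on UNIV (bump_on n a b)"
    using test_fun_bump_on[OF a, of n b] smooth_continuous[of UNIV "bump_on n a b" 0] by (simp add: test_fun_def)
   then have "bump_on n a b \<in> borel_measurable lebesgue"
    by (intro measurable_completion) (simp add: borel_measurable_continuous_onI)
   then show ?thesis by (rule measurable_restrict_space1)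
  qed
  have "(\<lambda>n. LINT x|halfline. d x * bump_on n a b x) \<longlonglongrightarrow> (LINT x|halfline. d x * indicator {a<..<b} x)"
  proof (rule integral_dominated_convergence[OF _ _ integrable_norm[OF i]])
   show "(\<lambda>x. d x * indicator {a<..<b} x) \<in> borel_measurable halfline"
    using a by (intro borel_measurable_times borel_measurable_indicator) (auto simp: sets_restrict_space_iff)
   show "(\<lambda>x. d x * bump_on n a b x) \<in> borel_measurable halfline" for n using bm by measurable
   show "AE x in halfline. (\<lambda>n. d x * bump_on n a b x) \<longlonglongrightarrow> d x * indicator {a<..<b} x"
    by (rule AE_I2) (intro tendsto_intros bump_on_tendsto)
   show "AE x in halfline. norm (d x * bump_on n a b x) \<le> norm (indicator {a..b} x *\<^sub>R d x)" for n
   proof (rule AE_I2)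
    fix x
    show "norm (d x * bump_on n a b x) \<le> norm (indicator {a..b} x *\<^sub>R d x)"
     using mult_left_mono[OF bump_on_bound[of n a b x] norm_ge_zero[of "d x"]] by (simp add: norm_mult mult.commute)
   qed
  qed
  then have "(LINT x|halfline. d x * indicator {a<..<b} x) = 0"
   using z[OF test_fun_bump_on[OF a]] by (simp add: LIMSEQ_const_iff)
  moreover have "(LINT x|halfline. d x * indicator {a<..<b} x) = (LINT x|halfline. indicator {a..b} x *\<^sub>R d x)"
  proof (rule integral_cong_AE)
   have "AE x in halfline. x \<notin> {a, b}" by (rule AE_halfline_negligible) simp
   then show "AE x in halfline. d x * indicator {a<..<b} x = indicator {a..b} x *\<^sub>R d x"
    by eventually_elim (auto simp: indicator_def)
   show "(\<lambda>x. d x * indicator {a<..<b} x) \<in> borel_measurable halfline"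
    using a by (intro borel_measurable_times borel_measurable_indicator) (auto simp: sets_restrict_space_iff)
  qed (use i in auto)
  ultimately show ?thesis using integral_halfline_interval[OF _ locL1_sub[OF lo], of a b] a by simp
 qed
 define D where "D x = integral {0..x} d" for x
 have D: "indef D d" by (simp add: indef_def lo D_def)
 have D0: "D x = 0" if x: "x \<ge> 0" for x
 proof -
  have const: "D y = D 1" if "y > 0" for y
  proof (cases "y \<le> 1")
   case True
   then have "D 1 - D y = 0" using indef_diff[OF D, of y 1] int0[of y 1] that by simp
   then show ?thesis by simp
  next
   case False
   then have "D y - D 1 = 0" using indef_diff[OF D, of 1 y] int0[of 1 y] by simp
   then show ?thesis by simp
  qed
  have "(D \<longlongrightarrow> D 0) (at 0 within {0..})"
   using indef_continuous[OF D] unfolding continuous_on_def by (rule bspec) simp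
  then have "(D \<longlongrightarrow> D 0) (at_right 0)" by (rule tendsto_within_subset) auto
  moreover have "\<forall>\<^sub>F y in at_right 0. D y = D 1" using eventually_at_right_less[of "0::real"] by eventually_elim (rule const)
  then have "(D \<longlongrightarrow> D 1) (at_right 0)" by (rule tendsto_eventually)
  ultimately have "D 0 = D 1" by (rule tendsto_unique[OF trivial_limit_at_right_real])
  moreover have "D 0 = 0" by (simp add: D_def)
  ultimately show ?thesis using const[of x] x by (cases "x = 0") simp_all
 qed
 have "AE x in halfline. (D has_vector_derivative d x) (at x within {0..})" by (rule indef_AE_deriv[OF D])
 moreover have "AE x in halfline. x \<in> space halfline" by (rule AE_space)
 ultimately show ?thesis
 proof eventually_elim
  case (elim x)
  then have x: "x \<in> {0..}" by simp
  have "((\<lambda>_. 0) has_vector_derivative d x) (at x within {0..})"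
   by (rule has_vector_derivative_transform[OF x _ elim(1)]) (simp add: D0)
  moreover have "((\<lambda>_. 0 :: complex) has_vector_derivative 0) (at x within {0..})" by simp
  ultimately show ?case
   by (rule vector_derivative_unique_within[OF halfline_within_nontriv, rotated]) (use x in simp)
 qed
qed

text \<open>The difference annihilates all test functions; these lie in \<open>L2\<close>, which
  permits subtracting the integrals. So the choice of a weak derivative inside
  \<open>sobolev_norm\<close> does not affect its value.\<close>

lemma weak_deriv_unique:
 assumes "h \<in> L2" "k \<in> L2" "weak_deriv j f h" "weak_deriv j f k"
 shows "l2_eq h k"
proof -
 have tL2: "q \<in> L2" if t: "test_fun q" for q
 proof -
  have c: "continuous_on UNIV q" using t smooth_continuous[of UNIV q 0] by (simp add: test_fun_def)
  have cp: "compact (closure {x. q x \<noteq> 0})" and cs: "closure {x. q x \<noteq> 0} \<subseteq> {0<..}" using t by (auto simp: test_fun_def)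
  obtain M where M: "\<And>x. x \<in> closure {x. q x \<noteq> 0} ==> norm (q x) \<le> M"
   using compact_imp_bounded[OF compact_continuous_image[OF continuous_on_subset[OF c subset_UNIV] cp]]
   unfolding bounded_iff by blast
  obtain B where B: "\<And>x. x \<in> closure {x. q x \<noteq> 0} ==> norm x \<le> B"
   using compact_imp_bounded[OF cp] unfolding bounded_iff by blast
  have pt: "q x = q x * indicator {0..B} x" for x
  proof (cases "q x = 0")
   case False
   then have "x \<in> closure {x. q x \<noteq> 0}" using closure_subset[of "{x. q x \<noteq> 0}"] by blast
   then have "0 < x" "norm x \<le> B" using cs B by auto
   then show ?thesis by (simp add: indicator_def)
  qed simp
  have Mb: "cmod (q x) \<le> \<bar>M\<bar>" for x
  proof (cases "q x = 0")
   case False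
   then have "x \<in> closure {x. q x \<noteq> 0}" using closure_subset[of "{x. q x \<noteq> 0}"] by blast
   then show ?thesis using M[of x] by simp
  qed simp
  have "q \<in> borel_measurable halfline"
   by (intro measurable_restrict_space1 measurable_completion) (simp add: c borel_measurable_continuous_onI)
  from L2_mult_bounded[OF this Mb interval_L2[OF order_refl, of B]] show ?thesis using pt by simp
 qed
 have "AE x in halfline. h x - k x = 0"
 proof (rule fundamental_lemma[OF L2_diff[OF assms(1,2)]])
  fix q assume t: "test_fun q"
  have "(-1) ^ j * (LINT x|halfline. h x * q x) = (-1) ^ j * (LINT x|halfline. k x * q x)"
   by (rule trans[OF sym[OF assms(3)[unfolded weak_deriv_def, THEN spec, THEN mp, OF t]]
    assms(4)[unfolded weak_deriv_def, THEN spec, THEN mp, OF t]])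
  then have "(LINT x|halfline. h x * q x) = (LINT x|halfline. k x * q x)" by simp
  moreover have "(LINT x|halfline. (h x - k x) * q x) = (LINT x|halfline. h x * q x) - (LINT x|halfline. k x * q x)"
   unfolding left_diff_distrib by (intro Bochner_Integration.integral_diff L2_prod_integrable assms tL2[OF t])
  ultimately show "(LINT x|halfline. (h x - k x) * q x) = 0" by simp
 qed
 then show ?thesis by (simp add: l2_eq_def)
qed

section \<open>The operator and its resolvent\<close>

lemma cmod_sq: "(cmod z)\<^sup>2 = Re z * Re z + Im z * Im z"
 unfolding cmod_power2 by (simp only: power2_eq_square)

lemma L2_local:
 assumes h: "h \<in> L2" and a: "0 \<le> a"
 shows "(\<lambda>x. (cmod (h x))\<^sup>2) integrable_on {a..b}"
  and "integral {a..b} (\<lambda>x. (cmod (h x))\<^sup>2) \<le> (norm (cls h))\<^sup>2"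
proof -
 have I: "((\<lambda>x. (cmod (h x))\<^sup>2) has_integral (norm (cls h))\<^sup>2) {0..}"
  unfolding norm_cls_sq[OF h] by (rule has_integral_integral_lebesgue_on[OF L2_integrable[OF h]]) simp
 then have i: "(\<lambda>x. (cmod (h x))\<^sup>2) integrable_on {0..}" by (rule has_integral_integrable)
 show j: "(\<lambda>x. (cmod (h x))\<^sup>2) integrable_on {a..b}"
  by (rule integrable_on_subinterval[OF i]) (use a in auto)
 have "integral {a..b} (\<lambda>x. (cmod (h x))\<^sup>2) \<le> integral {0..} (\<lambda>x. (cmod (h x))\<^sup>2)"
  by (rule integral_subset_le[OF _ j i]) (use a in auto)
 then show "integral {a..b} (\<lambda>x. (cmod (h x))\<^sup>2) \<le> (norm (cls h))\<^sup>2"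
  by (simp only: integral_unique[OF I])
qed

lemma cont_measurable_halfline: "continuous_on {0..} F ==> F \<in> borel_measurable halfline"
 by (rule continuous_imp_measurable_on_sets_lebesgue) simp_all

text \<open>Fatou along the intervals \<open>{0..n}\<close>; continuity supplies measurability and
  local integrability.\<close>

lemma L2_from_local:
 assumes G: "continuous_on {0..} G" and C: "0 \<le> C"
  and le: "\<And>b. 0 \<le> b ==> integral {0..b} (\<lambda>x. (cmod (G x))\<^sup>2) \<le> C"
 shows "G \<in> L2"
proof -
 have [measurable]: "G \<in> borel_measurable halfline" by (rule cont_measurable_halfline[OF G])
 have ind: "indicator {0..real n} \<in> borel_measurable halfline" for n
  by (intro borel_measurable_indicator) (auto simp: sets_restrict_space_iff)
 have fin: "(\<integral>\<^sup>+x. indicator {0..real n} x * ennreal ((cmod (G x))\<^sup>2) \<partial>halfline) \<le> ennreal C" for n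
 proof -
  have cG: "continuous_on {0..real n} G" by (rule continuous_on_subset[OF G]) auto
  have "(\<lambda>x. complex_of_real ((cmod (G x))\<^sup>2)) absolutely_integrable_on {0..real n}"
   by (rule absolutely_integrable_continuous_real) (intro continuous_intros cG)
  then have "integrable halfline (\<lambda>x. indicator {0..real n} x *\<^sub>R complex_of_real ((cmod (G x))\<^sup>2))"
   and eq: "(LINT x|halfline. indicator {0..real n} x *\<^sub>R complex_of_real ((cmod (G x))\<^sup>2)) = integral {0..real n} (\<lambda>x. complex_of_real ((cmod (G x))\<^sup>2))"
   using abs_int_halfline_iff[of 0] integral_halfline_interval[of 0] by simp_all
  then have i: "integrable halfline (\<lambda>x. complex_of_real (indicator {0..real n} x * (cmod (G x))\<^sup>2))"
   by (simp add: scaleR_conv_of_real)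
  then have i': "integrable halfline (\<lambda>x. indicator {0..real n} x * (cmod (G x))\<^sup>2)"
   by (subst (asm) complex_of_real_integrable_eq)
  have "(\<lambda>x. (cmod (G x))\<^sup>2) integrable_on {0..real n}"
   by (rule integrable_continuous_real) (intro continuous_intros cG)
  then have "integral {0..real n} (\<lambda>x. complex_of_real ((cmod (G x))\<^sup>2)) = complex_of_real (integral {0..real n} (\<lambda>x. (cmod (G x))\<^sup>2))"
   by (rule integral_linear[OF _ bounded_linear_of_real, unfolded o_def])
  moreover have "(LINT x|halfline. indicator {0..real n} x *\<^sub>R complex_of_real ((cmod (G x))\<^sup>2))
    = complex_of_real (LINT x|halfline. indicator {0..real n} x * (cmod (G x))\<^sup>2)"
   by (simp only: scaleR_conv_of_real of_real_mult[symmetric] integral_complex_of_real)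
  ultimately have "(LINT x|halfline. indicator {0..real n} x * (cmod (G x))\<^sup>2) = integral {0..real n} (\<lambda>x. (cmod (G x))\<^sup>2)"
   using eq by (metis of_real_eq_iff)
  then have le': "(LINT x|halfline. indicator {0..real n} x * (cmod (G x))\<^sup>2) \<le> C" using le[of "real n"] by simp
  have "(\<integral>\<^sup>+x. indicator {0..real n} x * ennreal ((cmod (G x))\<^sup>2) \<partial>halfline) = (\<integral>\<^sup>+x. ennreal (indicator {0..real n} x * (cmod (G x))\<^sup>2) \<partial>halfline)"
   by (intro nn_integral_cong) (simp add: indicator_def)
  also have "\<dots> = ennreal (LINT x|halfline. indicator {0..real n} x * (cmod (G x))\<^sup>2)"
   by (rule nn_integral_eq_integral[OF i']) simp
  also have "\<dots> \<le> ennreal C" using le' by (rule ennreal_leI)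
  finally show ?thesis .
 qed
 have "(\<integral>\<^sup>+x. ennreal ((cmod (G x))\<^sup>2) \<partial>halfline) = (\<integral>\<^sup>+x. liminf (\<lambda>n. indicator {0..real n} x * ennreal ((cmod (G x))\<^sup>2)) \<partial>halfline)"
 proof (rule nn_integral_cong)
  fix x assume "x \<in> space halfline"
  then have x: "0 \<le> x" by simp
  obtain N where N: "x \<le> real N" using real_arch_simple by blast
  have "(\<lambda>n. indicator {0..real n} x * ennreal ((cmod (G x))\<^sup>2)) \<longlonglongrightarrow> ennreal ((cmod (G x))\<^sup>2)"
   by (rule tendsto_eventually, unfold eventually_sequentially, rule exI[of _ N]) (use N x in simp)
  from lim_imp_Liminf[OF trivial_limit_sequentially this]
  show "ennreal ((cmod (G x))\<^sup>2) = liminf (\<lambda>n. indicator {0..real n} x * ennreal ((cmod (G x))\<^sup>2))" by (rule sym)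
 qed
 also have "\<dots> \<le> liminf (\<lambda>n. \<integral>\<^sup>+x. indicator {0..real n} x * ennreal ((cmod (G x))\<^sup>2) \<partial>halfline)"
  by (rule nn_integral_liminf) (use ind in measurable)
 also have "\<dots> \<le> liminf (\<lambda>n::nat. ennreal C)" by (rule Liminf_mono) (simp add: fin)
 also have "\<dots> = ennreal ((sqrt C)\<^sup>2)" using C by (simp add: Liminf_const)
 finally show ?thesis by (rule L2_nn_I(1)[rotated]) (use C in simp_all)
qed

lemma Re_integral: "f integrable_on S ==> (\<lambda>x. Re (f x)) integrable_on S \<and> integral S (\<lambda>x. Re (f x)) = Re (integral S f)"
 using integrable_linear[OF _ bounded_linear_Re, of f S] integral_linear[OF _ bounded_linear_Re, of f S]
 by (simp add: o_def)

text \<open>The differential inequality \<open>pt\<close> is integrated over \<open>{0..b}\<close>: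
  as \<open>Re Y\<close> increases by at most \<open>B\<close> whatever \<open>b\<close> is, the
  local integrals of \<open>|G|^2\<close> stay bounded.\<close>

lemma energy_L2:
 assumes Y: "indef Y y" and G: "continuous_on {0..} G" and h: "h \<in> L2" and c: "c > 0" and d: "d \<ge> 0" and B: "B \<ge> 0"
  and pt: "\<And>x. 0 \<le> x ==> c * (cmod (G x))\<^sup>2 \<le> Re (y x) + d * (cmod (h x))\<^sup>2"
  and bd: "\<And>b. 0 \<le> b ==> Re (Y b) - Re (Y 0) \<le> B"
 shows "G \<in> L2"
proof (rule L2_from_local[OF G])
 show "0 \<le> (B + d * (norm (cls h))\<^sup>2) / c" using c d B by simp
 fix b :: real assume b: "0 \<le> b"
 have cG: "continuous_on {0..b} G" by (rule continuous_on_subset[OF G]) auto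
 have iG: "(\<lambda>x. (cmod (G x))\<^sup>2) integrable_on {0..b}"
  by (rule integrable_continuous_real) (intro continuous_intros cG)
 have iy: "(\<lambda>x. Re (y x)) integrable_on {0..b}" "integral {0..b} (\<lambda>x. Re (y x)) = Re (integral {0..b} y)"
  using Re_integral[OF locL1_integrable_on[OF indef_locL1[OF Y] order_refl]] by blast+
 have ih: "(\<lambda>x. d * (cmod (h x))\<^sup>2) integrable_on {0..b}"
  by (rule integrable_on_mult_right[OF L2_local(1)[OF h order_refl]])
 have "c * integral {0..b} (\<lambda>x. (cmod (G x))\<^sup>2) = integral {0..b} (\<lambda>x. c * (cmod (G x))\<^sup>2)"
  by simp
 also have "\<dots> \<le> integral {0..b} (\<lambda>x. Re (y x) + d * (cmod (h x))\<^sup>2)"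
  by (rule integral_le[OF integrable_on_mult_right[OF iG] integrable_add[OF iy(1) ih]]) (simp add: pt)
 also have "\<dots> = Re (integral {0..b} y) + d * integral {0..b} (\<lambda>x. (cmod (h x))\<^sup>2)"
  using integral_add[OF iy(1) ih] iy(2) by simp
 also have "Re (integral {0..b} y) \<le> B"
  using bd[OF b] indef_diff[OF Y order_refl b] by (metis minus_complex.simps(1))
 also have "d * integral {0..b} (\<lambda>x. (cmod (h x))\<^sup>2) \<le> d * (norm (cls h))\<^sup>2"
  by (rule mult_left_mono[OF L2_local(2)[OF h order_refl] d])
 finally have "c * integral {0..b} (\<lambda>x. (cmod (G x))\<^sup>2) \<le> B + d * (norm (cls h))\<^sup>2" by simp
 then show "integral {0..b} (\<lambda>x. (cmod (G x))\<^sup>2) \<le> (B + d * (norm (cls h))\<^sup>2) / c"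
  using c by (simp add: pos_le_divide_eq mult.commute)
qed

lemma indef_cont_deriv:
 assumes F: "indef F f" and c: "continuous_on {0..} f" and x: "0 \<le> x"
 shows "(F has_vector_derivative f x) (at x within {0..})"
proof -
 have "((\<lambda>u. integral {0..u} f) has_vector_derivative f x) (at x within {0..x + 1})"
  by (rule integral_has_vector_derivative[OF continuous_on_subset[OF c]]) (use x in auto)
 moreover have "at x within {0..x+1} = at x within {0..}"
  by (rule at_within_nhd[of _ "{..<x+1}"]) auto
 ultimately have "((\<lambda>u. integral {0..u} f) has_vector_derivative f x) (at x within {0..})" by (simp only:)
 then have "((\<lambda>u. F 0 + integral {0..u} f) has_vector_derivative 0 + f x) (at x within {0..})"
  by (rule has_vector_derivative_add[OF has_vector_derivative_const])
 then have "((\<lambda>u. F 0 + integral {0..u} f) has_vector_derivative f x) (at x within {0..})" by (simp only: add_0_left)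
 then show ?thesis
  by (rule has_vector_derivative_transform[rotated 2]) (use x in simp, rule indefD[OF F], simp)
qed

text \<open>The primitive of the difference is zero, and its derivative at every point is the value
  of the continuous difference.\<close>

lemma cont_AE_eq:
 assumes F: "continuous_on {0..} F" and G: "continuous_on {0..} G" and AE: "l2_eq F G" and x: "0 \<le> x"
 shows "F x = (G x :: complex)"
proof -
 define D where "D t = F t - G t" for t
 have cD: "continuous_on {0..} D" unfolding D_def by (intro continuous_intros F G)
 have lD: "locL1 D" unfolding locL1_def
  by (intro allI absolutely_integrable_continuous_real continuous_on_subset[OF cD]) auto
 have z: "integral {0..t} D = 0" for t
 proof -
  have i: "integrable halfline (\<lambda>x. indicator {0..t} x *\<^sub>R D x)"
   using locL1_sub[OF lD order_refl, of t] by (simp add: abs_int_halfline_iff)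
  have "(LINT x|halfline. indicator {0..t} x *\<^sub>R D x) = (LINT x|halfline. 0)"
  proof (rule integral_cong_AE)
   show "AE x in halfline. indicator {0..t} x *\<^sub>R D x = 0"
    using AE unfolding l2_eq_def by eventually_elim (simp add: D_def)
  qed (use i in auto)
  then show ?thesis using integral_halfline_interval[OF order_refl locL1_sub[OF lD order_refl]] by simp
 qed
 have "indef (\<lambda>_. 0) D" by (simp add: indef_def lD z)
 then have "((\<lambda>_. 0) has_vector_derivative D x) (at x within {0..})" by (rule indef_cont_deriv[OF _ cD x])
 then have "D x = 0"
  by (rule vector_derivative_unique_within[OF halfline_within_nontriv[OF x] _ has_vector_derivative_const])
 then show ?thesis by (simp add: D_def)
qed

lemma indef_zero_deriv:
 assumes F: "indef F f" and z: "\<And>x. 0 \<le> x ==> F x = 0"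
 shows "l2_eq f (\<lambda>_. 0)"
proof -
 have "AE x in halfline. x \<in> space halfline" by (rule AE_space)
 with indef_AE_deriv[OF F] show ?thesis unfolding l2_eq_def
 proof eventually_elim
  case (elim x)
  then have x: "x \<in> {0..}" by simp
  have "((\<lambda>_. 0) has_vector_derivative f x) (at x within {0..})"
   by (rule has_vector_derivative_transform[OF x _ elim(1)]) (simp add: z)
  then show ?case
   by (rule vector_derivative_unique_within[OF halfline_within_nontriv _ has_vector_derivative_const, rotated]) (use x in simp)
 qed
qed

text \<open>The Neumann domain with explicit representatives of the function and its two
  derivatives. Square integrability of \<open>F1\<close> is recorded for integrations by parts;
  \<open>dataA_I\<close> derives it.\<close>

definition dataA :: "(real => complex) => (real => complex) => (real => complex) => bool" where
 "dataA F F1 F2 \<longleftrightarrow> indef F F1 \<and> indef F1 F2 \<and> F1 0 = 0 \<and> F \<in> L2 \<and> F1 \<in> L2 \<and> F2 \<in> L2"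

text \<open>\<open>Y = |F|^2\<close> satisfies \<open>Y'' >= 2 |F'|^2 - |F|^2 - |F''|^2\<close>. If
  \<open>Y'\<close> ever exceeded \<open>B + 1\<close>, it would stay above 1 and \<open>Y\<close>
  would grow linearly, against its integrability. So \<open>Y'\<close> is bounded above, and
  integrating the inequality puts \<open>F'\<close> into \<open>L2\<close>.\<close>

lemma dataA_I:
 assumes F: "indef F F1" and F1: "indef F1 F2" and 0: "F1 0 = 0" and L: "F \<in> L2" "F2 \<in> L2"
 shows "dataA F F1 F2"
proof -
 note cF = indef_cnj[OF F] and cF1 = indef_cnj[OF F1]
 define Y where "Y x = F x * cnj (F x)" for x
 define Y1 where "Y1 x = F x * cnj (F1 x) + F1 x * cnj (F x)" for x
 define Y2 where "Y2 x = (F x * cnj (F2 x) + F1 x * cnj (F1 x)) + (F1 x * cnj (F1 x) + F2 x * cnj (F x))" for x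
 have Y: "indef Y Y1" unfolding Y_def Y1_def by (rule indef_mult[OF F cF])
 have Y1: "indef Y1 Y2" unfolding Y1_def Y2_def by (rule indef_add[OF indef_mult[OF F cF1] indef_mult[OF F1 cF]])
 have ptY2: "Re (Y2 x) + ((cmod (F x))\<^sup>2 + (cmod (F2 x))\<^sup>2) \<ge> 2 * (cmod (F1 x))\<^sup>2" for x
 proof -
  have "(cmod (F x + F2 x))\<^sup>2 = (cmod (F x))\<^sup>2 + (cmod (F2 x))\<^sup>2 + 2 * Re (F x * cnj (F2 x))"
   by (simp add: cmod_sq algebra_simps)
  moreover have "Re (Y2 x) = 2 * Re (F x * cnj (F2 x)) + 2 * (cmod (F1 x))\<^sup>2" by (simp add: Y2_def cmod_sq)
  ultimately show ?thesis using zero_le_power2[of "cmod (F x + F2 x)"] by linarith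
 qed
 define B where "B = (norm (cls F))\<^sup>2 + (norm (cls F2))\<^sup>2"
 have iF: "(\<lambda>x. (cmod (F x))\<^sup>2 + (cmod (F2 x))\<^sup>2) integrable_on {a..b}" if "0 \<le> a" for a b
  by (intro integrable_add L2_local L that)
 have IF: "integral {a..b} (\<lambda>x. (cmod (F x))\<^sup>2 + (cmod (F2 x))\<^sup>2) \<le> B" if "0 \<le> a" for a b
  unfolding B_def using that L
  by (subst integral_add) (auto intro!: add_mono L2_local)
 have inc: "Re (Y1 b) - Re (Y1 a) \<ge> - B" if "0 \<le> a" "a \<le> b" for a b
 proof -
  have iy: "(\<lambda>x. Re (Y2 x)) integrable_on {a..b}" "integral {a..b} (\<lambda>x. Re (Y2 x)) = Re (integral {a..b} Y2)"
   using Re_integral[OF locL1_integrable_on[OF indef_locL1[OF Y1] that(1)]] by blast+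
  have "0 \<le> integral {a..b} (\<lambda>x. Re (Y2 x) + ((cmod (F x))\<^sup>2 + (cmod (F2 x))\<^sup>2))"
   by (rule integral_nonneg[OF integrable_add[OF iy(1) iF[OF that(1)]]]) (rule order_trans[OF _ ptY2], simp)
  also have "\<dots> = Re (Y1 b - Y1 a) + integral {a..b} (\<lambda>x. (cmod (F x))\<^sup>2 + (cmod (F2 x))\<^sup>2)"
   using integral_add[OF iy(1) iF[OF that(1)]] iy(2) indef_diff[OF Y1 that] by simp
  finally show ?thesis using IF[OF that(1), of b] by simp
 qed
 have upper: "Re (Y1 b) \<le> B + 1" if b: "0 \<le> b" for b
 proof (rule ccontr)
  assume "\<not> Re (Y1 b) \<le> B + 1"
  then have Y1ge: "Re (Y1 x) \<ge> 1" if "x \<ge> b" for x using inc[OF b that] by simp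
  have grow: "Re (Y x) - Re (Y b) \<ge> x - b" if x: "x \<ge> b" for x
  proof -
   have iy: "(\<lambda>x. Re (Y1 x)) integrable_on {b..x}" "integral {b..x} (\<lambda>x. Re (Y1 x)) = Re (integral {b..x} Y1)"
    using Re_integral[OF locL1_integrable_on[OF indef_locL1[OF Y] b]] by blast+
   have "integral {b..x} (\<lambda>x. 1) \<le> integral {b..x} (\<lambda>x. Re (Y1 x))"
    by (rule integral_le[OF _ iy(1)]) (use Y1ge in auto)
   then show ?thesis using iy(2) indef_diff[OF Y b x] x by (simp add: minus_complex.simps(1)[symmetric])
  qed
  have "1 \<le> cmod (Y x)" if "x \<ge> b + 1" for x
  proof -
   have "Re (Y b) \<ge> 0" by (simp add: Y_def)
   then have "Re (Y x) \<ge> 1" using grow[of x] that by simp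
   then show ?thesis using complex_Re_le_cmod[of "Y x"] by linarith
  qed
  moreover have "integrable halfline Y" unfolding Y_def by (rule L2_inner_integrable[OF L(1) L(1)])
  ultimately show False using integrable_not_bounded_below[of Y 1 "b + 1"] by simp
 qed
 have Y10: "Y1 0 = 0" by (simp add: Y1_def 0)
 have "F1 \<in> L2"
 proof (rule L2_from_local[OF indef_continuous[OF F1], of "(2 * B + 1) / 2"])
  show "0 \<le> (2 * B + 1) / 2" by (simp add: B_def)
  fix b :: real assume b: "0 \<le> b"
  have iy: "(\<lambda>x. Re (Y2 x)) integrable_on {0..b}" "integral {0..b} (\<lambda>x. Re (Y2 x)) = Re (integral {0..b} Y2)"
   using Re_integral[OF locL1_integrable_on[OF indef_locL1[OF Y1] order_refl]] by blast+
  have cG: "continuous_on {0..b} F1" by (rule continuous_on_subset[OF indef_continuous[OF F1]]) auto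
  have iG: "(\<lambda>x. 2 * (cmod (F1 x))\<^sup>2) integrable_on {0..b}"
   by (rule integrable_continuous_real) (intro continuous_intros cG)
  have "2 * integral {0..b} (\<lambda>x. (cmod (F1 x))\<^sup>2) = integral {0..b} (\<lambda>x. 2 * (cmod (F1 x))\<^sup>2)" by simp
  also have "\<dots> \<le> integral {0..b} (\<lambda>x. Re (Y2 x) + ((cmod (F x))\<^sup>2 + (cmod (F2 x))\<^sup>2))"
   by (rule integral_le[OF iG integrable_add[OF iy(1) iF[OF order_refl]]]) (rule ptY2)
  also have "\<dots> = Re (Y1 b - Y1 0) + integral {0..b} (\<lambda>x. (cmod (F x))\<^sup>2 + (cmod (F2 x))\<^sup>2)"
   using integral_add[OF iy(1) iF[OF order_refl]] iy(2) indef_diff[OF Y1 order_refl b] by simp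
  also have "\<dots> \<le> 2 * B + 1" using upper[OF b] IF[OF order_refl, of b] Y10 by simp
  finally show "integral {0..b} (\<lambda>x. (cmod (F1 x))\<^sup>2) \<le> (2 * B + 1) / 2" by simp
 qed
 then show ?thesis using assms by (simp add: dataA_def)
qed

lemma dataA_lin:
 assumes "dataA F F1 F2" "dataA G G1 G2"
 shows "dataA (\<lambda>x. F x + c * G x) (\<lambda>x. F1 x + c * G1 x) (\<lambda>x. F2 x + c * G2 x)"
 using assms unfolding dataA_def by (auto intro!: indef_add indef_cmult L2_add L2_scale)

lemma dataA_ibp:
 assumes "dataA F F1 F2" "dataA G G1 G2"
 shows "inner (cls F2) (cls G) = - inner (cls F1) (cls G1)"
proof -
 have F: "indef F1 F2" "F1 0 = 0" "F1 \<in> L2" "F2 \<in> L2" and G: "indef G G1" "G \<in> L2" "G1 \<in> L2"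
  using assms by (auto simp: dataA_def)
 have "l2_inner F1 G1 = - F1 0 * cnj (G 0) - l2_inner F2 G"
  unfolding l2_inner_def by (rule indef_ibp[OF F(1) indef_cnj[OF G(1)]]) (intro F G L2_cnj)+
 then have "l2_inner F2 G = - l2_inner F1 G1" by (simp add: F(2))
 then show ?thesis using F G by (simp add: inner_cls)
qed

text \<open>Integration by parts of \<open>F\<close> against its own derivative, then
  Cauchy-Schwarz. It bounds the boundary values of the Weyl sequence in
  \<open>opA_nonneg\<close>.\<close>

lemma boundary_value_bound:
 assumes "dataA F F1 F2"
 shows "(cmod (F 0))\<^sup>2 \<le> 2 * norm (cls F) * norm (cls F1)"
proof -
 have F: "indef F F1" "F \<in> L2" "F1 \<in> L2" using assms by (auto simp: dataA_def)
 have "l2_inner F F1 = - F 0 * cnj (F 0) - l2_inner F1 F"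
  unfolding l2_inner_def by (rule indef_ibp[OF F(1) indef_cnj[OF F(1)]]) (intro F L2_cnj)+
 then have "complex_of_real ((cmod (F 0))\<^sup>2) = - l2_inner F F1 - l2_inner F1 F"
  unfolding complex_norm_square by algebra
 then have "(cmod (F 0))\<^sup>2 = Re (- l2_inner F F1 - l2_inner F1 F)" by (metis Re_complex_of_real)
 also have "\<dots> = - inner (cls F) (cls F1) - inner (cls F1) (cls F)" using F by (simp add: inner_cls)
 also have "\<dots> \<le> 2 * norm (cls F) * norm (cls F1)"
  using norm_cauchy_schwarz[of "- cls F" "cls F1"] by (simp add: inner_commute)
 finally show ?thesis .
qed

section \<open>The free equation\<close>

lemma exp_deriv: "((\<lambda>x. complex_of_real (exp (a * x))) has_vector_derivative complex_of_real (a * exp (a * x))) (at x within S)"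
 by (rule has_vector_derivative_of_real) (auto intro!: derivative_eq_intros)

lemma indef_exp: "indef (\<lambda>x. complex_of_real (exp (a * x))) (\<lambda>x. complex_of_real (a * exp (a * x)))"
 by (rule indef_C1[OF exp_deriv]) (intro continuous_intros)

lemma exp_L2:
 assumes k: "p > 0" shows "(\<lambda>x. complex_of_real (exp (- p * x))) \<in> L2"
proof (rule L2_from_local)
 show "continuous_on {0..} (\<lambda>x. complex_of_real (exp (- p * x)))" by (intro continuous_intros)
 show "0 \<le> 1 / (2 * p)" using k by simp
 fix b :: real assume b: "0 \<le> b"
 have "((\<lambda>x. (exp (- p * x))\<^sup>2) has_integral (- exp (- 2 * p * b) / (2 * p) - (- exp (- 2 * p * 0) / (2 * p)))) {0..b}"
 proof (rule fundamental_theorem_of_calculus[OF b])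
  fix x
  have "(exp (- p * x))\<^sup>2 = exp (- 2 * p * x)" by (simp add: power2_eq_square flip: exp_add)
  then show "((\<lambda>x. - exp (- 2 * p * x) / (2 * p)) has_vector_derivative (exp (- p * x))\<^sup>2) (at x within {0..b})"
   unfolding has_real_derivative_iff_has_vector_derivative[symmetric]
   using k by (auto intro!: derivative_eq_intros)
 qed
 then have "integral {0..b} (\<lambda>x. (exp (- p * x))\<^sup>2) = - exp (- 2 * p * b) / (2 * p) + 1 / (2 * p)"
  by (simp add: integral_unique)
 also have "\<dots> \<le> 1 / (2 * p)" using k by simp
 finally show "integral {0..b} (\<lambda>x. (cmod (complex_of_real (exp (- p * x))))\<^sup>2) \<le> 1 / (2 * p)" by simp
qed

text \<open>Young's inequality, weighted so that the term with \<open>q\<close> takes up half of the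
  coercive term \<open>2 p |q|^2\<close> in the energy estimates.\<close>

lemma Re_cross:
 assumes k: "p > 0"
 shows "Re (2 * (h * cnj q)) \<le> p * (cmod q)\<^sup>2 + 1 / p * (cmod h)\<^sup>2"
proof -
 have "0 \<le> (sqrt p * cmod q - cmod h / sqrt p)\<^sup>2" by simp
 also have "\<dots> = p * (cmod q)\<^sup>2 + 1 / p * (cmod h)\<^sup>2 - 2 * (cmod h * cmod q)"
  using k by (simp add: power2_diff power_mult_distrib power_divide)
 finally have "2 * (cmod h * cmod q) \<le> p * (cmod q)\<^sup>2 + 1 / p * (cmod h)\<^sup>2" by simp
 moreover have "Re (h * cnj q) \<le> cmod h * cmod q"
  using complex_Re_le_cmod[of "h * cnj q"] by (simp add: norm_mult)
 ultimately show ?thesis by simp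
qed

text \<open>The equation \<open>- f'' + p\<^sup>2 f = h\<close> factors as \<open>(p - d/dx) Q = h\<close>, \<open>(p + d/dx) f = Q\<close>.\<close>

lemma solve_backward:
 assumes k: "p > 0" and h: "h \<in> L2"
 shows "\<exists>Q. indef Q (\<lambda>x. of_real p * Q x - h x) \<and> Q \<in> L2"
proof -
 define e where "e x = complex_of_real (exp (- p * x)) * h x" for x
 have ei: "integrable halfline e" unfolding e_def by (rule L2_prod_integrable[OF exp_L2[OF k] h])
 define c0 where "c0 = (LINT x|halfline. e x)"
 \<comment> \<open>The integral of \<open>e\<close> from \<open>x\<close> to infinity; this choice
   of the constant singles out the solution that does not grow.\<close>
 define K where "K x = c0 - integral {0..x} e" for x
 have lo: "locL1 e" by (rule locL1_integrable[OF ei])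
 have K: "indef K (\<lambda>x. (-1) * e x)"
  unfolding indef_def by (intro conjI locL1_cmult lo) (simp add: K_def)
 define Q where "Q x = complex_of_real (exp (p * x)) * K x" for x
 have Q: "indef Q (\<lambda>x. of_real p * Q x - h x)"
 proof (rule indef_cong[OF indef_mult[OF indef_exp[of p] K]])
  fix x
  have "complex_of_real (exp (p * x)) * complex_of_real (exp (- p * x)) = 1"
   by (simp flip: of_real_mult exp_add)
  then have "complex_of_real (exp (p * x)) * e x = h x" by (simp add: e_def mult.assoc[symmetric])
  then show "of_real p * Q x - h x = complex_of_real (exp (p * x)) * ((-1) * e x) + complex_of_real (p * exp (p * x)) * K x"
   by (simp add: Q_def algebra_simps)
 qed (simp add: Q_def)
 define B where "B = (norm (cls (\<lambda>x. complex_of_real (exp (- p * x)))))\<^sup>2 + (norm (cls h))\<^sup>2"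
 \<comment> \<open>Under the integral the exponentials combine to
   \<open>exp (- p * (y - x))\<close>, whose square has over \<open>{x..t}\<close> an integral
   bounded independently of \<open>x\<close> and \<open>t\<close>. The result provides the bound on
   the increments in \<open>energy_L2\<close>.\<close>
 have Qb: "cmod (Q x) \<le> B" if x: "0 \<le> x" for x
 proof -
  let ?E = "\<lambda>y. (cmod (complex_of_real (exp (- p * (y - x)))))\<^sup>2"
  have lim: "((\<lambda>t. complex_of_real (exp (p * x)) * (integral {0..t} e - integral {0..x} e)) \<longlongrightarrow> Q x) at_top"
   unfolding Q_def K_def c0_def by (intro tendsto_intros integral_halfline_tendsto ei)
  have "\<forall>\<^sub>F t in at_top. cmod (complex_of_real (exp (p * x)) * (integral {0..t} e - integral {0..x} e)) \<le> B"
   using eventually_ge_at_top[of x]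
  proof eventually_elim
   case (elim t)
   have "integral {0..t} e - integral {0..x} e = integral {x..t} e"
    using Henstock_Kurzweil_Integration.integral_combine[OF x elim locL1_integrable_on[OF lo order_refl]] by (metis add_diff_cancel_left')
   then have "complex_of_real (exp (p * x)) * (integral {0..t} e - integral {0..x} e) = integral {x..t} (\<lambda>y. complex_of_real (exp (p * x)) * e y)"
    by simp
   also have "cmod \<dots> \<le> integral {x..t} (\<lambda>y. ?E y + (cmod (h y))\<^sup>2)"
   proof (rule integral_norm_bound_integral)
    show "(\<lambda>y. complex_of_real (exp (p * x)) * e y) integrable_on {x..t}"
     by (rule integrable_on_mult_right[OF locL1_integrable_on[OF lo x]])
    show "(\<lambda>y. ?E y + (cmod (h y))\<^sup>2) integrable_on {x..t}"
     by (intro integrable_add L2_local h x integrable_continuous_real continuous_intros)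
    fix y
    have "complex_of_real (exp (p * x)) * e y = complex_of_real (exp (- p * (y - x))) * h y"
     by (simp add: e_def mult.assoc[symmetric] flip: of_real_mult exp_add) (simp add: algebra_simps)
    then have "cmod (complex_of_real (exp (p * x)) * e y) = cmod (complex_of_real (exp (- p * (y - x)))) * cmod (h y)"
     by (simp only: norm_mult)
    also have "\<dots> \<le> ?E y + (cmod (h y))\<^sup>2"
    proof -
     have "a * b \<le> a\<^sup>2 + b\<^sup>2" for a b :: real
     proof -
      have "0 \<le> (a - b)\<^sup>2 + a\<^sup>2 + b\<^sup>2" by (intro add_nonneg_nonneg) auto
      then show ?thesis unfolding power2_diff by simp
     qed
     then show ?thesis .
    qed
    finally show "norm (complex_of_real (exp (p * x)) * e y) \<le> ?E y + (cmod (h y))\<^sup>2" .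
   qed
   also have "\<dots> = integral {x..t} ?E + integral {x..t} (\<lambda>y. (cmod (h y))\<^sup>2)"
    by (intro integral_add L2_local h x integrable_continuous_real continuous_intros)
   also have "integral {x..t} ?E = integral {0..t - x} (\<lambda>y. (cmod (complex_of_real (exp (- p * y))))\<^sup>2)"
   proof -
    have "((?E \<circ> (+) x) has_integral integral {0..t - x} (\<lambda>y. (cmod (complex_of_real (exp (- p * y))))\<^sup>2)) {0..t - x}"
     unfolding o_def add_diff_cancel_left' by (intro integrable_integral L2_local(1)[OF exp_L2[OF k] order_refl])
    then show ?thesis unfolding has_integral_shift_Icc_real by (intro integral_unique) simp
   qed
   also have "\<dots> \<le> (norm (cls (\<lambda>x. complex_of_real (exp (- p * x)))))\<^sup>2"
    by (rule L2_local(2)[OF exp_L2[OF k] order_refl])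
   also have "integral {x..t} (\<lambda>y. (cmod (h y))\<^sup>2) \<le> (norm (cls h))\<^sup>2" by (rule L2_local(2)[OF h x])
   finally show ?case by (simp add: B_def)
  qed
  then show ?thesis by (rule tendsto_upperbound[OF tendsto_norm[OF lim]]) simp
 qed
 have "Q \<in> L2"
 proof (rule energy_L2[OF indef_mult[OF Q indef_cnj[OF Q]] indef_continuous[OF Q] h k, of "1 / p" "B\<^sup>2"])
  fix x
  have "Re (2 * (h x * cnj (Q x))) \<le> p * (cmod (Q x))\<^sup>2 + 1 / p * (cmod (h x))\<^sup>2" by (rule Re_cross[OF k])
  moreover have "Re (Q x * cnj (of_real p * Q x - h x) + (of_real p * Q x - h x) * cnj (Q x)) = 2 * (p * (cmod (Q x))\<^sup>2) - Re (2 * (h x * cnj (Q x)))"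
   by (simp add: cmod_sq algebra_simps)
  ultimately show "p * (cmod (Q x))\<^sup>2 \<le> Re (Q x * cnj (of_real p * Q x - h x) + (of_real p * Q x - h x) * cnj (Q x)) + 1 / p * (cmod (h x))\<^sup>2"
   by linarith
 next
  fix b :: real assume b: "0 \<le> b"
  have "Re (Q b * cnj (Q b)) = (cmod (Q b))\<^sup>2" "Re (Q 0 * cnj (Q 0)) = (cmod (Q 0))\<^sup>2"
   by (simp_all add: cmod_sq)
  moreover have "(cmod (Q b))\<^sup>2 \<le> B\<^sup>2" by (rule power_mono[OF Qb[OF b]]) simp
  ultimately show "Re (Q b * cnj (Q b)) - Re (Q 0 * cnj (Q 0)) \<le> B\<^sup>2" using zero_le_power2[of "cmod (Q 0)"] by linarith
 qed (use k in simp_all)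
 then show ?thesis using Q by blast
qed

lemma solve_free:
 assumes k: "p > 0" and h: "h \<in> L2"
 shows "\<exists>F F1. dataA F F1 (\<lambda>x. of_real (p\<^sup>2) * F x - h x)"
proof -
 obtain Q where Q: "indef Q (\<lambda>x. of_real p * Q x - h x)" and QL: "Q \<in> L2" using solve_backward[OF k h] by blast
 define e where "e x = complex_of_real (exp (p * x)) * Q x" for x
 have ce: "continuous_on {0..} e" unfolding e_def by (intro continuous_intros indef_continuous[OF Q])
 \<comment> \<open>This initial value gives \<open>F 0 = Q 0 / p\<close>, so that the derivative
   \<open>Q - p F\<close> vanishes at 0: the Neumann condition.\<close>
 define K where "K x = Q 0 / of_real p + integral {0..x} e" for x
 have K: "indef K e"
  unfolding indef_def locL1_def
  by (intro conjI allI impI absolutely_integrable_continuous_real continuous_on_subset[OF ce]) (auto simp: K_def)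
 define F where "F x = complex_of_real (exp (- p * x)) * K x" for x
 have F: "indef F (\<lambda>x. Q x - of_real p * F x)"
 proof (rule indef_cong[OF indef_mult[OF indef_exp[of "- p"] K]])
  fix x
  have "complex_of_real (exp (- p * x)) * complex_of_real (exp (p * x)) = 1"
   by (simp flip: of_real_mult exp_add)
  then have "complex_of_real (exp (- p * x)) * e x = Q x" by (simp add: e_def mult.assoc[symmetric])
  then show "Q x - of_real p * F x = complex_of_real (exp (- p * x)) * e x + complex_of_real (- p * exp (- p * x)) * K x"
   by (simp add: F_def algebra_simps)
 qed (simp add: F_def)
 have FL: "F \<in> L2"
 proof (rule energy_L2[OF indef_cmult[OF indef_mult[OF F indef_cnj[OF F]], of "-1"] indef_continuous[OF F] QL k, of "1 / p" "(cmod (F 0))\<^sup>2"])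
  fix x
  have "Re (2 * (Q x * cnj (F x))) \<le> p * (cmod (F x))\<^sup>2 + 1 / p * (cmod (Q x))\<^sup>2" by (rule Re_cross[OF k])
  moreover have "Re (-1 * (F x * cnj (Q x - of_real p * F x) + (Q x - of_real p * F x) * cnj (F x))) = 2 * (p * (cmod (F x))\<^sup>2) - Re (2 * (Q x * cnj (F x)))"
   by (simp add: cmod_sq algebra_simps)
  ultimately show "p * (cmod (F x))\<^sup>2 \<le> Re (-1 * (F x * cnj (Q x - of_real p * F x) + (Q x - of_real p * F x) * cnj (F x))) + 1 / p * (cmod (Q x))\<^sup>2"
   by linarith
 next
  fix b :: real
  have "Re (-1 * (F b * cnj (F b))) = - (cmod (F b))\<^sup>2" "Re (-1 * (F 0 * cnj (F 0))) = - (cmod (F 0))\<^sup>2"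
   by (simp_all add: cmod_sq)
  then show "Re (-1 * (F b * cnj (F b))) - Re (-1 * (F 0 * cnj (F 0))) \<le> (cmod (F 0))\<^sup>2" by simp
 qed (use k in simp_all)
 have F1: "indef (\<lambda>x. Q x - of_real p * F x) (\<lambda>x. of_real (p\<^sup>2) * F x - h x)"
  by (rule indef_cong[OF indef_diff'[OF Q indef_cmult[OF F, of "of_real p"]]]) (simp_all add: algebra_simps power2_eq_square)
 have "dataA F (\<lambda>x. Q x - of_real p * F x) (\<lambda>x. of_real (p\<^sup>2) * F x - h x)"
 proof (rule dataA_I[OF F F1 _ FL])
  show "Q 0 - of_real p * F 0 = 0" using k by (simp add: F_def K_def)
  show "(\<lambda>x. of_real (p\<^sup>2) * F x - h x) \<in> L2" by (intro L2_diff L2_scale FL h)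
 qed
 then show ?thesis by blast
qed

text \<open>Expansion of the form of \<open>R\<close> along a line. With \<open>h = R g\<close> and
  a suitable \<open>t\<close> it yields the Cauchy-Schwarz step \<open>CS\<close> in
  \<open>opA_nonneg\<close>.\<close>

lemma (in positive_contraction) form_diff:
 "inner (R (g - t *\<^sub>R h)) (g - t *\<^sub>R h) = inner (R g) g - 2 * t * inner (R g) h + t\<^sup>2 * inner (R h) h"
proof -
 have "inner (R h) g = inner (R g) h" unfolding sym[of h g] by (rule inner_commute)
 then show ?thesis
  by (simp add: linear_diff[OF lin] linear_scale[OF lin] inner_diff_left inner_diff_right power2_eq_square algebra_simps)
qed

lemma norm_diff_scaleR_sq:
 "(norm (a - t *\<^sub>R b))\<^sup>2 = (norm a)\<^sup>2 - 2 * t * inner a b + t\<^sup>2 * (norm b)\<^sup>2"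
 unfolding power2_norm_eq_inner inner_diff_left inner_diff_right inner_scaleR_left inner_scaleR_right inner_commute[of b a]
 unfolding power2_eq_square by (simp only: algebra_simps)

lemma cmul_1 [simp]: "cmul 1 u = u" "cmul (-1) u = - u" "cmul (of_real c) u = c *\<^sub>R u"
 unfolding cmul_Complex[of 1] cmul_Complex[of "-1"] cmul_Complex[of "of_real c"] by simp_all

section \<open>The perturbed operator and its resolvent\<close>

locale bounded_potential =
 fixes V :: "real => real" and Vb :: real
 assumes cont: "continuous_on {0..} V" and bd: "\<And>x. 0 \<le> x ==> \<bar>V x\<bar> \<le> Vb"
begin

lemma Vb_nonneg: "0 \<le> Vb" using bd[of 0] by simp

lemma V_meas: "(\<lambda>x. complex_of_real (V x)) \<in> borel_measurable halfline"
 by (rule cont_measurable_halfline) (intro continuous_intros cont)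

lemma V_L2: "f \<in> L2 ==> (\<lambda>x. of_real (V x) * f x) \<in> L2"
 by (rule L2_mult_bounded[OF V_meas, of Vb]) (simp_all add: bd)

definition mulV :: "hl2 => hl2" where "mulV u = cls (\<lambda>x. of_real (V x) * rep u x)"

lemma mulV_cls: assumes f: "f \<in> L2" shows "mulV (cls f) = cls (\<lambda>x. of_real (V x) * f x)"
 unfolding mulV_def by (rule cls_eqI[OF V_L2[OF rep_L2] V_L2[OF f] l2_eq_mult[OF rep_cls[OF f]]])

lemma mulV_add: "mulV (u + v) = mulV u + mulV v"
proof -
 obtain f g where f: "f \<in> L2" "u = cls f" and g: "g \<in> L2" "v = cls g" using ex_cls by metis
 show ?thesis unfolding f(2) g(2) plus_cls[OF f(1) g(1)] mulV_cls[OF f(1)] mulV_cls[OF g(1)] mulV_cls[OF L2_add[OF f(1) g(1)]]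
   plus_cls[OF V_L2[OF f(1)] V_L2[OF g(1)]] by (simp only: distrib_left)
qed

lemma mulV_cmul: "mulV (cmul c u) = cmul c (mulV u)"
proof -
 obtain f where f: "f \<in> L2" "u = cls f" using ex_cls by metis
 show ?thesis unfolding f(2) cmul_cls[OF f(1)] mulV_cls[OF f(1)] mulV_cls[OF L2_scale[OF f(1)]] cmul_cls[OF V_L2[OF f(1)]]
  by (simp only: mult.left_commute)
qed

lemma mulV_simps: "mulV (- u) = - mulV u" "mulV (c *\<^sub>R u) = c *\<^sub>R mulV u" "mulV (u - v) = mulV u - mulV v" "mulV 0 = 0"
proof -
 show m: "mulV (- u) = - mulV u" for u using mulV_cmul[of "-1" u] by simp
 show s: "mulV (c *\<^sub>R u) = c *\<^sub>R mulV u" for c using mulV_cmul[of "of_real c" u] by simp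
 show "mulV (u - v) = mulV u - mulV v" using mulV_add[of u "- v"] m[of v] by simp
 show "mulV 0 = 0" using mulV_add[of 0 0] by simp
qed

lemma mulV_norm: "norm (mulV u) \<le> Vb * norm u"
proof -
 obtain f where f: "f \<in> L2" "u = cls f" using ex_cls by metis
 have "(norm (mulV u))\<^sup>2 \<le> (LINT x|halfline. Vb\<^sup>2 * (cmod (f x))\<^sup>2)"
  unfolding f(2) mulV_cls[OF f(1)] norm_cls_sq[OF V_L2[OF f(1)]]
 proof (rule integral_mono)
  show "integrable halfline (\<lambda>x. (cmod (complex_of_real (V x) * f x))\<^sup>2)" by (rule L2_integrable[OF V_L2[OF f(1)]])
  show "integrable halfline (\<lambda>x. Vb\<^sup>2 * (cmod (f x))\<^sup>2)" by (rule integrable_mult_right[OF L2_integrable[OF f(1)]])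
  fix x assume "x \<in> space halfline"
  then have "\<bar>V x\<bar>\<^sup>2 \<le> Vb\<^sup>2" by (intro power_mono bd) simp_all
  then show "(cmod (complex_of_real (V x) * f x))\<^sup>2 \<le> Vb\<^sup>2 * (cmod (f x))\<^sup>2"
   by (simp add: norm_mult power_mult_distrib mult_right_mono)
 qed
 also have "\<dots> = (Vb * norm u)\<^sup>2" by (simp add: f(2) power_mult_distrib norm_cls_sq[OF f(1)])
 finally show ?thesis by (rule power2_le_imp_le) (simp add: Vb_nonneg)
qed

lemma mulV_sym: "inner (mulV u) v = inner u (mulV v)"
proof -
 obtain f g where f: "f \<in> L2" "u = cls f" and g: "g \<in> L2" "v = cls g" using ex_cls by metis
 show ?thesis unfolding f(2) g(2) mulV_cls[OF f(1)] mulV_cls[OF g(1)] inner_cls[OF V_L2[OF f(1)] g(1)] inner_cls[OF f(1) V_L2[OF g(1)]]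
  unfolding l2_inner_def by (simp add: mult_ac)
qed

lemma mulV_inner: "\<bar>inner (mulV u) u\<bar> \<le> Vb * (norm u)\<^sup>2"
proof -
 have "\<bar>inner (mulV u) u\<bar> \<le> norm (mulV u) * norm u" by (rule Cauchy_Schwarz_ineq2)
 also have "\<dots> \<le> (Vb * norm u) * norm u" by (rule mult_right_mono[OF mulV_norm]) simp
 finally show ?thesis by (simp add: power2_eq_square)
qed

text \<open>The graph of \<open>A\<close> on classes; a relation, since the representatives are
  quantified. With linearity, \<open>opA_zero\<close> shows that it is single-valued.\<close>

definition opA :: "hl2 => hl2 => bool" where
 "opA u w \<longleftrightarrow> (\<exists>F F1 F2. dataA F F1 F2 \<and> u = cls F \<and> w = mulV u - cls F2)"

lemma dataA_L2: assumes "dataA F F1 F2" shows "F \<in> L2" "F1 \<in> L2" "F2 \<in> L2"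
 using assms unfolding dataA_def by blast+

lemma opA_lin:
 assumes "opA u w" "opA u' w'" shows "opA (u + cmul c u') (w + cmul c w')"
proof -
 obtain F F1 F2 where F: "dataA F F1 F2" "u = cls F" "w = mulV u - cls F2" using assms(1) unfolding opA_def by blast
 obtain G G1 G2 where G: "dataA G G1 G2" "u' = cls G" "w' = mulV u' - cls G2" using assms(2) unfolding opA_def by blast
 note f = dataA_L2[OF F(1)] and g = dataA_L2[OF G(1)]
 have 1: "u + cmul c u' = cls (\<lambda>x. F x + c * G x)"
  unfolding F(2) G(2) cmul_cls[OF g(1)] plus_cls[OF f(1) L2_scale[OF g(1)]] ..
 have 2: "cls F2 + cmul c (cls G2) = cls (\<lambda>x. F2 x + c * G2 x)"
  unfolding cmul_cls[OF g(3)] plus_cls[OF f(3) L2_scale[OF g(3)]] ..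
 have "w + cmul c w' = mulV (u + cmul c u') - cls (\<lambda>x. F2 x + c * G2 x)"
  unfolding 2[symmetric] F(3) G(3) mulV_add mulV_cmul linear_diff[OF linear_cmul] by simp
 then show ?thesis unfolding opA_def using dataA_lin[OF F(1) G(1), of c] 1 by blast
qed

lemma opA_add: "opA u w ==> opA u' w' ==> opA (u + u') (w + w')"
 using opA_lin[of u w u' w' 1] by simp

lemma opA_diff: "opA u w ==> opA u' w' ==> opA (u - u') (w - w')"
 using opA_lin[of u w u' w' "-1"] by simp

lemma opA_cmul: assumes "opA u w" shows "opA (cmul c u) (cmul c w)"
 using opA_lin[OF opA_diff[OF assms assms] assms, of c] by simp

lemma opA_ibp:
 assumes F: "dataA F F1 F2" and G: "dataA G G1 G2"
 shows "inner (mulV (cls F) - cls F2) (cls G) = inner (cls F1) (cls G1) + inner (mulV (cls F)) (cls G)"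
 by (simp add: inner_diff_left dataA_ibp[OF F G])

lemma opA_sym: assumes "opA u w" "opA u' w'" shows "inner w u' = inner u w'"
proof -
 obtain F F1 F2 where F: "dataA F F1 F2" "u = cls F" "w = mulV u - cls F2" using assms(1) unfolding opA_def by blast
 obtain G G1 G2 where G: "dataA G G1 G2" "u' = cls G" "w' = mulV u' - cls G2" using assms(2) unfolding opA_def by blast
 have "inner w u' = inner (cls F1) (cls G1) + inner (mulV u) u'" unfolding F(3) unfolding F(2) G(2) by (rule opA_ibp[OF F(1) G(1)])
 moreover have "inner w' u = inner (cls G1) (cls F1) + inner (mulV u') u" unfolding G(3) unfolding F(2) G(2) by (rule opA_ibp[OF G(1) F(1)])
 ultimately show ?thesis
  using mulV_sym[of u u'] inner_commute[of u "mulV u'"] inner_commute[of "cls G1" "cls F1"] inner_commute[of w' u] by linarith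
qed

lemma opA_energy: assumes "opA u w" shows "- Vb * (norm u)\<^sup>2 \<le> inner w u"
proof -
 obtain F F1 F2 where F: "dataA F F1 F2" "u = cls F" "w = mulV u - cls F2" using assms(1) unfolding opA_def by blast
 have "inner w u = inner (cls F1) (cls F1) + inner (mulV u) u" unfolding F(3) unfolding F(2) by (rule opA_ibp[OF F(1) F(1)])
 then show ?thesis using mulV_inner[of u] inner_ge_zero[of "cls F1"] unfolding abs_le_iff mult_minus_left by linarith
qed

text \<open>The shift has two tasks: \<open>M - Vb >= 1\<close> makes the form of
  \<open>A + M\<close> at least 1, and \<open>Vb / M < 1\<close> makes the fixed point map of
  \<open>resolvent_ex\<close> a contraction.\<close>

definition M :: real where "M = 2 * Vb + 1"

lemma M: "M > 0" "M - Vb \<ge> 1" "Vb < M" "Vb / M \<ge> 0" "Vb / M < 1"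
 using Vb_nonneg by (simp_all add: M_def)

definition free :: "hl2 => hl2 => bool" where
 "free u h \<longleftrightarrow> (\<exists>F F1 F2. dataA F F1 F2 \<and> u = cls F \<and> cls F2 = M *\<^sub>R u - h)"

lemma free_ex: "\<exists>u. free u h"
proof -
 obtain f where f: "f \<in> L2" "h = cls f" using ex_cls by metis
 have "sqrt M > 0" using M(1) by simp
 from solve_free[OF this f(1)] obtain F F1 where F: "dataA F F1 (\<lambda>x. of_real ((sqrt M)\<^sup>2) * F x - f x)" by blast
 have "cls (\<lambda>x. of_real ((sqrt M)\<^sup>2) * F x - f x) = M *\<^sub>R cls F - h"
  unfolding f(2) scaleR_cls[OF dataA_L2(1)[OF F]] diff_cls[OF L2_scale[OF dataA_L2(1)[OF F]] f(1)]
  using M(1) by simp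
 then show ?thesis unfolding free_def using F by blast
qed

lemma free_diff: assumes "free u h" "free u' h'" shows "free (u - u') (h - h')"
proof -
 obtain F F1 F2 where F: "dataA F F1 F2" "u = cls F" "cls F2 = M *\<^sub>R u - h" using assms(1) unfolding free_def by blast
 obtain G G1 G2 where G: "dataA G G1 G2" "u' = cls G" "cls G2 = M *\<^sub>R u' - h'" using assms(2) unfolding free_def by blast
 note f = dataA_L2[OF F(1)] and g = dataA_L2[OF G(1)]
 have D: "dataA (\<lambda>x. F x - G x) (\<lambda>x. F1 x - G1 x) (\<lambda>x. F2 x - G2 x)" using dataA_lin[OF F(1) G(1), of "-1"] by simp
 have "cls (\<lambda>x. F2 x - G2 x) = M *\<^sub>R (u - u') - (h - h')"
  unfolding diff_cls[OF f(3) g(3), symmetric] F(3) G(3) by (simp add: scaleR_diff_right)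
 moreover have "u - u' = cls (\<lambda>x. F x - G x)" unfolding F(2) G(2) by (rule diff_cls[OF f(1) g(1)])
 ultimately show ?thesis unfolding free_def using D by blast
qed

lemma free_bound: assumes "free u h" shows "M * norm u \<le> norm h"
proof -
 obtain F F1 F2 where F: "dataA F F1 F2" "u = cls F" "cls F2 = M *\<^sub>R u - h" using assms(1) unfolding free_def by blast
 have "inner (M *\<^sub>R u - h) u = - inner (cls F1) (cls F1)" unfolding F(3)[symmetric] unfolding F(2) by (rule dataA_ibp[OF F(1) F(1)])
 then have "M * inner u u \<le> inner h u" unfolding inner_diff_left inner_scaleR_left using inner_ge_zero[of "cls F1"] by linarith
 also have "\<dots> \<le> norm h * norm u" by (rule norm_cauchy_schwarz)
 finally have "(M * norm u) * norm u \<le> norm h * norm u" by (simp add: dot_square_norm power2_eq_square mult.assoc)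
 then show ?thesis by (cases "u = 0") simp_all
qed

text \<open>\<open>- u'' + M u = g - V u\<close> is a fixed point problem for the free solution
  operator \<open>R0\<close>, with ratio \<open>Vb / M\<close> by \<open>free_bound\<close>.
  Surjectivity of \<open>A + M\<close> together with symmetry amounts to self-adjointness.\<close>

lemma resolvent_ex: "\<exists>u. opA u (g - M *\<^sub>R u)"
proof -
 define R0 where "R0 h = (SOME u. free u h)" for h
 have R0: "free (R0 h) h" for h unfolding R0_def by (rule someI_ex[OF free_ex])
 have "\<exists>!u. R0 (g - mulV u) = u"
 proof (rule banach_fix_type[OF M(4,5)], intro allI)
  fix x y
  have "M * norm (R0 (g - mulV x) - R0 (g - mulV y)) \<le> norm ((g - mulV x) - (g - mulV y))" by (rule free_bound[OF free_diff[OF R0 R0]])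
  also have "\<dots> = norm (mulV (x - y))" by (simp add: mulV_simps norm_minus_commute)
  also have "\<dots> \<le> Vb * norm (x - y)" by (rule mulV_norm)
  finally show "dist (R0 (g - mulV x)) (R0 (g - mulV y)) \<le> Vb / M * dist x y"
   using M(1) by (simp add: dist_norm pos_le_divide_eq mult.commute)
 qed
 then obtain u where u: "R0 (g - mulV u) = u" by blast
 have "free u (g - mulV u)" using R0[of "g - mulV u"] unfolding u .
 then obtain F F1 F2 where F: "dataA F F1 F2" "u = cls F" "cls F2 = M *\<^sub>R u - (g - mulV u)" unfolding free_def by blast
 have "g - M *\<^sub>R u = mulV u - cls F2" unfolding F(3) by simp
 then show ?thesis unfolding opA_def using F by blast
qed

lemma resolvent_unique: assumes "opA u (g - M *\<^sub>R u)" "opA v (g - M *\<^sub>R v)" shows "u = v"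
proof -
 have "(g - M *\<^sub>R u) - (g - M *\<^sub>R v) = - M *\<^sub>R (u - v)" by (simp add: scaleR_diff_right)
 then have "opA (u - v) (- M *\<^sub>R (u - v))" using opA_diff[OF assms] by (simp only:)
 from opA_energy[OF this, unfolded inner_scaleR_left dot_square_norm] have "(M - Vb) * (norm (u - v))\<^sup>2 \<le> 0" by (simp add: left_diff_distrib)
 moreover have "1 * (norm (u - v))\<^sup>2 \<le> (M - Vb) * (norm (u - v))\<^sup>2" by (rule mult_right_mono[OF M(2)]) simp
 ultimately have "(norm (u - v))\<^sup>2 \<le> 0" by linarith
 then show ?thesis by simp
qed

definition Rv :: "hl2 => hl2" where "Rv g = (THE u. opA u (g - M *\<^sub>R u))"

lemma Rv: "opA (Rv g) (g - M *\<^sub>R Rv g)"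
proof -
 have "\<exists>!u. opA u (g - M *\<^sub>R u)" using resolvent_ex resolvent_unique by blast
 then show ?thesis unfolding Rv_def by (rule theI')
qed

lemma Rv_eq: "opA u (g - M *\<^sub>R u) ==> Rv g = u" using resolvent_unique[OF Rv] .

lemma opA_iff: "opA u w \<longleftrightarrow> u = Rv (w + M *\<^sub>R u)"
 using Rv_eq[of u "w + M *\<^sub>R u"] Rv[of "w + M *\<^sub>R u"] by auto

lemma Rv_cmul: "Rv (cmul c g) = cmul c (Rv g)"
proof (rule Rv_eq)
 have "cmul c (g - M *\<^sub>R Rv g) = cmul c g - M *\<^sub>R cmul c (Rv g)"
  by (simp only: linear_diff[OF linear_cmul] cmul_scaleR)
 then show "opA (cmul c (Rv g)) (cmul c g - M *\<^sub>R cmul c (Rv g))" using opA_cmul[OF Rv[of g], of c] by (simp only:)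
qed

text \<open>This is \<open>A + M >= 1\<close> read at \<open>Rv f\<close>. Positivity of the
  resolvent and its bound by 1 both follow from it.\<close>

lemma Rv_energy: "(norm (Rv f))\<^sup>2 \<le> inner (Rv f) f"
proof -
 have "- Vb * (norm (Rv f))\<^sup>2 \<le> inner (f - M *\<^sub>R Rv f) (Rv f)" by (rule opA_energy[OF Rv])
 then have "(M - Vb) * (norm (Rv f))\<^sup>2 \<le> inner (Rv f) f" by (simp add: inner_diff_left dot_square_norm inner_commute algebra_simps)
 moreover have "1 * (norm (Rv f))\<^sup>2 \<le> (M - Vb) * (norm (Rv f))\<^sup>2" by (rule mult_right_mono[OF M(2)]) simp
 ultimately show ?thesis by simp
qed

lemma Rv_norm: "norm (Rv f) \<le> norm f"
proof -
 have "norm (Rv f) * norm (Rv f) \<le> norm f * norm (Rv f)"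
  using order_trans[OF Rv_energy norm_cauchy_schwarz] by (simp add: power2_eq_square mult.commute)
 then show ?thesis by (cases "Rv f = 0") simp_all
qed

text \<open>The continuous representative of the zero class is zero everywhere, and so is its
  derivative; the second derivative is zero almost everywhere. At \<open>Rv f = 0\<close> this gives
  injectivity of the resolvent.\<close>

lemma opA_zero: assumes "opA 0 w" shows "w = 0"
proof -
 obtain F F1 F2 where F: "dataA F F1 F2" "0 = cls F" "w = mulV 0 - cls F2" using assms unfolding opA_def by blast
 note f = dataA_L2[OF F(1)]
 have i: "indef F F1" "indef F1 F2" using F(1) by (simp_all add: dataA_def)
 have z: "continuous_on {0..} (\<lambda>x. 0::complex)" by simp
 have "l2_eq F (\<lambda>x. 0)" using F(2) by (simp add: cls_eq_iff[symmetric] f zero_cls)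
 from cont_AE_eq[OF indef_continuous[OF i(1)] z this] have "F x = 0" if "0 \<le> x" for x using that by simp
 from indef_zero_deriv[OF i(1) this] have "l2_eq F1 (\<lambda>x. 0)" .
 from cont_AE_eq[OF indef_continuous[OF i(2)] z this] have "F1 x = 0" if "0 \<le> x" for x using that by simp
 from indef_zero_deriv[OF i(2) this] have "cls F2 = 0" by (simp add: cls_eq_iff[symmetric] f zero_cls[symmetric])
 then show ?thesis by (simp add: F(3) mulV_simps)
qed

sublocale res: injective_positive_contraction Rv
proof (intro injective_positive_contraction.intro positive_contraction.intro injective_positive_contraction_axioms.intro)
 show "linear Rv"
 proof (rule linearI)
  fix f g
  have "(f - M *\<^sub>R Rv f) + (g - M *\<^sub>R Rv g) = f + g - M *\<^sub>R (Rv f + Rv g)" by (simp add: scaleR_add_right)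
  then show "Rv (f + g) = Rv f + Rv g" using Rv_eq opA_add[OF Rv[of f] Rv[of g]] by (simp only:)
 next
  fix c f show "Rv (c *\<^sub>R f) = c *\<^sub>R Rv f" using Rv_cmul[of "of_real c" f] by simp
 qed
 fix f g
 have "inner (f - M *\<^sub>R Rv f) (Rv g) = inner (Rv f) (g - M *\<^sub>R Rv g)" by (rule opA_sym[OF Rv Rv])
 then show "inner (Rv f) g = inner f (Rv g)" by (simp add: inner_diff_left inner_diff_right)
 show "0 \<le> inner (Rv f) f" by (rule order_trans[OF zero_le_power2 Rv_energy])
 have "inner (Rv f) f \<le> norm (Rv f) * norm f" by (rule norm_cauchy_schwarz)
 also have "\<dots> \<le> norm f * norm f" by (rule mult_right_mono[OF Rv_norm]) simp
 finally show "inner (Rv f) f \<le> inner f f" by (simp add: dot_square_norm power2_eq_square)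
 show "f = 0" if "Rv f = 0" using Rv[of f] opA_zero[of f] unfolding that by simp
qed

theorem spectral_opA:
 "\<exists>P. spectral P \<and> (\<forall>u w. u \<in> spectral.dom P (\<lambda>x. x) \<and> w = spectral.Phi P (\<lambda>x. x) u \<longleftrightarrow> opA u w) \<and>
   (\<forall>B u. B \<in> sets borel --> P B (cmul \<i> u) = cmul \<i> (P B u))"
proof -
 obtain P where P: "spectral P"
   "\<forall>f h. f \<in> spectral.dom P (\<lambda>x. x) \<and> h = spectral.Phi P (\<lambda>x. x) f \<longleftrightarrow> f = Rv (h + M *\<^sub>R f)"
   "\<forall>J B f. linear J \<and> (\<forall>f. Rv (J f) = J (Rv f)) \<and> (\<forall>f g. inner (J f) (J g) = inner f g) \<and> (\<forall>f. J (J f) = - f) \<and>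
    B \<in> sets borel --> P B (J f) = J (P B f)"
  using res.spectral_theorem[of M] by blast
 show ?thesis
 proof (rule exI[of _ P], intro conjI allI impI P(1))
  fix u w show "u \<in> spectral.dom P (\<lambda>x. x) \<and> w = spectral.Phi P (\<lambda>x. x) u \<longleftrightarrow> opA u w"
   unfolding opA_iff by (rule P(2)[rule_format])
 next
  fix B :: "real set" and u assume B: "B \<in> sets borel"
  show "P B (cmul \<i> u) = cmul \<i> (P B u)"
   by (rule P(3)[rule_format]) (intro conjI allI linear_cmul Rv_cmul inner_cmul_ii cmul_ii B)
 qed
qed

text \<open>From left to right the fundamental theorem turns absolute continuity into
  \<open>indef\<close>, and \<open>dataA_I\<close> adds the integrability of \<open>F1\<close>; from
  right to left \<open>indef\<close> returns absolute continuity and the derivatives.\<close>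

lemma schroedinger_iff: "(f, h) \<in> schroedinger V \<longleftrightarrow> f \<in> L2 \<and> h \<in> L2 \<and> opA (cls f) (cls h)"
proof
 assume "(f, h) \<in> schroedinger V"
 then obtain F F1 F2 where L: "f \<in> L2" "h \<in> L2" and F: "l2_eq f F" "ac_loc F1"
   "\<forall>x\<ge>0. (F has_vector_derivative F1 x) (at x within {0..})" "F1 0 = 0" "F2 \<in> L2"
   "AE x in halfline. (F1 has_vector_derivative F2 x) (at x within {0..})" "l2_eq h (\<lambda>x. - F2 x + of_real (V x) * F x)"
  unfolding schroedinger_def by blast
 have i1: "indef F1 F2" by (rule indef_iff_ac[OF F(2,6) locL1_L2[OF F(5)]])
 have i: "indef F F1" by (rule indef_C1[OF F(3)[rule_format] indef_continuous[OF i1]])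
 have FL: "F \<in> L2" by (rule L2_cong_AE[OF L(1) F(1) cont_measurable_halfline[OF indef_continuous[OF i]]])
 have D: "dataA F F1 F2" by (rule dataA_I[OF i i1 F(4) FL F(5)])
 have u: "cls f = cls F" by (rule cls_eqI[OF L(1) FL F(1)])
 have "cls h = cls (\<lambda>x. - F2 x + of_real (V x) * F x)" by (rule cls_eqI[OF L(2) L2_add[OF L2_minus[OF F(5)] V_L2[OF FL]] F(7)])
 also have "\<dots> = mulV (cls f) - cls F2"
  unfolding u mulV_cls[OF FL] diff_cls[OF V_L2[OF FL] F(5)] by simp
 finally show "f \<in> L2 \<and> h \<in> L2 \<and> opA (cls f) (cls h)" unfolding opA_def using L D u by blast
next
 assume r: "f \<in> L2 \<and> h \<in> L2 \<and> opA (cls f) (cls h)"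
 then obtain F F1 F2 where F: "dataA F F1 F2" "cls f = cls F" "cls h = mulV (cls f) - cls F2" unfolding opA_def by blast
 note L = dataA_L2[OF F(1)]
 have i: "indef F F1" "indef F1 F2" "F1 0 = 0" using F(1) by (simp_all add: dataA_def)
 have "cls h = cls (\<lambda>x. - F2 x + of_real (V x) * F x)"
  unfolding F(3) F(2) mulV_cls[OF L(1)] diff_cls[OF V_L2[OF L(1)] L(3)] by simp
 then have "l2_eq h (\<lambda>x. - F2 x + of_real (V x) * F x)"
  by (rule cls_eq_iff[OF _ L2_add[OF L2_minus[OF L(3)] V_L2[OF L(1)]], THEN iffD1, rotated]) (use r in blast)
 moreover have "l2_eq f F" using r F(2) L(1) by (simp add: cls_eq_iff)
 ultimately show "(f, h) \<in> schroedinger V"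
  unfolding schroedinger_def mem_Collect_eq prod.case
  using r L(3) i indef_ac_loc[OF i(1)] indef_ac_loc[OF i(2)] indef_cont_deriv[OF i(1) indef_continuous[OF i(2)]] indef_AE_deriv[OF i(2)]
  by blast
qed

section \<open>Nonnegativity\<close>

text \<open>By the Neumann condition the energy \<open>|D|^2 + |D'|^2\<close> starts from
  \<open>|D 0|^2\<close>, and up to \<open>|\<eta>|^2\<close> it grows at most at the rate
  \<open>2 + C\<close>. So on a bounded interval one boundary value and the right-hand side control
  the solution.\<close>

lemma gronwall:
 assumes D: "dataA D D1 D2" and \<eta>: "\<eta> \<in> L2" and eq: "\<And>x. 0 \<le> x ==> D2 x = of_real (q x) * D x - \<eta> x"
  and q: "\<And>x. 0 \<le> x ==> \<bar>q x\<bar> \<le> C" and b: "0 \<le> b"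
 shows "(cmod (D b))\<^sup>2 \<le> exp ((2 + C) * b) * ((cmod (D 0))\<^sup>2 + (norm (cls \<eta>))\<^sup>2)"
proof -
 have i: "indef D D1" "indef D1 D2" "D1 0 = 0" using D by (simp_all add: dataA_def)
 \<comment> \<open>The products \<open>2 d d1\<close>, \<open>2 C d d1\<close> and
   \<open>2 e d1\<close> are bounded by multiples of \<open>d^2 + d1^2\<close> with factors 1,
   \<open>C\<close> and 1, apart from \<open>e^2\<close>.\<close>
 define K where "K = 2 + C"
 have C: "0 \<le> C" using q[of 0] by simp
 define Y where "Y x = complex_of_real (exp (- K * x)) * (D x * cnj (D x) + D1 x * cnj (D1 x))" for x
 define y where "y x = complex_of_real (exp (- K * x)) * ((D x * cnj (D1 x) + D1 x * cnj (D x)) + (D1 x * cnj (D2 x) + D2 x * cnj (D1 x)))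
   + complex_of_real (- K * exp (- K * x)) * (D x * cnj (D x) + D1 x * cnj (D1 x))" for x
 have Y: "indef Y y" unfolding Y_def y_def
  by (rule indef_mult[OF indef_exp[of "- K"] indef_add[OF indef_mult[OF i(1) indef_cnj[OF i(1)]] indef_mult[OF i(2) indef_cnj[OF i(2)]]]])
 have pt: "Re (y x) \<le> (cmod (\<eta> x))\<^sup>2" if x: "0 \<le> x" for x
 proof -
  define d d1 e where "d = cmod (D x)" and "d1 = cmod (D1 x)" and "e = cmod (\<eta> x)"
  have r1: "Re (D x * cnj (D1 x)) \<le> d * d1"
   using complex_Re_le_cmod[of "D x * cnj (D1 x)"] by (simp add: norm_mult d_def d1_def)
  have "cmod (D2 x) \<le> C * d + e"
  proof -
   have "cmod (D2 x) \<le> cmod (of_real (q x) * D x) + e" unfolding eq[OF x] e_def by (rule norm_triangle_ineq4)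
   also have "cmod (of_real (q x) * D x) \<le> C * d" using q[OF x] by (simp add: norm_mult d_def mult_right_mono)
   finally show ?thesis by simp
  qed
  then have "cmod (D2 x) * d1 \<le> (C * d + e) * d1" by (rule mult_right_mono) (simp add: d1_def)
  then have r2: "Re (D2 x * cnj (D1 x)) \<le> (C * d + e) * d1"
   using complex_Re_le_cmod[of "D2 x * cnj (D1 x)"] by (simp add: norm_mult d1_def)
  have s1: "2 * (d * d1) \<le> d\<^sup>2 + d1\<^sup>2" using sum_squares_bound[of d d1] by simp
  have s2: "2 * (e * d1) \<le> e\<^sup>2 + d1\<^sup>2" using sum_squares_bound[of e d1] by simp
  have s3: "C * (2 * (d * d1)) \<le> C * (d\<^sup>2 + d1\<^sup>2)" by (rule mult_left_mono[OF s1 C])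
  have s4: "0 \<le> d\<^sup>2" by simp
  have "2 * Re (D x * cnj (D1 x)) + 2 * Re (D2 x * cnj (D1 x)) - K * (d\<^sup>2 + d1\<^sup>2) \<le> e\<^sup>2"
  proof -
   have "2 * Re (D x * cnj (D1 x)) + 2 * Re (D2 x * cnj (D1 x)) \<le> 2 * (d * d1) + C * (2 * (d * d1)) + 2 * (e * d1)"
    using r1 r2 by (simp add: algebra_simps)
   also have "\<dots> \<le> (d\<^sup>2 + d1\<^sup>2) + C * (d\<^sup>2 + d1\<^sup>2) + (e\<^sup>2 + (d\<^sup>2 + d1\<^sup>2))" using s1 s2 s3 s4 by linarith
   also have "\<dots> = K * (d\<^sup>2 + d1\<^sup>2) + e\<^sup>2" by (simp add: K_def algebra_simps)
   finally show ?thesis by simp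
  qed
  then have "exp (- K * x) * (2 * Re (D x * cnj (D1 x)) + 2 * Re (D2 x * cnj (D1 x)) - K * (d\<^sup>2 + d1\<^sup>2)) \<le> exp (- K * x) * e\<^sup>2"
   by (rule mult_left_mono) simp
  also have "\<dots> \<le> 1 * e\<^sup>2" by (rule mult_right_mono) (use x C in \<open>simp_all add: K_def mult_nonpos_nonneg\<close>)
  finally have "exp (- K * x) * (2 * Re (D x * cnj (D1 x)) + 2 * Re (D2 x * cnj (D1 x)) - K * (d\<^sup>2 + d1\<^sup>2)) \<le> (cmod (\<eta> x))\<^sup>2"
   by (simp add: e_def)
  moreover have "Re (y x) = exp (- K * x) * (2 * Re (D x * cnj (D1 x)) + 2 * Re (D2 x * cnj (D1 x)) - K * (d\<^sup>2 + d1\<^sup>2))"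
   by (simp add: y_def d_def d1_def cmod_sq algebra_simps)
  ultimately show ?thesis by simp
 qed
 have iy: "(\<lambda>x. Re (y x)) integrable_on {0..b}" "integral {0..b} (\<lambda>x. Re (y x)) = Re (integral {0..b} y)"
  using Re_integral[OF locL1_integrable_on[OF indef_locL1[OF Y] order_refl]] by blast+
 have "Re (Y b - Y 0) = integral {0..b} (\<lambda>x. Re (y x))" unfolding iy(2) indef_diff[OF Y order_refl b] ..
 also have "\<dots> \<le> integral {0..b} (\<lambda>x. (cmod (\<eta> x))\<^sup>2)"
  by (rule integral_le[OF iy(1) L2_local(1)[OF \<eta> order_refl]]) (simp add: pt)
 also have "\<dots> \<le> (norm (cls \<eta>))\<^sup>2" by (rule L2_local(2)[OF \<eta> order_refl])
 finally have "Re (Y b) \<le> Re (Y 0) + (norm (cls \<eta>))\<^sup>2" by simp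
 moreover have "Re (Y b) = exp (- K * b) * ((cmod (D b))\<^sup>2 + (cmod (D1 b))\<^sup>2)" by (simp add: Y_def cmod_sq algebra_simps)
 moreover have "Re (Y 0) = (cmod (D 0))\<^sup>2" by (simp add: Y_def cmod_sq i(3))
 ultimately have "exp (- K * b) * ((cmod (D b))\<^sup>2 + (cmod (D1 b))\<^sup>2) \<le> (cmod (D 0))\<^sup>2 + (norm (cls \<eta>))\<^sup>2" by simp
 then have "exp (K * b) * (exp (- K * b) * ((cmod (D b))\<^sup>2 + (cmod (D1 b))\<^sup>2)) \<le> exp (K * b) * ((cmod (D 0))\<^sup>2 + (norm (cls \<eta>))\<^sup>2)"
  by (rule mult_left_mono) simp
 moreover have "exp (K * b) * (exp (- K * b) * z) = z" for z :: real by (simp add: mult.assoc[symmetric] flip: exp_add)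
 ultimately have "(cmod (D b))\<^sup>2 + (cmod (D1 b))\<^sup>2 \<le> exp (K * b) * ((cmod (D 0))\<^sup>2 + (norm (cls \<eta>))\<^sup>2)" by (simp only:)
 then show ?thesis using zero_le_power2[of "cmod (D1 b)"] unfolding K_def by linarith
qed

text \<open>Substitute for compactness. Beyond \<open>b\<close> the potential is at least
  \<open>l / 2\<close>, which leaves a gap \<open>- l / 2\<close> in the energy identity; on
  \<open>{0..b}\<close> \<open>gronwall\<close> bounds \<open>F\<close> by its value at 0 and the
  error. It is applied to differences of approximate eigenvectors.\<close>

lemma compact_est:
 assumes neg: "l < 0" and b: "0 \<le> b" "\<And>x. b \<le> x ==> \<bar>V x\<bar> \<le> - l / 2"
 shows "\<exists>C0\<ge>0. \<forall>F F1 F2 e. dataA F F1 F2 \<and> mulV (cls F) - cls F2 = l *\<^sub>R cls F + e -->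
  (norm (cls F))\<^sup>2 \<le> C0 * ((cmod (F 0))\<^sup>2 + (norm e)\<^sup>2 + norm e * norm (cls F))"
proof -
 define C where "C = Vb + \<bar>l\<bar>"
 \<comment> \<open>The first summand is the cost of \<open>{0..b}\<close> by Gronwall; the 1 lets
   \<open>B0\<close> also dominate the factor of \<open>norm e * norm (cls F)\<close>.\<close>
 define B0 where "B0 = Vb * exp ((2 + C) * b) * b + 1"
 have B0: "B0 \<ge> 1" using Vb_nonneg b(1) by (simp add: B0_def)
 show ?thesis
 proof (rule exI[of _ "2 / (- l) * B0"], intro conjI allI impI)
  show "0 \<le> 2 / (- l) * B0" by (intro mult_nonneg_nonneg divide_nonneg_pos) (use neg B0 in simp_all)
  fix F F1 F2 e assume "dataA F F1 F2 \<and> mulV (cls F) - cls F2 = l *\<^sub>R cls F + e"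
  then have F: "dataA F F1 F2" and e: "mulV (cls F) - cls F2 = l *\<^sub>R cls F + e" by blast+
  note L = dataA_L2[OF F]
  define \<eta> where "\<eta> x = of_real (V x) * F x - of_real l * F x - F2 x" for x
  have \<eta>: "\<eta> \<in> L2" unfolding \<eta>_def by (intro L2_diff L2_scale V_L2 L)
  have "cls \<eta> = mulV (cls F) - l *\<^sub>R cls F - cls F2"
   unfolding \<eta>_def mulV_cls[OF L(1)] scaleR_cls[OF L(1)] by (simp only: diff_cls V_L2 L2_scale L2_diff L)
  then have e\<eta>: "cls \<eta> = e" using e by (simp add: algebra_simps)
  define E where "E = (cmod (F 0))\<^sup>2 + (norm e)\<^sup>2"
  have pt: "(cmod (F x))\<^sup>2 \<le> exp ((2 + C) * b) * E" if x: "0 \<le> x" "x \<le> b" for x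
  proof -
   have "(cmod (F x))\<^sup>2 \<le> exp ((2 + C) * x) * E" unfolding E_def e\<eta>[symmetric]
   proof (rule gronwall[OF F \<eta> _ _ x(1), where q = "\<lambda>x. V x - l"])
    show "F2 x = of_real (V x - l) * F x - \<eta> x" for x by (simp add: \<eta>_def algebra_simps)
    show "0 \<le> x ==> \<bar>V x - l\<bar> \<le> C" for x using bd[of x] by (simp add: C_def)
   qed
   also have "\<dots> \<le> exp ((2 + C) * b) * E"
    by (rule mult_right_mono) (use x Vb_nonneg in \<open>simp_all add: C_def E_def mult_left_mono\<close>)
   finally show ?thesis .
  qed
  have li: "integrable halfline (indicator {0..b} :: real => real)" and le: "(LINT x|halfline. (indicator {0..b} x :: real)) = b"
  proof -
   have m: "emeasure halfline {0..b} = ennreal b" using b(1) by (subst emeasure_restrict_space) (auto simp: sets_restrict_space)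
   have s: "{0..b} \<in> sets halfline" by (subst sets_restrict_space_iff) auto
   show "integrable halfline (indicator {0..b} :: real => real)" by (rule integrable_real_indicator[OF s]) (simp add: m)
   show "(LINT x|halfline. (indicator {0..b} x :: real)) = b" using m b(1) by (simp add: measure_def Int_absorb2)
  qed
  have iF: "integrable halfline (\<lambda>x. (l / 2) * (cmod (F x))\<^sup>2)" by (rule integrable_mult_right[OF L2_integrable[OF L(1)]])
  have iI: "integrable halfline (\<lambda>x. Vb * (exp ((2 + C) * b) * E) * indicator {0..b} x)" by (rule integrable_mult_right[OF li])
  have iV: "integrable halfline (\<lambda>x. V x * (cmod (F x))\<^sup>2)" and eV: "inner (mulV (cls F)) (cls F) = (LINT x|halfline. V x * (cmod (F x))\<^sup>2)"
  proof -
   have eq: "of_real (V x) * F x * cnj (F x) = complex_of_real (V x * (cmod (F x))\<^sup>2)" for x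
    by (simp only: of_real_mult complex_norm_square mult.assoc)
   have "integrable halfline (\<lambda>x. of_real (V x) * F x * cnj (F x))" by (rule L2_inner_integrable[OF V_L2[OF L(1)] L(1)])
   then show i: "integrable halfline (\<lambda>x. V x * (cmod (F x))\<^sup>2)" unfolding eq complex_of_real_integrable_eq .
   show "inner (mulV (cls F)) (cls F) = (LINT x|halfline. V x * (cmod (F x))\<^sup>2)"
    unfolding mulV_cls[OF L(1)] inner_cls[OF V_L2[OF L(1)] L(1)] l2_inner_def eq integral_complex_of_real by simp
  qed
  \<comment> \<open>\<open>V\<close> is replaced by \<open>l / 2\<close> on the whole half-line, and
    the deficit on \<open>{0..b}\<close> is paid with the pointwise bound \<open>pt\<close>.\<close>
  have "(l / 2) * (norm (cls F))\<^sup>2 - Vb * (exp ((2 + C) * b) * E) * b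
   = (LINT x|halfline. (l / 2) * (cmod (F x))\<^sup>2 - Vb * (exp ((2 + C) * b) * E) * indicator {0..b} x)"
   unfolding Bochner_Integration.integral_diff[OF iF iI] integral_mult_right_zero le norm_cls_sq[OF L(1)] ..
  also have "\<dots> \<le> inner (mulV (cls F)) (cls F)" unfolding eV
  proof (rule integral_mono[OF Bochner_Integration.integrable_diff[OF iF iI] iV])
   fix x assume "x \<in> space halfline"
   then have x: "0 \<le> x" by simp
   show "(l / 2) * (cmod (F x))\<^sup>2 - Vb * (exp ((2 + C) * b) * E) * indicator {0..b} x \<le> V x * (cmod (F x))\<^sup>2"
   proof (cases "x \<le> b")
    case True
    have "Vb * (cmod (F x))\<^sup>2 \<le> Vb * (exp ((2 + C) * b) * E)" by (rule mult_left_mono[OF pt[OF x True] Vb_nonneg])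
    moreover have "- Vb * (cmod (F x))\<^sup>2 \<le> V x * (cmod (F x))\<^sup>2" by (rule mult_right_mono) (use bd[OF x] in \<open>simp_all add: abs_le_iff\<close>)
    moreover have "(l / 2) * (cmod (F x))\<^sup>2 \<le> 0" by (rule mult_nonpos_nonneg) (use neg in simp_all)
    ultimately show ?thesis using True x by simp
   next
    case False
    have "(l / 2) * (cmod (F x))\<^sup>2 \<le> V x * (cmod (F x))\<^sup>2" by (rule mult_right_mono) (use b(2)[of x] False in \<open>simp_all add: abs_le_iff\<close>)
    then show ?thesis using False by simp
   qed
  qed
  also have "\<dots> \<le> inner (mulV (cls F) - cls F2) (cls F)" unfolding opA_ibp[OF F F] by simp
  also have "\<dots> = l * (norm (cls F))\<^sup>2 + inner e (cls F)" unfolding e by (simp add: inner_add_left dot_square_norm)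
  also have "inner e (cls F) \<le> norm e * norm (cls F)" by (rule norm_cauchy_schwarz)
  finally have "(- l / 2) * (norm (cls F))\<^sup>2 \<le> Vb * exp ((2 + C) * b) * b * E + norm e * norm (cls F)" by (simp add: algebra_simps)
  also have "\<dots> \<le> B0 * E + B0 * (norm e * norm (cls F))"
  proof (rule add_mono)
   show "Vb * exp ((2 + C) * b) * b * E \<le> B0 * E" by (rule mult_right_mono) (simp_all add: B0_def E_def)
   show "norm e * norm (cls F) \<le> B0 * (norm e * norm (cls F))" using mult_right_mono[OF B0, of "norm e * norm (cls F)"] by simp
  qed
  finally have f: "(- l / 2) * (norm (cls F))\<^sup>2 \<le> B0 * (E + norm e * norm (cls F))" by (simp add: distrib_left)
  have "(2 / (- l)) * ((- l / 2) * (norm (cls F))\<^sup>2) \<le> (2 / (- l)) * (B0 * (E + norm e * norm (cls F)))"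
   by (rule mult_left_mono[OF f]) (use neg in simp)
  moreover have "(2 / (- l)) * ((- l / 2) * (norm (cls F))\<^sup>2) = (norm (cls F))\<^sup>2" using neg by simp
  ultimately show "(norm (cls F))\<^sup>2 \<le> 2 / (- l) * B0 * ((cmod (F 0))\<^sup>2 + (norm e)\<^sup>2 + norm e * norm (cls F))"
   by (simp only: E_def mult.assoc)
 qed
qed

text \<open>\<open>\<rho>\<close> is the top of the numerical range of the resolvent, so
  \<open>1 / \<rho> - M\<close> is the bottom of the spectrum of \<open>A\<close>. If that is
  negative, nearly maximal vectors for the form of \<open>Rv\<close> give the Weyl sequence
  \<open>v\<close>; the case \<open>M * \<rho> <= 1\<close> is a direct estimate.\<close>

lemma opA_nonneg:
 assumes decay: "\<And>p. p > 0 ==> \<exists>b\<ge>0. \<forall>x\<ge>b. \<bar>V x\<bar> \<le> p"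
  and noev: "\<And>l u. l < 0 ==> opA u (l *\<^sub>R u) ==> u = 0" and A: "opA u w"
 shows "0 \<le> inner w u"
proof -
 define S where "S = (\<lambda>g. inner (Rv g) g) ` cball 0 1"
 define \<rho> where "\<rho> = Sup S"
 have bdd: "bdd_above S"
 proof (rule bdd_aboveI)
  fix y assume "y \<in> S"
  then obtain g where g: "norm g \<le> 1" "y = inner (Rv g) g" by (auto simp: S_def)
  have "y \<le> (norm g)\<^sup>2" using res.le[of g] by (simp add: g(2) dot_square_norm)
  also have "\<dots> \<le> 1" using g(1) by (simp add: power_le_one)
  finally show "y \<le> 1" .
 qed
 have S1: "inner (Rv g) g \<le> \<rho>" if "norm g \<le> 1" for g
  unfolding \<rho>_def by (rule cSup_upper[OF _ bdd]) (use that in \<open>simp add: S_def\<close>)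
 have S2: "inner (Rv g) g \<le> \<rho> * (norm g)\<^sup>2" for g
 proof (cases "g = 0")
  case False
  have "inner (Rv (g /\<^sub>R norm g)) (g /\<^sub>R norm g) \<le> \<rho>" by (rule S1) (use False in simp)
  then have "inner (Rv g) g / (norm g)\<^sup>2 \<le> \<rho>" by (simp add: linear_scale[OF res.lin] power2_eq_square divide_inverse mult_ac)
  then show ?thesis using False by (simp add: pos_divide_le_eq)
 qed (simp add: linear_0[OF res.lin])
 \<comment> \<open>Positivity of the form at \<open>g - Rv g / \<rho>\<close>, with its upper bound
   \<open>\<rho>\<close> inserted at \<open>Rv g\<close>.\<close>
 have CS: "(norm (Rv g))\<^sup>2 \<le> \<rho> * inner (Rv g) g" if \<rho>: "\<rho> > 0" for g
 proof -
  have "0 \<le> inner (Rv (g - (1/\<rho>) *\<^sub>R Rv g)) (g - (1/\<rho>) *\<^sub>R Rv g)" by (rule res.pos)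
  also have "\<dots> = inner (Rv g) g - 2 * (1/\<rho>) * inner (Rv g) (Rv g) + (1/\<rho>)\<^sup>2 * inner (Rv (Rv g)) (Rv g)" by (rule res.form_diff)
  also have "(1/\<rho>)\<^sup>2 * inner (Rv (Rv g)) (Rv g) \<le> (1/\<rho>)\<^sup>2 * (\<rho> * (norm (Rv g))\<^sup>2)" by (rule mult_left_mono[OF S2]) simp
  also have "(1/\<rho>)\<^sup>2 * (\<rho> * (norm (Rv g))\<^sup>2) = 1 / \<rho> * (norm (Rv g))\<^sup>2" using \<rho> by (simp add: power2_eq_square)
  finally have "(norm (Rv g))\<^sup>2 / \<rho> \<le> inner (Rv g) g" unfolding dot_square_norm by simp
  then show ?thesis using \<rho> by (simp add: pos_divide_le_eq mult.commute)
 qed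
 show ?thesis
 proof (cases "M * \<rho> \<le> 1")
  case True
  define g where "g = w + M *\<^sub>R u"
  have u: "u = Rv g" using A unfolding opA_iff g_def .
  show ?thesis
  proof (cases "\<rho> \<le> 0")
   case True
   have "(norm (Rv g))\<^sup>2 \<le> \<rho> * (norm g)\<^sup>2" by (rule order_trans[OF Rv_energy S2])
   also have "\<dots> \<le> 0" by (rule mult_nonpos_nonneg[OF True]) simp
   finally have "u = 0" using u by simp
   then show ?thesis by simp
  next
   case False
   have N: "(norm u)\<^sup>2 \<le> \<rho> * inner u g" unfolding u by (rule CS) (use False in simp)
   have "M * (norm u)\<^sup>2 \<le> M * (\<rho> * inner u g)" by (rule mult_left_mono[OF N]) (use M(1) in simp)
   also have "\<dots> = (M * \<rho>) * inner u g" by simp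
   also have "\<dots> \<le> 1 * inner u g" by (rule mult_right_mono[OF True]) (use res.pos[of g] u in simp)
   finally have "M * (norm u)\<^sup>2 \<le> inner u g" by simp
   moreover have "inner u g = inner w u + M * (norm u)\<^sup>2" by (simp add: g_def inner_add_right dot_square_norm inner_commute)
   ultimately show ?thesis by simp
  qed
 next
  case False
  then have \<rho>: "\<rho> > 0" using M(1) by (metis mult_nonneg_nonpos not_le order.strict_implies_order order_trans zero_le_one)
  define l where "l = 1 / \<rho> - M"
  have l: "l < 0" using False \<rho> by (simp add: l_def field_simps)
  obtain b where b: "b \<ge> 0" "\<forall>x\<ge>b. \<bar>V x\<bar> \<le> - l / 2" using decay[of "- l / 2"] l by auto
  obtain C0 where C0: "C0 \<ge> 0" "\<forall>F F1 F2 e. dataA F F1 F2 \<and> mulV (cls F) - cls F2 = l *\<^sub>R cls F + e -->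
   (norm (cls F))\<^sup>2 \<le> C0 * ((cmod (F 0))\<^sup>2 + (norm e)\<^sup>2 + norm e * norm (cls F))"
   using compact_est[OF l b(1) b(2)[rule_format]] by blast
  have "\<forall>n. \<exists>g. norm g \<le> 1 \<and> \<rho> - inverse (real (Suc n)) < inner (Rv g) g"
  proof
   fix n
   have "S \<noteq> {}" by (simp add: S_def)
   moreover have "\<rho> - inverse (real (Suc n)) < Sup S" unfolding \<rho>_def by simp
   ultimately obtain y where y: "y \<in> S" "\<rho> - inverse (real (Suc n)) < y" using less_cSupD by blast
   then obtain g where "g \<in> cball 0 1" "y = inner (Rv g) g" unfolding S_def by blast
   then show "\<exists>g. norm g \<le> 1 \<and> \<rho> - inverse (real (Suc n)) < inner (Rv g) g"
    using y(2) by (intro exI[of _ g]) simp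
  qed
  then obtain g where g: "\<And>n. norm (g n) \<le> 1" "\<And>n. \<rho> - inverse (real (Suc n)) < inner (Rv (g n)) (g n)" by metis
  define v where "v n = Rv (g n)" for n
  \<comment> \<open>The error in \<open>A v n = l v n + e n\<close>. It equals
    \<open>- (v n - \<rho> g n) / \<rho>\<close>, which is small because \<open>g n\<close> nearly
    attains the supremum.\<close>
  define e where "e n = g n - M *\<^sub>R v n - l *\<^sub>R v n" for n
  have v1: "norm (v n) \<le> 1" for n unfolding v_def by (rule order_trans[OF Rv_norm g(1)])
  have v2: "\<rho> - inverse (real (Suc n)) \<le> norm (v n)" for n
  proof -
   have "inner (v n) (g n) \<le> norm (v n) * norm (g n)" by (rule norm_cauchy_schwarz)
   also have "\<dots> \<le> norm (v n) * 1" by (rule mult_left_mono[OF g(1)]) simp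
   finally show ?thesis using g(2)[of n] by (simp add: v_def)
  qed
  have e2: "(norm (e n))\<^sup>2 \<le> inverse (real (Suc n)) / \<rho>" for n
  proof -
   have "e n = (- 1 / \<rho>) *\<^sub>R (v n - \<rho> *\<^sub>R g n)" using \<rho> by (simp add: e_def l_def scaleR_diff_right scaleR_diff_left)
   then have "(norm (e n))\<^sup>2 = (1 / \<rho>)\<^sup>2 * (norm (v n - \<rho> *\<^sub>R g n))\<^sup>2" by (simp add: power_mult_distrib power_divide)
   also have "(norm (v n - \<rho> *\<^sub>R g n))\<^sup>2 = (norm (v n))\<^sup>2 - 2 * \<rho> * inner (v n) (g n) + \<rho>\<^sup>2 * (norm (g n))\<^sup>2"
    by (rule norm_diff_scaleR_sq)
   also have "\<dots> \<le> \<rho> * inner (v n) (g n) - 2 * \<rho> * inner (v n) (g n) + \<rho>\<^sup>2 * 1"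
    using CS[OF \<rho>, of "g n"] g(1)[of n] by (intro add_mono diff_right_mono mult_left_mono) (simp_all add: v_def power_le_one)
   also have "\<dots> = \<rho> * (\<rho> - inner (v n) (g n))" by (simp add: power2_eq_square algebra_simps)
   also have "\<dots> \<le> \<rho> * inverse (real (Suc n))" by (rule mult_left_mono) (use g(2)[of n] \<rho> in \<open>simp_all add: v_def\<close>)
   finally have "(norm (e n))\<^sup>2 \<le> (1 / \<rho>)\<^sup>2 * (\<rho> * inverse (real (Suc n)))" by (simp add: mult_left_mono)
   then show ?thesis using \<rho> by (simp add: power2_eq_square field_simps)
  qed
  have e0: "e \<longlonglongrightarrow> 0"
  proof -
   have "(\<lambda>n. inverse (real (Suc n)) / \<rho>) \<longlonglongrightarrow> 0 / \<rho>" by (intro tendsto_divide LIMSEQ_inverse_real_of_nat tendsto_const) (use \<rho> in simp)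
   then have z: "(\<lambda>n. inverse (real (Suc n)) / \<rho>) \<longlonglongrightarrow> 0" by simp
   have "(\<lambda>n. (norm (e n))\<^sup>2) \<longlonglongrightarrow> 0"
    by (rule Lim_null_comparison[OF always_eventually z], rule allI, unfold real_norm_def abs_power2, rule e2)
   then show ?thesis using tendsto_real_sqrt[of "\<lambda>n. (norm (e n))\<^sup>2" 0] by (simp add: tendsto_norm_zero_iff)
  qed
  have "\<forall>n. \<exists>F F1 F2. dataA F F1 F2 \<and> v n = cls F \<and> g n - M *\<^sub>R v n = mulV (v n) - cls F2"
   using Rv unfolding opA_def v_def by blast
  then obtain F F1 F2 where F: "\<And>n. dataA (F n) (F1 n) (F2 n)" "\<And>n. v n = cls (F n)" "\<And>n. g n - M *\<^sub>R v n = mulV (v n) - cls (F2 n)"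
   by metis
  have eqF: "mulV (cls (F n)) - cls (F2 n) = l *\<^sub>R cls (F n) + e n" for n
   using F(3)[of n] by (simp add: e_def F(2))
  define q where "q = 1 + M + Vb"
  have F1b: "(norm (cls (F1 n)))\<^sup>2 \<le> q" for n
  proof -
   have "inner (g n - M *\<^sub>R v n) (v n) = inner (cls (F1 n)) (cls (F1 n)) + inner (mulV (v n)) (v n)"
    using opA_ibp[OF F(1)[of n] F(1)[of n]] unfolding F(2)[symmetric] F(3)[symmetric] .
   then have "(norm (cls (F1 n)))\<^sup>2 = inner (g n) (v n) - M * (norm (v n))\<^sup>2 - inner (mulV (v n)) (v n)"
    by (simp add: dot_square_norm inner_diff_left)
   moreover have "inner (g n) (v n) \<le> 1"
    using norm_cauchy_schwarz[of "g n" "v n"] mult_mono[OF g(1)[of n] v1[of n]] by simp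
   moreover have "0 \<le> M * (norm (v n))\<^sup>2" using M(1) by simp
   moreover have "- inner (mulV (v n)) (v n) \<le> Vb"
   proof -
    have "Vb * (norm (v n))\<^sup>2 \<le> Vb * 1" by (rule mult_left_mono) (simp_all add: power_le_one v1 Vb_nonneg)
    then show ?thesis using mulV_inner[of "v n"] by (simp add: abs_le_iff)
   qed
   ultimately show ?thesis using M(1) unfolding q_def by linarith
  qed
  \<comment> \<open>The derivatives are bounded by the energy (\<open>F1b\<close>), hence so are the
    boundary values. Bolzano-Weierstrass makes them converge along \<open>r\<close>, and by
    \<open>est\<close> this suffices for convergence of \<open>v\<close> along
    \<open>r\<close>.\<close>
  have "bounded (range (\<lambda>n. F n 0))"
   unfolding bounded_iff
  proof (rule exI[of _ "sqrt (2 * sqrt q)"], intro ballI)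
   fix x assume "x \<in> range (\<lambda>n. F n 0)"
   then obtain n where x: "x = F n 0" by blast
   have "(cmod (F n 0))\<^sup>2 \<le> 2 * norm (cls (F n)) * norm (cls (F1 n))" by (rule boundary_value_bound[OF F(1)])
   also have "\<dots> \<le> 2 * 1 * sqrt q" using v1[of n] real_le_rsqrt[OF F1b[of n]] by (intro mult_mono) (simp_all add: F(2))
   finally show "norm x \<le> sqrt (2 * sqrt q)" unfolding x by (intro real_le_rsqrt) simp
  qed
  then obtain a r where r: "strict_mono r" and a: "((\<lambda>n. F n 0) \<circ> r) \<longlonglongrightarrow> a" using bounded_imp_convergent_subsequence by blast
  have er: "(e \<circ> r) \<longlonglongrightarrow> 0" by (rule LIMSEQ_subseq_LIMSEQ[OF e0 r])
  have est: "(norm (v (r j) - v (r k)))\<^sup>2 \<le> C0 * ((cmod (F (r j) 0 - F (r k) 0))\<^sup>2 + (norm (e (r j) - e (r k)))\<^sup>2 + norm (e (r j) - e (r k)) * norm (v (r j) - v (r k)))" for j k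
  proof -
   note L = dataA_L2[OF F(1)]
   have D: "dataA (\<lambda>x. F (r j) x - F (r k) x) (\<lambda>x. F1 (r j) x - F1 (r k) x) (\<lambda>x. F2 (r j) x - F2 (r k) x)"
    using dataA_lin[OF F(1) F(1), of "r j" "-1" "r k"] by simp
   have "mulV (cls (\<lambda>x. F (r j) x - F (r k) x)) - cls (\<lambda>x. F2 (r j) x - F2 (r k) x) = l *\<^sub>R cls (\<lambda>x. F (r j) x - F (r k) x) + (e (r j) - e (r k))"
    unfolding diff_cls[OF L(1) L(1), symmetric] diff_cls[OF L(3) L(3), symmetric] mulV_simps
    using eqF[of "r j"] eqF[of "r k"] by (simp add: algebra_simps)
   with D have "(norm (cls (\<lambda>x. F (r j) x - F (r k) x)))\<^sup>2 \<le> C0 * ((cmod (F (r j) 0 - F (r k) 0))\<^sup>2 + (norm (e (r j) - e (r k)))\<^sup>2 + norm (e (r j) - e (r k)) * norm (cls (\<lambda>x. F (r j) x - F (r k) x)))"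
    by (intro C0(2)[rule_format, of _ "\<lambda>x. F1 (r j) x - F1 (r k) x" "\<lambda>x. F2 (r j) x - F2 (r k) x"]) blast
   then show ?thesis unfolding diff_cls[OF L(1) L(1), symmetric] F(2)[symmetric] .
  qed
  have "Cauchy (v \<circ> r)"
  proof (rule metric_CauchyI)
   fix p :: real assume p: "p > 0"
   \<comment> \<open>With \<open>d^2 <= d\<close> and \<open>norm (v (r m) - v (r n)) <= 2\<close>,
     the three terms of \<open>est\<close> add up to at most \<open>4 * d\<close>; the denominator
     then makes \<open>4 C0 d\<close> smaller than \<open>p^2\<close>.\<close>
   define d where "d = min 1 (p\<^sup>2 / (4 * C0 + 1))"
   have d: "d > 0" "d \<le> 1" "(4 * C0 + 1) * d \<le> p\<^sup>2"
   proof -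
    show "d > 0" "d \<le> 1" using p C0(1) by (simp_all add: d_def)
    have "d \<le> p\<^sup>2 / (4 * C0 + 1)" by (simp add: d_def)
    then show "(4 * C0 + 1) * d \<le> p\<^sup>2" using C0(1) by (simp add: pos_le_divide_eq mult.commute)
   qed
   obtain N1 where N1: "\<forall>m\<ge>N1. \<forall>n\<ge>N1. dist (((\<lambda>n. F n 0) \<circ> r) m) (((\<lambda>n. F n 0) \<circ> r) n) < d"
    using metric_CauchyD[OF LIMSEQ_imp_Cauchy[OF a] d(1)] by blast
   obtain N2 where N2: "\<forall>m\<ge>N2. \<forall>n\<ge>N2. dist ((e \<circ> r) m) ((e \<circ> r) n) < d"
    using metric_CauchyD[OF LIMSEQ_imp_Cauchy[OF er] d(1)] by blast
   show "\<exists>N. \<forall>m\<ge>N. \<forall>n\<ge>N. dist ((v \<circ> r) m) ((v \<circ> r) n) < p"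
   proof (rule exI[of _ "max N1 N2"], intro allI impI)
    fix m n assume mn: "max N1 N2 \<le> m" "max N1 N2 \<le> n"
    have A1: "cmod (F (r m) 0 - F (r n) 0) \<le> d" using N1[rule_format, of m n] mn by (simp add: dist_norm)
    have A2: "norm (e (r m) - e (r n)) \<le> d" using N2[rule_format, of m n] mn by (simp add: dist_norm)
    have A3: "norm (v (r m) - v (r n)) \<le> 2" using norm_triangle_ineq4[of "v (r m)" "v (r n)"] v1[of "r m"] v1[of "r n"] by linarith
    have dd: "d\<^sup>2 \<le> d" using d by (simp add: power2_eq_square mult_left_le)
    have "(cmod (F (r m) 0 - F (r n) 0))\<^sup>2 \<le> d\<^sup>2" "(norm (e (r m) - e (r n)))\<^sup>2 \<le> d\<^sup>2"
     by (intro power_mono A1 A2; simp)+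
    moreover have "norm (e (r m) - e (r n)) * norm (v (r m) - v (r n)) \<le> d * 2" by (rule mult_mono[OF A2 A3]) (use d in simp_all)
    ultimately have "(cmod (F (r m) 0 - F (r n) 0))\<^sup>2 + (norm (e (r m) - e (r n)))\<^sup>2 + norm (e (r m) - e (r n)) * norm (v (r m) - v (r n)) \<le> 4 * d"
     using dd by linarith
    then have "(norm (v (r m) - v (r n)))\<^sup>2 \<le> C0 * (4 * d)" by (rule order_trans[OF est mult_left_mono[OF _ C0(1)]])
    also have "\<dots> < (4 * C0 + 1) * d" using d(1) by (simp add: algebra_simps)
    also have "\<dots> \<le> p\<^sup>2" by (rule d(3))
    finally have "norm (v (r m) - v (r n)) < p" by (rule power2_less_imp_less) (use p in simp)
    then show "dist ((v \<circ> r) m) ((v \<circ> r) n) < p" by (simp add: dist_norm)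
   qed
  qed
  then obtain z where z: "(v \<circ> r) \<longlonglongrightarrow> z" using Cauchy_convergent_iff convergent_def by blast
  have "(\<lambda>n. Rv (l *\<^sub>R (v \<circ> r) n + (e \<circ> r) n + M *\<^sub>R (v \<circ> r) n)) \<longlonglongrightarrow> Rv (l *\<^sub>R z + 0 + M *\<^sub>R z)"
  proof (rule bounded_linear.tendsto[OF bounded_linear_intro[of Rv 1]])
   show "Rv (x + y) = Rv x + Rv y" "Rv (c *\<^sub>R x) = c *\<^sub>R Rv x" for x y c by (rule linear_add[OF res.lin], rule linear_scale[OF res.lin])
   show "norm (Rv x) \<le> norm x * 1" for x using Rv_norm by simp
   show "(\<lambda>n. l *\<^sub>R (v \<circ> r) n + (e \<circ> r) n + M *\<^sub>R (v \<circ> r) n) \<longlonglongrightarrow> l *\<^sub>R z + 0 + M *\<^sub>R z"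
    by (intro tendsto_add tendsto_scaleR tendsto_const z er)
  qed
  moreover have "Rv (l *\<^sub>R (v \<circ> r) n + (e \<circ> r) n + M *\<^sub>R (v \<circ> r) n) = (v \<circ> r) n" for n
   by (simp add: e_def v_def)
  ultimately have "(v \<circ> r) \<longlonglongrightarrow> Rv (l *\<^sub>R z + M *\<^sub>R z)" by (simp add: o_def)
  from LIMSEQ_unique[OF z this] have "opA z (l *\<^sub>R z)" unfolding opA_iff .
  then have "z = 0" by (rule noev[OF l])
  \<comment> \<open>\<open>norm (v n)\<close> is at least the value of the form at
    \<open>g n\<close>, which tends to the positive number \<open>\<rho>\<close>; so the limit
    cannot be zero.\<close>
  moreover have "\<rho> - 0 \<le> norm z"
  proof (rule LIMSEQ_le[OF _ tendsto_norm[OF z]])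
   show "(\<lambda>n. \<rho> - ((\<lambda>n. inverse (real (Suc n))) \<circ> r) n) \<longlonglongrightarrow> \<rho> - 0"
    by (intro tendsto_diff tendsto_const LIMSEQ_subseq_LIMSEQ[OF LIMSEQ_inverse_real_of_nat r])
   show "\<exists>N. \<forall>n\<ge>N. \<rho> - ((\<lambda>n. inverse (real (Suc n))) \<circ> r) n \<le> norm ((v \<circ> r) n)" using v2 by auto
  qed
  ultimately show ?thesis using \<rho> by simp
 qed
qed

end

section \<open>Projection-valued measures on the space of classes\<close>

text \<open>Starts from an arbitrary \<open>E\<close> with \<open>pvm E\<close>, since the
  functional calculus uses one obtained by choice; \<open>Q\<close> below is its action on
  classes.\<close>

locale halfline_pvm =
 fixes E :: "real set => (real => complex) => real => complex"
 assumes pvm: "pvm E"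
begin

lemma
 assumes B: "B \<in> sets borel"
 shows E_L2: "f \<in> L2 ==> E B f \<in> L2"
  and E_cong: "f \<in> L2 ==> g \<in> L2 ==> l2_eq f g ==> l2_eq (E B f) (E B g)"
  and E_add: "f \<in> L2 ==> g \<in> L2 ==> l2_eq (E B (\<lambda>x. f x + g x)) (\<lambda>x. E B f x + E B g x)"
  and E_cmul: "f \<in> L2 ==> l2_eq (E B (\<lambda>x. c * f x)) (\<lambda>x. c * E B f x)"
  and E_idem: "f \<in> L2 ==> l2_eq (E B (E B f)) (E B f)"
  and E_sym: "f \<in> L2 ==> g \<in> L2 ==> l2_inner (E B f) g = l2_inner f (E B g)"
proof -
 note b = bspec[OF conjunct1[OF iffD1[OF pvm_def pvm]] B]
 show "f \<in> L2 ==> E B f \<in> L2" by (rule b[THEN conjunct1, rule_format])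
 show "f \<in> L2 ==> g \<in> L2 ==> l2_eq f g ==> l2_eq (E B f) (E B g)"
  by (rule b[THEN conjunct2, THEN conjunct1, rule_format])
 show "f \<in> L2 ==> g \<in> L2 ==> l2_eq (E B (\<lambda>x. f x + g x)) (\<lambda>x. E B f x + E B g x)"
  by (rule b[THEN conjunct2, THEN conjunct2, THEN conjunct1, rule_format])
 show "f \<in> L2 ==> l2_eq (E B (\<lambda>x. c * f x)) (\<lambda>x. c * E B f x)"
  by (rule b[THEN conjunct2, THEN conjunct2, THEN conjunct2, THEN conjunct1, rule_format])
 show "f \<in> L2 ==> l2_eq (E B (E B f)) (E B f)"
  by (rule b[THEN conjunct2, THEN conjunct2, THEN conjunct2, THEN conjunct2, THEN conjunct1, rule_format])
 show "f \<in> L2 ==> g \<in> L2 ==> l2_inner (E B f) g = l2_inner f (E B g)"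
  by (rule b[THEN conjunct2, THEN conjunct2, THEN conjunct2, THEN conjunct2, THEN conjunct2, rule_format])
qed

definition Q where "Q B u = cls (E B (rep u))"

lemma Q_cls: "B \<in> sets borel ==> f \<in> L2 ==> Q B (cls f) = cls (E B f)"
 unfolding Q_def by (intro cls_eqI E_L2 E_cong rep_L2 rep_cls) assumption+

lemma Q_cmul: assumes B: "B \<in> sets borel" shows "Q B (cmul c u) = cmul c (Q B u)"
proof -
 obtain f where f: "f \<in> L2" "u = cls f" using ex_cls by blast
 show ?thesis unfolding f(2) cmul_cls[OF f(1)] Q_cls[OF B f(1)] Q_cls[OF B L2_scale[OF f(1)]] cmul_cls[OF E_L2[OF B f(1)]]
  by (intro cls_eqI E_cmul E_L2 L2_scale B f)
qed

sublocale spectral Q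
proof (rule spectral.intro)
 fix B :: "real set" assume B: "B \<in> sets borel"
 have add: "Q B (u + v) = Q B u + Q B v" for u v
 proof -
  obtain f g where f: "f \<in> L2" "u = cls f" and g: "g \<in> L2" "v = cls g" using ex_cls by metis
  show ?thesis
   unfolding f(2) g(2) plus_cls[OF f(1) g(1)] Q_cls[OF B f(1)] Q_cls[OF B g(1)] Q_cls[OF B L2_add[OF f(1) g(1)]]
    plus_cls[OF E_L2[OF B f(1)] E_L2[OF B g(1)]]
   by (intro cls_eqI E_add E_L2 L2_add B f g)
 qed
 have scale: "Q B (c *\<^sub>R u) = c *\<^sub>R Q B u" for c u
  using Q_cmul[OF B, of "of_real c" u] unfolding cmul_Complex[of "of_real c"] by simp
 show "linear (Q B)" by (rule linearI) (rule add, rule scale)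
 fix u v :: hl2
 obtain f g where f: "f \<in> L2" "u = cls f" and g: "g \<in> L2" "v = cls g" using ex_cls by metis
 show "Q B (Q B u) = Q B u" unfolding f(2) Q_cls[OF B f(1)] Q_cls[OF B E_L2[OF B f(1)]]
  by (intro cls_eqI E_idem E_L2 B f)
 show "inner (Q B u) v = inner u (Q B v)"
  unfolding f(2) g(2) Q_cls[OF B f(1)] Q_cls[OF B g(1)] inner_cls[OF E_L2[OF B f(1)] g(1)] inner_cls[OF f(1) E_L2[OF B g(1)]]
  by (simp only: E_sym[OF B f(1) g(1)])
next
 fix u :: hl2
 obtain f where f: "f \<in> L2" "u = cls f" using ex_cls by blast
 have "l2_eq (E UNIV f) f" using conjunct2[OF iffD1[OF pvm_def pvm]] f(1) by blast
 then have e: "cls (E UNIV f) = cls f" by (rule cls_eqI[OF E_L2[OF _ f(1)] f(1), rotated]) simp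
 have "Q UNIV (cls f) = cls (E UNIV f)" by (rule Q_cls[OF _ f(1)]) simp
 then show "Q UNIV u = u" unfolding f(2) e .
next
 fix D :: "nat => real set" and u :: hl2 assume D: "range D \<subseteq> sets borel" "disjoint_family D"
 obtain f where f: "f \<in> L2" "u = cls f" using ex_cls by blast
 have Di: "D i \<in> sets borel" for i using D(1) by auto
 have DU: "(\<Union>i. D i) \<in> sets borel" using Di by (intro sets.countable_UN') auto
 have lim: "(\<lambda>n. l2_norm (\<lambda>x. E (\<Union>i. D i) f x - (\<Sum>i<n. E (D i) f x))) \<longlonglongrightarrow> 0"
  using conjunct2[OF conjunct2[OF iffD1[OF pvm_def pvm]]] D f(1) by blast
 have eq: "norm (Q (\<Union>i. D i) u - (\<Sum>i<n. Q (D i) u)) = l2_norm (\<lambda>x. E (\<Union>i. D i) f x - (\<Sum>i<n. E (D i) f x))" for n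
 proof -
  have "(\<Sum>i<n. Q (D i) u) = (\<Sum>i<n. cls (E (D i) f))" by (intro sum.cong refl) (simp add: f(2) Q_cls[OF Di f(1)])
  also have "\<dots> = cls (\<lambda>x. \<Sum>i<n. E (D i) f x)" by (rule sum_cls) (rule E_L2[OF Di f(1)])
  finally have "Q (\<Union>i. D i) u - (\<Sum>i<n. Q (D i) u) = cls (\<lambda>x. E (\<Union>i. D i) f x - (\<Sum>i<n. E (D i) f x))"
   unfolding f(2) Q_cls[OF DU f(1)] by (simp only: diff_cls[OF E_L2[OF DU f(1)] L2_sum[OF E_L2[OF Di f(1)]]])
  then show ?thesis by (simp only: norm_cls[OF L2_diff[OF E_L2[OF DU f(1)] L2_sum[OF E_L2[OF Di f(1)]]]])
 qed
 have "(\<lambda>n. Q (\<Union>i. D i) u - (\<Sum>i<n. Q (D i) u)) \<longlonglongrightarrow> 0"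
  by (rule tendsto_norm_zero_cancel) (simp only: eq lim)
 then have "(\<lambda>n. Q (\<Union>i. D i) u - (Q (\<Union>i. D i) u - (\<Sum>i<n. Q (D i) u))) \<longlonglongrightarrow> Q (\<Union>i. D i) u - 0"
  by (intro tendsto_diff tendsto_const)
 then show "(\<lambda>n. \<Sum>i<n. Q (D i) u) \<longlonglongrightarrow> Q (\<Union>i. D i) u" by simp
qed

lemma measure_of_borel_eq:
 assumes "\<And>B. B \<in> sets borel ==> m B = m' B"
 shows "measure_of UNIV (sets (borel :: real measure)) m = measure_of UNIV (sets borel) m'"
 by (rule measure_of_eq) (use assms sets.sigma_sets_eq[of "borel :: real measure"] in auto)

lemma spec_meas_eq: assumes f: "f \<in> L2" shows "spec_meas E f = mu (cls f)"
 unfolding spec_meas_def mu_def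
 by (rule measure_of_borel_eq) (simp add: Q_cls[OF _ f] norm_cls[OF E_L2[OF _ f]])

lemma spec_dom_iff: "f \<in> spec_dom E p \<longleftrightarrow> f \<in> L2 \<and> cls f \<in> dom p"
 using spec_meas_eq[of f] by (auto simp: spec_dom_def dom_def)

lemma mu_cmul_ii: "mu (cmul \<i> v) = mu v"
 unfolding mu_def
 by (rule measure_of_borel_eq) (simp add: Q_cmul norm_eq_sqrt_inner inner_cmul_ii)

text \<open>The even powers of \<open>\<i>\<close> give the real part, a real polarization for
  \<open>f\<close> and \<open>g\<close>; the odd powers give the imaginary part, one for
  \<open>f\<close> and \<open>\<i> g\<close>.\<close>

lemma polarization_sum:
 assumes f: "f \<in> L2" and g: "g \<in> L2"
 shows "(\<Sum>k<4. \<i> ^ k * of_real (LINT \<mu>|spec_meas E (\<lambda>x. f x + \<i> ^ k * g x). p \<mu>)) / 4 =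
  Complex (((LINT x|mu (cls f + cls g). p x) - (LINT x|mu (cls f - cls g). p x)) / 4)
   (((LINT x|mu (cls f + cmul \<i> (cls g)). p x) - (LINT x|mu (cls f - cmul \<i> (cls g)). p x)) / 4)"
proof -
 have eq: "spec_meas E (\<lambda>x. f x + \<i> ^ k * g x) = mu (cls f + (Re (\<i> ^ k) *\<^sub>R cls g + Im (\<i> ^ k) *\<^sub>R cmul \<i> (cls g)))" for k
  by (simp only: spec_meas_eq[OF L2_add[OF f L2_scale[OF g]]] plus_cls[OF f L2_scale[OF g], symmetric] cmul_cls[OF g, symmetric] cmul_Complex[of "\<i> ^ k"])
 show ?thesis
  unfolding eq by (rule complex_eqI) (simp_all add: numeral_eq_Suc algebra_simps)
qed

text \<open>The real part of the weak identity determines \<open>h\<close> by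
  \<open>Phi_unique\<close>. Conversely the imaginary part is the same identity at
  \<open>\<i> g\<close>, which lies in the domain by \<open>mu_cmul_ii\<close>.\<close>

lemma spec_int_iff:
 assumes m: "p \<in> borel_fun"
 shows "spec_int E p f h \<longleftrightarrow> f \<in> L2 \<and> cls f \<in> dom p \<and> h \<in> L2 \<and> cls h = Phi p (cls f)"
proof
 assume s: "spec_int E p f h"
 then have f: "f \<in> L2" "cls f \<in> dom p" and h: "h \<in> L2" by (auto simp: spec_int_def spec_dom_iff)
 have "cls h = Phi p (cls f)"
 proof (rule Phi_unique[OF m f(2)])
  fix v assume v: "v \<in> dom p"
  then have "rep v \<in> spec_dom E p" by (simp add: spec_dom_iff)
  with s have "l2_inner h (rep v) = (\<Sum>k<4. \<i> ^ k * of_real (LINT \<mu>|spec_meas E (\<lambda>x. f x + \<i> ^ k * rep v x). p \<mu>)) / 4"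
   by (simp only: spec_int_def)
  from this[unfolded polarization_sum[OF f(1) rep_L2] l2_inner_cls[OF h rep_L2] cls_rep complex.inject]
  show "inner (cls h) v = ((LINT x|mu (cls f + v). p x) - (LINT x|mu (cls f - v). p x)) / 4" by (rule conjunct1)
 qed
 with f h show "f \<in> L2 \<and> cls f \<in> dom p \<and> h \<in> L2 \<and> cls h = Phi p (cls f)" by blast
next
 assume r: "f \<in> L2 \<and> cls f \<in> dom p \<and> h \<in> L2 \<and> cls h = Phi p (cls f)"
 then have f: "f \<in> L2" "cls f \<in> dom p" and h: "h \<in> L2" "cls h = Phi p (cls f)" by blast+
 show "spec_int E p f h" unfolding spec_int_def
 proof (intro conjI ballI)
  show "f \<in> spec_dom E p" using f by (simp add: spec_dom_iff)
  show "h \<in> L2" by (rule h)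
  fix g assume "g \<in> spec_dom E p"
  then have g: "g \<in> L2" "cls g \<in> dom p" by (simp_all add: spec_dom_iff)
  have gi: "cmul \<i> (cls g) \<in> dom p" using g(2) by (simp add: dom_def mu_cmul_ii)
  show "l2_inner h g = (\<Sum>k<4. \<i> ^ k * of_real (LINT \<mu>|spec_meas E (\<lambda>x. f x + \<i> ^ k * g x). p \<mu>)) / 4"
   unfolding polarization_sum[OF f(1) g(1)] l2_inner_cls[OF h(1) g(1)] h(2) inner_Phi[OF m f(2) g(2)] inner_Phi[OF m f(2) gi] ..
 qed
qed

lemma fcalc_props:
 assumes T: "spectral_measure T = E" and m: "p \<in> borel_fun" and f: "f \<in> L2" "cls f \<in> dom p"
 shows "fcalc T p f \<in> L2" "cls (fcalc T p f) = Phi p (cls f)"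
proof -
 have "spec_int E p f (rep (Phi p (cls f)))" using f by (simp add: spec_int_iff[OF m])
 then have "spec_int E p f (fcalc T p f)" unfolding fcalc_def T by (rule someI[of "spec_int E p f"])
 then show "fcalc T p f \<in> L2" "cls (fcalc T p f) = Phi p (cls f)" by (simp_all add: spec_int_iff[OF m])
qed

end

text \<open>Commuting with \<open>cmul \<i>\<close> makes real-linear projections complex-linear and
  their symmetry one for the complex inner product.\<close>

lemma pvm_from_spectral:
 fixes P :: "real set => hl2 => hl2"
 assumes sp: "spectral P" and comm: "\<And>B u. B \<in> sets borel ==> P B (cmul \<i> u) = cmul \<i> (P B u)"
 shows "pvm (\<lambda>B f. rep (P B (cls f)))"
proof -
 interpret spectral P by (rule sp)
 have cc: "P B (cmul c u) = cmul c (P B u)" if "B \<in> sets borel" for B c u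
  unfolding cmul_Complex[of c] by (simp add: linear_add[OF lin[OF that]] linear_scale[OF lin[OF that]] comm[OF that])
 show ?thesis unfolding pvm_def
 proof (intro conjI ballI allI impI)
  fix B :: "real set" assume B: "B \<in> sets borel"
  fix f assume f: "f \<in> L2"
  show "rep (P B (cls f)) \<in> L2" by simp
  show "l2_eq (rep (P B (cls (rep (P B (cls f)))))) (rep (P B (cls f)))" by (simp add: idem[OF B])
  fix c
  have "cls (\<lambda>x. c * rep (P B (cls f)) x) = cmul c (P B (cls f))" by (simp add: cmul_cls[symmetric])
  then show "l2_eq (rep (P B (cls (\<lambda>x. c * f x)))) (\<lambda>x. c * rep (P B (cls f)) x)"
   by (simp add: cls_eq_iff[symmetric] L2_scale cmul_cls[OF f, symmetric] cc[OF B])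
  fix g assume g: "g \<in> L2"
  show "l2_eq (rep (P B (cls (\<lambda>x. f x + g x)))) (\<lambda>x. rep (P B (cls f)) x + rep (P B (cls g)) x)"
   by (simp add: cls_eq_iff[symmetric] L2_add plus_cls[symmetric] f g linear_add[OF lin[OF B]])
  show "l2_inner (rep (P B (cls f))) g = l2_inner f (rep (P B (cls g)))"
   by (simp add: l2_inner_cls f g sym[OF B] comm[OF B, symmetric])
  show "l2_eq (rep (P B (cls f))) (rep (P B (cls g)))" if "l2_eq f g"
   using cls_eqI[OF f g that] by simp
 next
  fix f assume f: "f \<in> L2"
  show "l2_eq (rep (P UNIV (cls f))) f" by (simp add: rep_cls[OF f])
 next
  fix D :: "nat => real set" and f assume D: "range D \<subseteq> sets borel \<and> disjoint_family D" and f: "f \<in> L2"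
  have eq: "l2_norm (\<lambda>x. rep (P (\<Union>i. D i) (cls f)) x - (\<Sum>i<n. rep (P (D i) (cls f)) x)) = norm (P (\<Union>i. D i) (cls f) - (\<Sum>i<n. P (D i) (cls f)))" for n
   by (simp add: norm_cls[symmetric] L2_diff L2_sum diff_cls[symmetric] sum_cls[symmetric])
  have "(\<lambda>n. P (\<Union>i. D i) (cls f) - (\<Sum>i<n. P (D i) (cls f))) \<longlonglongrightarrow> P (\<Union>i. D i) (cls f) - P (\<Union>i. D i) (cls f)"
   by (intro tendsto_diff tendsto_const sums) (use D in blast)+
  then show "(\<lambda>n. l2_norm (\<lambda>x. rep (P (\<Union>i. D i) (cls f)) x - (\<Sum>i<n. rep (P (D i) (cls f)) x))) \<longlonglongrightarrow> 0"
   unfolding eq by (simp add: tendsto_norm_zero)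
 qed
qed

text \<open>Constructing one measure from \<open>P\<close> shows that the choice in
  \<open>spectral_measure\<close> is not void; the chosen one is then known by its two defining
  properties.\<close>

lemma spectral_measure_props:
 fixes P :: "real set => hl2 => hl2"
 assumes sp: "spectral P" and comm: "\<And>B u. B \<in> sets borel ==> P B (cmul \<i> u) = cmul \<i> (P B u)"
  and T: "\<And>f h. (f, h) \<in> T \<longleftrightarrow> f \<in> L2 \<and> h \<in> L2 \<and> cls f \<in> spectral.dom P (\<lambda>x. x) \<and> cls h = spectral.Phi P (\<lambda>x. x) (cls f)"
 shows "pvm (spectral_measure T) \<and> T = {(f, h). spec_int (spectral_measure T) (\<lambda>\<mu>. \<mu>) f h}"
proof -
 define E where "E = (\<lambda>B f. rep (P B (cls f)))"
 have E: "pvm E" unfolding E_def by (rule pvm_from_spectral[OF sp comm])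
 interpret E: halfline_pvm E by unfold_locales (rule E)
 have Q: "E.Q = P" by (intro ext) (simp only: E.Q_def, simp add: E_def)
 have "T = {(f, h). spec_int E (\<lambda>\<mu>. \<mu>) f h}"
  by (auto simp: T E.spec_int_iff[unfolded Q])
 with E have "\<exists>E. pvm E \<and> T = {(f, h). spec_int E (\<lambda>\<mu>. \<mu>) f h}" by blast
 then show ?thesis unfolding spectral_measure_def by (rule someI_ex)
qed

section \<open>Functional calculus of a nonnegative operator\<close>

text \<open>The condition of \<open>has_time_deriv\<close> on vectors. Here the derivative is
  unique, whereas \<open>time_deriv\<close> returns some representative.\<close>

definition hderiv :: "(real => 'a::real_normed_vector) => 'a => real => bool" where
 "hderiv U v t \<longleftrightarrow> ((\<lambda>s. norm ((U s - U t) /\<^sub>R (s - t) - v)) \<longlongrightarrow> 0) (at t)"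

lemma hderiv_unique:
 assumes v: "hderiv U v t" and w: "hderiv U w t" shows "v = w"
proof -
 have "((\<lambda>s. norm ((U s - U t) /\<^sub>R (s - t) - w) + norm ((U s - U t) /\<^sub>R (s - t) - v)) \<longlongrightarrow> 0 + 0) (at t)"
  by (intro tendsto_add v[unfolded hderiv_def] w[unfolded hderiv_def])
 moreover have "\<forall>\<^sub>F s in at t. norm (v - w) \<le> norm ((U s - U t) /\<^sub>R (s - t) - w) + norm ((U s - U t) /\<^sub>R (s - t) - v)"
 proof (rule always_eventually, rule allI)
  fix s
  show "norm (v - w) \<le> norm ((U s - U t) /\<^sub>R (s - t) - w) + norm ((U s - U t) /\<^sub>R (s - t) - v)"
   using norm_triangle_ineq4[of "(U s - U t) /\<^sub>R (s - t) - w" "(U s - U t) /\<^sub>R (s - t) - v"] by simp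
 qed
 ultimately have "norm (v - w) \<le> 0 + 0" by (rule tendsto_lowerbound) simp
 then show ?thesis by simp
qed

lemma hderiv_add:
 assumes v: "hderiv U v t" and w: "hderiv W w t" shows "hderiv (\<lambda>s. U s + W s) (v + w) t"
 unfolding hderiv_def
proof (rule Lim_null_comparison)
 have "((\<lambda>s. norm ((U s - U t) /\<^sub>R (s - t) - v) + norm ((W s - W t) /\<^sub>R (s - t) - w)) \<longlongrightarrow> 0 + 0) (at t)"
  by (intro tendsto_add v[unfolded hderiv_def] w[unfolded hderiv_def])
 then show "((\<lambda>s. norm ((U s - U t) /\<^sub>R (s - t) - v) + norm ((W s - W t) /\<^sub>R (s - t) - w)) \<longlongrightarrow> 0) (at t)" by simp
 show "\<forall>\<^sub>F s in at t. norm (norm ((U s + W s - (U t + W t)) /\<^sub>R (s - t) - (v + w))) \<le> norm ((U s - U t) /\<^sub>R (s - t) - v) + norm ((W s - W t) /\<^sub>R (s - t) - w)"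
 proof (rule always_eventually, rule allI)
  fix s
  have "(U s + W s - (U t + W t)) /\<^sub>R (s - t) - (v + w) = ((U s - U t) /\<^sub>R (s - t) - v) + ((W s - W t) /\<^sub>R (s - t) - w)"
   by (simp add: algebra_simps)
  then show "norm (norm ((U s + W s - (U t + W t)) /\<^sub>R (s - t) - (v + w))) \<le> norm ((U s - U t) /\<^sub>R (s - t) - v) + norm ((W s - W t) /\<^sub>R (s - t) - w)"
   by (simp only: real_norm_def abs_norm_cancel norm_triangle_ineq)
 qed
qed

lemma has_time_deriv_iff:
 assumes u: "\<And>s. u s \<in> L2"
 shows "has_time_deriv u v t \<longleftrightarrow> v \<in> L2 \<and> hderiv (\<lambda>s. cls (u s)) (cls v) t"
proof -
 have "l2_norm (\<lambda>x. (u s x - u t x) / of_real (s - t) - v x) = norm ((cls (u s) - cls (u t)) /\<^sub>R (s - t) - cls v)"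
  if v: "v \<in> L2" for s
 proof -
  have "(cls (u s) - cls (u t)) /\<^sub>R (s - t) - cls v = cls (\<lambda>x. of_real (inverse (s - t)) * (u s x - u t x) - v x)"
   by (simp only: diff_cls[OF u u] scaleR_cls[OF L2_diff[OF u u]] diff_cls[OF L2_scale[OF L2_diff[OF u u]] v])
  also have "(\<lambda>x. of_real (inverse (s - t)) * (u s x - u t x) - v x) = (\<lambda>x. (u s x - u t x) / of_real (s - t) - v x)"
   by (simp add: divide_inverse mult.commute)
  finally have eq: "(cls (u s) - cls (u t)) /\<^sub>R (s - t) - cls v = cls (\<lambda>x. (u s x - u t x) / of_real (s - t) - v x)" .
  have "(\<lambda>x. (u s x - u t x) / of_real (s - t) - v x) \<in> L2"
   using L2_diff[OF L2_scale[OF L2_diff[OF u u], of "inverse (of_real (s - t))"] v] by (simp add: divide_inverse mult.commute)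
  then show ?thesis unfolding eq by (simp only: norm_cls)
 qed
 then show ?thesis unfolding has_time_deriv_def hderiv_def using u by auto
qed

text \<open>Each \<open>time_deriv\<close> is a choice, but \<open>hderiv_unique\<close> forces its
  class; so candidates \<open>U n\<close> determine all iterates up to null sets.\<close>

lemma time_deriv_iterate:
 assumes u: "\<And>s. u s \<in> L2" "\<And>s. cls (u s) = U 0 s" and U: "\<And>n t. hderiv (U n) (U (Suc n) t) t"
 shows "(\<forall>t. (time_deriv ^^ n) u t \<in> L2 \<and> cls ((time_deriv ^^ n) u t) = U n t) \<and> (\<forall>t. \<exists>v. has_time_deriv ((time_deriv ^^ n) u) v t)"
proof -
 have step: "\<exists>v. has_time_deriv w v t" "time_deriv w t \<in> L2" "cls (time_deriv w t) = U (Suc n) t"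
  if w: "\<And>t. w t \<in> L2" "\<And>t. cls (w t) = U n t" for w n t
 proof -
  have "(\<lambda>s. cls (w s)) = U n" using w(2) by blast
  then have "has_time_deriv w (rep (U (Suc n) t)) t" using U[of n t] by (simp add: has_time_deriv_iff[OF w(1)])
  then show ex: "\<exists>v. has_time_deriv w v t" by blast
  then have "has_time_deriv w (time_deriv w t) t" unfolding time_deriv_def by (rule someI_ex)
  then have "time_deriv w t \<in> L2 \<and> hderiv (U n) (cls (time_deriv w t)) t"
   using \<open>(\<lambda>s. cls (w s)) = U n\<close> by (simp add: has_time_deriv_iff[OF w(1)])
  then show "time_deriv w t \<in> L2" "cls (time_deriv w t) = U (Suc n) t" using hderiv_unique[OF _ U] by blast+
 qed
 have "\<forall>t. (time_deriv ^^ n) u t \<in> L2 \<and> cls ((time_deriv ^^ n) u t) = U n t"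
 proof (induction n)
  case (Suc n)
  then show ?case using step(2,3)[of "(time_deriv ^^ n) u" n] by simp
 qed (simp add: u)
 then show ?thesis using step(1)[of "(time_deriv ^^ n) u" n] by blast
qed

locale nonneg_spectral = spectral P for P :: "real set => 'a::{real_inner,complete_space} => 'a" +
 assumes nonneg: "AE x in mu f. 0 \<le> x"
begin

text \<open>The smooth vectors of \<open>A\<close>: on them functions of polynomial growth can be
  applied and composed without further conditions on domains.\<close>

definition Dinf where "Dinf = {u. \<forall>n. u \<in> dom (\<lambda>x. sqrt x ^ n)}"

text \<open>Growth of order \<open>n / 2\<close> with an explicit constant; only nonnegative
  \<open>x\<close> are tested, since the spectrum lies there.\<close>

definition gr :: "(real => real) => real => nat => bool" where
 "gr p c n \<longleftrightarrow> p \<in> borel_fun \<and> 0 \<le> c \<and> (\<forall>x\<ge>0. \<bar>p x\<bar> \<le> c * sqrt x ^ n)"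

lemma gr_sqrt: "gr (\<lambda>x. sqrt x ^ n) 1 n" by (simp add: gr_def)

lemma gr_mult: assumes "gr p c n" "gr q d m" shows "gr (\<lambda>x. p x * q x) (c * d) (n + m)"
proof -
 have "\<bar>p x * q x\<bar> \<le> (c * sqrt x ^ n) * (d * sqrt x ^ m)" if "0 \<le> x" for x
  unfolding abs_mult by (rule mult_mono) (use assms that in \<open>auto simp: gr_def\<close>)
 then show ?thesis using assms by (auto simp: gr_def power_add mult_ac)
qed

lemma gr_dom:
 assumes g: "gr p c n" and u: "u \<in> dom (\<lambda>x. sqrt x ^ n)"
 shows "u \<in> dom p" "norm (Phi p u) \<le> c * norm (Phi (\<lambda>x. sqrt x ^ n) u)"
proof -
 have m [measurable]: "p \<in> borel_fun" and c: "0 \<le> c" using g by (auto simp: gr_def)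
 have i: "integrable (mu u) (\<lambda>x. c\<^sup>2 * (sqrt x ^ n)\<^sup>2)" using u unfolding dom_def by simp
 have pt: "(p x)\<^sup>2 \<le> c\<^sup>2 * (sqrt x ^ n)\<^sup>2" if "0 \<le> x" for x
 proof -
  have "\<bar>p x\<bar>\<^sup>2 \<le> (c * sqrt x ^ n)\<^sup>2" by (rule power_mono) (use g that in \<open>auto simp: gr_def\<close>)
  then show ?thesis by (simp add: power_mult_distrib)
 qed
 have AE: "AE x in mu u. (p x)\<^sup>2 \<le> c\<^sup>2 * (sqrt x ^ n)\<^sup>2" using nonneg by eventually_elim (rule pt)
 have j: "integrable (mu u) (\<lambda>x. (p x)\<^sup>2)"
  by (rule Bochner_Integration.integrable_bound[OF i]) (use AE in \<open>auto elim!: eventually_mono\<close>)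
 then show d: "u \<in> dom p" by (simp add: dom_def)
 have "(norm (Phi p u))\<^sup>2 \<le> (LINT x|mu u. c\<^sup>2 * (sqrt x ^ n)\<^sup>2)"
  unfolding norm_Phi[OF m d] by (rule integral_mono_AE[OF j i AE])
 also have "\<dots> = (c * norm (Phi (\<lambda>x. sqrt x ^ n) u))\<^sup>2"
  by (simp add: power_mult_distrib norm_Phi[OF _ u])
 finally show "norm (Phi p u) \<le> c * norm (Phi (\<lambda>x. sqrt x ^ n) u)" by (rule power2_le_imp_le) (use c in simp)
qed

lemma gr_measurable: "gr p c n ==> p \<in> borel_fun" by (simp add: gr_def)

lemma gr_domD: "gr p c n ==> u \<in> Dinf ==> u \<in> dom p"
 by (rule gr_dom(1)) (auto simp: Dinf_def)

lemma gr_Dinf: assumes g: "gr p c n" and u: "u \<in> Dinf" shows "Phi p u \<in> Dinf"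
 unfolding Dinf_def
proof (intro CollectI allI)
 fix m show "Phi p u \<in> dom (\<lambda>x. sqrt x ^ m)"
  unfolding dom_Phi_iff[OF gr_measurable[OF g] gr_measurable[OF gr_sqrt] gr_domD[OF g u]]
  by (rule gr_domD[OF gr_mult[OF gr_sqrt g] u])
qed

lemma Phi_cong:
 assumes "gr p c n" "gr q d m" "u \<in> Dinf" "\<And>x. 0 \<le> x ==> p x = q x"
 shows "Phi p u = Phi q u"
proof (rule Phi_AE_cong(1)[OF gr_measurable[OF assms(1)] gr_measurable[OF assms(2)] gr_domD[OF assms(1,3)]])
 show "AE x in mu u. p x = q x" using nonneg by eventually_elim (rule assms(4))
qed

lemma Phi_Phi_eq:
 assumes p: "gr p c n" and q: "gr q d m" and \<eta>: "gr \<eta> e l" and u: "u \<in> Dinf"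
  and eq: "\<And>x. 0 \<le> x ==> q x * p x = \<eta> x"
 shows "Phi q (Phi p u) = Phi \<eta> u"
 unfolding Phi_Phi[OF gr_measurable[OF p] gr_measurable[OF q] gr_domD[OF p u] gr_domD[OF gr_mult[OF q p] u]]
 by (rule Phi_cong[OF gr_mult[OF q p] \<eta> u eq])

text \<open>Taylor's formula in \<open>s\<close> bounds the error of the difference quotient by
  \<open>|s - t| * sqrt x ^ l\<close>, with \<open>l\<close> the growth of the second time
  derivative; on \<open>Dinf\<close> the calculus turns this into a bound in norm.\<close>

lemma hderiv_Phi:
 assumes u: "u \<in> Dinf" and g0: "\<And>s. gr (p 0 s) (c s) n" and g1: "gr (p 1 t) d m"
  and der: "\<And>i s x. i \<le> 1 ==> 0 \<le> x ==> ((\<lambda>s. p i s x) has_real_derivative p (Suc i) s x) (at s)"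
  and bd: "\<And>s x. 0 \<le> x ==> \<bar>p (Suc 1) s x\<bar> \<le> sqrt x ^ l"
 shows "hderiv (\<lambda>s. Phi (p 0 s) u) (Phi (p 1 t) u) t"
 unfolding hderiv_def
proof (rule Lim_null_comparison)
 show "\<forall>\<^sub>F s in at t. norm (norm ((Phi (p 0 s) u - Phi (p 0 t) u) /\<^sub>R (s - t) - Phi (p 1 t) u)) \<le> \<bar>s - t\<bar> * norm (Phi (\<lambda>x. sqrt x ^ l) u)"
  unfolding eventually_at_filter
 proof (rule always_eventually, intro allI impI)
  fix s assume st: "s \<noteq> t"
  define R where "R x = inverse (s - t) * (p 0 s x - p 0 t x) - p 1 t x" for x
  note m0 [measurable] = gr_measurable[OF g0] and m1 [measurable] = gr_measurable[OF g1]
  note d0 = gr_domD[OF g0 u] and d1 = gr_domD[OF g1 u]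
  have dd: "u \<in> dom (\<lambda>x. p 0 s x - p 0 t x)"
   using dom_add[OF m0 _ d0, of "\<lambda>x. - p 0 t x" s] d0[of t] by (simp add: dom_uminus)
  have "(Phi (p 0 s) u - Phi (p 0 t) u) /\<^sub>R (s - t) - Phi (p 1 t) u = Phi R u"
   unfolding R_def
   by (subst Phi_diff, measurable, rule dom_scale[OF dd], rule d1, subst Phi_scale, measurable, rule dd, subst Phi_diff[OF m0 m0 d0 d0], rule refl)
  moreover have "gr R \<bar>s - t\<bar> l" unfolding gr_def
  proof (intro conjI allI impI)
   show "R \<in> borel_fun" unfolding R_def by measurable
   fix x :: real assume x: "0 \<le> x"
   have "norm (p 0 s x - (\<Sum>i\<le>1. p i t x * (s - t) ^ i / fact i)) \<le> sqrt x ^ l * norm (s - t) ^ Suc 1 / fact 1"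
    by (rule field_Taylor[where f = "\<lambda>i s. p i s x" and S = UNIV]) (use der bd x in auto)
   moreover have "p 0 s x - (\<Sum>i\<le>1. p i t x * (s - t) ^ i / fact i) = p 0 s x - p 0 t x - p 1 t x * (s - t)" by simp
   moreover have "sqrt x ^ l * norm (s - t) ^ Suc 1 / fact 1 = sqrt x ^ l * (\<bar>s - t\<bar> * \<bar>s - t\<bar>)" by simp
   ultimately have T: "\<bar>p 0 s x - p 0 t x - p 1 t x * (s - t)\<bar> \<le> sqrt x ^ l * (\<bar>s - t\<bar> * \<bar>s - t\<bar>)" by (simp only: real_norm_def)
   have "R x = (p 0 s x - p 0 t x - p 1 t x * (s - t)) / (s - t)" using st by (simp add: R_def field_simps)
   then have "\<bar>R x\<bar> = \<bar>p 0 s x - p 0 t x - p 1 t x * (s - t)\<bar> / \<bar>s - t\<bar>" by simp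
   also have "\<dots> \<le> (sqrt x ^ l * (\<bar>s - t\<bar> * \<bar>s - t\<bar>)) / \<bar>s - t\<bar>" by (rule divide_right_mono[OF T]) simp
   also have "\<dots> = \<bar>s - t\<bar> * sqrt x ^ l"
   proof -
    have "y * (a * a) / a = a * y" if "a \<noteq> 0" for a y :: real using that by simp
    then show ?thesis using st by (simp only: abs_eq_0 right_minus_eq simp_thms)
   qed
   finally show "\<bar>R x\<bar> \<le> \<bar>s - t\<bar> * sqrt x ^ l" .
  qed simp
  ultimately show "norm (norm ((Phi (p 0 s) u - Phi (p 0 t) u) /\<^sub>R (s - t) - Phi (p 1 t) u)) \<le> \<bar>s - t\<bar> * norm (Phi (\<lambda>x. sqrt x ^ l) u)"
   using gr_dom(2)[of R "\<bar>s - t\<bar>" l u] u by (simp add: Dinf_def)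
 qed
 show "((\<lambda>s. \<bar>s - t\<bar> * norm (Phi (\<lambda>x. sqrt x ^ l) u)) \<longlongrightarrow> 0) (at t)"
  by (rule tendsto_eq_intros | simp)+
qed

text \<open>The \<open>n\<close>-th time derivative of \<open>cos (t * sqrt x + th)\<close>: each
  derivative multiplies by \<open>sqrt x\<close> and advances the phase by a quarter turn. The phase
  treats sines, cosines and their signs uniformly.\<close>

definition wv :: "nat => real => real => real => real" where
 "wv n th t x = sqrt x ^ n * cos (t * sqrt x + th + real n * (pi / 2))"

definition sc :: "real => real => real" where
 "sc t x = (if x = 0 then t else sin (t * sqrt x) / sqrt x)"

lemma gr_wv: "gr (wv n th t) 1 n"
 unfolding gr_def wv_def by (auto simp: abs_mult intro!: mult_left_le)

lemma gr_sc: "gr (sc t) \<bar>t\<bar> 0"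
proof -
 have "\<bar>sin (t * sqrt x) / sqrt x\<bar> \<le> \<bar>t\<bar>" if "0 < x" for x
  using abs_sin_x_le_abs_x[of "t * sqrt x"] that by (simp add: abs_mult pos_divide_le_eq)
 moreover have "sc t \<in> borel_fun" unfolding sc_def by measurable
 ultimately show ?thesis unfolding gr_def sc_def by auto
qed

lemma wv_deriv: "((\<lambda>s. wv n th s x) has_real_derivative wv (Suc n) th s x) (at s)"
proof -
 have "cos (s * sqrt x + th + real (Suc n) * (pi / 2)) = - sin (s * sqrt x + th + real n * (pi / 2))"
 proof -
  have "s * sqrt x + th + real (Suc n) * (pi / 2) = (s * sqrt x + th + real n * (pi / 2)) + pi / 2" by (simp add: field_simps)
  then show ?thesis by (simp only: cos_add[of _ "pi / 2"] cos_pi_half sin_pi_half mult_zero_right mult_1_right diff_0)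
 qed
 then show ?thesis unfolding wv_def by (auto intro!: derivative_eq_intros)
qed

lemma hderiv_wv: assumes u: "u \<in> Dinf" shows "hderiv (\<lambda>s. Phi (wv n th s) u) (Phi (wv (Suc n) th t) u) t"
proof -
 have "hderiv (\<lambda>s. Phi ((\<lambda>i. wv (n + i) th) 0 s) u) (Phi ((\<lambda>i. wv (n + i) th) 1 t) u) t"
 proof (rule hderiv_Phi[where l = "n + 2", OF u gr_wv gr_wv])
  show "((\<lambda>s. wv (n + i) th s x) has_real_derivative wv (n + Suc i) th s x) (at s)" for i s x
   using wv_deriv[of "n + i" th x s] by simp
  show "0 \<le> x ==> \<bar>wv (n + Suc 1) th s x\<bar> \<le> sqrt x ^ (n + 2)" for s x
   using gr_wv[of "n + 2" th s] by (simp add: gr_def)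
 qed
 then show ?thesis by simp
qed

lemma hderiv_sc: assumes u: "u \<in> Dinf" shows "hderiv (\<lambda>s. Phi (sc s) u) (Phi (wv 0 0 t) u) t"
proof -
 define f where "f i = (case i of 0 => sc | Suc j => wv j 0)" for i :: nat
 have "hderiv (\<lambda>s. Phi (f 0 s) u) (Phi (f 1 t) u) t"
 proof (rule hderiv_Phi[OF u])
  show "gr (f 0 s) \<bar>s\<bar> 0" for s by (simp add: f_def gr_sc)
  show "gr (f 1 t) 1 0" by (simp add: f_def gr_wv)
  show "((\<lambda>s. f i s x) has_real_derivative f (Suc i) s x) (at s)" if i: "i \<le> 1" and x: "0 \<le> x" for i s x
  proof (cases i)
   case 0
   have "((\<lambda>s. sc s x) has_real_derivative wv 0 0 s x) (at s)"
   proof (cases "x = 0")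
    case True then show ?thesis by (simp add: sc_def wv_def)
   next
    case False then show ?thesis using x by (auto simp: sc_def wv_def mult.assoc intro!: derivative_eq_intros)
   qed
   then show ?thesis by (simp add: f_def 0)
  next
   case (Suc j) then show ?thesis using wv_deriv[of j 0 x s] by (simp add: f_def)
  qed
  show "0 \<le> x ==> \<bar>f (Suc 1) s x\<bar> \<le> sqrt x ^ 1" for s x
   using gr_wv[of 1 0 s] by (simp add: f_def gr_def)
 qed
 then show ?thesis by (simp add: f_def)
qed

lemma wv_shift: "wv (Suc n) th t x = wv n (th + pi / 2) t x * sqrt x"
proof -
 have "t * sqrt x + th + real (Suc n) * (pi / 2) = t * sqrt x + (th + pi / 2) + real n * (pi / 2)" by (simp add: field_simps)
 then have "cos (t * sqrt x + th + real (Suc n) * (pi / 2)) = cos (t * sqrt x + (th + pi / 2) + real n * (pi / 2))" by (rule arg_cong)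
 then show ?thesis unfolding wv_def by (simp only: power_Suc mult_ac)
qed

text \<open>In the second identity one factor \<open>sqrt x\<close> moves onto the vector at the
  price of a phase. So the time derivatives of \<open>cos (t sqrt A) f\<close> involve
  \<open>f\<close> only through \<open>sqrt A f\<close>.\<close>

lemma Phi_sqrt_wv:
 assumes u: "u \<in> Dinf" shows "Phi sqrt (Phi (wv n th t) u) = Phi (wv n th t) (Phi sqrt u)"
  "Phi (wv (Suc n) th t) u = Phi (wv n (th + pi / 2) t) (Phi sqrt u)"
proof -
 have s: "gr sqrt 1 1" using gr_sqrt[of 1] by simp
 show "Phi sqrt (Phi (wv n th t) u) = Phi (wv n th t) (Phi sqrt u)"
  by (rule trans[OF Phi_Phi_eq[OF gr_wv s gr_mult[OF s gr_wv] u refl] Phi_Phi_eq[OF s gr_wv gr_mult[OF s gr_wv] u, symmetric]]) simp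
 show "Phi (wv (Suc n) th t) u = Phi (wv n (th + pi / 2) t) (Phi sqrt u)"
  by (rule Phi_Phi_eq[OF s gr_wv gr_wv u, symmetric]) (simp add: wv_shift)
qed

text \<open>The factor \<open>sqrt x\<close> cancels the denominator and leaves a sine, which is a
  cosine with phase \<open>- (pi / 2)\<close>; at \<open>x = 0\<close>, where
  \<open>sc t x = t\<close>, both sides vanish.\<close>

lemma Phi_sqrt_sc: assumes u: "u \<in> Dinf" shows "Phi sqrt (Phi (sc t) u) = Phi (wv 0 (- (pi / 2)) t) u"
proof -
 have s: "gr sqrt 1 1" using gr_sqrt[of 1] by simp
 show ?thesis
 proof (rule Phi_Phi_eq[OF gr_sc s gr_wv u])
  fix x :: real
  have "sin (t * sqrt x) = cos (t * sqrt x - pi / 2)" using cos_diff[of "t * sqrt x" "pi / 2"] by simp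
  then show "sqrt x * sc t x = wv 0 (- (pi / 2)) t x" by (simp add: sc_def wv_def)
 qed
qed

lemma gr_id: "gr (\<lambda>x. x) 1 2" by (simp add: gr_def)

text \<open>Two quarter turns of the phase amount to a sign, so \<open>A\<close> acts as minus the
  second time derivative.\<close>

lemma Phi_id_wv: assumes u: "u \<in> Dinf" shows "Phi (\<lambda>x. x) (Phi (wv n th t) u) = - Phi (wv (n + 2) th t) u"
proof -
 have "Phi (\<lambda>x. x) (Phi (wv n th t) u) = Phi (\<lambda>x. (- 1) * wv (n + 2) th t x) u"
 proof (rule Phi_Phi_eq[OF gr_wv gr_id gr_mult[OF _ gr_wv] u])
  show "gr (\<lambda>x. - 1) 1 0" by (simp add: gr_def)
  fix x :: real assume x: "0 \<le> x"
  have "cos (t * sqrt x + th + real (n + 2) * (pi / 2)) = - cos (t * sqrt x + th + real n * (pi / 2))"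
   using cos_periodic_pi[of "t * sqrt x + th + real n * (pi / 2)"] by (simp add: algebra_simps)
  then show "x * wv n th t x = - 1 * wv (n + 2) th t x" using x by (simp add: wv_def power_add)
 qed
 also have "\<dots> = - Phi (wv (n + 2) th t) u" by (simp only: Phi_scale[OF gr_measurable[OF gr_wv] gr_domD[OF gr_wv u]]) simp
 finally show ?thesis .
qed

lemma Phi_id_sc: assumes u: "u \<in> Dinf" shows "Phi (\<lambda>x. x) (Phi (sc t) u) = - Phi (wv 1 0 t) u"
proof -
 have "Phi (\<lambda>x. x) (Phi (sc t) u) = Phi (\<lambda>x. (- 1) * wv 1 0 t x) u"
 proof (rule Phi_Phi_eq[OF gr_sc gr_id gr_mult[OF _ gr_wv] u])
  show "gr (\<lambda>x. - 1) 1 0" by (simp add: gr_def)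
  fix x :: real assume x: "0 \<le> x"
  have "cos (t * sqrt x + pi / 2) = - sin (t * sqrt x)" by (simp add: minus_sin_cos_eq)
  then show "x * sc t x = - 1 * wv 1 0 t x" using x by (simp add: wv_def sc_def real_div_sqrt field_simps)
 qed
 also have "\<dots> = - Phi (wv 1 0 t) u" by (simp only: Phi_scale[OF gr_measurable[OF gr_wv] gr_domD[OF gr_wv u]]) simp
 finally show ?thesis .
qed

lemma Phi_initial: assumes u: "u \<in> Dinf" shows "Phi (wv 0 0 0) u = u" "Phi (sc 0) u = 0" "Phi (wv 1 0 0) u = 0"
proof -
 have 1: "Phi (\<lambda>x. 1) u = u" by simp
 have z: "Phi (\<lambda>x. 0 * 1) u = 0" by (subst Phi_scale) (simp_all add: dom_bounded[of _ 1])
 have "wv 0 0 0 = (\<lambda>x. 1)" "sc 0 = (\<lambda>x. 0 * 1)" "wv 1 0 0 = (\<lambda>x. 0 * 1)" by (simp_all add: wv_def sc_def fun_eq_iff)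
 then show "Phi (wv 0 0 0) u = u" "Phi (sc 0) u = 0" "Phi (wv 1 0 0) u = 0" using 1 z by simp_all
qed

text \<open>Cosines have modulus at most 1, whence a bound independent of \<open>t\<close> and the
  phase; \<open>n\<close> time derivatives cost \<open>n\<close> half powers of
  \<open>A\<close>.\<close>

lemma norm_Phi_wv:
 assumes u: "u \<in> Dinf"
 shows "norm (Phi (\<lambda>x. sqrt x ^ j) (Phi (wv n th t) u)) \<le> norm (Phi (\<lambda>x. sqrt x ^ (j + n)) u)"
proof -
 have "Phi (\<lambda>x. sqrt x ^ j) (Phi (wv n th t) u) = Phi (\<lambda>x. sqrt x ^ j * wv n th t x) u"
  by (rule Phi_Phi_eq[OF gr_wv gr_sqrt gr_mult[OF gr_sqrt gr_wv] u refl])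
 then show ?thesis using gr_dom(2)[OF gr_mult[OF gr_sqrt gr_wv], of u j n th t] u by (simp add: Dinf_def)
qed

end

section \<open>Smooth functions with square-integrable derivatives\<close>

abbreviation nd :: "nat => (real => complex) => real => complex" where "nd \<equiv> nth_deriv {0..}"

text \<open>A smooth representative that lies in every \<open>H^k\<close>; Sobolev norms can be
  computed from its classical derivatives.\<close>

definition sob_smooth :: "(real => complex) => bool" where
 "sob_smooth F \<longleftrightarrow> smooth_fun_on {0..} F \<and> (\<forall>j. nd j F \<in> L2)"

lemma sob_smoothD:
 assumes "sob_smooth F" shows "smooth_fun_on {0..} F" "nd j F \<in> L2" "F \<in> L2" "indef (nd j F) (nd (Suc j) F)"
proof -
 show s: "smooth_fun_on {0..} F" and L: "nd j F \<in> L2" for j using assms by (auto simp: sob_smooth_def)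
 show "F \<in> L2" using L[of 0] by simp
 show "indef (nd j F) (nd (Suc j) F)"
  by (rule indef_C1[OF smooth_has_deriv[OF s] smooth_continuous[OF s]]) simp
qed

lemma nd_nd: "nd i (nd j F) = nd (i + j) F"
 by (simp only: nth_deriv_def funpow_add comp_apply)

lemma sob_smooth_nd: assumes F: "sob_smooth F" shows "sob_smooth (nd j F)"
proof -
 note D = sob_smoothD[OF F]
 have "smooth_fun_on {0..} ((\<lambda>i. nd (i + j) F) 0)"
 proof (rule nth_deriv_chain(2)[OF nontriv_atLeast])
  fix n and x :: real assume "x \<in> {0..}"
  then show "(nd (n + j) F has_vector_derivative nd (Suc n + j) F x) (at x within {0..})"
   using smooth_has_deriv[OF D(1), of x "n + j"] by simp
 qed
 then show ?thesis using D(2) by (simp add: sob_smooth_def nd_nd)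
qed

lemma L2_cong_halfline:
 assumes f: "f \<in> L2" and eq: "\<And>x. 0 \<le> x ==> g x = f x" shows "g \<in> L2" "cls g = cls f"
proof -
 have m: "g \<in> borel_measurable halfline"
  by (rule measurable_cong[THEN iffD1, OF _ L2_measurable[OF f]]) (use eq in simp)
 have e: "l2_eq f g" unfolding l2_eq_def by (rule AE_I2) (use eq in simp)
 show g: "g \<in> L2" by (rule L2_cong_AE[OF f e m])
 show "cls g = cls f" by (rule cls_eqI[OF g f l2_eq_sym[OF e]])
qed

lemma sob_smooth_cong:
 assumes F: "sob_smooth F" and eq: "\<And>x. 0 \<le> x ==> G x = F x"
 shows "sob_smooth G" "0 \<le> x ==> nd j G x = nd j F x" "cls (nd j G) = cls (nd j F)"
proof -
 note D = sob_smoothD[OF F]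
 have n: "0 \<le> x ==> nd j G x = nd j F x" for j x
  by (rule nth_deriv_cong_smooth(2)[OF nontriv_atLeast D(1)]) (simp_all add: eq)
 show "0 \<le> x ==> nd j G x = nd j F x" by (rule n)
 have "smooth_fun_on {0..} G" by (rule nth_deriv_cong_smooth(1)[OF nontriv_atLeast D(1)]) (simp add: eq)
 then show "sob_smooth G" using L2_cong_halfline(1)[OF D(2) n] by (simp add: sob_smooth_def)
 show "cls (nd j G) = cls (nd j F)" by (rule L2_cong_halfline(2)[OF D(2) n])
qed

lemma sob_smooth_minus:
 assumes F: "sob_smooth F"
 shows "sob_smooth (\<lambda>x. - F x)" "0 \<le> x ==> nd j (\<lambda>x. - F x) x = - nd j F x" "cls (nd j (\<lambda>x. - F x)) = - cls (nd j F)"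
proof -
 note D = sob_smoothD[OF F]
 note m = nth_deriv_linear[OF nontriv_atLeast D(1) bounded_linear_minus[OF bounded_linear_ident]]
 have n: "0 \<le> x ==> nd j (\<lambda>x. - F x) x = - nd j F x" for j x by (rule m(2)) simp
 show "0 \<le> x ==> nd j (\<lambda>x. - F x) x = - nd j F x" by (rule n)
 show "sob_smooth (\<lambda>x. - F x)" using m(1) L2_cong_halfline(1)[OF L2_minus[OF D(2)] n] by (simp add: sob_smooth_def)
 show "cls (nd j (\<lambda>x. - F x)) = - cls (nd j F)" unfolding minus_cls[OF D(2)] by (rule L2_cong_halfline(2)[OF L2_minus[OF D(2)] n])
qed

lemma sob_smooth_add:
 assumes F: "sob_smooth F" and G: "sob_smooth G"
 shows "sob_smooth (\<lambda>x. F x + G x)" "0 \<le> x ==> nd j (\<lambda>x. F x + G x) x = nd j F x + nd j G x"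
  "cls (nd j (\<lambda>x. F x + G x)) = cls (nd j F) + cls (nd j G)"
proof -
 note D = sob_smoothD[OF F] and E = sob_smoothD[OF G]
 note m = nth_deriv_add[OF nontriv_atLeast D(1) E(1)]
 have n: "0 \<le> x ==> nd j (\<lambda>x. F x + G x) x = nd j F x + nd j G x" for j x by (rule m(2)) simp
 show "0 \<le> x ==> nd j (\<lambda>x. F x + G x) x = nd j F x + nd j G x" by (rule n)
 show "sob_smooth (\<lambda>x. F x + G x)" using m(1) L2_cong_halfline(1)[OF L2_add[OF D(2) E(2)] n] by (simp add: sob_smooth_def)
 show "cls (nd j (\<lambda>x. F x + G x)) = cls (nd j F) + cls (nd j G)"
  unfolding plus_cls[OF D(2) E(2)] by (rule L2_cong_halfline(2)[OF L2_add[OF D(2) E(2)] n])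
qed

text \<open>The \<open>l^1\<close> version of \<open>sobolev_norm\<close>, comparable to it up to
  the factor \<open>k + 1\<close> by \<open>sobolev_smooth\<close>.\<close>

definition sob_sum :: "nat => (real => complex) => real" where "sob_sum k F = (\<Sum>j\<le>k. norm (cls (nd j F)))"

lemma sob_sum_member: "j \<le> k ==> norm (cls (nd j F)) \<le> sob_sum k F"
 unfolding sob_sum_def by (rule member_le_sum) simp_all

lemma sob_sum_mono: "j \<le> k ==> sob_sum j F \<le> sob_sum k F"
 unfolding sob_sum_def by (rule sum_mono2) auto

lemma sob_smooth_scaleR:
 assumes v: "bdd_smooth {0..} v" and F: "sob_smooth F"
 shows "sob_smooth (\<lambda>x. of_real (v x) * F x)"
  and "0 \<le> x ==> nd n (\<lambda>x. of_real (v x) * F x) x = (\<Sum>k\<le>n. real (n choose k) *\<^sub>R (nth_deriv {0..} k v x *\<^sub>R nd (n - k) F x))"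
proof -
 note D = sob_smoothD[OF F]
 have sv: "smooth_fun_on {0..} v" and bv: "\<And>n. \<exists>C. \<forall>x\<in>{0..}. \<bar>nth_deriv {0..} n v x\<bar> \<le> C" using v by (auto simp: bdd_smooth_def)
 note m = nth_deriv_scaleR[OF nontriv_atLeast sv D(1), unfolded scaleR_conv_of_real[where 'a = complex]]
 have f: "0 \<le> x ==> nd n (\<lambda>x. of_real (v x) * F x) x = (\<Sum>k\<le>n. real (n choose k) *\<^sub>R (nth_deriv {0..} k v x *\<^sub>R nd (n - k) F x))" for n x
  unfolding scaleR_conv_of_real[where 'a = complex] by (rule m(2)) simp
 show "0 \<le> x ==> nd n (\<lambda>x. of_real (v x) * F x) x = (\<Sum>k\<le>n. real (n choose k) *\<^sub>R (nth_deriv {0..} k v x *\<^sub>R nd (n - k) F x))" by (rule f)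
 have L: "(\<lambda>x. \<Sum>k\<le>n. real (n choose k) *\<^sub>R (nth_deriv {0..} k v x *\<^sub>R nd (n - k) F x)) \<in> L2" for n
 proof (rule L2_sum)
  fix k
  obtain C where C: "\<forall>x\<in>{0..}. \<bar>nth_deriv {0..} k v x\<bar> \<le> C" using bv by blast
  have "(\<lambda>x. complex_of_real (nth_deriv {0..} k v x) * nd (n - k) F x) \<in> L2"
  proof (rule L2_mult_bounded[OF _ _ D(2)])
   show "(\<lambda>x. complex_of_real (nth_deriv {0..} k v x)) \<in> borel_measurable halfline"
    by (rule cont_measurable_halfline) (intro continuous_intros smooth_continuous sv)
   show "0 \<le> x ==> cmod (complex_of_real (nth_deriv {0..} k v x)) \<le> C" for x using C by simp
  qed
  from L2_scale[OF this, of "of_real (real (n choose k))"]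
  show "(\<lambda>x. real (n choose k) *\<^sub>R (nth_deriv {0..} k v x *\<^sub>R nd (n - k) F x)) \<in> L2" by (simp only: scaleR_conv_of_real)
 qed
 show "sob_smooth (\<lambda>x. of_real (v x) * F x)" unfolding sob_smooth_def
  using m(1) L2_cong_halfline(1)[OF L f] by blast
qed

lemma bdd_smooth_deriv: assumes v: "bdd_smooth {0..} v" shows "bdd_smooth {0..} (nth_deriv {0..} 1 v)"
proof -
 have sv: "smooth_fun_on {0..} v" and bv: "\<And>n. \<exists>C. \<forall>x\<in>{0..}. \<bar>nth_deriv {0..} n v x\<bar> \<le> C" using v by (auto simp: bdd_smooth_def)
 define v' where "v' = nth_deriv {0..} 1 v"
 have nv: "nth_deriv {0..} m v' = nth_deriv {0..} (m + 1) v" for m unfolding v'_def by (simp only: nth_deriv_def funpow_add comp_apply)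
 have "bdd_smooth {0..} v'" unfolding bdd_smooth_def nv
 proof (intro conjI allI bv)
  have "smooth_fun_on {0..} ((\<lambda>i. nth_deriv {0..} (i + 1) v) 0)"
  proof (rule nth_deriv_chain(2)[OF nontriv_atLeast])
   fix n and x :: real assume "x \<in> {0..}"
   then show "(nth_deriv {0..} (n + 1) v has_vector_derivative nth_deriv {0..} (Suc n + 1) v x) (at x within {0..})"
    using smooth_has_deriv[OF sv, of x "n + 1"] by simp
  qed
  then show "smooth_fun_on {0..} v'" by (simp add: v'_def)
 qed
 then show ?thesis by (simp add: v'_def)
qed

text \<open>Induction through \<open>(v F)' = v F' + v' F\<close>, for all \<open>v\<close>
  simultaneously because \<open>v'\<close> is again bounded with all derivatives.\<close>

lemma norm_nd_scaleR:
 assumes v: "bdd_smooth {0..} v"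
 shows "\<exists>C\<ge>0. \<forall>F. sob_smooth F --> norm (cls (nd n (\<lambda>x. of_real (v x) * F x))) \<le> C * sob_sum n F"
 using v
proof (induction n arbitrary: v)
 case (0 v)
 then obtain C where C: "\<forall>x\<in>{0..}. \<bar>v x\<bar> \<le> C" unfolding bdd_smooth_def using nth_deriv_0 by metis
 interpret bounded_potential v C
 proof
  show "continuous_on {0..} v" using 0 smooth_continuous[of "{0..}" v 0] by (simp add: bdd_smooth_def)
  show "0 \<le> x ==> \<bar>v x\<bar> \<le> C" for x using C by simp
 qed
 show ?case
 proof (rule exI[of _ C], intro conjI allI impI)
  show "0 \<le> C" by (rule Vb_nonneg)
  fix F assume F: "sob_smooth F"
  show "norm (cls (nd 0 (\<lambda>x. of_real (v x) * F x))) \<le> C * sob_sum 0 F"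
   using mulV_norm[of "cls F"] by (simp add: mulV_cls sob_smoothD(3)[OF F] sob_sum_def)
 qed
next
 case (Suc n v)
 have sv: "smooth_fun_on {0..} v" and bv: "\<And>n. \<exists>C. \<forall>x\<in>{0..}. \<bar>nth_deriv {0..} n v x\<bar> \<le> C" using Suc.prems by (auto simp: bdd_smooth_def)
 define v' where "v' = nth_deriv {0..} 1 v"
 have v': "bdd_smooth {0..} v'" unfolding v'_def by (rule bdd_smooth_deriv[OF Suc.prems])
 obtain C1 where C1: "C1 \<ge> 0" "\<And>F. sob_smooth F ==> norm (cls (nd n (\<lambda>x. of_real (v x) * F x))) \<le> C1 * sob_sum n F" using Suc.IH[OF Suc.prems] by blast
 obtain C2 where C2: "C2 \<ge> 0" "\<And>F. sob_smooth F ==> norm (cls (nd n (\<lambda>x. of_real (v' x) * F x))) \<le> C2 * sob_sum n F" using Suc.IH[OF v'] by blast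
 show ?case
 proof (rule exI[of _ "C1 + C2"], intro conjI allI impI)
  show "0 \<le> C1 + C2" using C1(1) C2(1) by simp
  fix F assume F: "sob_smooth F"
  note D = sob_smoothD[OF F] and S = sob_smooth_scaleR(1)[OF Suc.prems F]
  have F': "sob_smooth (nd 1 F)" by (rule sob_smooth_nd[OF F])
  note A = sob_smooth_scaleR(1)[OF Suc.prems F'] and B = sob_smooth_scaleR(1)[OF v' F]
  have d: "nd 1 (\<lambda>x. of_real (v x) * F x) x = of_real (v x) * nd 1 F x + of_real (v' x) * F x" if x: "0 \<le> x" for x
   using sob_smooth_scaleR(2)[OF Suc.prems F x, of 1] by (simp add: v'_def scaleR_conv_of_real)
  have "cls (nd (Suc n) (\<lambda>x. of_real (v x) * F x)) = cls (nd n (nd 1 (\<lambda>x. of_real (v x) * F x)))" by (simp add: nd_nd)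
  also have "\<dots> = cls (nd n (\<lambda>x. of_real (v x) * nd 1 F x + of_real (v' x) * F x))"
   by (rule sob_smooth_cong(3)[OF sob_smooth_add(1)[OF A B] d])
  also have "\<dots> = cls (nd n (\<lambda>x. of_real (v x) * nd 1 F x)) + cls (nd n (\<lambda>x. of_real (v' x) * F x))"
   by (rule sob_smooth_add(3)[OF A B])
  finally have eq: "cls (nd (Suc n) (\<lambda>x. of_real (v x) * F x)) = cls (nd n (\<lambda>x. of_real (v x) * nd 1 F x)) + cls (nd n (\<lambda>x. of_real (v' x) * F x))" .
  have "norm (cls (nd (Suc n) (\<lambda>x. of_real (v x) * F x))) \<le> C1 * sob_sum n (nd 1 F) + C2 * sob_sum n F"
   unfolding eq by (rule order_trans[OF norm_triangle_ineq add_mono[OF C1(2)[OF F'] C2(2)[OF F]]])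
  also have "sob_sum n (nd 1 F) \<le> sob_sum (Suc n) F"
  proof -
   have "sob_sum n (nd 1 F) = (\<Sum>j\<le>n. norm (cls (nd (Suc j) F)))" by (simp add: sob_sum_def nd_nd)
   also have "\<dots> \<le> sob_sum (Suc n) F" unfolding sob_sum_def by (simp add: sum.atMost_Suc_shift del: sum.atMost_Suc)
   finally show ?thesis .
  qed
  also have "sob_sum n F \<le> sob_sum (Suc n) F" by (rule sob_sum_mono) simp
  finally show "norm (cls (nd (Suc n) (\<lambda>x. of_real (v x) * F x))) \<le> (C1 + C2) * sob_sum (Suc n) F"
   using C1(1) C2(1) by (simp add: distrib_right mult_left_mono)
 qed
qed

text \<open>Comparison with \<open>1 / (1 + x^2)\<close>, whose primitive \<open>arctan\<close>
  stays below \<open>pi / 2\<close>.\<close>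

lemma L2_decay:
 assumes G: "continuous_on {0..} G" and le: "\<And>x. 0 \<le> x ==> (cmod (G x))\<^sup>2 * (1 + x\<^sup>2) \<le> C"
 shows "G \<in> L2"
proof (rule L2_from_local[OF G])
 have C: "0 \<le> C" using order_trans[OF _ le[of 0]] by simp
 show "0 \<le> C * (pi / 2)" using C by simp
 fix b :: real assume b: "0 \<le> b"
 have I: "((\<lambda>x. C * (1 / (1 + x\<^sup>2))) has_integral C * (arctan b - arctan 0)) {0..b}"
 proof (intro has_integral_mult_right fundamental_theorem_of_calculus b)
  fix x
  show "(arctan has_vector_derivative 1 / (1 + x\<^sup>2)) (at x within {0..b})"
   unfolding has_real_derivative_iff_has_vector_derivative[symmetric]
   by (auto intro!: derivative_eq_intros simp: inverse_eq_divide)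
 qed
 have cG: "continuous_on {0..b} G" by (rule continuous_on_subset[OF G]) auto
 have "integral {0..b} (\<lambda>x. (cmod (G x))\<^sup>2) \<le> integral {0..b} (\<lambda>x. C * (1 / (1 + x\<^sup>2)))"
 proof (rule integral_le)
  show "(\<lambda>x. (cmod (G x))\<^sup>2) integrable_on {0..b}" by (rule integrable_continuous_real) (intro continuous_intros cG)
  show "(\<lambda>x. C * (1 / (1 + x\<^sup>2))) integrable_on {0..b}" by (rule has_integral_integrable[OF I])
  fix x assume x: "x \<in> {0..b}"
  have "0 < 1 + x\<^sup>2" using zero_le_power2[of x] by linarith
  then show "(cmod (G x))\<^sup>2 \<le> C * (1 / (1 + x\<^sup>2))" using le[of x] x by (simp add: pos_le_divide_eq)
 qed
 also have "\<dots> = C * arctan b" using integral_unique[OF I] by simp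
 also have "\<dots> \<le> C * (pi / 2)" by (rule mult_left_mono[OF _ C]) (use arctan_ubound[of b] in simp)
 finally show "integral {0..b} (\<lambda>x. (cmod (G x))\<^sup>2) \<le> C * (pi / 2)" .
qed

lemma sob_smooth_schwartz:
 assumes f: "schwartz f" shows "sob_smooth f" "0 \<le> x ==> nd j f x = nth_deriv UNIV j f x"
proof -
 have s: "smooth_fun_on UNIV f" and b: "\<And>m n. \<exists>C. \<forall>x. \<bar>x\<bar> ^ m * norm (nth_deriv UNIV n f x) \<le> C"
  using f by (auto simp: schwartz_def)
 have n: "0 \<le> x ==> nd j f x = nth_deriv UNIV j f x" for j x
  by (rule nth_deriv_subset(2)[OF nontriv_atLeast subset_UNIV s]) simp
 show "0 \<le> x ==> nd j f x = nth_deriv UNIV j f x" by (rule n)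
 have LL: "nth_deriv UNIV j f \<in> L2" for j
 proof -
  obtain C0 where C0: "\<forall>x. \<bar>x\<bar> ^ 0 * norm (nth_deriv UNIV j f x) \<le> C0" using b by blast
  obtain C1 where C1: "\<forall>x. \<bar>x\<bar> ^ 1 * norm (nth_deriv UNIV j f x) \<le> C1" using b by blast
  show ?thesis
  proof (rule L2_decay)
   show "continuous_on {0..} (nth_deriv UNIV j f)" by (rule continuous_on_subset[OF smooth_continuous[OF s]]) simp
   fix x
   have "(norm (nth_deriv UNIV j f x))\<^sup>2 \<le> C0\<^sup>2" by (rule power_mono) (use C0 in simp_all)
   moreover have "(\<bar>x\<bar> * norm (nth_deriv UNIV j f x))\<^sup>2 \<le> C1\<^sup>2" by (rule power_mono) (use C1 in simp_all)
   ultimately show "(cmod (nth_deriv UNIV j f x))\<^sup>2 * (1 + x\<^sup>2) \<le> C0\<^sup>2 + C1\<^sup>2"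
    by (simp add: power_mult_distrib algebra_simps)
  qed
 qed
 show "sob_smooth f" unfolding sob_smooth_def
 proof (intro conjI allI)
  show "smooth_fun_on {0..} f" by (rule nth_deriv_subset(1)[OF nontriv_atLeast subset_UNIV s])
  show "nd j f \<in> L2" for j by (rule L2_cong_halfline(1)[OF LL[of j] n])
 qed
qed

lemma nth_deriv_zero_on_open:
 assumes Z: "open Z" "\<And>y. y \<in> Z ==> p y = 0" and x: "x \<in> Z"
 shows "nth_deriv UNIV n p x = 0"
proof -
 have "\<forall>y\<in>Z. nth_deriv UNIV n p y = 0"
 proof (induction n)
  case (Suc n)
  show ?case
  proof
   fix y assume y: "y \<in> Z"
   have "(nth_deriv UNIV n p has_vector_derivative 0) (at y)"
    by (rule has_vector_derivative_transform_within_open[OF has_vector_derivative_const Z(1) y]) (use Suc in simp)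
   then show "nth_deriv UNIV (Suc n) p y = 0" by (simp add: nth_deriv_Suc vector_derivative_at)
  qed
 qed (use Z(2) in simp)
 then show ?thesis using x by blast
qed

lemma nth_deriv_outside_support:
 assumes "x \<notin> closure {x. p x \<noteq> 0}" shows "nth_deriv UNIV n p x = 0"
proof (rule nth_deriv_zero_on_open)
 show "open (- closure {x. p x \<noteq> 0})" by (rule open_Compl[OF closed_closure])
 show "x \<in> - closure {x. p x \<noteq> 0}" using assms by simp
 show "y \<in> - closure {x. p x \<noteq> 0} ==> p y = 0" for y using closure_subset[of "{x. p x \<noteq> 0}"] by blast
qed

lemma schwartz_test_fun: assumes p: "test_fun p" shows "schwartz p"
proof -
 have s: "smooth_fun_on UNIV p" and c: "compact (closure {x. p x \<noteq> 0})" using p by (auto simp: test_fun_def)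
 note z = nth_deriv_outside_support[of _ p]
 have "\<exists>C. \<forall>x. \<bar>x\<bar> ^ m * norm (nth_deriv UNIV n p x) \<le> C" for m n
 proof -
  have "continuous_on (closure {x. p x \<noteq> 0}) (\<lambda>x. \<bar>x\<bar> ^ m * norm (nth_deriv UNIV n p x))"
   by (intro continuous_intros continuous_on_subset[OF smooth_continuous[OF s]]) simp
  from compact_imp_bounded[OF compact_continuous_image[OF this c]]
  obtain B where B: "\<forall>y\<in>(\<lambda>x. \<bar>x\<bar> ^ m * norm (nth_deriv UNIV n p x)) ` closure {x. p x \<noteq> 0}. norm y \<le> B"
   unfolding bounded_iff by blast
  have "\<bar>x\<bar> ^ m * norm (nth_deriv UNIV n p x) \<le> \<bar>B\<bar>" for x
  proof (cases "x \<in> closure {x. p x \<noteq> 0}")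
   case True
   then have "norm (\<bar>x\<bar> ^ m * norm (nth_deriv UNIV n p x)) \<le> B" using B by blast
   then show ?thesis by (simp only: real_norm_def)
  qed (simp add: z)
  then show ?thesis by blast
 qed
 with s show ?thesis by (simp add: schwartz_def)
qed

text \<open>Integration by parts \<open>j\<close> times; the boundary terms at 0 vanish because the
  support of a test function stays away from 0.\<close>

lemma weak_deriv_smooth:
 assumes F: "sob_smooth F" and e: "l2_eq f F" and f: "f \<in> L2"
 shows "weak_deriv j f (nd j F)"
 unfolding weak_deriv_def
proof (intro allI impI)
 fix p assume p: "test_fun p"
 note P = sob_smooth_schwartz[OF schwartz_test_fun[OF p]]
 note Q = sob_smoothD[OF P(1)] and D = sob_smoothD[OF F]
 have "0 \<notin> closure {x. p x \<noteq> 0}" using p by (auto simp: test_fun_def)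
 then have p0: "nd i p 0 = 0" for i using nth_deriv_outside_support P(2)[of 0 i] by simp
 have ind: "(LINT x|halfline. nd i F x * nd j p x) = (-1) ^ j * (LINT x|halfline. nd (i + j) F x * p x)" for i
 proof (induction j arbitrary: i)
  case (Suc j)
  have "(LINT x|halfline. nd i F x * nd (Suc j) p x) = - nd i F 0 * nd j p 0 - (LINT x|halfline. nd (Suc i) F x * nd j p x)"
   by (rule indef_ibp[OF D(4) Q(4) D(2) D(2) Q(2) Q(2)])
  then show ?case using Suc[of "Suc i"] by (simp add: p0)
 qed simp
 have "(LINT x|halfline. f x * nth_deriv UNIV j p x) = (LINT x|halfline. nd 0 F x * nd j p x)"
 proof (rule integral_cong_AE)
  have s: "AE x in halfline. x \<in> space halfline" by (rule AE_space)
  show "AE x in halfline. f x * nth_deriv UNIV j p x = nd 0 F x * nd j p x"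
   using e[unfolded l2_eq_def] s by eventually_elim (simp add: P(2))
  have m: "nth_deriv UNIV j p \<in> borel_measurable halfline"
   using p by (intro cont_measurable_halfline continuous_on_subset[OF smooth_continuous]) (auto simp: test_fun_def)
  show "(\<lambda>x. f x * nth_deriv UNIV j p x) \<in> borel_measurable halfline"
   by (intro borel_measurable_times L2_measurable f m)
  show "(\<lambda>x. nd 0 F x * nd j p x) \<in> borel_measurable halfline"
   by (intro borel_measurable_times L2_measurable D Q)
 qed
 then show "(LINT x|halfline. f x * nth_deriv UNIV j p x) = (-1) ^ j * (LINT x|halfline. nd j F x * p x)"
  using ind[of 0] by simp
qed

text \<open>Uniqueness of weak derivatives identifies the chosen ones with the classical derivatives
  of \<open>F\<close>; the two inequalities compare a Euclidean norm with the sum of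
  \<open>k + 1\<close> terms.\<close>

lemma sobolev_smooth:
 assumes F: "sob_smooth F" and f: "f \<in> L2" and e: "cls f = cls F"
 shows "f \<in> sobolev k" "sobolev_norm k f \<le> sob_sum k F" "sob_sum k F \<le> real (Suc k) * sobolev_norm k f"
proof -
 note D = sob_smoothD[OF F]
 have eq: "l2_eq f F" using e by (simp add: cls_eq_iff f D(3))
 note W = weak_deriv_smooth[OF F eq f]
 show "f \<in> sobolev k" unfolding sobolev_def using f D(2) W by blast
 have n: "l2_norm (SOME h. h \<in> L2 \<and> weak_deriv j f h) = norm (cls (nd j F))" for j
 proof -
  have "\<exists>h. h \<in> L2 \<and> weak_deriv j f h" using D(2) W by blast
  then have s: "(SOME h. h \<in> L2 \<and> weak_deriv j f h) \<in> L2 \<and> weak_deriv j f (SOME h. h \<in> L2 \<and> weak_deriv j f h)" by (rule someI_ex)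
  show ?thesis unfolding norm_cls[OF D(2)]
   by (rule l2_norm_cong[OF _ D(2) weak_deriv_unique[OF _ D(2) _ W]]) (use s in blast)+
 qed
 have N: "sobolev_norm k f = L2_set (\<lambda>j. norm (cls (nd j F))) {..k}" unfolding sobolev_norm_def n L2_set_def ..
 show "sobolev_norm k f \<le> sob_sum k F" unfolding N sob_sum_def by (rule L2_set_le_sum) simp
 have "sob_sum k F \<le> (\<Sum>j\<le>k. sobolev_norm k f)" unfolding sob_sum_def N
  by (intro sum_mono member_le_L2_set) simp_all
 then show "sob_sum k F \<le> real (Suc k) * sobolev_norm k f" by simp
qed

section \<open>Elliptic regularity\<close>

lemma bdd_smooth_const_halfline: "bdd_smooth {0..} (\<lambda>x. c)"
proof -
 define d where "d n = (\<lambda>x::real. if n = 0 then c else 0)" for n :: nat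
 have d: "(d n has_vector_derivative d (Suc n) x) (at x within {0..})" for n x by (simp add: d_def)
 have "bdd_smooth {0..} (d 0)" unfolding bdd_smooth_def
 proof (intro conjI allI)
  show "smooth_fun_on {0..} (d 0)" by (rule nth_deriv_chain(2)[OF nontriv_atLeast, where d = d, OF d])
  fix n
  have "\<bar>nth_deriv {0..} n (d 0) x\<bar> \<le> \<bar>c\<bar>" if "x \<in> {0..}" for x
   unfolding nth_deriv_chain(1)[OF nontriv_atLeast, where d = d, OF d that] by (simp add: d_def)
  then show "\<exists>C. \<forall>x\<in>{0..}. \<bar>nth_deriv {0..} n (d 0) x\<bar> \<le> C" by blast
 qed
 then show ?thesis by (simp add: d_def)
qed

text \<open>All derivatives of the unknowns of a linear system of differential equations lie in the module
 that the unknowns generate over the bounded smooth functions.\<close>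

inductive_set smod :: "(real => complex) set => (real => complex) set" for B where
 base: "F \<in> B ==> F \<in> smod B"
| add: "F \<in> smod B ==> G \<in> smod B ==> (\<lambda>x. F x + G x) \<in> smod B"
| mult: "bdd_smooth {0..} v ==> F \<in> smod B ==> (\<lambda>x. of_real (v x) * F x) \<in> smod B"

text \<open>The product rule keeps derivatives inside the module, so \<open>smooth_coind\<close>
  applies; bounded coefficients keep its members in \<open>L2\<close>.\<close>

lemma smod_sob_smooth:
 assumes L: "\<And>F. F \<in> B ==> F \<in> L2"
  and d: "\<And>F. F \<in> B ==> \<exists>G\<in>smod B. \<forall>x\<in>{0..}. (F has_vector_derivative G x) (at x within {0..})"
  and F: "F \<in> smod B"
 shows "sob_smooth F"
proof -
 have L': "F \<in> L2" if "F \<in> smod B" for F using that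
 proof induction
  case (mult v F)
  have sv: "smooth_fun_on {0..} v" using mult(1) by (simp add: bdd_smooth_def)
  have "\<exists>C. \<forall>x\<in>{0..}. \<bar>nth_deriv {0..} 0 v x\<bar> \<le> C" using mult(1) unfolding bdd_smooth_def by blast
  then obtain C where C: "\<forall>x\<in>{0..}. \<bar>v x\<bar> \<le> C" by auto
  show ?case
  proof (rule L2_mult_bounded[OF _ _ mult.IH])
   show "(\<lambda>x. complex_of_real (v x)) \<in> borel_measurable halfline"
    by (rule cont_measurable_halfline) (intro continuous_intros smooth_continuous[OF sv, of 0, unfolded nth_deriv_0])
   show "0 \<le> x ==> cmod (complex_of_real (v x)) \<le> C" for x using C by simp
  qed
 next
  case (base F) then show ?case by (rule L)
 next
  case (add F G) show ?case by (rule L2_add[OF add.IH])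
 qed
 have d': "\<exists>G\<in>smod B. \<forall>x\<in>{0..}. (F has_vector_derivative G x) (at x within {0..})" if "F \<in> smod B" for F using that
 proof induction
  case (base F) then show ?case by (rule d)
 next
  case (add F G)
  obtain F' where F': "F' \<in> smod B" "\<And>x. x \<in> {0..} ==> (F has_vector_derivative F' x) (at x within {0..})" using add.IH(1) by blast
  obtain G' where G': "G' \<in> smod B" "\<And>x. x \<in> {0..} ==> (G has_vector_derivative G' x) (at x within {0..})" using add.IH(2) by blast
  show ?case
   by (rule bexI[OF _ smod.add[OF F'(1) G'(1)]], rule ballI) (rule has_vector_derivative_add[OF F'(2) G'(2)])
 next
  case (mult v F)
  obtain F' where F': "F' \<in> smod B" "\<And>x. x \<in> {0..} ==> (F has_vector_derivative F' x) (at x within {0..})" using mult.IH by blast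
  have sv: "smooth_fun_on {0..} v" using mult(1) by (simp add: bdd_smooth_def)
  show ?case
  proof (rule bexI[OF _ smod.add[OF smod.mult[OF mult(1) F'(1)] smod.mult[OF bdd_smooth_deriv[OF mult(1)] mult(2)]]], rule ballI)
   fix x :: real assume x: "x \<in> {0..}"
   have "(v has_vector_derivative nth_deriv {0..} 1 v x) (at x within {0..})" using smooth_has_deriv[OF sv x, of 0] by simp
   then have "((\<lambda>x. complex_of_real (v x)) has_vector_derivative of_real (nth_deriv {0..} 1 v x)) (at x within {0..})"
    by (rule bounded_linear.has_vector_derivative[OF bounded_linear_of_real])
   from has_vector_derivative_mult[OF this F'(2)[OF x]]
   show "((\<lambda>x. of_real (v x) * F x) has_vector_derivative of_real (v x) * F' x + of_real (nth_deriv {0..} 1 v x) * F x) (at x within {0..})" .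
  qed
 qed
 have S: "smooth_fun_on {0..} F \<and> (\<forall>n. \<exists>g\<in>smod B. \<forall>x\<in>{0..}. nth_deriv {0..} n F x = g x)"
  by (rule smooth_coind[OF nontriv_atLeast d' F])
 show ?thesis unfolding sob_smooth_def
 proof (intro conjI allI)
  show "smooth_fun_on {0..} F" using S by blast
  fix j
  obtain g where g: "g \<in> smod B" "\<forall>x\<in>{0..}. nd j F x = g x" using S by blast
  show "nd j F \<in> L2" by (rule L2_cong_halfline(1)[OF L'[OF g(1)]]) (use g(2) in simp)
 qed
qed

lemma indef_cong_AE:
 assumes F: "indef F f" and e: "l2_eq f g" and g: "g \<in> L2" shows "indef F g"
proof (rule indef_iff_ac[OF indef_ac_loc[OF F] _ locL1_L2[OF g]])
 show "AE x in halfline. (F has_vector_derivative g x) (at x within {0..})"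
  using indef_AE_deriv[OF F] e[unfolded l2_eq_def] by eventually_elim simp
qed

lemma sob_smooth_unique:
 assumes F: "sob_smooth F" and G: "sob_smooth G" and e: "cls F = cls G"
 shows "0 \<le> x ==> F x = G x" "cls (nd j F) = cls (nd j G)" "sob_sum j F = sob_sum j G"
proof -
 note D = sob_smoothD[OF F] and E = sob_smoothD[OF G]
 have cF: "continuous_on {0..} F" "continuous_on {0..} G"
  using smooth_continuous[OF D(1), of 0] smooth_continuous[OF E(1), of 0] by simp_all
 have l: "l2_eq F G" using e D(3) E(3) by (simp add: cls_eq_iff)
 have eq: "0 \<le> x ==> F x = G x" for x by (rule cont_AE_eq[OF cF l])
 then show "0 \<le> x ==> F x = G x" .
 have n: "cls (nd j F) = cls (nd j G)" for j by (rule sob_smooth_cong(3)[OF G eq])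
 then show "cls (nd j F) = cls (nd j G)" "sob_sum j F = sob_sum j G" by (simp_all add: sob_sum_def)
qed

lemma sob_sum_cong: "sob_smooth F ==> (\<And>x. 0 \<le> x ==> G x = F x) ==> sob_sum k G = sob_sum k F"
 unfolding sob_sum_def by (intro sum.cong refl arg_cong[of _ _ norm] sob_smooth_cong(3))

lemma sob_sum_add_minus:
 assumes F: "sob_smooth F" and G: "sob_smooth G"
 shows "sob_sum k (\<lambda>x. F x + - G x) \<le> sob_sum k F + sob_sum k G"
proof -
 have "norm (cls (nd j (\<lambda>x. F x + - G x))) \<le> norm (cls (nd j F)) + norm (cls (nd j G))" for j
  unfolding sob_smooth_add(3)[OF F sob_smooth_minus(1)[OF G]] sob_smooth_minus(3)[OF G]
  using norm_triangle_ineq[of "cls (nd j F)" "- cls (nd j G)"] by simp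
 then have "sob_sum k (\<lambda>x. F x + - G x) \<le> (\<Sum>j\<le>k. norm (cls (nd j F)) + norm (cls (nd j G)))"
  unfolding sob_sum_def by (intro sum_mono)
 then show ?thesis by (simp add: sob_sum_def sum.distrib)
qed

lemma sum_shift_le:
 fixes a :: "nat => real" assumes "\<And>j. 0 \<le> a j"
 shows "(\<Sum>j\<le>k. a (j + n)) \<le> (\<Sum>j\<le>k + n. a j)"
proof -
 have "(\<Sum>j\<le>k. a (j + n)) = (\<Sum>j\<in>(\<lambda>j. j + n) ` {..k}. a j)" by (simp add: sum.reindex inj_on_def)
 also have "\<dots> \<le> (\<Sum>j\<le>k + n. a j)" by (rule sum_mono2) (use assms in auto)
 finally show ?thesis .
qed

lemma sob_sum_nd: "sob_sum k (nd n F) \<le> sob_sum (k + n) F"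
 using sum_shift_le[where a = "\<lambda>j. norm (cls (nd j F))" and k = k and n = n] by (simp add: sob_sum_def nd_nd)

lemma sob_sum_scaleR:
 assumes v: "bdd_smooth {0..} v"
 shows "\<exists>C\<ge>0. \<forall>F. sob_smooth F --> sob_sum n (\<lambda>x. of_real (v x) * F x) \<le> C * sob_sum n F"
proof -
 obtain C where C: "\<And>j. C j \<ge> 0" "\<And>j F. sob_smooth F ==> norm (cls (nd j (\<lambda>x. of_real (v x) * F x))) \<le> C j * sob_sum j F"
  using norm_nd_scaleR[OF v] by metis
 show ?thesis
 proof (rule exI[of _ "\<Sum>j\<le>n. C j"], intro conjI allI impI)
  show "0 \<le> (\<Sum>j\<le>n. C j)" by (intro sum_nonneg C(1))
  fix F assume F: "sob_smooth F"
  have "norm (cls (nd j (\<lambda>x. of_real (v x) * F x))) \<le> C j * sob_sum n F" if "j \<le> n" for j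
   by (rule order_trans[OF C(2)[OF F] mult_left_mono[OF sob_sum_mono[OF that] C(1)]])
  then show "sob_sum n (\<lambda>x. of_real (v x) * F x) \<le> (\<Sum>j\<le>n. C j) * sob_sum n F"
   unfolding sob_sum_def[of n "\<lambda>x. of_real (v x) * F x"] sum_distrib_right by (intro sum_mono) simp
 qed
qed

locale smooth_potential = bounded_potential +
 assumes smooth: "bdd_smooth {0..} V"
begin

lemma sob_dataA: assumes F: "sob_smooth F" and 0: "nd 1 F 0 = 0" shows "dataA F (nd 1 F) (nd 2 F)"
proof -
 note D = sob_smoothD[OF F]
 have "indef F (nd 1 F)" "indef (nd 1 F) (nd 2 F)" using D(4)[of 0] D(4)[of 1] by (simp_all add: numeral_2_eq_2)
 then show ?thesis unfolding dataA_def using D(2,3) 0 by blast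
qed

text \<open>Taken for all \<open>n\<close> together, the equations
  \<open>F n'' = V F n - F (n + 1)\<close> form a closed linear system for the functions
  \<open>F n\<close> and their first derivatives. Its coefficients have bounded derivatives, so all
  orders of regularity come at once.\<close>

lemma regularity:
 assumes A: "\<And>n::nat. opA (u n) (u (Suc n))"
 shows "\<exists>F. \<forall>n. sob_smooth (F n) \<and> cls (F n) = u n \<and> nd 1 (F n) 0 = 0 \<and>
  (\<forall>x\<ge>0. nd 2 (F n) x = of_real (V x) * F n x + - F (Suc n) x)"
proof -
 obtain F F1 F2 where F: "\<And>n. dataA (F n) (F1 n) (F2 n)" "\<And>n. u n = cls (F n)" "\<And>n. u (Suc n) = mulV (u n) - cls (F2 n)"
  using A unfolding opA_def by metis
 note L = dataA_L2[OF F(1)]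
 have i: "indef (F n) (F1 n)" "indef (F1 n) (F2 n)" "F1 n 0 = 0" for n using F(1)[of n] by (simp_all add: dataA_def)
 \<comment> \<open>The constant coefficient \<open>- 1\<close> is written as a multiplier, so that
   \<open>G n\<close> has the form generated by \<open>smod\<close>.\<close>
 define G where "G n x = of_real (V x) * F n x + of_real (- 1) * F (Suc n) x" for n x
 have GL: "G n \<in> L2" for n unfolding G_def by (intro L2_add V_L2 L2_scale L)
 have "cls (F2 n) = cls (G n)" for n
 proof -
  have "cls (F2 n) = mulV (u n) - u (Suc n)" by (simp add: F(3))
  also have "\<dots> = cls (G n)" unfolding F(2) mulV_cls[OF L(1)] diff_cls[OF V_L2[OF L(1)] L(1)] G_def by simp
  finally show ?thesis .
 qed
 then have e: "l2_eq (F2 n) (G n)" for n by (simp add: cls_eq_iff L GL)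
 have i1: "indef (F1 n) (G n)" for n by (rule indef_cong_AE[OF i(2) e GL])
 have cG: "continuous_on {0..} (G n)" for n unfolding G_def by (intro continuous_intros cont indef_continuous[OF i(1)])
 have d0: "0 \<le> x ==> (F n has_vector_derivative F1 n x) (at x within {0..})" for n x
  by (rule indef_cont_deriv[OF i(1) indef_continuous[OF i(2)]])
 have d1: "0 \<le> x ==> (F1 n has_vector_derivative G n x) (at x within {0..})" for n x
  by (rule indef_cont_deriv[OF i1 cG])
 define B where "B = range F \<union> range F1"
 have S: "sob_smooth (F n)" for n
 proof (rule smod_sob_smooth[where B = B])
  show "F n \<in> smod B" by (rule smod.base) (simp add: B_def)
  fix H assume H: "H \<in> B"
  then show "H \<in> L2" using L by (auto simp: B_def)
  show "\<exists>G\<in>smod B. \<forall>x\<in>{0..}. (H has_vector_derivative G x) (at x within {0..})"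
  proof (cases "H \<in> range F")
   case True
   then obtain n where n: "H = F n" by blast
   show ?thesis
    by (rule bexI[of _ "F1 n"]) (use d0 in \<open>simp add: n\<close>, rule smod.base, simp add: B_def)
  next
   case False
   then obtain n where n: "H = F1 n" using H by (auto simp: B_def)
   show ?thesis
   proof (rule bexI[of _ "G n"])
    show "\<forall>x\<in>{0..}. (H has_vector_derivative G n x) (at x within {0..})" using d1 by (simp add: n)
    show "G n \<in> smod B" unfolding G_def
     by (intro smod.add smod.mult[OF smooth] smod.mult[OF bdd_smooth_const_halfline] smod.base) (simp_all add: B_def)
   qed
  qed
 qed
 note D = sob_smoothD(1)[OF S]
 have n1: "nd 1 (F n) x = F1 n x" if x: "0 \<le> x" for n x
 proof (rule vector_derivative_unique_within[OF halfline_within_nontriv[OF x] _ d0[OF x]])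
  show "(F n has_vector_derivative nd 1 (F n) x) (at x within {0..})"
   using smooth_has_deriv[OF D, of x 0 n] x by simp
 qed
 have n2: "nd 2 (F n) x = G n x" if x: "0 \<le> x" for n x
 proof (rule vector_derivative_unique_within[OF halfline_within_nontriv[OF x] _ d1[OF x]])
  have "(nd 1 (F n) has_vector_derivative nd 2 (F n) x) (at x within {0..})"
   using smooth_has_deriv[OF D, of x 1 n] x by (simp add: numeral_2_eq_2)
  then show "(F1 n has_vector_derivative nd 2 (F n) x) (at x within {0..})"
   by (rule has_vector_derivative_transform[rotated 2]) (use x n1 in simp_all)
 qed
 show ?thesis using S F(2) n1[of 0] i(3) n2 by (intro exI[of _ F]) (simp add: G_def)
qed

text \<open>An eigenvector gives the sequence \<open>l ^ n *\<^sub>R u\<close> for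
  \<open>regularity\<close>, hence a smooth square-integrable eigenfunction with Neumann condition,
  which the hypothesis excludes.\<close>

lemma no_eigenvalue_opA:
 assumes noev: "no_negative_eigenvalue V" and l: "l < 0" and A: "opA u (l *\<^sub>R u)"
 shows "u = 0"
proof -
 have sc: "opA (c *\<^sub>R u) (c *\<^sub>R (l *\<^sub>R u))" for c using opA_cmul[OF A, of "of_real c"] by simp
 have "opA (l ^ n *\<^sub>R u) (l ^ Suc n *\<^sub>R u)" for n using sc[of "l ^ n"] by (simp add: mult.commute)
 from regularity[of "\<lambda>n. l ^ n *\<^sub>R u", OF this] obtain F where F: "\<And>n. sob_smooth (F n)" "\<And>n. cls (F n) = l ^ n *\<^sub>R u" "\<And>n. nd 1 (F n) 0 = 0"
  "\<And>n x. 0 \<le> x ==> nd 2 (F n) x = of_real (V x) * F n x + - F (Suc n) x" by metis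
 note D = sob_smoothD[OF F(1)]
 have cF: "continuous_on {0..} (F n)" for n using smooth_continuous[OF D(1), of 0 n] by simp
 have "l2_eq (F 1) (\<lambda>x. of_real l * F 0 x)"
 proof (rule cls_eq_iff[THEN iffD1, OF D(3) L2_scale[OF D(3)]])
  show "cls (F 1) = cls (\<lambda>x. of_real l * F 0 x)" unfolding scaleR_cls[OF D(3), symmetric] F(2) by simp
 qed
 from cont_AE_eq[OF cF _ this] have F1: "F 1 x = of_real l * F 0 x" if "0 \<le> x" for x
  using that by (simp add: continuous_intros cF)
 have "F 0 x = 0" if x: "0 \<le> x" for x
 proof (rule ccontr)
  assume "F 0 x \<noteq> 0"
  moreover have "\<forall>x\<ge>0. - nd 2 (F 0) x + of_real (V x) * F 0 x = of_real l * F 0 x"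
   using F(4)[of _ 0] F1 by simp
  ultimately show False
   using noev l x D(1)[of 0] D(3)[of 0] F(3)[of 0] unfolding no_negative_eigenvalue_def by blast
 qed
 then have "cls (F 0) = cls (\<lambda>x. 0)" by (intro L2_cong_halfline(2) L2_0)
 then show ?thesis using F(2)[of 0] by (simp add: zero_cls)
qed

end

text \<open>At the spectral projection of \<open>f\<close> to \<open>{- n..<0}\<close> the form is
  the integral of \<open>x\<close> over this set. Its nonnegativity makes the set null, as
  \<open>x < 0\<close> there. The cut-off at \<open>- n\<close> places the vector in the
  domain.\<close>

lemma (in spectral) nonneg_support:
 assumes "\<And>u. u \<in> dom (\<lambda>x. x) ==> 0 \<le> inner (Phi (\<lambda>x. x) u) u"
 shows "AE x in mu f. 0 \<le> x"
proof -
 have "AE x in mu f. x \<notin> {- real n..<0}" for n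
 proof -
  define I where "I = (indicator {- real n..<0} :: real => real)"
  have m [measurable]: "I \<in> borel_fun" by (simp add: I_def)
  have I: "f \<in> dom I" by (rule dom_bounded[of _ 1]) (simp_all add: I_def indicator_def)
  have b: "\<bar>x * I x\<bar> \<le> real n" for x by (simp add: I_def indicator_def)
  have xI: "f \<in> dom (\<lambda>x. x * I x)" by (rule dom_bounded[of _ "real n"]) (simp_all add: b)
  have IxI: "(\<lambda>x. I x * (x * I x)) = (\<lambda>x. x * I x)" by (auto simp: I_def indicator_def)
  have v: "Phi I f \<in> dom (\<lambda>x. x)" using xI by (simp add: dom_Phi_iff[OF m _ I])
  have e: "Phi (\<lambda>x. x) (Phi I f) = Phi (\<lambda>x. x * I x) f" by (rule Phi_Phi[OF m _ I xI]) simp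
  have w: "Phi (\<lambda>x. x * I x) f \<in> dom I" by (rule dom_bounded[of _ 1]) (simp_all add: I_def indicator_def)
  have "inner (Phi (\<lambda>x. x) (Phi I f)) (Phi I f) = inner (Phi I (Phi (\<lambda>x. x * I x) f)) f"
   unfolding e by (rule sym_Phi[OF m w I, symmetric])
  also have "Phi I (Phi (\<lambda>x. x * I x) f) = Phi (\<lambda>x. x * I x) f"
   by (subst Phi_Phi[OF _ m xI]) (simp_all add: IxI xI)
  also have "inner (Phi (\<lambda>x. x * I x) f) f = (LINT x|mu f. x * I x)" by (rule inner_Phi_self[OF _ xI]) simp
  finally have "0 \<le> (LINT x|mu f. x * I x)" using assms[OF v] by simp
  moreover have "0 \<le> (LINT x|mu f. - (x * I x))" by (rule integral_nonneg_AE) (simp add: I_def indicator_def)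
  ultimately have z: "(LINT x|mu f. - (x * I x)) = 0" by simp
  have i: "integrable (mu f) (\<lambda>x. - (x * I x))" by (rule integrable_bounded[of _ "real n"]) (simp_all add: b)
  have "AE x in mu f. - (x * I x) = 0"
   using integral_nonneg_eq_0_iff_AE[OF i] z by (simp add: I_def indicator_def)
  then show ?thesis by eventually_elim (auto simp: I_def indicator_def split: if_splits)
 qed
 then have "AE x in mu f. \<forall>n. x \<notin> {- real n..<0}" by (simp only: AE_all_countable simp_thms)
 then show ?thesis
 proof eventually_elim
  case (elim x)
  obtain n where "- x \<le> real n" using real_arch_simple by blast
  then show ?case using spec[OF elim, of n] by auto
 qed
qed

section \<open>Graph norms and Sobolev norms\<close>

locale wave_setup = smooth_potential V Vb + nonneg_spectral P
 for V Vb and P :: "real set => hl2 => hl2" +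
 assumes op: "opA u w \<longleftrightarrow> u \<in> dom (\<lambda>x. x) \<and> w = Phi (\<lambda>x. x) u"
begin

text \<open>The norm of the power \<open>j / 2\<close> of \<open>A\<close> applied to
  \<open>u\<close>, the spectral counterpart of \<open>j\<close> derivatives.\<close>

definition pw :: "nat => hl2 => real" where "pw j u = norm (Phi (\<lambda>x. sqrt x ^ j) u)"

definition pw_sum :: "nat => hl2 => real" where "pw_sum k u = (\<Sum>j\<le>k. pw j u)"

lemma pw_nonneg: "0 \<le> pw j u" by (simp add: pw_def)

lemma pw_0: "pw 0 u = norm u" by (simp add: pw_def)

lemma pw_id: assumes u: "u \<in> Dinf" shows "pw j (Phi (\<lambda>x. x) u) = pw (j + 2) u"
 unfolding pw_def
 by (rule arg_cong[of _ _ norm], rule Phi_Phi_eq[OF gr_id gr_sqrt gr_sqrt u]) (simp add: power_add)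

lemma pw_sum_mono: "j \<le> k ==> pw_sum j u \<le> pw_sum k u"
 unfolding pw_sum_def by (rule sum_mono2) (auto simp: pw_nonneg)

lemma pw_sum_id: assumes u: "u \<in> Dinf" shows "pw_sum k (Phi (\<lambda>x. x) u) \<le> pw_sum (k + 2) u"
 unfolding pw_sum_def pw_id[OF u] by (rule sum_shift_le) (rule pw_nonneg)

lemma Dinf_id: "u \<in> Dinf ==> Phi (\<lambda>x. x) u \<in> Dinf" by (rule gr_Dinf[OF gr_id])

lemma Dinf_opA: "u \<in> Dinf ==> opA u (Phi (\<lambda>x. x) u)" unfolding op using gr_domD[OF gr_id] by blast

lemma Dinf_add: assumes "u \<in> Dinf" "v \<in> Dinf" shows "u + v \<in> Dinf"
 unfolding Dinf_def
proof (intro CollectI allI)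
 fix n show "u + v \<in> dom (\<lambda>x. sqrt x ^ n)"
  by (rule dom_sum[OF gr_measurable[OF gr_sqrt] gr_domD[OF gr_sqrt assms(1)] gr_domD[OF gr_sqrt assms(2)]])
qed

lemma Dinf_smooth_seq:
 assumes u: "u \<in> Dinf"
 obtains F :: "nat => real => complex" where "\<And>n. sob_smooth (F n)" "cls (F 0) = u" "cls (F 1) = Phi (\<lambda>x. x) u" "nd 1 (F 0) 0 = 0"
  "\<And>x. 0 \<le> x ==> nd 2 (F 0) x = of_real (V x) * F 0 x + - F 1 x"
proof -
 define U where "U n = ((Phi (\<lambda>x. x)) ^^ n) u" for n
 have U: "U n \<in> Dinf" for n by (induction n) (simp_all add: U_def u Dinf_id)
 have "opA (U n) (U (Suc n))" for n using Dinf_opA[OF U[of n]] by (simp add: U_def)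
 from regularity[of U, OF this] obtain F where F: "\<forall>n. sob_smooth (F n) \<and> cls (F n) = U n \<and> nd 1 (F n) 0 = 0 \<and>
  (\<forall>x\<ge>0. nd 2 (F n) x = of_real (V x) * F n x + - F (Suc n) x)" by blast
 show ?thesis by (rule that[of F]) (use F in \<open>auto simp: U_def\<close>)
qed

text \<open>\<open>Dinf_smooth_seq\<close> selects its own representatives. Continuity identifies a
  given \<open>F\<close> with the selected one, so the inductions below may start from any
  \<open>F\<close>.\<close>

lemma Dinf_step:
 assumes u: "u \<in> Dinf" and F: "sob_smooth F" "cls F = u"
 obtains G where "nd 1 F 0 = 0" "sob_smooth G" "cls G = Phi (\<lambda>x. x) u"
  "\<And>x. 0 \<le> x ==> nd 2 F x = of_real (V x) * F x + - G x"
proof -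
 obtain H where H: "\<And>n::nat. sob_smooth (H n)" "cls (H 0) = u" "cls (H 1) = Phi (\<lambda>x. x) u" "nd 1 (H 0) 0 = 0"
  "\<And>x. 0 \<le> x ==> nd 2 (H 0) x = of_real (V x) * H 0 x + - H 1 x" by (rule Dinf_smooth_seq[OF u]) blast
 have eq: "F x = H 0 x" if "0 \<le> x" for x by (rule sob_smooth_unique(1)[OF F(1) H(1) _ that]) (simp add: F(2) H(2))
 have n: "nd j F x = nd j (H 0) x" if "0 \<le> x" for j x by (rule sob_smooth_cong(2)[OF H(1) eq that])
 show ?thesis by (rule that[of "H 1"]) (use n[of _ 1] n[of _ 2] eq H in simp_all)
qed

text \<open>One factor \<open>sqrt A\<close> is moved across the inner product on the spectral side,
  one derivative on the differential side. This settles order 1, which the inductions below, in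
  steps of two, take as a base case.\<close>

lemma pw_1_sq:
 assumes u: "u \<in> Dinf" and F: "sob_smooth F" "cls F = u"
 shows "(pw 1 u)\<^sup>2 = (norm (cls (nd 1 F)))\<^sup>2 + inner (mulV u) u"
proof -
 obtain G where G: "nd 1 F 0 = 0" "sob_smooth G" "cls G = Phi (\<lambda>x. x) u"
  "\<And>x. 0 \<le> x ==> nd 2 F x = of_real (V x) * F x + - G x" by (rule Dinf_step[OF u F]) blast
 note L = sob_smoothD[OF F(1)]
 have s: "gr sqrt 1 1" using gr_sqrt[of 1] by simp
 have "cls (nd 2 F) = mulV (cls F) - cls G"
  unfolding mulV_cls[OF L(3)] diff_cls[OF V_L2[OF L(3)] sob_smoothD(3)[OF G(2)]]
  by (rule L2_cong_halfline(2)[OF L2_diff[OF V_L2[OF L(3)] sob_smoothD(3)[OF G(2)]]]) (simp add: G(4))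
 then have "inner (Phi (\<lambda>x. x) u) u = inner (mulV (cls F) - cls (nd 2 F)) (cls F)" by (simp add: G(3) F(2))
 also have "\<dots> = (norm (cls (nd 1 F)))\<^sup>2 + inner (mulV u) u"
  unfolding opA_ibp[OF sob_dataA[OF F(1) G(1)] sob_dataA[OF F(1) G(1)]] unfolding F(2) dot_square_norm ..
 finally have 1: "inner (Phi (\<lambda>x. x) u) u = (norm (cls (nd 1 F)))\<^sup>2 + inner (mulV u) u" .
 have "Phi sqrt (Phi sqrt u) = Phi (\<lambda>x. x) u" by (rule Phi_Phi_eq[OF s s gr_id u]) simp
 then have "inner (Phi (\<lambda>x. x) u) u = inner (Phi sqrt (Phi sqrt u)) u" by simp
 also have "\<dots> = inner (Phi sqrt u) (Phi sqrt u)"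
  by (rule sym_Phi[OF gr_measurable[OF s] gr_domD[OF s gr_Dinf[OF s u]] gr_domD[OF s u]])
 also have "\<dots> = (pw 1 u)\<^sup>2" by (simp add: pw_def dot_square_norm)
 finally show ?thesis using 1 by simp
qed

lemma sq_interpolation:
 assumes "a\<^sup>2 \<le> c\<^sup>2 + Vb * d\<^sup>2" "0 \<le> c" "0 \<le> d" shows "a \<le> (1 + Vb) * (d + c)"
proof (rule power2_le_imp_le)
 have "c\<^sup>2 + Vb * d\<^sup>2 \<le> (1 + Vb) * (c\<^sup>2 + d\<^sup>2)" using Vb_nonneg by (simp add: algebra_simps)
 also have "\<dots> \<le> (1 + Vb) * (d + c)\<^sup>2"
  by (rule mult_left_mono) (use assms(2,3) Vb_nonneg in \<open>simp_all add: power2_sum\<close>)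
 also have "\<dots> \<le> (1 + Vb)\<^sup>2 * (d + c)\<^sup>2"
  by (rule mult_right_mono) (use Vb_nonneg self_le_power[of "1 + Vb" 2] in simp_all)
 finally show "a\<^sup>2 \<le> ((1 + Vb) * (d + c))\<^sup>2" using assms(1) by (simp add: power_mult_distrib)
 show "0 \<le> (1 + Vb) * (d + c)" using assms(2,3) Vb_nonneg by simp
qed

lemma sob_sum_0: "sob_sum 0 F = norm (cls F)" by (simp add: sob_sum_def)

lemma sob_sum_1: "sob_sum 1 F = norm (cls F) + norm (cls (nd 1 F))" by (simp add: sob_sum_def)

text \<open>Induction in steps of two (\<open>induct_nat_012\<close>): by the equation two
  derivatives of \<open>F\<close> are traded for \<open>V F\<close> and a representative of
  \<open>A u\<close>, which need only \<open>n\<close> derivatives each.\<close>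

lemma sob_sum_le_pw_sum:
 "\<exists>C\<ge>0. \<forall>u F. u \<in> Dinf --> sob_smooth F --> cls F = u --> sob_sum k F \<le> C * pw_sum k u" (is "?P k")
proof (rule induct_nat_012[of _ k])
 show "?P 0"
  by (rule exI[of _ 1]) (simp add: sob_sum_0 pw_sum_def pw_0)
 show "?P (Suc 0)"
 proof (rule exI[of _ "2 + Vb"], intro conjI allI impI)
  show "0 \<le> 2 + Vb" using Vb_nonneg by simp
  fix u F assume u: "u \<in> Dinf" and F: "sob_smooth F" "cls F = u"
  have "(norm (cls (nd 1 F)))\<^sup>2 \<le> (pw 1 u)\<^sup>2 + Vb * (pw 0 u)\<^sup>2"
   using pw_1_sq[OF u F] mulV_inner[of u] unfolding pw_0 by linarith
  from sq_interpolation[OF this pw_nonneg pw_nonneg]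
  have "norm (cls (nd 1 F)) \<le> (1 + Vb) * pw_sum 1 u" by (simp add: pw_sum_def)
  moreover have "norm (cls F) \<le> pw_sum 1 u" using pw_sum_mono[of 0 1 u] by (simp add: F(2) pw_sum_def pw_0)
  ultimately have "sob_sum 1 F \<le> pw_sum 1 u + (1 + Vb) * pw_sum 1 u" unfolding sob_sum_1 by (rule add_mono[rotated])
  then show "sob_sum (Suc 0) F \<le> (2 + Vb) * pw_sum (Suc 0) u" by (simp add: algebra_simps)
 qed
next
 fix n
 assume "?P n"
 then obtain C0 where C0: "C0 \<ge> 0" "\<And>u F. u \<in> Dinf ==> sob_smooth F ==> cls F = u ==> sob_sum n F \<le> C0 * pw_sum n u" by blast
 assume "?P (Suc n)"
 then obtain C1 where C1: "C1 \<ge> 0" "\<And>u F. u \<in> Dinf ==> sob_smooth F ==> cls F = u ==> sob_sum (Suc n) F \<le> C1 * pw_sum (Suc n) u" by blast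
 obtain Cv where Cv: "Cv \<ge> 0" "\<And>F. sob_smooth F ==> sob_sum n (\<lambda>x. of_real (V x) * F x) \<le> Cv * sob_sum n F"
  using sob_sum_scaleR[OF smooth] by blast
 show "?P (Suc (Suc n))"
 proof (rule exI[of _ "C1 + (Cv * C0 + C0)"], intro conjI allI impI)
  show "0 \<le> C1 + (Cv * C0 + C0)" using C0(1) C1(1) Cv(1) by simp
  fix u F assume u: "u \<in> Dinf" and F: "sob_smooth F" "cls F = u"
  obtain G where G: "nd 1 F 0 = 0" "sob_smooth G" "cls G = Phi (\<lambda>x. x) u"
   "\<And>x. 0 \<le> x ==> nd 2 F x = of_real (V x) * F x + - G x" by (rule Dinf_step[OF u F]) blast
  define B where "B = pw_sum (Suc (Suc n)) u"
  note VF = sob_smooth_scaleR(1)[OF smooth F(1)]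
  have "norm (cls (nd (Suc (Suc n)) F)) \<le> sob_sum n (nd 2 F)"
   using sob_sum_member[of n n "nd 2 F"] by (simp add: nd_nd)
  also have "\<dots> = sob_sum n (\<lambda>x. of_real (V x) * F x + - G x)"
   by (rule sob_sum_cong[OF sob_smooth_add(1)[OF VF sob_smooth_minus(1)[OF G(2)]] G(4)])
  also have "\<dots> \<le> sob_sum n (\<lambda>x. of_real (V x) * F x) + sob_sum n G" by (rule sob_sum_add_minus[OF VF G(2)])
  also have "sob_sum n G \<le> C0 * B"
   using order_trans[OF C0(2)[OF Dinf_id[OF u] G(2,3)] mult_left_mono[OF pw_sum_id[OF u] C0(1)]] by (simp add: B_def)
  also have "sob_sum n (\<lambda>x. of_real (V x) * F x) \<le> Cv * (C0 * B)"
   unfolding B_def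
   by (rule order_trans[OF Cv(2)[OF F(1)] mult_left_mono[OF order_trans[OF C0(2)[OF u F] mult_left_mono[OF pw_sum_mono C0(1)]] Cv(1)]]) simp
  finally have 1: "norm (cls (nd (Suc (Suc n)) F)) \<le> Cv * (C0 * B) + C0 * B" by simp
  have 2: "sob_sum (Suc n) F \<le> C1 * B" unfolding B_def
   by (rule order_trans[OF C1(2)[OF u F] mult_left_mono[OF pw_sum_mono C1(1)]]) simp
  have "sob_sum (Suc (Suc n)) F = sob_sum (Suc n) F + norm (cls (nd (Suc (Suc n)) F))" unfolding sob_sum_def by simp
  also have "\<dots> \<le> C1 * B + (Cv * (C0 * B) + C0 * B)" by (rule add_mono[OF 2 1])
  also have "\<dots> = (C1 + (Cv * C0 + C0)) * B" by (simp add: algebra_simps)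
  finally show "sob_sum (Suc (Suc n)) F \<le> (C1 + (Cv * C0 + C0)) * pw_sum (Suc (Suc n)) u" unfolding B_def .
 qed
qed

text \<open>The same trade read backwards: \<open>pw\<close> of order \<open>n + 2\<close> at
  \<open>u\<close> is that of order \<open>n\<close> at \<open>A u\<close>, whose representative is
  \<open>V F - F''\<close>.\<close>

lemma pw_le_sob_sum:
 "\<exists>C\<ge>0. \<forall>u F. u \<in> Dinf --> sob_smooth F --> cls F = u --> pw k u \<le> C * sob_sum k F" (is "?P k")
proof (rule induct_nat_012[of _ k])
 show "?P 0"
  by (rule exI[of _ 1]) (simp add: sob_sum_0 pw_0)
 show "?P (Suc 0)"
 proof (rule exI[of _ "1 + Vb"], intro conjI allI impI)
  show "0 \<le> 1 + Vb" using Vb_nonneg by simp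
  fix u F assume u: "u \<in> Dinf" and F: "sob_smooth F" "cls F = u"
  have "(pw 1 u)\<^sup>2 \<le> (norm (cls (nd 1 F)))\<^sup>2 + Vb * (norm (cls F))\<^sup>2"
   using pw_1_sq[OF u F] mulV_inner[of u] unfolding F(2) by linarith
  from sq_interpolation[OF this norm_ge_zero norm_ge_zero]
  show "pw (Suc 0) u \<le> (1 + Vb) * sob_sum (Suc 0) F" using sob_sum_1[of F] by simp
 qed
next
 fix n
 assume "?P n"
 then obtain C0 where C0: "C0 \<ge> 0" "\<And>u F. u \<in> Dinf ==> sob_smooth F ==> cls F = u ==> pw n u \<le> C0 * sob_sum n F" by blast
 obtain Cv where Cv: "Cv \<ge> 0" "\<And>F. sob_smooth F ==> sob_sum n (\<lambda>x. of_real (V x) * F x) \<le> Cv * sob_sum n F"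
  using sob_sum_scaleR[OF smooth] by blast
 show "?P (Suc (Suc n))"
 proof (rule exI[of _ "C0 * (Cv + 1)"], intro conjI allI impI)
  show "0 \<le> C0 * (Cv + 1)" using C0(1) Cv(1) by simp
  fix u F assume u: "u \<in> Dinf" and F: "sob_smooth F" "cls F = u"
  obtain G where G: "nd 1 F 0 = 0" "sob_smooth G" "cls G = Phi (\<lambda>x. x) u"
   "\<And>x. 0 \<le> x ==> nd 2 F x = of_real (V x) * F x + - G x" by (rule Dinf_step[OF u F]) blast
  note VF = sob_smooth_scaleR(1)[OF smooth F(1)] and F2 = sob_smooth_nd[OF F(1), of 2]
  have "sob_sum n G = sob_sum n (\<lambda>x. of_real (V x) * F x + - nd 2 F x)"
   by (rule sob_sum_cong[OF sob_smooth_add(1)[OF VF sob_smooth_minus(1)[OF F2]]]) (simp add: G(4))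
  also have "\<dots> \<le> sob_sum n (\<lambda>x. of_real (V x) * F x) + sob_sum n (nd 2 F)" by (rule sob_sum_add_minus[OF VF F2])
  also have "sob_sum n (\<lambda>x. of_real (V x) * F x) \<le> Cv * sob_sum (Suc (Suc n)) F"
   by (rule order_trans[OF Cv(2)[OF F(1)] mult_left_mono[OF sob_sum_mono Cv(1)]]) simp
  also have "sob_sum n (nd 2 F) \<le> sob_sum (Suc (Suc n)) F" using sob_sum_nd[of n 2 F] by simp
  finally have 1: "sob_sum n G \<le> (Cv + 1) * sob_sum (Suc (Suc n)) F" by (simp add: distrib_right)
  have "pw (Suc (Suc n)) u = pw n (Phi (\<lambda>x. x) u)" using pw_id[OF u, of n] by simp
  also have "\<dots> \<le> C0 * sob_sum n G" by (rule C0(2)[OF Dinf_id[OF u] G(2,3)])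
  also have "\<dots> \<le> C0 * ((Cv + 1) * sob_sum (Suc (Suc n)) F)" by (rule mult_left_mono[OF 1 C0(1)])
  finally show "pw (Suc (Suc n)) u \<le> C0 * (Cv + 1) * sob_sum (Suc (Suc n)) F" by (simp only: mult.assoc)
 qed
qed

lemma Dinf_smooth_rep: assumes "u \<in> Dinf" shows "\<exists>F. sob_smooth F \<and> cls F = u"
 by (rule Dinf_smooth_seq[OF assms]) blast

lemma Dinf_sobolev: assumes u: "cls f \<in> Dinf" and f: "f \<in> L2" shows "f \<in> sobolev k"
 using Dinf_smooth_rep[OF u] sobolev_smooth(1)[OF _ f] by metis

text \<open>Between the two comparisons of norms the evolution acts on the quantities
  \<open>pw\<close>, where it is a contraction up to \<open>l\<close> extra half powers of
  \<open>A\<close>. Hence the constant is independent of \<open>t\<close> and of the phases.\<close>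

lemma wave_estimate:
 "\<exists>C>0. \<forall>p p' t f g h. f \<in> L2 --> g \<in> L2 --> h \<in> L2 --> cls f \<in> Dinf --> cls g \<in> Dinf -->
   cls h = Phi (wv l p t) (cls f) + Phi (wv l p' t) (cls g) -->
   sobolev_norm k h \<le> C * (sobolev_norm (k + l) f + sobolev_norm (k + l) g)"
proof -
 obtain C where C: "C \<ge> 0" "\<And>u F. u \<in> Dinf ==> sob_smooth F ==> cls F = u ==> sob_sum k F \<le> C * pw_sum k u"
  using sob_sum_le_pw_sum[of k] by blast
 obtain c where c: "\<And>j. c j \<ge> 0" "\<And>j u F. u \<in> Dinf ==> sob_smooth F ==> cls F = u ==> pw j u \<le> c j * sob_sum j F"
  using pw_le_sob_sum by metis
 \<comment> \<open>\<open>c (j + l)\<close> is the price of passing from \<open>pw\<close> to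
   derivatives, \<open>k + l + 1\<close> that of passing from their sum to
   \<open>sobolev_norm\<close>.\<close>
 define K where "K = (\<Sum>j\<le>k. c (j + l)) * real (Suc (k + l))"
 have K: "0 \<le> K" unfolding K_def by (intro mult_nonneg_nonneg sum_nonneg c(1)) simp
 have low: "(\<Sum>j\<le>k. pw (j + l) (cls f)) \<le> K * sobolev_norm (k + l) f" if f: "f \<in> L2" "cls f \<in> Dinf" for f
 proof -
  obtain F where F: "sob_smooth F" "cls F = cls f" using Dinf_smooth_rep[OF f(2)] by blast
  note S = sobolev_smooth[OF F(1) f(1) F(2)[symmetric], of "k + l"]
  have "pw (j + l) (cls f) \<le> c (j + l) * (real (Suc (k + l)) * sobolev_norm (k + l) f)" if j: "j \<le> k" for j
  proof -
   have "pw (j + l) (cls f) \<le> c (j + l) * sob_sum (j + l) F" by (rule c(2)[OF f(2) F])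
   also have "\<dots> \<le> c (j + l) * (real (Suc (k + l)) * sobolev_norm (k + l) f)"
    by (rule mult_left_mono[OF order_trans[OF sob_sum_mono S(3)] c(1)]) (use j in simp)
   finally show ?thesis .
  qed
  then have "(\<Sum>j\<le>k. pw (j + l) (cls f)) \<le> (\<Sum>j\<le>k. c (j + l) * (real (Suc (k + l)) * sobolev_norm (k + l) f))"
   by (intro sum_mono) simp
  then show ?thesis unfolding K_def sum_distrib_right[symmetric] by (simp only: mult.assoc)
 qed
 have CK: "C * K + 1 > 0" using mult_nonneg_nonneg[OF C(1) K] by linarith
 show ?thesis
 proof (rule exI[of _ "C * K + 1"], intro conjI allI impI CK)
  fix p p' t f g h
  assume f: "f \<in> L2" and g: "g \<in> L2" and h: "h \<in> L2" and fD: "cls f \<in> Dinf" and gD: "cls g \<in> Dinf"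
   and e: "cls h = Phi (wv l p t) (cls f) + Phi (wv l p' t) (cls g)"
  note wf = gr_Dinf[OF gr_wv fD, of l p t] and wg = gr_Dinf[OF gr_wv gD, of l p' t]
  have hD: "cls h \<in> Dinf" unfolding e by (rule Dinf_add[OF wf wg])
  obtain H where H: "sob_smooth H" "cls H = cls h" using Dinf_smooth_rep[OF hD] by blast
  have b: "pw j (cls h) \<le> pw (j + l) (cls f) + pw (j + l) (cls g)" for j
  proof -
   have "Phi (\<lambda>x. sqrt x ^ j) (cls h) = Phi (\<lambda>x. sqrt x ^ j) (Phi (wv l p t) (cls f)) + Phi (\<lambda>x. sqrt x ^ j) (Phi (wv l p' t) (cls g))"
    unfolding e by (rule Phi_sum[OF gr_measurable[OF gr_sqrt] gr_domD[OF gr_sqrt wf] gr_domD[OF gr_sqrt wg]])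
   then show ?thesis unfolding pw_def
    using norm_triangle_le[OF add_mono[OF norm_Phi_wv[OF fD, of j l p t] norm_Phi_wv[OF gD, of j l p' t]]] by simp
  qed
  have "sobolev_norm k h \<le> sob_sum k H" by (rule sobolev_smooth(2)[OF H(1) h H(2)[symmetric]])
  also have "\<dots> \<le> C * pw_sum k (cls h)" by (rule C(2)[OF hD H])
  also have "\<dots> \<le> C * (K * sobolev_norm (k + l) f + K * sobolev_norm (k + l) g)"
  proof (rule mult_left_mono[OF _ C(1)])
   have "pw_sum k (cls h) \<le> (\<Sum>j\<le>k. pw (j + l) (cls f) + pw (j + l) (cls g))" unfolding pw_sum_def by (rule sum_mono[OF b])
   also have "\<dots> \<le> K * sobolev_norm (k + l) f + K * sobolev_norm (k + l) g"
    unfolding sum.distrib by (rule add_mono[OF low[OF f fD] low[OF g gD]])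
   finally show "pw_sum k (cls h) \<le> K * sobolev_norm (k + l) f + K * sobolev_norm (k + l) g" .
  qed
  also have "\<dots> = (C * K) * (sobolev_norm (k + l) f + sobolev_norm (k + l) g)" by (simp add: algebra_simps)
  also have "\<dots> \<le> (C * K + 1) * (sobolev_norm (k + l) f + sobolev_norm (k + l) g)"
   by (rule mult_right_mono) (simp_all add: sobolev_norm_def sum_nonneg)
  finally show "sobolev_norm k h \<le> (C * K + 1) * (sobolev_norm (k + l) f + sobolev_norm (k + l) g)" .
 qed
qed

section \<open>Even initial data\<close>

text \<open>Compatibility with the Neumann condition to all orders. Being preserved by
  \<open>A\<close>, it places the data in \<open>Dinf\<close>.\<close>

definition even_smooth :: "(real => complex) => bool" where
 "even_smooth F \<longleftrightarrow> sob_smooth F \<and> (\<forall>j. nd (2 * j + 1) F 0 = 0)"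

text \<open>In Leibniz's formula for a derivative of odd order of \<open>V F\<close>, one of the two
  factors carries an odd order, so every term vanishes at 0.\<close>

lemma even_smooth_step:
 assumes V_odd: "\<And>j. nth_deriv {0..} (2 * j + 1) V 0 = 0" and F: "even_smooth F"
 shows "opA (cls F) (cls (\<lambda>x. of_real (V x) * F x + - nd 2 F x))" "even_smooth (\<lambda>x. of_real (V x) * F x + - nd 2 F x)"
proof -
 have S: "sob_smooth F" and odd: "\<And>j. nd (2 * j + 1) F 0 = 0" using F by (auto simp: even_smooth_def)
 note L = sob_smoothD[OF S]
 note VF = sob_smooth_scaleR[OF smooth S] and F2 = sob_smooth_nd[OF S, of 2]
 have D: "dataA F (nd 1 F) (nd 2 F)" by (rule sob_dataA[OF S]) (use odd[of 0] in simp)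
 have "cls (\<lambda>x. of_real (V x) * F x + - nd 2 F x) = mulV (cls F) - cls (nd 2 F)"
  unfolding mulV_cls[OF L(3)] diff_cls[OF V_L2[OF L(3)] L(2)] by simp
 then show "opA (cls F) (cls (\<lambda>x. of_real (V x) * F x + - nd 2 F x))" unfolding opA_def using D by blast
 show "even_smooth (\<lambda>x. of_real (V x) * F x + - nd 2 F x)" unfolding even_smooth_def
 proof (intro conjI allI)
  show "sob_smooth (\<lambda>x. of_real (V x) * F x + - nd 2 F x)" by (rule sob_smooth_add(1)[OF VF(1) sob_smooth_minus(1)[OF F2]])
  fix j
  have "nd (2 * j + 1) (\<lambda>x. of_real (V x) * F x + - nd 2 F x) 0 = nd (2 * j + 1) (\<lambda>x. of_real (V x) * F x) 0 + nd (2 * j + 1) (\<lambda>x. - nd 2 F x) 0"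
   by (rule sob_smooth_add(2)[OF VF(1) sob_smooth_minus(1)[OF F2] order_refl])
  also have "nd (2 * j + 1) (\<lambda>x. - nd 2 F x) 0 = - nd (2 * j + 1) (nd 2 F) 0" by (rule sob_smooth_minus(2)[OF F2 order_refl])
  also have "nd (2 * j + 1) (nd 2 F) 0 = 0" using odd[of "Suc j"] by (simp add: nd_nd)
  also have "nd (2 * j + 1) (\<lambda>x. of_real (V x) * F x) 0 = 0"
   unfolding VF(2)[OF order_refl]
  proof (rule sum.neutral, rule ballI)
   fix k assume k: "k \<in> {..2 * j + 1}"
   show "real (2 * j + 1 choose k) *\<^sub>R (nth_deriv {0..} k V 0 *\<^sub>R nd (2 * j + 1 - k) F 0) = 0"
   proof (cases "odd k")
    case True
    then obtain i where "k = 2 * i + 1" by (rule oddE)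
    then show ?thesis using V_odd[of i] by simp
   next
    case False
    then have "odd (2 * j + 1 - k)" using k by simp
    then obtain i where "2 * j + 1 - k = 2 * i + 1" by (rule oddE)
    then show ?thesis using odd[of i] by simp
   qed
  qed
  finally show "nd (2 * j + 1) (\<lambda>x. of_real (V x) * F x + - nd 2 F x) 0 = 0" by simp
 qed
qed

text \<open>Iterating \<open>even_smooth_step\<close> yields the domains of all integer powers; half
  powers follow from \<open>|x ^ n| <= 1 + (x ^ n)^2\<close>.\<close>

lemma even_smooth_Dinf:
 assumes V_odd: "\<And>j. nth_deriv {0..} (2 * j + 1) V 0 = 0" and F: "even_smooth F"
 shows "cls F \<in> Dinf"
proof -
 have pw: "cls F \<in> dom (\<lambda>x. x ^ n)" if "even_smooth F" for n F using that
 proof (induction n arbitrary: F)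
  case 0 show ?case by (rule dom_bounded[of _ 1]) simp_all
 next
  case (Suc n)
  note st = even_smooth_step[OF V_odd Suc.prems]
  have d: "cls F \<in> dom (\<lambda>x. x)" "cls (\<lambda>x. of_real (V x) * F x + - nd 2 F x) = Phi (\<lambda>x. x) (cls F)" using st(1) unfolding op by blast+
  have "Phi (\<lambda>x. x) (cls F) \<in> dom (\<lambda>x. x ^ n)" using Suc.IH[OF st(2)] unfolding d(2) .
  then have "cls F \<in> dom (\<lambda>x. x ^ n * x)" by (subst (asm) dom_Phi_iff[OF _ _ d(1)]) simp_all
  then show ?case by (simp add: mult.commute)
 qed
 show ?thesis unfolding Dinf_def
 proof (intro CollectI allI)
  fix n
  interpret finite_measure "mu (cls F)" by (rule finite_mu)
  have i: "integrable (mu (cls F)) (\<lambda>x. 1 + (x ^ n)\<^sup>2)"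
   using pw[OF F, of n] unfolding dom_def by (intro Bochner_Integration.integrable_add) simp_all
  have "integrable (mu (cls F)) (\<lambda>x. (sqrt x ^ n)\<^sup>2)"
  proof (rule Bochner_Integration.integrable_bound[OF i])
   show "AE x in mu (cls F). norm ((sqrt x ^ n)\<^sup>2) \<le> norm (1 + (x ^ n)\<^sup>2)"
   proof (rule AE_I2)
    fix x
    have "(sqrt x)\<^sup>2 = \<bar>x\<bar>" by (simp only: power2_eq_square real_sqrt_mult[symmetric] real_sqrt_abs2)
    then have "(sqrt x ^ n)\<^sup>2 = \<bar>x ^ n\<bar>" by (simp add: power_mult[symmetric] mult.commute[of n] power_abs) (simp add: power_mult)
    moreover have "2 * \<bar>x ^ n\<bar> \<le> 1 + (x ^ n)\<^sup>2" using sum_squares_bound[of "\<bar>x ^ n\<bar>" 1] by simp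
    ultimately show "norm ((sqrt x ^ n)\<^sup>2) \<le> norm (1 + (x ^ n)\<^sup>2)" unfolding real_norm_def by linarith
   qed
  qed simp
  then show "cls F \<in> dom (\<lambda>x. sqrt x ^ n)" by (simp add: dom_def)
 qed
qed

lemma even_smooth_schwartz:
 assumes f: "schwartz f" and ev: "even_fun f" shows "even_smooth f"
proof -
 have "nd (2 * j + 1) f 0 = 0" for j
  using sob_smooth_schwartz(2)[OF f order_refl] nth_deriv_odd_zero[OF _ ev] f by (simp add: schwartz_def)
 then show ?thesis using sob_smooth_schwartz(1)[OF f] by (simp add: even_smooth_def)
qed

end

text \<open>Both estimates are \<open>wave_estimate\<close> for the data \<open>sqrt A f\<close> and
  \<open>g\<close>, with phases \<open>0\<close> and \<open>- (pi / 2)\<close> for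
  \<open>sqrt A u\<close>, and \<open>pi / 2\<close> and \<open>0\<close> for the time derivative of
  \<open>u\<close>.\<close>

theorem theorem1p3:
  fixes V r :: "real \<Rightarrow> real" and \<alpha> :: real and c :: "nat \<Rightarrow> real"
  assumes V_smooth: "smooth_fun_on {0..} V"
    and alpha: "\<alpha> > 0"
    and V_asymp: "\<And>x. x \<ge> 1 \<Longrightarrow> V x = - (1 / 4) * x powr (- 2) * (1 + r x)"
    and r_smooth: "smooth_fun_on {1..} r"
    and r_bound: "\<And>k x. x \<ge> 1 \<Longrightarrow> \<bar>nth_deriv {1..} k r x\<bar> \<le> c k * x powr (- \<alpha> - real k)"
    and no_ev: "no_negative_eigenvalue V"
    and V_odd: "\<And>j. nth_deriv {0..} (2 * j + 1) V 0 = 0"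
  shows "\<exists>C :: nat \<Rightarrow> nat \<Rightarrow> real. (\<forall>k l. C k l > 0) \<and>
    (\<forall>f g u. schwartz f \<and> even_fun f \<and> schwartz g \<and> even_fun g \<and> u = wave_solution V f g \<longrightarrow>
       solves_cauchy V f g u \<and>
       f \<in> dom_sqrt_A V \<and> (\<forall>t. u t \<in> dom_sqrt_A V) \<and> time_smooth (\<lambda>t. sqrt_A V (u t)) \<and>
       (\<forall>t\<ge>0. \<forall>k l.
          sqrt_A V f \<in> sobolev (k + l) \<and> g \<in> sobolev (k + l) \<and>
          (time_deriv ^^ l) (\<lambda>s. sqrt_A V (u s)) t \<in> sobolev k \<and>
          (time_deriv ^^ l) (time_deriv u) t \<in> sobolev k \<and>
          sobolev_norm k ((time_deriv ^^ l) (\<lambda>s. sqrt_A V (u s)) t)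
            \<le> C k l * (sobolev_norm (k + l) (sqrt_A V f) + sobolev_norm (k + l) g) \<and>
          sobolev_norm k ((time_deriv ^^ l) (time_deriv u) t)
            \<le> C k l * (sobolev_norm (k + l) (sqrt_A V f) + sobolev_norm (k + l) g)))"
proof -
 have sm: "bdd_smooth {0..} V" by (rule potential_bdd_smooth[OF V_smooth V_asymp r_smooth alpha r_bound])
 have decay: "\<exists>b\<ge>0. \<forall>x\<ge>b. \<bar>V x\<bar> \<le> \<epsilon>" if e: "\<epsilon> > 0" for \<epsilon>
 proof -
  obtain b where "b \<ge> 1" "\<forall>x\<ge>b. \<bar>V x\<bar> \<le> \<epsilon>" using potential_decay[OF V_asymp alpha r_bound e] by blast
  then show ?thesis by (intro exI[of _ b]) simp
 qed
 have "\<exists>C. \<forall>x\<in>{0..}. \<bar>nth_deriv {0..} 0 V x\<bar> \<le> C" using sm unfolding bdd_smooth_def by blast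
 then obtain Vb where Vb: "\<forall>x\<in>{0..}. \<bar>V x\<bar> \<le> Vb" by auto
 interpret smooth_potential V Vb
 proof
  show "continuous_on {0..} V" using smooth_continuous[OF V_smooth, of 0] by simp
  show "0 \<le> x ==> \<bar>V x\<bar> \<le> Vb" for x using Vb by simp
  show "bdd_smooth {0..} V" by (rule sm)
 qed
 \<comment> \<open>The measure chosen in the definitions. \<open>P0\<close> below is an auxiliary
   one, which proves that the choice succeeds.\<close>
 define E where "E = spectral_measure (schroedinger V)"
 obtain P0 where P0: "spectral P0" "\<forall>u w. u \<in> spectral.dom P0 (\<lambda>x. x) \<and> w = spectral.Phi P0 (\<lambda>x. x) u \<longleftrightarrow> opA u w"
   "\<forall>B u. B \<in> sets borel --> P0 B (cmul \<i> u) = cmul \<i> (P0 B u)" using spectral_opA by blast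
 have "pvm E \<and> schroedinger V = {(f, h). spec_int E (\<lambda>\<mu>. \<mu>) f h}" unfolding E_def
 proof (rule spectral_measure_props[OF P0(1) P0(3)[rule_format]])
  fix f h
  show "(f, h) \<in> schroedinger V \<longleftrightarrow> f \<in> L2 \<and> h \<in> L2 \<and> cls f \<in> spectral.dom P0 (\<lambda>x. x) \<and> cls h = spectral.Phi P0 (\<lambda>x. x) (cls f)"
   unfolding schroedinger_iff P0(2)[rule_format, symmetric] ..
 qed
 then have E: "pvm E" and TE: "schroedinger V = {(f, h). spec_int E (\<lambda>\<mu>. \<mu>) f h}" by blast+
 interpret E: halfline_pvm E by (rule halfline_pvm.intro[OF E])
 have op: "opA u w \<longleftrightarrow> u \<in> E.dom (\<lambda>x. x) \<and> w = E.Phi (\<lambda>x. x) u" for u w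
 proof -
  have "opA u w \<longleftrightarrow> (rep u, rep w) \<in> schroedinger V" by (simp add: schroedinger_iff)
  also have "\<dots> \<longleftrightarrow> spec_int E (\<lambda>\<mu>. \<mu>) (rep u) (rep w)" unfolding TE by simp
  also have "\<dots> \<longleftrightarrow> u \<in> E.dom (\<lambda>x. x) \<and> w = E.Phi (\<lambda>x. x) u" by (simp add: E.spec_int_iff)
  finally show ?thesis .
 qed
 have nn: "AE x in E.mu f. 0 \<le> x" for f
 proof (rule E.nonneg_support)
  fix u assume "u \<in> E.dom (\<lambda>x. x)"
  then have "opA u (E.Phi (\<lambda>x. x) u)" by (simp add: op)
  from opA_nonneg[OF decay no_eigenvalue_opA[OF no_ev] this] show "0 \<le> inner (E.Phi (\<lambda>x. x) u) u" .
 qed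
 interpret W: wave_setup V Vb E.Q
  by (intro wave_setup.intro wave_setup_axioms.intro smooth_potential_axioms nonneg_spectral.intro nonneg_spectral_axioms.intro E.spectral_axioms nn op)
 have "\<forall>k l. \<exists>C>0. \<forall>\<theta> \<theta>' t f g h. f \<in> L2 --> g \<in> L2 --> h \<in> L2 --> cls f \<in> W.Dinf --> cls g \<in> W.Dinf -->
   cls h = E.Phi (W.wv l \<theta> t) (cls f) + E.Phi (W.wv l \<theta>' t) (cls g) -->
   sobolev_norm k h \<le> C * (sobolev_norm (k + l) f + sobolev_norm (k + l) g)"
  by (intro allI W.wave_estimate)
 then obtain C where C: "\<And>k l. C k l > 0"
  and est: "\<And>k l \<theta> \<theta>' t f g h. f \<in> L2 ==> g \<in> L2 ==> h \<in> L2 ==> cls f \<in> W.Dinf ==> cls g \<in> W.Dinf ==>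
   cls h = E.Phi (W.wv l \<theta> t) (cls f) + E.Phi (W.wv l \<theta>' t) (cls g) ==>
   sobolev_norm k h \<le> C k l * (sobolev_norm (k + l) f + sobolev_norm (k + l) g)"
  by metis
 have s: "W.gr sqrt 1 1" using W.gr_sqrt[of 1] by simp
 note fc = E.fcalc_props[OF E_def[symmetric]]
 show ?thesis
 proof (rule exI[of _ C], intro conjI allI impI)
  show "C k l > 0" for k l by (rule C)
 next
  fix f g u assume a: "schwartz f \<and> even_fun f \<and> schwartz g \<and> even_fun g \<and> u = wave_solution V f g"
  have f: "schwartz f" "even_fun f" and g: "schwartz g" "even_fun g" and u: "u = wave_solution V f g" using a by blast+
  have fL: "f \<in> L2" and gL: "g \<in> L2" using sob_smooth_schwartz(1)[OF f(1)] sob_smooth_schwartz(1)[OF g(1)] by (simp_all add: sob_smoothD(3))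
  \<comment> \<open>\<open>A\<close> is the class of \<open>sqrt A f\<close>; with \<open>G\<close>
    it forms the pair of data in which the estimated quantities are expressed.\<close>
  define F G A where "F = cls f" and "G = cls g" and "A = E.Phi sqrt F"
  have FD: "F \<in> W.Dinf" unfolding F_def by (rule W.even_smooth_Dinf[OF V_odd W.even_smooth_schwartz[OF f]])
  have GD: "G \<in> W.Dinf" unfolding G_def by (rule W.even_smooth_Dinf[OF V_odd W.even_smooth_schwartz[OF g]])
  have AD: "A \<in> W.Dinf" unfolding A_def by (rule W.gr_Dinf[OF s FD])
  \<comment> \<open>Candidates for the time derivatives of \<open>u\<close>. Order 0 is separate
    because \<open>sc\<close> is not of the form \<open>wv\<close>; its time derivative is
    \<open>wv 0 0\<close>.\<close>
  define U where "U n t = (case n of 0 => E.Phi (W.wv 0 0 t) F + E.Phi (W.sc t) G | Suc m => E.Phi (W.wv (Suc m) 0 t) F + E.Phi (W.wv m 0 t) G)" for n t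
  \<comment> \<open>Candidates for the time derivatives of \<open>sqrt A u\<close>; the phase
    \<open>- (pi / 2)\<close> is the sine that \<open>Phi_sqrt_sc\<close> produces.\<close>
  define S where "S n t = E.Phi (W.wv n 0 t) A + E.Phi (W.wv n (- (pi / 2)) t) G" for n t
  note wvm = W.gr_measurable[OF W.gr_wv] and scm = W.gr_measurable[OF W.gr_sc]
  note wF = W.gr_domD[OF W.gr_wv FD] and cG = W.gr_domD[OF W.gr_sc GD]
  have ut: "u t = (\<lambda>x. fcalc (schroedinger V) (W.wv 0 0 t) f x + fcalc (schroedinger V) (W.sc t) g x)" for t
  proof -
   have "(\<lambda>\<mu>. cos (t * sqrt \<mu>)) = W.wv 0 0 t" by (simp add: W.wv_def fun_eq_iff)
   moreover have "(\<lambda>\<mu>. if \<mu> = 0 then t else sin (t * sqrt \<mu>) / sqrt \<mu>) = W.sc t" by (simp add: W.sc_def fun_eq_iff)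
   ultimately show ?thesis unfolding u wave_solution_def by (simp only:)
  qed
  note cf = fc[OF wvm fL wF[unfolded F_def]] and sg = fc[OF scm gL cG[unfolded G_def]]
  have uL: "u t \<in> L2" for t unfolding ut by (rule L2_add[OF cf(1) sg(1)])
  have uU: "cls (u t) = U 0 t" for t
   unfolding ut plus_cls[OF cf(1) sg(1), symmetric] cf(2) sg(2) by (simp add: U_def F_def G_def)
  have U: "hderiv (U n) (U (Suc n) t) t" for n t
  proof (cases n)
   case 0
   have "hderiv (\<lambda>s. E.Phi (W.wv 0 0 s) F + E.Phi (W.sc s) G) (E.Phi (W.wv (Suc 0) 0 t) F + E.Phi (W.wv 0 0 t) G) t"
    by (rule hderiv_add[OF W.hderiv_wv[OF FD] W.hderiv_sc[OF GD]])
   then show ?thesis by (simp add: 0 U_def[abs_def])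
  next
   case (Suc m)
   have "hderiv (\<lambda>s. E.Phi (W.wv (Suc m) 0 s) F + E.Phi (W.wv m 0 s) G) (E.Phi (W.wv (Suc (Suc m)) 0 t) F + E.Phi (W.wv (Suc m) 0 t) G) t"
    by (rule hderiv_add[OF W.hderiv_wv[OF FD] W.hderiv_wv[OF GD]])
   then show ?thesis by (simp add: Suc U_def[abs_def])
  qed
  note itu = time_deriv_iterate[of u U, OF uL uU U]
  have UD: "U 0 t \<in> W.Dinf" for t
   unfolding U_def by (simp add: W.Dinf_add[OF W.gr_Dinf[OF W.gr_wv FD] W.gr_Dinf[OF W.gr_sc GD]])
  \<comment> \<open>One half power of \<open>A\<close> is shifted from the evolution onto
    \<open>F\<close>, so the derivative of order \<open>l + 1\<close> becomes an expression of order
    \<open>l\<close> in \<open>A\<close> and \<open>G\<close>, as \<open>est\<close>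
    requires.\<close>
  have U1: "U (Suc l) t = E.Phi (W.wv l (0 + pi / 2) t) A + E.Phi (W.wv l 0 t) G" for l t
   unfolding A_def W.Phi_sqrt_wv(2)[OF FD, symmetric] by (simp add: U_def)
  have idU: "E.Phi (\<lambda>x. x) (U 0 t) = - U 2 t" for t
  proof -
   have "E.Phi (\<lambda>x. x) (U 0 t) = E.Phi (\<lambda>x. x) (E.Phi (W.wv 0 0 t) F) + E.Phi (\<lambda>x. x) (E.Phi (W.sc t) G)"
    unfolding U_def nat.case
    by (rule E.Phi_sum[OF W.gr_measurable[OF W.gr_id] W.gr_domD[OF W.gr_id W.gr_Dinf[OF W.gr_wv FD]] W.gr_domD[OF W.gr_id W.gr_Dinf[OF W.gr_sc GD]]])
   then show ?thesis unfolding W.Phi_id_wv[OF FD] W.Phi_id_sc[OF GD] by (simp add: U_def numeral_2_eq_2)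
  qed
  have sU: "E.Phi sqrt (U 0 t) = S 0 t" for t
  proof -
   have "E.Phi sqrt (U 0 t) = E.Phi sqrt (E.Phi (W.wv 0 0 t) F) + E.Phi sqrt (E.Phi (W.sc t) G)"
    unfolding U_def nat.case
    by (rule E.Phi_sum[OF W.gr_measurable[OF s] W.gr_domD[OF s W.gr_Dinf[OF W.gr_wv FD]] W.gr_domD[OF s W.gr_Dinf[OF W.gr_sc GD]]])
   then show ?thesis unfolding W.Phi_sqrt_wv(1)[OF FD] W.Phi_sqrt_sc[OF GD] by (simp add: S_def A_def)
  qed
  have uD: "cls (u t) \<in> E.dom sqrt" for t unfolding uU by (rule W.gr_domD[OF s UD])
  note su = fc[OF W.gr_measurable[OF s] uL uD]
  note sf = fc[OF W.gr_measurable[OF s] fL W.gr_domD[OF s FD, unfolded F_def]]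
  have Af: "cls (sqrt_A V f) = A" unfolding sf(2) A_def F_def ..
  have S: "hderiv (S n) (S (Suc n) t) t" for n t
   unfolding S_def[abs_def] by (rule hderiv_add[OF W.hderiv_wv[OF AD] W.hderiv_wv[OF GD]])
  have suS: "cls (sqrt_A V (u t)) = S 0 t" for t unfolding su(2) uU by (rule sU)
  note its = time_deriv_iterate[of "\<lambda>t. sqrt_A V (u t)" S, OF su(1) suS S]
  have uL': "(time_deriv ^^ n) u t \<in> L2" "cls ((time_deriv ^^ n) u t) = U n t" for n t using itu[of n] by blast+
  have sL': "(time_deriv ^^ n) (\<lambda>t. sqrt_A V (u t)) t \<in> L2" "cls ((time_deriv ^^ n) (\<lambda>t. sqrt_A V (u t)) t) = S n t" for n t using its[of n] by blast+
  have Dw: "E.Phi (W.wv l a t) A + E.Phi (W.wv l b t) G \<in> W.Dinf" for l a b t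
   by (rule W.Dinf_add[OF W.gr_Dinf[OF W.gr_wv AD] W.gr_Dinf[OF W.gr_wv GD]])
  have swap: "(time_deriv ^^ l) (time_deriv u) t = (time_deriv ^^ Suc l) u t" for l t by (simp add: funpow_swap1)
  have cauchy: "solves_cauchy V f g u" unfolding solves_cauchy_def
  proof (intro conjI allI)
   show "time_smooth u" unfolding time_smooth_def using itu by blast
   fix t
   have m: "(\<lambda>x. - (time_deriv ^^ 2) u t x) \<in> L2" by (rule L2_minus[OF uL'(1)])
   have "cls (\<lambda>x. - (time_deriv ^^ 2) u t x) = - U 2 t" unfolding minus_cls[OF uL'(1), symmetric] uL'(2) ..
   then have "opA (cls (u t)) (cls (\<lambda>x. - (time_deriv ^^ 2) u t x))"
    unfolding op uU idU using W.gr_domD[OF W.gr_id UD] by simp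
   then show "(u t, \<lambda>x. - (time_deriv ^^ 2) u t x) \<in> schroedinger V" using uL m by (simp add: schroedinger_iff)
  next
   have "cls (u 0) = cls f" unfolding uU by (simp add: U_def W.Phi_initial[OF FD] W.Phi_initial[OF GD]) (simp add: F_def)
   then show "l2_eq (u 0) f" by (rule cls_eq_iff[OF uL fL, THEN iffD1])
   have "cls (time_deriv u 0) = U 1 0" using uL'(2)[of 1 0] by simp
   also have "\<dots> = cls g" using W.Phi_initial[OF FD] W.Phi_initial[OF GD] by (simp add: U_def G_def)
   finally show "l2_eq (time_deriv u 0) g" using cls_eq_iff[OF uL'(1)[of 1 0] gL] by simp
  qed
  have dd: "f \<in> dom_sqrt_A V" "u t \<in> dom_sqrt_A V" for t
   unfolding fcalc_dom_def E_def[symmetric] E.spec_dom_iff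
   using fL W.gr_domD[OF s FD] uL[of t] uD[of t] by (simp_all add: F_def)
  show "solves_cauchy V f g u" by (rule cauchy)
  show "f \<in> dom_sqrt_A V" "u t \<in> dom_sqrt_A V" for t by (rule dd)+
   show "time_smooth (\<lambda>t. sqrt_A V (u t))" unfolding time_smooth_def using its by blast
   fix t :: real and k l :: nat
   show "sqrt_A V f \<in> sobolev (k + l)" by (rule W.Dinf_sobolev[OF _ sf(1)]) (simp only: Af AD)
   show "g \<in> sobolev (k + l)" by (rule W.Dinf_sobolev[OF GD[unfolded G_def] gL])
   show "(time_deriv ^^ l) (\<lambda>s. sqrt_A V (u s)) t \<in> sobolev k"
    by (rule W.Dinf_sobolev[OF _ sL'(1)]) (simp only: sL'(2) S_def Dw)
   show "(time_deriv ^^ l) (time_deriv u) t \<in> sobolev k" unfolding swap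
    by (rule W.Dinf_sobolev[OF _ uL'(1)]) (simp only: uL'(2) U1 Dw)
   show "sobolev_norm k ((time_deriv ^^ l) (\<lambda>s. sqrt_A V (u s)) t)
      \<le> C k l * (sobolev_norm (k + l) (sqrt_A V f) + sobolev_norm (k + l) g)"
    by (rule est[where l = l and t = t and \<theta> = 0 and \<theta>' = "- (pi / 2)", OF sf(1) gL sL'(1)]) (simp_all only: Af AD GD[unfolded G_def] sL'(2) S_def G_def)
   show "sobolev_norm k ((time_deriv ^^ l) (time_deriv u) t)
      \<le> C k l * (sobolev_norm (k + l) (sqrt_A V f) + sobolev_norm (k + l) g)" unfolding swap
    by (rule est[where l = l and t = t and \<theta> = "0 + pi / 2" and \<theta>' = 0, OF sf(1) gL uL'(1)]) (simp_all only: Af AD GD[unfolded G_def] uL'(2) U1 G_def)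
 qed
qed

end
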